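(* Let $(\mathcal{C},\otimes,I)$ be a small symmetric monoidal category and let $\partial\colon\mathcal{C}^{\mathbb{N}}\to\mathcal{C}^{\mathbb{N}}$ be the delay functor. For all sequences $\mathbf{X},\mathbf{Y}$, the hom-set $\mathrm{eStream}(\mathbf{X},\mathbf{Y})$ of the free feedback monoidal category over $(\mathcal{C}^{\mathbb{N}},\partial)$ is in bijection, naturally in $\mathbf{X}$ and $\mathbf{Y}$, with $$\mathrm{St}_{\partial}(\mathcal{C}^{\mathbb{N}})(\mathbf{X},\mathbf{Y}) := \int^{\mathbf{S}\in\mathcal{C}^{\mathbb{N}}}\mathcal{C}^{\mathbb{N}}(\partial\mathbf{S}\otimes\mathbf{X},\ \mathbf{S}\otimes\mathbf{Y}),$$ which is exactly the set $\mathrm{eSeq}(\mathbf{X},\mathbf{Y})$ of dinatural sequences from $\mathbf{X}$ to $\mathbf{Y}$.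
   Context: $\mathcal{C}^{\mathbb{N}}$ is the symmetric monoidal category of sequences $\mathbf{X}=(X_0,X_1,\dots)$ of objects of $\mathcal{C}$ with componentwise morphisms and tensor. The delay functor is $\partial(X_0,X_1,\dots)=(I,X_0,X_1,\dots)$ on objects and $\partial(f_0,f_1,\dots)=(\mathrm{id}_I,f_0,f_1,\dots)$ on morphisms; it is symmetric strong monoidal. A dinatural sequence from $\mathbf{X}$ to $\mathbf{Y}$ is a sequence of objects $(M_n)_{n\in\mathbb{N}}$ together with morphisms $f_n\colon M_{n-1}\otimes X_n\to M_n\otimes Y_n$ ($M_{-1}:=I$), modulo the equivalence relation generated by $(f_n;(r_n\otimes 1))_n\sim((r_{n-1}\otimes 1);f_n)_n$ for all $f_n\colon M_{n-1}\otimes X_n\to N_n\otimes Y_n$ and $r_n\colon N_n\to M_n$ (with $r_{-1}=\mathrm{id}_I$); here $;$ denotes composition in diagrammatic order. The coend above is the coproduct over $\mathbf{S}$ of the hom-sets quotiented by the equivalence generated by $(\partial r\otimes 1);h\sim h;(r\otimes 1)$ for $r\colon\mathbf{S}\to\mathbf{T}$ and $h\colon\partial\mathbf{T}\otimes\mathbf{X}\to\mathbf{S}\otimes\mathbf{Y}$. A feedback monoidal category is a symmetric monoidal category $\mathcal{D}$ with a symmetric strong monoidal endofunctor $F$ and operations $\mathrm{fbk}_S\colon\mathcal{D}(F(S)\otimes X,S\otimes Y)\to\mathcal{D}(X,Y)$ satisfying: (A1) $u;\mathrm{fbk}_S(f);v=\mathrm{fbk}_S((\mathrm{id}_{FS}\otimes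 u);f;(\mathrm{id}_S\otimes v))$; (A2) $\mathrm{fbk}_I(f)=f$; (A3) $\mathrm{fbk}_T(\mathrm{fbk}_S(f))=\mathrm{fbk}_{S\otimes T}(f)$; (A4) $\mathrm{fbk}_S(f)\otimes g=\mathrm{fbk}_S(f\otimes g)$; (A5) $\mathrm{fbk}_S((Fh\otimes\mathrm{id}_X);f)=\mathrm{fbk}_T(f;(h\otimes\mathrm{id}_Y))$ for $h\colon S\to T$, $f\colon FT\otimes X\to S\otimes Y$ (coherence isomorphisms suppressed). A feedback functor is a symmetric monoidal functor $G$ with $G\circ F=F'\circ G$ that preserves $\mathrm{fbk}$ (up to the monoidal structure maps of $G$). The free feedback monoidal category over $(\mathcal{D},F)$ is a feedback monoidal category with the same objects, equipped with a symmetric monoidal functor from $\mathcal{D}$ commuting with the endofunctors, such that every such functor from $\mathcal{D}$ into a feedback monoidal category extends uniquely to a feedback functor.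
   Formalization: In "free feedback monoidal category", both the free category and the target categories are also required to have an endofunctor that preserves feedback, F(fbk_S f) = fbk_{FS}(F f); with (A1)-(A5) alone the coend category is not free. *)

theory Defs
  imports Main
begin

section \<open>Symmetric monoidal categories\<close>

text \<open>
  Carriers are sets inside types, so every category below is small. Every arrow carries its own
  domain and codomain. Composition \<open>f \<Zcomp> g\<close> is in diagrammatic order. The tensor is
  \<open>\<otimes>\<close> on objects and \<open>\<odot>\<close> on arrows.
\<close>

record ('o, 'm) smc =
  Obj :: "'o set"
  Arr :: "'m set"
  Dom :: "'m \<Rightarrow> 'o"
  Cod :: "'m \<Rightarrow> 'o"
  Id :: "'o \<Rightarrow> 'm"
  Comp :: "'m \<Rightarrow> 'm \<Rightarrow> 'm"  (infixl "\<Zcomp>\<index>" 60)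
  Unit :: 'o
  TenO :: "'o \<Rightarrow> 'o \<Rightarrow> 'o"  (infixr "\<otimes>\<index>" 70)
  TenA :: "'m \<Rightarrow> 'm \<Rightarrow> 'm"  (infixr "\<odot>\<index>" 70)
  Assoc :: "'o \<Rightarrow> 'o \<Rightarrow> 'o \<Rightarrow> 'm"  \<comment> \<open>\<open>(X \<otimes> Y) \<otimes> Z \<rightarrow> X \<otimes> (Y \<otimes> Z)\<close>\<close>
  Lunit :: "'o \<Rightarrow> 'm"  \<comment> \<open>\<open>I \<otimes> X \<rightarrow> X\<close>\<close>
  Runit :: "'o \<Rightarrow> 'm"  \<comment> \<open>\<open>X \<otimes> I \<rightarrow> X\<close>\<close>
  Sym :: "'o \<Rightarrow> 'o \<Rightarrow> 'm"  \<comment> \<open>\<open>X \<otimes> Y \<rightarrow> Y \<otimes> X\<close>\<close>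

definition hom :: "('o, 'm, 'z) smc_scheme \<Rightarrow> 'o \<Rightarrow> 'o \<Rightarrow> 'm set" where
  "hom C X Y = {f \<in> Arr C. Dom C f = X \<and> Cod C f = Y}"

definition is_inverse :: "('o, 'm, 'z) smc_scheme \<Rightarrow> 'm \<Rightarrow> 'm \<Rightarrow> bool" where
  "is_inverse C f g \<longleftrightarrow> g \<in> hom C (Cod C f) (Dom C f) \<and>
     f \<Zcomp>\<^bsub>C\<^esub> g = Id C (Dom C f) \<and> g \<Zcomp>\<^bsub>C\<^esub> f = Id C (Cod C f)"

definition iso :: "('o, 'm, 'z) smc_scheme \<Rightarrow> 'o \<Rightarrow> 'o \<Rightarrow> 'm set" where
  "iso C X Y = {f \<in> hom C X Y. \<exists>g. is_inverse C f g}"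

definition arr_inv :: "('o, 'm, 'z) smc_scheme \<Rightarrow> 'm \<Rightarrow> 'm" where
  "arr_inv C f = (THE g. is_inverse C f g)"

locale category =
  fixes C :: "('o, 'm, 'z) smc_scheme" (structure)
  assumes dom_obj: "f \<in> Arr C \<Longrightarrow> Dom C f \<in> Obj C"
    and cod_obj: "f \<in> Arr C \<Longrightarrow> Cod C f \<in> Obj C"
    and id_hom: "X \<in> Obj C \<Longrightarrow> Id C X \<in> hom C X X"
    and comp_hom: "\<lbrakk>f \<in> hom C X Y; g \<in> hom C Y Z\<rbrakk> \<Longrightarrow> f \<Zcomp> g \<in> hom C X Z"
    and id_left: "f \<in> hom C X Y \<Longrightarrow> Id C X \<Zcomp> f = f"
    and id_right: "f \<in> hom C X Y \<Longrightarrow> f \<Zcomp> Id C Y = f"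
    and comp_assoc: "\<lbrakk>f \<in> hom C W X; g \<in> hom C X Y; h \<in> hom C Y Z\<rbrakk> \<Longrightarrow>
      (f \<Zcomp> g) \<Zcomp> h = f \<Zcomp> (g \<Zcomp> h)"

locale symmetric_monoidal_category = category +
  assumes unit_obj: "Unit C \<in> Obj C"
    and ten_obj: "\<lbrakk>X \<in> Obj C; Y \<in> Obj C\<rbrakk> \<Longrightarrow> X \<otimes> Y \<in> Obj C"
    and ten_hom: "\<lbrakk>f \<in> hom C X X'; g \<in> hom C Y Y'\<rbrakk> \<Longrightarrow> f \<odot> g \<in> hom C (X \<otimes> Y) (X' \<otimes> Y')"
    and ten_id: "\<lbrakk>X \<in> Obj C; Y \<in> Obj C\<rbrakk> \<Longrightarrow> Id C X \<odot> Id C Y = Id C (X \<otimes> Y)"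
    and ten_comp: "\<lbrakk>f \<in> hom C X X'; f' \<in> hom C X' X''; g \<in> hom C Y Y'; g' \<in> hom C Y' Y''\<rbrakk> \<Longrightarrow>
      (f \<Zcomp> f') \<odot> (g \<Zcomp> g') = (f \<odot> g) \<Zcomp> (f' \<odot> g')"
    and assoc_iso: "\<lbrakk>X \<in> Obj C; Y \<in> Obj C; Z \<in> Obj C\<rbrakk> \<Longrightarrow>
      Assoc C X Y Z \<in> iso C ((X \<otimes> Y) \<otimes> Z) (X \<otimes> (Y \<otimes> Z))"
    and lunit_iso: "X \<in> Obj C \<Longrightarrow> Lunit C X \<in> iso C (Unit C \<otimes> X) X"
    and runit_iso: "X \<in> Obj C \<Longrightarrow> Runit C X \<in> iso C (X \<otimes> Unit C) X"
    and sym_hom: "\<lbrakk>X \<in> Obj C; Y \<in> Obj C\<rbrakk> \<Longrightarrow> Sym C X Y \<in> hom C (X \<otimes> Y) (Y \<otimes> X)"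
    and assoc_nat: "\<lbrakk>f \<in> hom C X X'; g \<in> hom C Y Y'; h \<in> hom C Z Z'\<rbrakk> \<Longrightarrow>
      ((f \<odot> g) \<odot> h) \<Zcomp> Assoc C X' Y' Z' = Assoc C X Y Z \<Zcomp> (f \<odot> (g \<odot> h))"
    and lunit_nat: "f \<in> hom C X Y \<Longrightarrow> (Id C (Unit C) \<odot> f) \<Zcomp> Lunit C Y = Lunit C X \<Zcomp> f"
    and runit_nat: "f \<in> hom C X Y \<Longrightarrow> (f \<odot> Id C (Unit C)) \<Zcomp> Runit C Y = Runit C X \<Zcomp> f"
    and sym_nat: "\<lbrakk>f \<in> hom C X X'; g \<in> hom C Y Y'\<rbrakk> \<Longrightarrow>
      (f \<odot> g) \<Zcomp> Sym C X' Y' = Sym C X Y \<Zcomp> (g \<odot> f)"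
    and pentagon: "\<lbrakk>W \<in> Obj C; X \<in> Obj C; Y \<in> Obj C; Z \<in> Obj C\<rbrakk> \<Longrightarrow>
      (Assoc C W X Y \<odot> Id C Z) \<Zcomp> Assoc C W (X \<otimes> Y) Z \<Zcomp> (Id C W \<odot> Assoc C X Y Z)
        = Assoc C (W \<otimes> X) Y Z \<Zcomp> Assoc C W X (Y \<otimes> Z)"
    and triangle: "\<lbrakk>X \<in> Obj C; Y \<in> Obj C\<rbrakk> \<Longrightarrow>
      Assoc C X (Unit C) Y \<Zcomp> (Id C X \<odot> Lunit C Y) = Runit C X \<odot> Id C Y"
    and sym_inv: "\<lbrakk>X \<in> Obj C; Y \<in> Obj C\<rbrakk> \<Longrightarrow> Sym C X Y \<Zcomp> Sym C Y X = Id C (X \<otimes> Y)"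
    and hexagon: "\<lbrakk>X \<in> Obj C; Y \<in> Obj C; Z \<in> Obj C\<rbrakk> \<Longrightarrow>
      Assoc C X Y Z \<Zcomp> Sym C X (Y \<otimes> Z) \<Zcomp> Assoc C Y Z X
        = (Sym C X Y \<odot> Id C Z) \<Zcomp> Assoc C Y X Z \<Zcomp> (Id C Y \<odot> Sym C X Z)"


section \<open>Symmetric strong monoidal functors\<close>

record ('o, 'm, 'p, 'q) mfun =
  OMap :: "'o \<Rightarrow> 'p"
  AMap :: "'m \<Rightarrow> 'q"
  UnitMap :: 'q  \<comment> \<open>\<open>I \<rightarrow> F I\<close>\<close>
  TenMap :: "'o \<Rightarrow> 'o \<Rightarrow> 'q"  \<comment> \<open>\<open>F X \<otimes> F Y \<rightarrow> F (X \<otimes> Y)\<close>\<close>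

locale symmetric_monoidal_functor =
  C: symmetric_monoidal_category C + D: symmetric_monoidal_category D
  for C :: "('o, 'm, 'y) smc_scheme" and D :: "('p, 'q, 'z) smc_scheme" +
  fixes F :: "('o, 'm, 'p, 'q) mfun"
  assumes map_obj: "X \<in> Obj C \<Longrightarrow> OMap F X \<in> Obj D"
    and map_hom: "f \<in> hom C X Y \<Longrightarrow> AMap F f \<in> hom D (OMap F X) (OMap F Y)"
    and map_id: "X \<in> Obj C \<Longrightarrow> AMap F (Id C X) = Id D (OMap F X)"
    and map_comp: "\<lbrakk>f \<in> hom C X Y; g \<in> hom C Y Z\<rbrakk> \<Longrightarrow>
      AMap F (f \<Zcomp>\<^bsub>C\<^esub> g) = AMap F f \<Zcomp>\<^bsub>D\<^esub> AMap F g"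
    and unit_map_iso: "UnitMap F \<in> iso D (Unit D) (OMap F (Unit C))"
    and ten_map_iso: "\<lbrakk>X \<in> Obj C; Y \<in> Obj C\<rbrakk> \<Longrightarrow>
      TenMap F X Y \<in> iso D (OMap F X \<otimes>\<^bsub>D\<^esub> OMap F Y) (OMap F (X \<otimes>\<^bsub>C\<^esub> Y))"
    and ten_map_nat: "\<lbrakk>f \<in> hom C X X'; g \<in> hom C Y Y'\<rbrakk> \<Longrightarrow>
      (AMap F f \<odot>\<^bsub>D\<^esub> AMap F g) \<Zcomp>\<^bsub>D\<^esub> TenMap F X' Y' = TenMap F X Y \<Zcomp>\<^bsub>D\<^esub> AMap F (f \<odot>\<^bsub>C\<^esub> g)"
    and map_assoc: "\<lbrakk>X \<in> Obj C; Y \<in> Obj C; Z \<in> Obj C\<rbrakk> \<Longrightarrow>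
      (TenMap F X Y \<odot>\<^bsub>D\<^esub> Id D (OMap F Z)) \<Zcomp>\<^bsub>D\<^esub> TenMap F (X \<otimes>\<^bsub>C\<^esub> Y) Z \<Zcomp>\<^bsub>D\<^esub> AMap F (Assoc C X Y Z)
        = Assoc D (OMap F X) (OMap F Y) (OMap F Z) \<Zcomp>\<^bsub>D\<^esub>
            (Id D (OMap F X) \<odot>\<^bsub>D\<^esub> TenMap F Y Z) \<Zcomp>\<^bsub>D\<^esub> TenMap F X (Y \<otimes>\<^bsub>C\<^esub> Z)"
    and map_lunit: "X \<in> Obj C \<Longrightarrow>
      (UnitMap F \<odot>\<^bsub>D\<^esub> Id D (OMap F X)) \<Zcomp>\<^bsub>D\<^esub> TenMap F (Unit C) X \<Zcomp>\<^bsub>D\<^esub> AMap F (Lunit C X)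
        = Lunit D (OMap F X)"
    and map_runit: "X \<in> Obj C \<Longrightarrow>
      (Id D (OMap F X) \<odot>\<^bsub>D\<^esub> UnitMap F) \<Zcomp>\<^bsub>D\<^esub> TenMap F X (Unit C) \<Zcomp>\<^bsub>D\<^esub> AMap F (Runit C X)
        = Runit D (OMap F X)"
    and map_sym: "\<lbrakk>X \<in> Obj C; Y \<in> Obj C\<rbrakk> \<Longrightarrow>
      TenMap F X Y \<Zcomp>\<^bsub>D\<^esub> AMap F (Sym C X Y) = Sym D (OMap F X) (OMap F Y) \<Zcomp>\<^bsub>D\<^esub> TenMap F Y X"

text \<open>The composite monoidal functor, \<open>F\<close> first; \<open>E\<close> is the codomain category of \<open>G\<close>.\<close>

definition mfun_comp ::
  "('r, 's, 'z) smc_scheme \<Rightarrow> ('o, 'm, 'p, 'q) mfun \<Rightarrow> ('p, 'q, 'r, 's) mfun \<Rightarrow> ('o, 'm, 'r, 's) mfun"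
where
  "mfun_comp E F G =
    \<lparr>OMap = (\<lambda>X. OMap G (OMap F X)),
     AMap = (\<lambda>f. AMap G (AMap F f)),
     UnitMap = UnitMap G \<Zcomp>\<^bsub>E\<^esub> AMap G (UnitMap F),
     TenMap = (\<lambda>X Y. TenMap G (OMap F X) (OMap F Y) \<Zcomp>\<^bsub>E\<^esub> AMap G (TenMap F X Y))\<rparr>"

text \<open>
  Equality of monoidal functors out of \<open>C\<close>, structure maps included; values outside the carriers
  of \<open>C\<close> are irrelevant.
\<close>

definition mfun_eq ::
  "('o, 'm, 'z) smc_scheme \<Rightarrow> ('o, 'm, 'p, 'q) mfun \<Rightarrow> ('o, 'm, 'p, 'q) mfun \<Rightarrow> bool"
where
  "mfun_eq C F G \<longleftrightarrow>
    (\<forall>X \<in> Obj C. OMap F X = OMap G X) \<and>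
    (\<forall>f \<in> Arr C. AMap F f = AMap G f) \<and>
    UnitMap F = UnitMap G \<and>
    (\<forall>X \<in> Obj C. \<forall>Y \<in> Obj C. TenMap F X Y = TenMap G X Y)"


section \<open>Feedback monoidal categories\<close>

text \<open>
  \<open>Fbk E S X Y\<close> takes the objects explicitly, since they cannot be recovered from an arrow
  \<open>F S \<otimes> X \<rightarrow> S \<otimes> Y\<close>.
\<close>

record ('o, 'm) fbc = "('o, 'm) smc" +
  Endo :: "('o, 'm, 'o, 'm) mfun"
  Fbk :: "'o \<Rightarrow> 'o \<Rightarrow> 'o \<Rightarrow> 'm \<Rightarrow> 'm"

locale feedback_category =
  symmetric_monoidal_category E + Endo: symmetric_monoidal_functor E E "Endo E"
  for E :: "('o, 'm, 'z) fbc_scheme" (structure) +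
  assumes fbk_hom: "\<lbrakk>S \<in> Obj E; X \<in> Obj E; Y \<in> Obj E; f \<in> hom E (OMap (Endo E) S \<otimes> X) (S \<otimes> Y)\<rbrakk> \<Longrightarrow>
      Fbk E S X Y f \<in> hom E X Y"
    and fbk_tightening: "\<lbrakk>S \<in> Obj E; f \<in> hom E (OMap (Endo E) S \<otimes> X) (S \<otimes> Y);
        u \<in> hom E X' X; v \<in> hom E Y Y'\<rbrakk> \<Longrightarrow>
      u \<Zcomp> Fbk E S X Y f \<Zcomp> v
        = Fbk E S X' Y' ((Id E (OMap (Endo E) S) \<odot> u) \<Zcomp> f \<Zcomp> (Id E S \<odot> v))"
    and fbk_vanishing: "\<lbrakk>X \<in> Obj E; Y \<in> Obj E; f \<in> hom E (OMap (Endo E) (Unit E) \<otimes> X) (Unit E \<otimes> Y)\<rbrakk> \<Longrightarrow>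
      Fbk E (Unit E) X Y f
        = arr_inv E (Lunit E X) \<Zcomp> (UnitMap (Endo E) \<odot> Id E X) \<Zcomp> f \<Zcomp> Lunit E Y"
    and fbk_joining: "\<lbrakk>S \<in> Obj E; T \<in> Obj E; X \<in> Obj E; Y \<in> Obj E;
        f \<in> hom E (OMap (Endo E) S \<otimes> (OMap (Endo E) T \<otimes> X)) (S \<otimes> (T \<otimes> Y))\<rbrakk> \<Longrightarrow>
      Fbk E T X Y (Fbk E S (OMap (Endo E) T \<otimes> X) (T \<otimes> Y) f)
        = Fbk E (S \<otimes> T) X Y
            ((arr_inv E (TenMap (Endo E) S T) \<odot> Id E X) \<Zcomp>
             Assoc E (OMap (Endo E) S) (OMap (Endo E) T) X \<Zcomp> f \<Zcomp> arr_inv E (Assoc E S T Y))"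
    and fbk_strength: "\<lbrakk>S \<in> Obj E; X \<in> Obj E; Y \<in> Obj E;
        f \<in> hom E (OMap (Endo E) S \<otimes> X) (S \<otimes> Y); g \<in> hom E X' Y'\<rbrakk> \<Longrightarrow>
      Fbk E S X Y f \<odot> g
        = Fbk E S (X \<otimes> X') (Y \<otimes> Y')
            (arr_inv E (Assoc E (OMap (Endo E) S) X X') \<Zcomp> (f \<odot> g) \<Zcomp> Assoc E S Y Y')"
    and fbk_sliding: "\<lbrakk>X \<in> Obj E; Y \<in> Obj E; h \<in> hom E S T;
        f \<in> hom E (OMap (Endo E) T \<otimes> X) (S \<otimes> Y)\<rbrakk> \<Longrightarrow>
      Fbk E S X Y ((AMap (Endo E) h \<odot> Id E X) \<Zcomp> f) = Fbk E T X Y (f \<Zcomp> (h \<odot> Id E Y))"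

text \<open>
  \<open>G\<close> commutes with the endofunctors \<open>F\<close> of \<open>C\<close> and \<open>F'\<close> of \<open>D\<close>: the two composites are equal
  as monoidal functors.
\<close>

definition commutes_with ::
  "('o, 'm, 'y) smc_scheme \<Rightarrow> ('o, 'm, 'o, 'm) mfun \<Rightarrow>
   ('p, 'q, 'z) smc_scheme \<Rightarrow> ('p, 'q, 'p, 'q) mfun \<Rightarrow> ('o, 'm, 'p, 'q) mfun \<Rightarrow> bool"
where
  "commutes_with C F D F' G \<longleftrightarrow> mfun_eq C (mfun_comp D F G) (mfun_comp D G F')"

locale feedback_functor =
  E: feedback_category E + B: feedback_category B + symmetric_monoidal_functor E B G
  for E :: "('o, 'm, 'y) fbc_scheme" and B :: "('p, 'q, 'z) fbc_scheme"
    and G :: "('o, 'm, 'p, 'q) mfun" +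
  assumes commutes: "commutes_with E (Endo E) B (Endo B) G"
    and map_fbk: "\<lbrakk>S \<in> Obj E; X \<in> Obj E; Y \<in> Obj E; f \<in> hom E (OMap (Endo E) S \<otimes>\<^bsub>E\<^esub> X) (S \<otimes>\<^bsub>E\<^esub> Y)\<rbrakk> \<Longrightarrow>
      AMap G (Fbk E S X Y f)
        = Fbk B (OMap G S) (OMap G X) (OMap G Y)
            (TenMap G (OMap (Endo E) S) X \<Zcomp>\<^bsub>B\<^esub> AMap G f \<Zcomp>\<^bsub>B\<^esub> arr_inv B (TenMap G S Y))"

text \<open>
  \<open>E\<close> with \<open>J\<close> is a free feedback monoidal category over \<open>(D, F)\<close>. It has the objects of \<open>D\<close>
  and \<open>J\<close> is the identity on them. HOL cannot quantify over types inside a formula, so the type of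
  the target categories of the universal property is a parameter.

  The condition \<open>feedback_functor B B (Endo B)\<close> says that the endofunctor itself preserves feedback,
  \<open>F (fbk\<^sub>S f) = fbk\<^bsub>F S\<^esub> (F f)\<close>. The axioms of \<open>feedback_category\<close> do not imply it. Without it, the
  extension \<open>[S, f] \<mapsto> fbk (G f)\<close> of \<open>G\<close> to the coend \<open>St\<close> below need not commute with the
  endofunctors.
\<close>

definition free_feedback_category ::
  "('p, 'q) fbc itself \<Rightarrow> ('o, 'm, 'y) smc_scheme \<Rightarrow> ('o, 'm, 'o, 'm) mfun \<Rightarrow>
   ('o, 'e) fbc \<Rightarrow> ('o, 'm, 'o, 'e) mfun \<Rightarrow> bool"
where
  "free_feedback_category _ D F E J \<longleftrightarrow>
    symmetric_monoidal_functor D D F \<and>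
    feedback_category E \<and> feedback_functor E E (Endo E) \<and>
    Obj E = Obj D \<and>
    symmetric_monoidal_functor D E J \<and>
    (\<forall>X \<in> Obj D. OMap J X = X) \<and>
    commutes_with D F E (Endo E) J \<and>
    (\<forall>(B :: ('p, 'q) fbc) G.
      feedback_category B \<and> feedback_functor B B (Endo B) \<and>
      symmetric_monoidal_functor D B G \<and> commutes_with D F B (Endo B) G \<longrightarrow>
      (\<exists>H. feedback_functor E B H \<and> mfun_eq D (mfun_comp B J H) G \<and>
        (\<forall>H'. feedback_functor E B H' \<and> mfun_eq D (mfun_comp B J H') G \<longrightarrow> mfun_eq E H' H)))"


section \<open>The coend of stateful morphisms\<close>

definition St_carrier ::
  "('o, 'm, 'z) smc_scheme \<Rightarrow> ('o, 'm, 'o, 'm) mfun \<Rightarrow> 'o \<Rightarrow> 'o \<Rightarrow> ('o \<times> 'm) set"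
where
  "St_carrier D F X Y = (SIGMA S : Obj D. hom D (OMap F S \<otimes>\<^bsub>D\<^esub> X) (S \<otimes>\<^bsub>D\<^esub> Y))"

definition St_step ::
  "('o, 'm, 'z) smc_scheme \<Rightarrow> ('o, 'm, 'o, 'm) mfun \<Rightarrow> 'o \<Rightarrow> 'o \<Rightarrow> 'o \<times> 'm \<Rightarrow> 'o \<times> 'm \<Rightarrow> bool"
where
  "St_step D F X Y p q \<longleftrightarrow>
    (\<exists>S \<in> Obj D. \<exists>T \<in> Obj D. \<exists>r \<in> hom D S T. \<exists>h \<in> hom D (OMap F T \<otimes>\<^bsub>D\<^esub> X) (S \<otimes>\<^bsub>D\<^esub> Y).
      p = (S, (AMap F r \<odot>\<^bsub>D\<^esub> Id D X) \<Zcomp>\<^bsub>D\<^esub> h) \<and> q = (T, h \<Zcomp>\<^bsub>D\<^esub> (r \<odot>\<^bsub>D\<^esub> Id D Y)))"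

definition St_rel ::
  "('o, 'm, 'z) smc_scheme \<Rightarrow> ('o, 'm, 'o, 'm) mfun \<Rightarrow> 'o \<Rightarrow> 'o \<Rightarrow> (('o \<times> 'm) \<times> ('o \<times> 'm)) set"
where
  "St_rel D F X Y = {(p, q) \<in> St_carrier D F X Y \<times> St_carrier D F X Y. equivclp (St_step D F X Y) p q}"

definition St ::
  "('o, 'm, 'z) smc_scheme \<Rightarrow> ('o, 'm, 'o, 'm) mfun \<Rightarrow> 'o \<Rightarrow> 'o \<Rightarrow> ('o \<times> 'm) set set"
where
  "St D F X Y = St_carrier D F X Y // St_rel D F X Y"

text \<open>
  The action of \<open>u : X' \<rightarrow> X\<close> and \<open>v : Y \<rightarrow> Y'\<close> on classes:
  \<open>[S, f] \<mapsto> [S, (id \<otimes> u) \<Zcomp> f \<Zcomp> (id \<otimes> v)]\<close>.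
\<close>

definition St_map ::
  "('o, 'm, 'z) smc_scheme \<Rightarrow> ('o, 'm, 'o, 'm) mfun \<Rightarrow> 'm \<Rightarrow> 'm \<Rightarrow> ('o \<times> 'm) set \<Rightarrow> ('o \<times> 'm) set"
where
  "St_map D F u v c =
    (\<Union>(S, f) \<in> c. St_rel D F (Dom D u) (Cod D v) ``
      {(S, (Id D (OMap F S) \<odot>\<^bsub>D\<^esub> u) \<Zcomp>\<^bsub>D\<^esub> f \<Zcomp>\<^bsub>D\<^esub> (Id D S \<odot>\<^bsub>D\<^esub> v))})"


section \<open>Sequences and the delay functor\<close>

definition seq_category :: "('o, 'm, 'z) smc_scheme \<Rightarrow> (nat \<Rightarrow> 'o, nat \<Rightarrow> 'm) smc" where
  "seq_category C =
    \<lparr>Obj = {X. \<forall>n. X n \<in> Obj C},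
     Arr = {f. \<forall>n. f n \<in> Arr C},
     Dom = (\<lambda>f n. Dom C (f n)),
     Cod = (\<lambda>f n. Cod C (f n)),
     Id = (\<lambda>X n. Id C (X n)),
     Comp = (\<lambda>f g n. f n \<Zcomp>\<^bsub>C\<^esub> g n),
     Unit = (\<lambda>n. Unit C),
     TenO = (\<lambda>X Y n. X n \<otimes>\<^bsub>C\<^esub> Y n),
     TenA = (\<lambda>f g n. f n \<odot>\<^bsub>C\<^esub> g n),
     Assoc = (\<lambda>X Y Z n. Assoc C (X n) (Y n) (Z n)),
     Lunit = (\<lambda>X n. Lunit C (X n)),
     Runit = (\<lambda>X n. Runit C (X n)),
     Sym = (\<lambda>X Y n. Sym C (X n) (Y n))\<rparr>"

text \<open>
  \<open>case_nat a s\<close> is the sequence \<open>(a, s 0, s 1, \<dots>)\<close>. The structure map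
  \<open>\<partial>X \<otimes> \<partial>Y \<rightarrow> \<partial>(X \<otimes> Y)\<close> is \<open>I \<otimes> I \<rightarrow> I\<close> at index \<open>0\<close> and the identity elsewhere.
\<close>

definition delay :: "('o, 'm, 'z) smc_scheme \<Rightarrow> (nat \<Rightarrow> 'o, nat \<Rightarrow> 'm, nat \<Rightarrow> 'o, nat \<Rightarrow> 'm) mfun" where
  "delay C =
    \<lparr>OMap = (\<lambda>X. case_nat (Unit C) X),
     AMap = (\<lambda>f. case_nat (Id C (Unit C)) f),
     UnitMap = (\<lambda>n. Id C (Unit C)),
     TenMap = (\<lambda>X Y. case_nat (Lunit C (Unit C)) (\<lambda>n. Id C (X n \<otimes>\<^bsub>C\<^esub> Y n)))\<rparr>"


section \<open>Dinatural sequences\<close>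

text \<open>\<open>case_nat (Unit C) M n\<close> is \<open>M\<^sub>n\<^sub>-\<^sub>1\<close>, with \<open>M\<^sub>-\<^sub>1 = I\<close>.\<close>

definition eSeq_carrier ::
  "('o, 'm, 'z) smc_scheme \<Rightarrow> (nat \<Rightarrow> 'o) \<Rightarrow> (nat \<Rightarrow> 'o) \<Rightarrow> ((nat \<Rightarrow> 'o) \<times> (nat \<Rightarrow> 'm)) set"
where
  "eSeq_carrier C X Y = {(M, f). (\<forall>n. M n \<in> Obj C) \<and>
    (\<forall>n. f n \<in> hom C (case_nat (Unit C) M n \<otimes>\<^bsub>C\<^esub> X n) (M n \<otimes>\<^bsub>C\<^esub> Y n))}"

definition eSeq_step ::
  "('o, 'm, 'z) smc_scheme \<Rightarrow> (nat \<Rightarrow> 'o) \<Rightarrow> (nat \<Rightarrow> 'o) \<Rightarrow>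
   (nat \<Rightarrow> 'o) \<times> (nat \<Rightarrow> 'm) \<Rightarrow> (nat \<Rightarrow> 'o) \<times> (nat \<Rightarrow> 'm) \<Rightarrow> bool"
where
  "eSeq_step C X Y p q \<longleftrightarrow>
    (\<exists>M N f r. (\<forall>n. M n \<in> Obj C) \<and> (\<forall>n. N n \<in> Obj C) \<and>
      (\<forall>n. f n \<in> hom C (case_nat (Unit C) M n \<otimes>\<^bsub>C\<^esub> X n) (N n \<otimes>\<^bsub>C\<^esub> Y n)) \<and>
      (\<forall>n. r n \<in> hom C (N n) (M n)) \<and>
      p = (M, \<lambda>n. f n \<Zcomp>\<^bsub>C\<^esub> (r n \<odot>\<^bsub>C\<^esub> Id C (Y n))) \<and>
      q = (N, \<lambda>n. (case_nat (Id C (Unit C)) r n \<odot>\<^bsub>C\<^esub> Id C (X n)) \<Zcomp>\<^bsub>C\<^esub> f n))"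

definition eSeq_rel ::
  "('o, 'm, 'z) smc_scheme \<Rightarrow> (nat \<Rightarrow> 'o) \<Rightarrow> (nat \<Rightarrow> 'o) \<Rightarrow>
   (((nat \<Rightarrow> 'o) \<times> (nat \<Rightarrow> 'm)) \<times> ((nat \<Rightarrow> 'o) \<times> (nat \<Rightarrow> 'm))) set"
where
  "eSeq_rel C X Y = {(p, q) \<in> eSeq_carrier C X Y \<times> eSeq_carrier C X Y. equivclp (eSeq_step C X Y) p q}"

definition eSeq ::
  "('o, 'm, 'z) smc_scheme \<Rightarrow> (nat \<Rightarrow> 'o) \<Rightarrow> (nat \<Rightarrow> 'o) \<Rightarrow> ((nat \<Rightarrow> 'o) \<times> (nat \<Rightarrow> 'm)) set set"
where
  "eSeq C X Y = eSeq_carrier C X Y // eSeq_rel C X Y"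

text \<open>
  A type large enough for the arrows of a category whose objects are sequences and whose
  hom-sets are the sets \<open>St (seq_category C) (delay C) X Y\<close>: domain, codomain, class.
\<close>

type_synonym ('o, 'm) stream_arr =
  "(nat \<Rightarrow> 'o) \<times> (nat \<Rightarrow> 'o) \<times> ((nat \<Rightarrow> 'o) \<times> (nat \<Rightarrow> 'm)) set"

end

theory Submission
  imports Defs
begin

text \<open>
  For any symmetric monoidal category \<open>D\<close> with a symmetric strong monoidal endofunctor \<open>F\<close>, the sets
  \<open>St D F X Y\<close> are the hom-sets of a category: \<open>[S, f]\<close> and \<open>[T, g]\<close> compose to a class with state
  \<open>S \<otimes> T\<close>, coherence isomorphisms between state objects being absorbed by sliding. Feedback over \<open>S\<close>
  turns part of the input and output into state, \<open>[T, g] \<mapsto> [T \<otimes> S, g]\<close>.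

  The construction is functorial: \<open>N\<close> commuting with the endofunctors sends \<open>[S, f]\<close> to \<open>[N S, N f]\<close>;
  for \<open>N = F\<close> this is the endofunctor of the new category. If \<open>B\<close> is itself a feedback category whose
  endofunctor preserves feedback, then \<open>[S, f] \<mapsto> fbk\<^sub>S f\<close> is a feedback functor to \<open>B\<close> from the
  category built on \<open>B\<close>. The extension of \<open>G : D \<rightarrow> B\<close> is the composite of these two functors. It is
  unique because \<open>[S, f] = fbk\<^sub>S (J f)\<close>, where \<open>J\<close> embeds \<open>D\<close> by the trivial state.

  Any other free feedback category is isomorphic to this one over \<open>D\<close>, which gives the natural
  bijection. The coend and the dinatural sequences coincide because the generating steps are converse
  to each other.
\<close>

section \<open>Typed arrows\<close>

text \<open>The laws of the new category hold only up to sliding, so most proofs have two halves.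
  One is an identity of diagrams in a symmetric monoidal category in which the incoming state
  \<open>P\<close> and the outgoing state \<open>Q\<close> are unrelated objects; neither
  \<open>F\<close> nor classes occur in it. The other puts in \<open>F S\<close> and
  \<open>S\<close> and matches the two state objects, such as
  \<open>(S \<otimes> T) \<otimes> U\<close> and \<open>S \<otimes> (T \<otimes> U)\<close>, by an
  isomorphism whose image under \<open>F\<close> is known from monoidality. For the interchange law
  this isomorphism is the symmetry, and there the symmetry of \<open>F\<close> enters. Among the
  laws, only the sliding axiom itself moves along an arrow that need not be invertible.

  The tensor is a composite of two one-sided whiskerings, so that naturality and functoriality can
  be checked in one argument at a time.

  Freeness can be stated only for targets of one type. To identify a given free category with the
  constructed one, it is needed on the given side for two types: that of the constructed category,
  to obtain a functor into it, and its own, to see that going there and back is the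
  identity.\<close>

text \<open>
  An arrow with explicit endpoints; the body \<open>None\<close> marks an ill-typed expression. Endpoints and
  composites are then total, associativity holds without typing conditions, and the simplifier can
  normalise diagrams.
\<close>

datatype ('o, 'm) typed = Typed (src: 'o) (tgt: 'o) (body: "'m option")

definition ok :: "('o, 'm, 'z) smc_scheme \<Rightarrow> ('o, 'm) typed \<Rightarrow> bool" where
  "ok C a \<longleftrightarrow> (\<exists>f. body a = Some f \<and> f \<in> hom C (src a) (tgt a))"

definition mk :: "('o, 'm, 'z) smc_scheme \<Rightarrow> 'o \<Rightarrow> 'o \<Rightarrow> 'm \<Rightarrow> ('o, 'm) typed" where
  "mk C X Y f = Typed X Y (if f \<in> hom C X Y then Some f else None)"

definition raw :: "('o, 'm) typed \<Rightarrow> 'm" where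
  "raw a = the (body a)"

definition tcomp :: "('o, 'm, 'z) smc_scheme \<Rightarrow> ('o, 'm) typed \<Rightarrow> ('o, 'm) typed \<Rightarrow> ('o, 'm) typed"
    (infixr "\<bullet>\<index>" 60) where
  "tcomp C a b = Typed (src a) (tgt b)
    (if ok C a \<and> ok C b \<and> tgt a = src b then Some (raw a \<Zcomp>\<^bsub>C\<^esub> raw b) else None)"

definition tten :: "('o, 'm, 'z) smc_scheme \<Rightarrow> ('o, 'm) typed \<Rightarrow> ('o, 'm) typed \<Rightarrow> ('o, 'm) typed"
    (infixr "\<boxtimes>\<index>" 70) where
  "tten C a b = Typed (src a \<otimes>\<^bsub>C\<^esub> src b) (tgt a \<otimes>\<^bsub>C\<^esub> tgt b)
    (if ok C a \<and> ok C b then Some (raw a \<odot>\<^bsub>C\<^esub> raw b) else None)"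

definition tinv :: "('o, 'm, 'z) smc_scheme \<Rightarrow> ('o, 'm) typed \<Rightarrow> ('o, 'm) typed" where
  "tinv C a = mk C (tgt a) (src a) (arr_inv C (raw a))"

definition tid :: "('o, 'm, 'z) smc_scheme \<Rightarrow> 'o \<Rightarrow> ('o, 'm) typed" ("\<iota>\<index>") where
  "tid C X = mk C X X (Id C X)"

definition tassoc :: "('o, 'm, 'z) smc_scheme \<Rightarrow> 'o \<Rightarrow> 'o \<Rightarrow> 'o \<Rightarrow> ('o, 'm) typed" ("\<alpha>\<index>") where
  "tassoc C X Y Z = mk C ((X \<otimes>\<^bsub>C\<^esub> Y) \<otimes>\<^bsub>C\<^esub> Z) (X \<otimes>\<^bsub>C\<^esub> (Y \<otimes>\<^bsub>C\<^esub> Z)) (Assoc C X Y Z)"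

definition tunassoc :: "('o, 'm, 'z) smc_scheme \<Rightarrow> 'o \<Rightarrow> 'o \<Rightarrow> 'o \<Rightarrow> ('o, 'm) typed" ("\<beta>\<index>") where
  "tunassoc C X Y Z = tinv C (tassoc C X Y Z)"

definition tlunit :: "('o, 'm, 'z) smc_scheme \<Rightarrow> 'o \<Rightarrow> ('o, 'm) typed" ("\<l>\<index>") where
  "tlunit C X = mk C (Unit C \<otimes>\<^bsub>C\<^esub> X) X (Lunit C X)"

definition trunit :: "('o, 'm, 'z) smc_scheme \<Rightarrow> 'o \<Rightarrow> ('o, 'm) typed" ("\<r>\<index>") where
  "trunit C X = mk C (X \<otimes>\<^bsub>C\<^esub> Unit C) X (Runit C X)"

definition tsym :: "('o, 'm, 'z) smc_scheme \<Rightarrow> 'o \<Rightarrow> 'o \<Rightarrow> ('o, 'm) typed" ("\<sigma>\<index>") where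
  "tsym C X Y = mk C (X \<otimes>\<^bsub>C\<^esub> Y) (Y \<otimes>\<^bsub>C\<^esub> X) (Sym C X Y)"

definition tiso :: "('o, 'm, 'z) smc_scheme \<Rightarrow> ('o, 'm) typed \<Rightarrow> bool" where
  "tiso C a \<longleftrightarrow> ok C a \<and> raw a \<in> iso C (src a) (tgt a)"

lemma src_tgt_simps [simp]:
  "src (mk C X Y f) = X" "tgt (mk C X Y f) = Y"
  "src (a \<bullet>\<^bsub>C\<^esub> b) = src a" "tgt (a \<bullet>\<^bsub>C\<^esub> b) = tgt b"
  "src (a \<boxtimes>\<^bsub>C\<^esub> b) = src a \<otimes>\<^bsub>C\<^esub> src b" "tgt (a \<boxtimes>\<^bsub>C\<^esub> b) = tgt a \<otimes>\<^bsub>C\<^esub> tgt b"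
  "src (tinv C a) = tgt a" "tgt (tinv C a) = src a"
  "src (\<iota>\<^bsub>C\<^esub> X) = X" "tgt (\<iota>\<^bsub>C\<^esub> X) = X"
  "src (\<alpha>\<^bsub>C\<^esub> X Y Z) = (X \<otimes>\<^bsub>C\<^esub> Y) \<otimes>\<^bsub>C\<^esub> Z" "tgt (\<alpha>\<^bsub>C\<^esub> X Y Z) = X \<otimes>\<^bsub>C\<^esub> (Y \<otimes>\<^bsub>C\<^esub> Z)"
  "tgt (\<beta>\<^bsub>C\<^esub> X Y Z) = (X \<otimes>\<^bsub>C\<^esub> Y) \<otimes>\<^bsub>C\<^esub> Z" "src (\<beta>\<^bsub>C\<^esub> X Y Z) = X \<otimes>\<^bsub>C\<^esub> (Y \<otimes>\<^bsub>C\<^esub> Z)"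
  "src (\<l>\<^bsub>C\<^esub> X) = Unit C \<otimes>\<^bsub>C\<^esub> X" "tgt (\<l>\<^bsub>C\<^esub> X) = X"
  "src (\<r>\<^bsub>C\<^esub> X) = X \<otimes>\<^bsub>C\<^esub> Unit C" "tgt (\<r>\<^bsub>C\<^esub> X) = X"
  "src (\<sigma>\<^bsub>C\<^esub> X Y) = X \<otimes>\<^bsub>C\<^esub> Y" "tgt (\<sigma>\<^bsub>C\<^esub> X Y) = Y \<otimes>\<^bsub>C\<^esub> X"
  by (simp_all add: mk_def tcomp_def tten_def tinv_def tid_def tassoc_def tunassoc_def tlunit_def
      trunit_def tsym_def)

lemma ok_mk: "ok C (mk C X Y f) \<longleftrightarrow> f \<in> hom C X Y"
  by (auto simp: ok_def mk_def)

lemma raw_mk: "f \<in> hom C X Y \<Longrightarrow> raw (mk C X Y f) = f"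
  by (simp add: raw_def mk_def)

lemma mk_raw: "ok C a \<Longrightarrow> mk C (src a) (tgt a) (raw a) = a"
  by (cases a) (auto simp: ok_def mk_def raw_def)

lemma raw_hom: "ok C a \<Longrightarrow> raw a \<in> hom C (src a) (tgt a)"
  by (auto simp: ok_def raw_def)

lemma typed_eqI: "\<lbrakk>ok C a; ok C b; src a = src b; tgt a = tgt b; raw a = raw b\<rbrakk> \<Longrightarrow> a = b"
  by (metis mk_raw)

section \<open>The calculus of typed arrows in a category\<close>

context category
begin

lemma ok_comp [simp]: "ok C (a \<bullet> b) \<longleftrightarrow> ok C a \<and> ok C b \<and> tgt a = src b"
  using comp_hom raw_hom unfolding ok_def tcomp_def by (auto simp: raw_def ok_def)

lemma ok_id [simp]: "ok C (\<iota> X) \<longleftrightarrow> X \<in> Obj C"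
proof
  assume "ok C (\<iota> X)"
  then show "X \<in> Obj C" using dom_obj[of "Id C X"] by (simp add: tid_def ok_mk hom_def)
qed (simp add: tid_def ok_mk id_hom)

lemma ok_obj: "ok C a \<Longrightarrow> src a \<in> Obj C" "ok C a \<Longrightarrow> tgt a \<in> Obj C"
  using dom_obj[of "raw a"] cod_obj[of "raw a"] raw_hom[of C a] by (auto simp: hom_def)

lemma raw_comp: "\<lbrakk>ok C a; ok C b; tgt a = src b\<rbrakk> \<Longrightarrow> raw (a \<bullet> b) = raw a \<Zcomp> raw b"
  by (simp add: tcomp_def raw_def)

lemma raw_id: "X \<in> Obj C \<Longrightarrow> raw (\<iota> X) = Id C X"
  by (simp add: tid_def id_hom raw_mk)

lemma tcomp_assoc [simp]: "(a \<bullet> b) \<bullet> c = a \<bullet> (b \<bullet> c)"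
proof (cases "ok C a \<and> ok C b \<and> ok C c \<and> tgt a = src b \<and> tgt b = src c")
  case True
  then show ?thesis
    using comp_assoc raw_hom by (intro typed_eqI[where C = C]) (fastforce simp: raw_comp)+
next
  case False
  then have "\<not> ok C ((a \<bullet> b) \<bullet> c)" "\<not> ok C (a \<bullet> (b \<bullet> c))" by auto
  moreover have "\<not> ok C (x \<bullet> y) \<Longrightarrow> x \<bullet> y = Typed (src x) (tgt y) None" for x y
    unfolding ok_comp by (auto simp: tcomp_def)
  ultimately show ?thesis by simp
qed

lemma tcomp_id_left [simp]: "\<lbrakk>ok C a; src a = X\<rbrakk> \<Longrightarrow> \<iota> X \<bullet> a = a"
  using id_left[OF raw_hom] by (intro typed_eqI[where C = C]) (auto simp: ok_obj raw_comp raw_id)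

lemma tcomp_id_right [simp]: "\<lbrakk>ok C a; tgt a = X\<rbrakk> \<Longrightarrow> a \<bullet> \<iota> X = a"
  using id_right[OF raw_hom] by (intro typed_eqI[where C = C]) (auto simp: ok_obj raw_comp raw_id)

lemma tcomp_cancel_mid [simp]: "\<lbrakk>ok C a; tgt a = X\<rbrakk> \<Longrightarrow> a \<bullet> \<iota> X \<bullet> b = a \<bullet> b"
  by (metis tcomp_assoc tcomp_id_right)

text \<open>Composites are kept nested to the right, so the factors of a known composite are usually
  followed by a tail. This form of an equation carries the tail along; most rewriting of diagrams
  goes through it.\<close>

lemma tcomp_reassoc: "a \<bullet> b = c \<Longrightarrow> a \<bullet> b \<bullet> k = c \<bullet> k"
  by (metis tcomp_assoc)

lemma tinv:
  assumes "tiso C a"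
  shows "ok C (tinv C a)" "a \<bullet> tinv C a = \<iota> (src a)" "tinv C a \<bullet> a = \<iota> (tgt a)"
proof -
  have a: "ok C a" "raw a \<in> hom C (src a) (tgt a)" using assms by (auto simp: tiso_def raw_hom)
  then have D: "Dom C (raw a) = src a" "Cod C (raw a) = tgt a" by (auto simp: hom_def)
  obtain g where g: "is_inverse C (raw a) g" using assms by (auto simp: tiso_def iso_def)
  \<comment> \<open>Inverses are unique, so the description \<open>arr_inv\<close> denotes
    \<open>g\<close>.\<close>
  have "h = g" if "is_inverse C (raw a) h" for h
  proof -
    have *: "h \<in> hom C (tgt a) (src a)" "g \<in> hom C (tgt a) (src a)" using that g D by (auto
        simp: is_inverse_def)
    have "h = h \<Zcomp> (raw a \<Zcomp> g)" using g D id_right[OF *(1)] by (simp add: is_inverse_def)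
    also have "\<dots> = g" using that D id_left[OF *(2)] by (simp add: is_inverse_def
        flip: comp_assoc[OF *(1) a(2) *(2)])
    finally show ?thesis .
  qed
  then have "arr_inv C (raw a) = g" unfolding arr_inv_def using g by blast
  then have g: "arr_inv C (raw a) \<in> hom C (tgt a) (src a)"
    "raw a \<Zcomp> arr_inv C (raw a) = Id C (src a)" "arr_inv C (raw a) \<Zcomp> raw a = Id C (tgt a)"
    using g D by (auto simp: is_inverse_def)
  show *: "ok C (tinv C a)" using g(1) by (simp add: tinv_def ok_mk)
  have r: "raw (tinv C a) = arr_inv C (raw a)" using g(1) by (simp add: tinv_def raw_mk)
  show "a \<bullet> tinv C a = \<iota> (src a)" "tinv C a \<bullet> a = \<iota> (tgt a)"
    using a * r g by (auto intro!: typed_eqI[where C = C] simp: raw_comp raw_id ok_obj)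
qed

lemma tiso_ok: "tiso C a \<Longrightarrow> ok C a"
  by (simp add: tiso_def)

text \<open>Exhibiting a two-sided inverse also identifies \<open>tinv\<close>; the inverses of
  composites, tensors, symmetries and images under functors are all computed in this way.\<close>

lemma tisoI:
  assumes "ok C a" "ok C b" "src b = tgt a" "tgt b = src a" "a \<bullet> b = \<iota> (src a)" "b \<bullet> a = \<iota> (tgt a)"
  shows "tiso C a" "tinv C a = b"
proof -
  have *: "raw a \<in> hom C (src a) (tgt a)" "raw b \<in> hom C (tgt a) (src a)" using assms raw_hom
      by fastforce+
  have "raw (a \<bullet> b) = Id C (src a)" "raw (b \<bullet> a) = Id C (tgt a)"
    using assms by (simp_all add: ok_obj raw_id)
  then have "raw a \<Zcomp> raw b = Id C (src a)" "raw b \<Zcomp> raw a = Id C (tgt a)"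
    using assms(1-4) by (simp_all add: raw_comp)
  then have "is_inverse C (raw a) (raw b)"
    using * by (simp add: is_inverse_def hom_def)
  then show i: "tiso C a" using * assms by (auto simp: tiso_def iso_def)
  have "tinv C a = tinv C a \<bullet> a \<bullet> b" using assms tinv[OF i] by simp
  also have "\<dots> = (tinv C a \<bullet> a) \<bullet> b" by simp
  also have "\<dots> = b" unfolding tinv(3)[OF i] using assms(2,3) by simp
  finally show "tinv C a = b" .
qed

lemma tinv_tinv [simp]: "tiso C a \<Longrightarrow> tinv C (tinv C a) = a"
  and tiso_tinv [simp]: "tiso C a \<Longrightarrow> tiso C (tinv C a)"
  using tisoI[of "tinv C a" a] tinv[of a] tiso_ok by auto

lemma tinv_cancel [simp]:
  "\<lbrakk>tiso C a; ok C k; src k = src a\<rbrakk> \<Longrightarrow> a \<bullet> tinv C a \<bullet> k = k"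
  "\<lbrakk>tiso C a; ok C k; src k = tgt a\<rbrakk> \<Longrightarrow> tinv C a \<bullet> a \<bullet> k = k"
  "tiso C a \<Longrightarrow> a \<bullet> tinv C a = \<iota> (src a)" "tiso C a \<Longrightarrow> tinv C a \<bullet> a = \<iota> (tgt a)"
  by (simp_all add: tinv flip: tcomp_assoc)

lemma tiso_comp [simp]: "\<lbrakk>tiso C a; tiso C b; tgt a = src b\<rbrakk> \<Longrightarrow> tiso C (a \<bullet> b)"
  and tinv_comp: "\<lbrakk>tiso C a; tiso C b; tgt a = src b\<rbrakk> \<Longrightarrow> tinv C (a \<bullet> b) = tinv C b \<bullet> tinv C a"
  using tisoI[of "a \<bullet> b" "tinv C b \<bullet> tinv C a"] by (auto simp: tinv tiso_ok)

lemma tiso_id [simp]: "X \<in> Obj C \<Longrightarrow> tiso C (\<iota> X)"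
  and tinv_id [simp]: "X \<in> Obj C \<Longrightarrow> tinv C (\<iota> X) = \<iota> X"
  using tisoI[of "\<iota> X" "\<iota> X"] by auto

lemma tcomp_move_left: "\<lbrakk>tiso C a; a \<bullet> b = c; ok C b; src b = tgt a\<rbrakk> \<Longrightarrow> b = tinv C a \<bullet> c"
  by auto

lemma tcomp_move_right: "\<lbrakk>tiso C b; a \<bullet> b = c; ok C a; tgt a = src b\<rbrakk> \<Longrightarrow> a = c \<bullet> tinv C b"
  by auto

lemma tcomp_iso_epi: "\<lbrakk>tiso C a; ok C b; ok C c; src b = tgt a; src c = tgt a; a \<bullet> b = a \<bullet> c\<rbrakk> \<Longrightarrow> b
    = c"
  by (metis tcomp_move_left)

lemma tcomp_iso_mono: "\<lbrakk>tiso C a; ok C b; ok C c; tgt b = src a; tgt c = src a; b \<bullet> a = c \<bullet> a\<rbrakk> \<Longrightarrow> b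
    = c"
  by (metis tcomp_move_right)

lemma tinv_mk: "f \<in> iso C X Y \<Longrightarrow> tinv C (mk C X Y f) = mk C Y X (arr_inv C f)"
  by (simp add: tinv_def raw_mk iso_def)

lemma arr_inv_raw: "tiso C a \<Longrightarrow> arr_inv C (raw a) = raw (tinv C a)"
  using tinv(1)[of a] by (simp add: tinv_def ok_mk raw_mk)

lemma raw_iso: "tiso C a \<Longrightarrow> raw a \<in> iso C (src a) (tgt a)"
  by (simp add: tiso_def)

lemma tiso_mk: "tiso C (mk C X Y f) \<longleftrightarrow> f \<in> iso C X Y"
  by (auto simp: tiso_def ok_mk raw_mk iso_def)

end

section \<open>Typed arrows and the tensor product\<close>

context symmetric_monoidal_category
begin

lemmas [simp] = unit_obj ten_obj

lemma ok_ten [simp]: "ok C (a \<boxtimes> b) \<longleftrightarrow> ok C a \<and> ok C b"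
  using ten_hom raw_hom unfolding ok_def tten_def by (auto simp: raw_def ok_def)

lemma raw_ten: "\<lbrakk>ok C a; ok C b\<rbrakk> \<Longrightarrow> raw (a \<boxtimes> b) = raw a \<odot> raw b"
  by (simp add: tten_def raw_def)

lemma ok_None: "\<not> ok C (Typed X Y None)"
  by (simp add: ok_def)

lemma not_ok_ten: "\<not> ok C a \<or> \<not> ok C b \<Longrightarrow> a \<boxtimes> b = Typed (src a \<otimes> src b) (tgt a \<otimes> tgt b) None"
  by (auto simp: tten_def)

lemma not_ok_comp: "\<not> ok C a \<or> \<not> ok C b \<Longrightarrow> a \<bullet> b = Typed (src a) (tgt b) None"
  by (auto simp: tcomp_def)

text \<open>With an ill-typed factor neither side has a body, so only endpoints are assumed. They
  matter because \<open>\<otimes>\<close> need not be injective on objects: the right-hand side can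
  be well-typed although the composites on the left do not match.\<close>

lemma tten_comp: "\<lbrakk>tgt a = src b; tgt c = src d\<rbrakk> \<Longrightarrow> (a \<bullet> b) \<boxtimes> (c \<bullet> d) = (a \<boxtimes> c) \<bullet> (b \<boxtimes> d)"
proof (cases "ok C a \<and> ok C b \<and> ok C c \<and> ok C d")
  case True
  moreover assume "tgt a = src b" "tgt c = src d"
  ultimately show ?thesis
    using ten_comp raw_hom by (intro typed_eqI[where C = C]) (fastforce simp: raw_comp raw_ten)+
next
  case False
  then show ?thesis by (auto simp add: ok_None not_ok_ten not_ok_comp)
qed

lemma tten_id [simp]: "\<lbrakk>X \<in> Obj C; Y \<in> Obj C\<rbrakk> \<Longrightarrow> \<iota> X \<boxtimes> \<iota> Y = \<iota> (X \<otimes> Y)"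
  by (intro typed_eqI[where C = C]) (auto simp: raw_ten raw_id ten_id)

lemma whisker_left_comp: "tgt a = src b \<Longrightarrow> \<iota> X \<boxtimes> (a \<bullet> b) = (\<iota> X \<boxtimes> a) \<bullet> (\<iota> X \<boxtimes> b)"
proof (cases "X \<in> Obj C")
  case True
  then show "tgt a = src b \<Longrightarrow> ?thesis" using tten_comp[of "\<iota> X" "\<iota> X" a b] by simp
qed (simp add: ok_None not_ok_ten not_ok_comp)

lemma whisker_right_comp: "tgt a = src b \<Longrightarrow> (a \<bullet> b) \<boxtimes> \<iota> X = (a \<boxtimes> \<iota> X) \<bullet> (b \<boxtimes> \<iota> X)"
proof (cases "X \<in> Obj C")
  case True
  then show "tgt a = src b \<Longrightarrow> ?thesis" using tten_comp[of a b "\<iota> X" "\<iota> X"] by simp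
qed (simp add: ok_None not_ok_ten not_ok_comp)

lemmas whisker = whisker_left_comp whisker_right_comp

lemma interchange:
  assumes "src b = Y" "tgt a = X'" "src a = X" "tgt b = Y'"
  shows "(a \<boxtimes> \<iota> Y) \<bullet> (\<iota> X' \<boxtimes> b) = a \<boxtimes> b" "(\<iota> X \<boxtimes> b) \<bullet> (a \<boxtimes> \<iota> Y') = a \<boxtimes> b"
proof (atomize (full), cases "ok C a \<and> ok C b")
  case True
  then show "(a \<boxtimes> \<iota> Y) \<bullet> (\<iota> X' \<boxtimes> b) = a \<boxtimes> b \<and> (\<iota> X \<boxtimes> b) \<bullet> (a \<boxtimes> \<iota> Y') = a \<boxtimes> b"
    using assms by (auto simp flip: tten_comp)
next
  case False
  then show "(a \<boxtimes> \<iota> Y) \<bullet> (\<iota> X' \<boxtimes> b) = a \<boxtimes> b \<and> (\<iota> X \<boxtimes> b) \<bullet> (a \<boxtimes> \<iota> Y') = a \<boxtimes> b"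
    using assms by (auto simp add: ok_None not_ok_ten not_ok_comp)
qed

lemma tiso_ten [simp]: "\<lbrakk>tiso C a; tiso C b\<rbrakk> \<Longrightarrow> tiso C (a \<boxtimes> b)"
  and tinv_ten: "\<lbrakk>tiso C a; tiso C b\<rbrakk> \<Longrightarrow> tinv C (a \<boxtimes> b) = tinv C a \<boxtimes> tinv C b"
  using tisoI[of "a \<boxtimes> b" "tinv C a \<boxtimes> tinv C b"] tiso_ok
  by (auto simp: tinv ok_obj simp flip: tten_comp)

lemma tiso_structure [simp]:
  "\<lbrakk>X \<in> Obj C; Y \<in> Obj C; Z \<in> Obj C\<rbrakk> \<Longrightarrow> tiso C (\<alpha> X Y Z)"
  "\<lbrakk>X \<in> Obj C; Y \<in> Obj C; Z \<in> Obj C\<rbrakk> \<Longrightarrow> tiso C (\<beta> X Y Z)"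
  "X \<in> Obj C \<Longrightarrow> tiso C (\<l> X)" "X \<in> Obj C \<Longrightarrow> tiso C (\<r> X)"
  using assoc_iso lunit_iso runit_iso
  by (auto simp: tassoc_def tunassoc_def tlunit_def trunit_def tiso_mk)

lemma ok_structure [simp]:
  "\<lbrakk>X \<in> Obj C; Y \<in> Obj C; Z \<in> Obj C\<rbrakk> \<Longrightarrow> ok C (\<alpha> X Y Z)"
  "\<lbrakk>X \<in> Obj C; Y \<in> Obj C; Z \<in> Obj C\<rbrakk> \<Longrightarrow> ok C (\<beta> X Y Z)"
  "X \<in> Obj C \<Longrightarrow> ok C (\<l> X)" "X \<in> Obj C \<Longrightarrow> ok C (\<r> X)"
  "\<lbrakk>X \<in> Obj C; Y \<in> Obj C\<rbrakk> \<Longrightarrow> ok C (\<sigma> X Y)"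
  using sym_hom by (auto simp: tiso_ok tsym_def ok_mk)

lemma raw_structure:
  "\<lbrakk>X \<in> Obj C; Y \<in> Obj C; Z \<in> Obj C\<rbrakk> \<Longrightarrow> raw (\<alpha> X Y Z) = Assoc C X Y Z"
  "X \<in> Obj C \<Longrightarrow> raw (\<l> X) = Lunit C X" "X \<in> Obj C \<Longrightarrow> raw (\<r> X) = Runit C X"
  "\<lbrakk>X \<in> Obj C; Y \<in> Obj C\<rbrakk> \<Longrightarrow> raw (\<sigma> X Y) = Sym C X Y"
  using assoc_iso lunit_iso runit_iso sym_hom
  by (auto simp: tassoc_def tlunit_def trunit_def tsym_def raw_mk iso_def)

lemma raw_unassoc:
  "\<lbrakk>X \<in> Obj C; Y \<in> Obj C; Z \<in> Obj C\<rbrakk> \<Longrightarrow> raw (\<beta> X Y Z) = arr_inv C (Assoc C X Y Z)"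
  by (simp add: tunassoc_def arr_inv_raw[symmetric] raw_structure)

lemma \<alpha>\<beta> [simp]:
  assumes "X \<in> Obj C" "Y \<in> Obj C" "Z \<in> Obj C"
  shows "\<alpha> X Y Z \<bullet> \<beta> X Y Z = \<iota> ((X \<otimes> Y) \<otimes> Z)" "\<beta> X Y Z \<bullet> \<alpha> X Y Z = \<iota> (X \<otimes> (Y \<otimes> Z))"
    "\<lbrakk>ok C k; src k = (X \<otimes> Y) \<otimes> Z\<rbrakk> \<Longrightarrow> \<alpha> X Y Z \<bullet> \<beta> X Y Z \<bullet> k = k"
    "\<lbrakk>ok C k; src k = X \<otimes> (Y \<otimes> Z)\<rbrakk> \<Longrightarrow> \<beta> X Y Z \<bullet> \<alpha> X Y Z \<bullet> k = k"
  using assms by (auto simp: tunassoc_def)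

lemma tinv_assoc [simp]:
  assumes "X \<in> Obj C" "Y \<in> Obj C" "Z \<in> Obj C"
  shows "tinv C (\<alpha> X Y Z) = \<beta> X Y Z" "tinv C (\<beta> X Y Z) = \<alpha> X Y Z"
  using assms by (auto simp: tunassoc_def)

lemma \<sigma>\<sigma> [simp]:
  assumes "X \<in> Obj C" "Y \<in> Obj C"
  shows "\<sigma> X Y \<bullet> \<sigma> Y X = \<iota> (X \<otimes> Y)"
    "\<lbrakk>ok C k; src k = X \<otimes> Y\<rbrakk> \<Longrightarrow> \<sigma> X Y \<bullet> \<sigma> Y X \<bullet> k = k"
proof -
  show *: "\<sigma> X Y \<bullet> \<sigma> Y X = \<iota> (X \<otimes> Y)"
    using assms by (auto intro!: typed_eqI[where C = C] simp: raw_comp raw_id raw_structure sym_inv)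
  show "\<lbrakk>ok C k; src k = X \<otimes> Y\<rbrakk> \<Longrightarrow> \<sigma> X Y \<bullet> \<sigma> Y X \<bullet> k = k"
    using * by (simp flip: tcomp_assoc)
qed

lemma tiso_sym [simp]: "\<lbrakk>X \<in> Obj C; Y \<in> Obj C\<rbrakk> \<Longrightarrow> tiso C (\<sigma> X Y)"
  and tinv_sym [simp]: "\<lbrakk>X \<in> Obj C; Y \<in> Obj C\<rbrakk> \<Longrightarrow> tinv C (\<sigma> X Y) = \<sigma> Y X"
  using tisoI[of "\<sigma> X Y" "\<sigma> Y X"] by auto

lemma \<alpha>_natural:
  assumes "ok C f" "ok C g" "ok C h" "tgt f = X'" "tgt g = Y'" "tgt h = Z'" "src f = X" "src g
      = Y" "src h = Z"
  shows "((f \<boxtimes> g) \<boxtimes> h) \<bullet> \<alpha> X' Y' Z' = \<alpha> X Y Z \<bullet> (f \<boxtimes> (g \<boxtimes> h))"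
  using assms assoc_nat[of "raw f" X X' "raw g" Y Y' "raw h" Z Z'] raw_hom[of C f] raw_hom[of C g]
      raw_hom[of C h]
  by (auto intro!: typed_eqI[where C = C] simp: raw_comp raw_ten raw_structure ok_obj)

lemma \<beta>_natural:
  assumes "ok C f" "ok C g" "ok C h" "tgt f = X'" "tgt g = Y'" "tgt h = Z'" "src f = X" "src g
      = Y" "src h = Z"
  shows "(f \<boxtimes> (g \<boxtimes> h)) \<bullet> \<beta> X' Y' Z' = \<beta> X Y Z \<bullet> ((f \<boxtimes> g) \<boxtimes> h)"
proof -
  have o: "X \<in> Obj C" "Y \<in> Obj C" "Z \<in> Obj C" "X' \<in> Obj C" "Y' \<in> Obj C" "Z' \<in> Obj C"
    using assms ok_obj by auto
  have "\<beta> X Y Z \<bullet> (((f \<boxtimes> g) \<boxtimes> h) \<bullet> \<alpha> X' Y' Z') \<bullet> \<beta> X' Y' Z' = (f \<boxtimes> (g \<boxtimes> h)) \<bullet> \<beta> X' Y' Z'"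
    unfolding \<alpha>_natural[OF assms] using assms o by simp
  then show ?thesis using o assms by simp
qed

lemma \<l>_natural:
  assumes "ok C f" "src f = X" "tgt f = Y"
  shows "(\<iota> (Unit C) \<boxtimes> f) \<bullet> \<l> Y = \<l> X \<bullet> f"
  using assms lunit_nat[of "raw f" X Y] raw_hom[of C f]
  by (auto intro!: typed_eqI[where C = C] simp: raw_comp raw_ten raw_structure ok_obj raw_id)

lemma \<r>_natural:
  assumes "ok C f" "src f = X" "tgt f = Y"
  shows "(f \<boxtimes> \<iota> (Unit C)) \<bullet> \<r> Y = \<r> X \<bullet> f"
  using assms runit_nat[of "raw f" X Y] raw_hom[of C f]
  by (auto intro!: typed_eqI[where C = C] simp: raw_comp raw_ten raw_structure ok_obj raw_id)

lemma \<sigma>_natural: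
  assumes "ok C f" "ok C g" "tgt f = X'" "tgt g = Y'" "src f = X" "src g = Y"
  shows "(f \<boxtimes> g) \<bullet> \<sigma> X' Y' = \<sigma> X Y \<bullet> (g \<boxtimes> f)"
  using assms sym_nat[of "raw f" X X' "raw g" Y Y'] raw_hom[of C f] raw_hom[of C g]
  by (auto intro!: typed_eqI[where C = C] simp: raw_comp raw_ten raw_structure ok_obj)

lemma \<alpha>_pentagon:
  assumes "W \<in> Obj C" "X \<in> Obj C" "Y \<in> Obj C" "Z \<in> Obj C"
  shows "(\<alpha> W X Y \<boxtimes> \<iota> Z) \<bullet> \<alpha> W (X \<otimes> Y) Z \<bullet> (\<iota> W \<boxtimes> \<alpha> X Y Z) = \<alpha> (W \<otimes> X) Y Z \<bullet> \<alpha> W X (Y \<otimes> Z)"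
  using assms pentagon[of W X Y Z] raw_hom[of C "\<alpha> W X Y \<boxtimes> \<iota> Z"]  raw_hom[of C
      "\<alpha> W (X \<otimes> Y) Z"] raw_hom[of C "\<iota> W \<boxtimes> \<alpha> X Y Z"]
  by (auto intro!: typed_eqI[where C = C] simp: raw_comp raw_ten raw_structure raw_id comp_assoc)

lemma \<alpha>_triangle:
  assumes "X \<in> Obj C" "Y \<in> Obj C"
  shows "\<alpha> X (Unit C) Y \<bullet> (\<iota> X \<boxtimes> \<l> Y) = \<r> X \<boxtimes> \<iota> Y"
  using assms triangle[of X Y]
  by (auto intro!: typed_eqI[where C = C] simp: raw_comp raw_ten raw_structure raw_id)

lemma \<sigma>_hexagon:
  assumes "X \<in> Obj C" "Y \<in> Obj C" "Z \<in> Obj C"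
  shows "\<alpha> X Y Z \<bullet> \<sigma> X (Y \<otimes> Z) \<bullet> \<alpha> Y Z X = (\<sigma> X Y \<boxtimes> \<iota> Z) \<bullet> \<alpha> Y X Z \<bullet> (\<iota> Y \<boxtimes> \<sigma> X Z)"
proof -
  have "raw ((\<alpha> X Y Z \<bullet> \<sigma> X (Y \<otimes> Z)) \<bullet> \<alpha> Y Z X) = raw (((\<sigma> X Y \<boxtimes> \<iota> Z) \<bullet> \<alpha> Y X Z) \<bullet> (\<iota> Y \<boxtimes> \<sigma> X Z))"
    using assms hexagon[of X Y Z]
    by (simp add: raw_comp raw_ten raw_structure raw_id del: tcomp_assoc)
  then show ?thesis using assms by (intro typed_eqI[where C = C]) auto
qed

end

section \<open>Coherence\<close>

context symmetric_monoidal_category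
begin

lemma whisker_cancel:
  assumes "tiso C a" "W \<in> Obj C"
  shows "(\<iota> W \<boxtimes> a) \<bullet> (\<iota> W \<boxtimes> tinv C a) = \<iota> (W \<otimes> src a)"
    "(\<iota> W \<boxtimes> tinv C a) \<bullet> (\<iota> W \<boxtimes> a) = \<iota> (W \<otimes> tgt a)"
    "(a \<boxtimes> \<iota> W) \<bullet> (tinv C a \<boxtimes> \<iota> W) = \<iota> (src a \<otimes> W)"
    "(tinv C a \<boxtimes> \<iota> W) \<bullet> (a \<boxtimes> \<iota> W) = \<iota> (tgt a \<otimes> W)"
    "\<lbrakk>ok C k; src k = W \<otimes> src a\<rbrakk> \<Longrightarrow> (\<iota> W \<boxtimes> a) \<bullet> (\<iota> W \<boxtimes> tinv C a) \<bullet> k = k"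
    "\<lbrakk>ok C k; src k = W \<otimes> tgt a\<rbrakk> \<Longrightarrow> (\<iota> W \<boxtimes> tinv C a) \<bullet> (\<iota> W \<boxtimes> a) \<bullet> k = k"
    "\<lbrakk>ok C k; src k = src a \<otimes> W\<rbrakk> \<Longrightarrow> (a \<boxtimes> \<iota> W) \<bullet> (tinv C a \<boxtimes> \<iota> W) \<bullet> k = k"
    "\<lbrakk>ok C k; src k = tgt a \<otimes> W\<rbrakk> \<Longrightarrow> (tinv C a \<boxtimes> \<iota> W) \<bullet> (a \<boxtimes> \<iota> W) \<bullet> k = k"
proof -
  note * = tiso_ok[OF assms(1)] ok_obj[OF tiso_ok[OF assms(1)]]
  show 1: "(\<iota> W \<boxtimes> a) \<bullet> (\<iota> W \<boxtimes> tinv C a) = \<iota> (W \<otimes> src a)"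
    "(\<iota> W \<boxtimes> tinv C a) \<bullet> (\<iota> W \<boxtimes> a) = \<iota> (W \<otimes> tgt a)"
    "(a \<boxtimes> \<iota> W) \<bullet> (tinv C a \<boxtimes> \<iota> W) = \<iota> (src a \<otimes> W)"
    "(tinv C a \<boxtimes> \<iota> W) \<bullet> (a \<boxtimes> \<iota> W) = \<iota> (tgt a \<otimes> W)"
    using assms * by (simp_all flip: whisker)
  show "\<lbrakk>ok C k; src k = W \<otimes> src a\<rbrakk> \<Longrightarrow> (\<iota> W \<boxtimes> a) \<bullet> (\<iota> W \<boxtimes> tinv C a) \<bullet> k = k"
    "\<lbrakk>ok C k; src k = W \<otimes> tgt a\<rbrakk> \<Longrightarrow> (\<iota> W \<boxtimes> tinv C a) \<bullet> (\<iota> W \<boxtimes> a) \<bullet> k = k"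
    "\<lbrakk>ok C k; src k = src a \<otimes> W\<rbrakk> \<Longrightarrow> (a \<boxtimes> \<iota> W) \<bullet> (tinv C a \<boxtimes> \<iota> W) \<bullet> k = k"
    "\<lbrakk>ok C k; src k = tgt a \<otimes> W\<rbrakk> \<Longrightarrow> (tinv C a \<boxtimes> \<iota> W) \<bullet> (a \<boxtimes> \<iota> W) \<bullet> k = k"
    using 1[THEN tcomp_reassoc] by simp_all
qed

lemma whisker_cancel_structure [simp]:
  assumes "W \<in> Obj C" "X \<in> Obj C" "Y \<in> Obj C" "Z \<in> Obj C"
  shows
    "(\<iota> W \<boxtimes> \<alpha> X Y Z) \<bullet> (\<iota> W \<boxtimes> \<beta> X Y Z) = \<iota> (W \<otimes> ((X \<otimes> Y) \<otimes> Z))"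
    "(\<iota> W \<boxtimes> \<beta> X Y Z) \<bullet> (\<iota> W \<boxtimes> \<alpha> X Y Z) = \<iota> (W \<otimes> (X \<otimes> (Y \<otimes> Z)))"
    "(\<alpha> X Y Z \<boxtimes> \<iota> W) \<bullet> (\<beta> X Y Z \<boxtimes> \<iota> W) = \<iota> (((X \<otimes> Y) \<otimes> Z) \<otimes> W)"
    "(\<beta> X Y Z \<boxtimes> \<iota> W) \<bullet> (\<alpha> X Y Z \<boxtimes> \<iota> W) = \<iota> ((X \<otimes> (Y \<otimes> Z)) \<otimes> W)"
    "\<lbrakk>ok C k; src k = W \<otimes> ((X \<otimes> Y) \<otimes> Z)\<rbrakk> \<Longrightarrow> (\<iota> W \<boxtimes> \<alpha> X Y Z) \<bullet> (\<iota> W \<boxtimes> \<beta> X Y Z) \<bullet> k = k"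
    "\<lbrakk>ok C k; src k = W \<otimes> (X \<otimes> (Y \<otimes> Z))\<rbrakk> \<Longrightarrow> (\<iota> W \<boxtimes> \<beta> X Y Z) \<bullet> (\<iota> W \<boxtimes> \<alpha> X Y Z) \<bullet> k = k"
    "\<lbrakk>ok C k; src k = ((X \<otimes> Y) \<otimes> Z) \<otimes> W\<rbrakk> \<Longrightarrow> (\<alpha> X Y Z \<boxtimes> \<iota> W) \<bullet> (\<beta> X Y Z \<boxtimes> \<iota> W) \<bullet> k = k"
    "\<lbrakk>ok C k; src k = (X \<otimes> (Y \<otimes> Z)) \<otimes> W\<rbrakk> \<Longrightarrow> (\<beta> X Y Z \<boxtimes> \<iota> W) \<bullet> (\<alpha> X Y Z \<boxtimes> \<iota> W) \<bullet> k = k"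
  using assms whisker_cancel[of "\<alpha> X Y Z" W] by simp_all

lemma whisker_cancel_sym [simp]:
  assumes "W \<in> Obj C" "X \<in> Obj C" "Y \<in> Obj C"
  shows
    "(\<iota> W \<boxtimes> \<sigma> X Y) \<bullet> (\<iota> W \<boxtimes> \<sigma> Y X) = \<iota> (W \<otimes> (X \<otimes> Y))"
    "(\<sigma> X Y \<boxtimes> \<iota> W) \<bullet> (\<sigma> Y X \<boxtimes> \<iota> W) = \<iota> ((X \<otimes> Y) \<otimes> W)"
    "\<lbrakk>ok C k; src k = W \<otimes> (X \<otimes> Y)\<rbrakk> \<Longrightarrow> (\<iota> W \<boxtimes> \<sigma> X Y) \<bullet> (\<iota> W \<boxtimes> \<sigma> Y X) \<bullet> k = k"
    "\<lbrakk>ok C k; src k = (X \<otimes> Y) \<otimes> W\<rbrakk> \<Longrightarrow> (\<sigma> X Y \<boxtimes> \<iota> W) \<bullet> (\<sigma> Y X \<boxtimes> \<iota> W) \<bullet> k = k"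
  using assms whisker_cancel[of "\<sigma> X Y" W] by simp_all

section \<open>Coherence of the unit isomorphisms\<close>

lemma tten_unit_faithful:
  assumes "ok C f" "ok C g" "src f = src g" "tgt f = tgt g" "f \<boxtimes> \<iota> (Unit C) = g \<boxtimes> \<iota> (Unit C)"
  shows "f = g"
proof (rule tcomp_iso_epi)
  \<comment> \<open>Naturality of \<open>\<r>\<close> turns
    \<open>f \<boxtimes> \<iota> (Unit C)\<close> back into \<open>f\<close>, and
    \<open>\<r>\<close> is invertible.\<close>
  show "\<r> (src f) \<bullet> f = \<r> (src f) \<bullet> g"
    using assms by (simp flip: \<r>_natural)
qed (use assms ok_obj in auto)

lemma unit_tten_faithful:
  assumes "ok C f" "ok C g" "src f = src g" "tgt f = tgt g" "\<iota> (Unit C) \<boxtimes> f = \<iota> (Unit C) \<boxtimes> g"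
  shows "f = g"
proof (rule tcomp_iso_epi)
  show "\<l> (src f) \<bullet> f = \<l> (src f) \<bullet> g"
    using assms by (simp flip: \<l>_natural)
qed (use assms ok_obj in auto)

text \<open>Naturality with identities in two of the three places. A tensor of identities is
  normalised to a single identity, so the general form would not match these instances.\<close>

lemma \<alpha>_natural_whisker:
  "\<lbrakk>ok C f; Y \<in> Obj C; Z \<in> Obj C; tgt f = X'; src f = X\<rbrakk> \<Longrightarrow>
    ((f \<boxtimes> \<iota> Y) \<boxtimes> \<iota> Z) \<bullet> \<alpha> X' Y Z = \<alpha> X Y Z \<bullet> (f \<boxtimes> \<iota> (Y \<otimes> Z))"
  "\<lbrakk>ok C f; X \<in> Obj C; Z \<in> Obj C; tgt f = Y'; src f = Y\<rbrakk> \<Longrightarrow>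
    ((\<iota> X \<boxtimes> f) \<boxtimes> \<iota> Z) \<bullet> \<alpha> X Y' Z = \<alpha> X Y Z \<bullet> (\<iota> X \<boxtimes> (f \<boxtimes> \<iota> Z))"
  "\<lbrakk>ok C f; X \<in> Obj C; Y \<in> Obj C; tgt f = Z'; src f = Z\<rbrakk> \<Longrightarrow>
    (\<iota> (X \<otimes> Y) \<boxtimes> f) \<bullet> \<alpha> X Y Z' = \<alpha> X Y Z \<bullet> (\<iota> X \<boxtimes> (\<iota> Y \<boxtimes> f))"
  using \<alpha>_natural[of f "\<iota> Y" "\<iota> Z" X' Y Z X Y Z] \<alpha>_natural[of "\<iota> X" f "\<iota> Z" X Y' Z X Y Z]
    \<alpha>_natural[of "\<iota> X" "\<iota> Y" f X Y Z' X Y Z] by simp_all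

lemma \<beta>_natural_whisker:
  "\<lbrakk>ok C f; Y \<in> Obj C; Z \<in> Obj C; tgt f = X'; src f = X\<rbrakk> \<Longrightarrow>
    (f \<boxtimes> \<iota> (Y \<otimes> Z)) \<bullet> \<beta> X' Y Z = \<beta> X Y Z \<bullet> ((f \<boxtimes> \<iota> Y) \<boxtimes> \<iota> Z)"
  "\<lbrakk>ok C f; X \<in> Obj C; Z \<in> Obj C; tgt f = Y'; src f = Y\<rbrakk> \<Longrightarrow>
    (\<iota> X \<boxtimes> (f \<boxtimes> \<iota> Z)) \<bullet> \<beta> X Y' Z = \<beta> X Y Z \<bullet> ((\<iota> X \<boxtimes> f) \<boxtimes> \<iota> Z)"
  "\<lbrakk>ok C f; X \<in> Obj C; Y \<in> Obj C; tgt f = Z'; src f = Z\<rbrakk> \<Longrightarrow>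
    (\<iota> X \<boxtimes> (\<iota> Y \<boxtimes> f)) \<bullet> \<beta> X Y Z' = \<beta> X Y Z \<bullet> (\<iota> (X \<otimes> Y) \<boxtimes> f)"
  using \<beta>_natural[of f "\<iota> Y" "\<iota> Z" X' Y Z X Y Z] \<beta>_natural[of "\<iota> X" f "\<iota> Z" X Y' Z X Y Z]
    \<beta>_natural[of "\<iota> X" "\<iota> Y" f X Y Z' X Y Z] by simp_all

text \<open>The pentagon with some of its sides moved across and inverted, one version for each way
  in which associators meet in the diagrams below.\<close>

lemma pentagons:
  assumes "W \<in> Obj C" "X \<in> Obj C" "Y \<in> Obj C" "Z \<in> Obj C"
  shows
    "\<beta> W (X \<otimes> Y) Z \<bullet> (\<beta> W X Y \<boxtimes> \<iota> Z) \<bullet> \<alpha> (W \<otimes> X) Y Z = (\<iota> W \<boxtimes> \<alpha> X Y Z) \<bullet> \<beta> W X (Y \<otimes> Z)"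
    "\<beta> (W \<otimes> X) Y Z \<bullet> (\<alpha> W X Y \<boxtimes> \<iota> Z) \<bullet> \<alpha> W (X \<otimes> Y) Z = \<alpha> W X (Y \<otimes> Z) \<bullet> (\<iota> W \<boxtimes> \<beta> X Y Z)"
    "\<alpha> W (X \<otimes> Y) Z \<bullet> (\<iota> W \<boxtimes> \<alpha> X Y Z) \<bullet> \<beta> W X (Y \<otimes> Z) = (\<beta> W X Y \<boxtimes> \<iota> Z) \<bullet> \<alpha> (W \<otimes> X) Y Z"
    "\<beta> W X (Y \<otimes> Z) \<bullet> \<beta> (W \<otimes> X) Y Z = (\<iota> W \<boxtimes> \<beta> X Y Z) \<bullet> \<beta> W (X \<otimes> Y) Z \<bullet> (\<beta> W X Y \<boxtimes> \<iota> Z)"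
    "\<alpha> W X (Y \<otimes> Z) \<bullet> (\<iota> W \<boxtimes> \<beta> X Y Z) \<bullet> \<beta> W (X \<otimes> Y) Z = \<beta> (W \<otimes> X) Y Z \<bullet> (\<alpha> W X Y \<boxtimes> \<iota> Z)"
proof -
  note p = \<alpha>_pentagon[OF assms]
  have "\<beta> W (X \<otimes> Y) Z \<bullet> (\<beta> W X Y \<boxtimes> \<iota> Z) \<bullet> (\<alpha> (W \<otimes> X) Y Z \<bullet> \<alpha> W X (Y \<otimes> Z)) \<bullet> \<beta> W X (Y \<otimes> Z)
     = (\<iota> W \<boxtimes> \<alpha> X Y Z) \<bullet> \<beta> W X (Y \<otimes> Z)"
    unfolding p[symmetric] using assms by simp
  then show "\<beta> W (X \<otimes> Y) Z \<bullet> (\<beta> W X Y \<boxtimes> \<iota> Z) \<bullet> \<alpha> (W \<otimes> X) Y Z = (\<iota> W \<boxtimes> \<alpha> X Y Z) \<bullet> \<beta> W X (Y \<otimes> Z)"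
    using assms by simp
  have "\<beta> (W \<otimes> X) Y Z \<bullet> ((\<alpha> W X Y \<boxtimes> \<iota> Z) \<bullet> \<alpha> W (X \<otimes> Y) Z \<bullet> (\<iota> W \<boxtimes> \<alpha> X Y Z)) \<bullet> (\<iota> W \<boxtimes> \<beta> X Y Z)
     = \<alpha> W X (Y \<otimes> Z) \<bullet> (\<iota> W \<boxtimes> \<beta> X Y Z)"
    unfolding p using assms by simp
  then show *: "\<beta> (W \<otimes> X) Y Z \<bullet> (\<alpha> W X Y \<boxtimes> \<iota> Z) \<bullet> \<alpha> W (X \<otimes> Y) Z = \<alpha> W X (Y \<otimes> Z) \<bullet> (\<iota> W \<boxtimes> \<beta> X Y Z)"
    using assms by simp
  have "(\<beta> W X Y \<boxtimes> \<iota> Z) \<bullet> ((\<alpha> W X Y \<boxtimes> \<iota> Z) \<bullet> \<alpha> W (X \<otimes> Y) Z \<bullet> (\<iota> W \<boxtimes> \<alpha> X Y Z)) \<bullet> \<beta> W X (Y \<otimes> Z)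
     = (\<beta> W X Y \<boxtimes> \<iota> Z) \<bullet> \<alpha> (W \<otimes> X) Y Z"
    unfolding p using assms by simp
  then show "\<alpha> W (X \<otimes> Y) Z \<bullet> (\<iota> W \<boxtimes> \<alpha> X Y Z) \<bullet> \<beta> W X (Y \<otimes> Z) = (\<beta> W X Y \<boxtimes> \<iota> Z) \<bullet> \<alpha> (W \<otimes> X) Y Z"
    using assms by simp
  have "\<beta> W X (Y \<otimes> Z) \<bullet> \<beta> (W \<otimes> X) Y Z \<bullet> ((\<alpha> W X Y \<boxtimes> \<iota> Z) \<bullet> \<alpha> W (X \<otimes> Y) Z \<bullet> (\<iota> W \<boxtimes> \<alpha> X Y Z))
     \<bullet> (\<iota> W \<boxtimes> \<beta> X Y Z) \<bullet> \<beta> W (X \<otimes> Y) Z \<bullet> (\<beta> W X Y \<boxtimes> \<iota> Z)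
     = (\<iota> W \<boxtimes> \<beta> X Y Z) \<bullet> \<beta> W (X \<otimes> Y) Z \<bullet> (\<beta> W X Y \<boxtimes> \<iota> Z)"
    unfolding p using assms by simp
  then show "\<beta> W X (Y \<otimes> Z) \<bullet> \<beta> (W \<otimes> X) Y Z = (\<iota> W \<boxtimes> \<beta> X Y Z) \<bullet> \<beta> W (X \<otimes> Y) Z \<bullet> (\<beta> W X Y \<boxtimes> \<iota> Z)"
    using assms by simp
  show "\<alpha> W X (Y \<otimes> Z) \<bullet> (\<iota> W \<boxtimes> \<beta> X Y Z) \<bullet> \<beta> W (X \<otimes> Y) Z = \<beta> (W \<otimes> X) Y Z \<bullet> (\<alpha> W X Y \<boxtimes> \<iota> Z)"
    using assms *[THEN tcomp_reassoc, of "\<beta> W (X \<otimes> Y) Z"] by simp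
qed

text \<open>Kelly's derivation of a unit law that is not among the axioms. Both sides are tensored
  with the unit on the left and preceded by the invertible \<open>?a\<close>; the pentagon at
  \<open>I, I, X, Y\<close>, two triangles and naturality of the associator make them equal.\<close>

lemma \<l>_tensor:
  assumes "X \<in> Obj C" "Y \<in> Obj C"
  shows "\<alpha> (Unit C) X Y \<bullet> \<l> (X \<otimes> Y) = \<l> X \<boxtimes> \<iota> Y"
proof (rule unit_tten_faithful)
  let ?I = "Unit C"
  note p = \<alpha>_pentagon[of ?I ?I X Y]
  let ?a = "(\<alpha> ?I ?I X \<boxtimes> \<iota> Y) \<bullet> \<alpha> ?I (?I \<otimes> X) Y"
  have "?a \<bullet> (\<iota> ?I \<boxtimes> (\<alpha> ?I X Y \<bullet> \<l> (X \<otimes> Y))) = \<alpha> (?I \<otimes> ?I) X Y \<bullet> \<alpha> ?I ?I (X \<otimes> Y)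
      \<bullet> (\<iota> ?I \<boxtimes> \<l> (X \<otimes> Y))"
    using assms p[THEN tcomp_reassoc] by (simp add: whisker)
  also have "\<dots> = \<alpha> (?I \<otimes> ?I) X Y \<bullet> (\<r> ?I \<boxtimes> \<iota> (X \<otimes> Y))"
    using assms by (simp add: \<alpha>_triangle)
  also have "\<dots> = ((\<r> ?I \<boxtimes> \<iota> X) \<boxtimes> \<iota> Y) \<bullet> \<alpha> ?I X Y"
    using assms by (simp add: \<alpha>_natural_whisker)
  also have "\<dots> = ?a \<bullet> (\<iota> ?I \<boxtimes> (\<l> X \<boxtimes> \<iota> Y))"
    using assms by (simp add: \<alpha>_natural_whisker whisker flip: \<alpha>_triangle)
  finally show "\<iota> ?I \<boxtimes> (\<alpha> ?I X Y \<bullet> \<l> (X \<otimes> Y)) = \<iota> ?I \<boxtimes> (\<l> X \<boxtimes> \<iota> Y)"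
    using assms by (elim tcomp_iso_epi[rotated 5]) simp_all
qed (use assms in auto)

text \<open>The mirror image of \<open>\<l>_tensor\<close>: the comparison is made after tensoring
  with the unit on the right and composing with \<open>\<alpha> X Y ?I\<close>.\<close>

lemma \<r>_tensor:
  assumes "X \<in> Obj C" "Y \<in> Obj C"
  shows "\<alpha> X Y (Unit C) \<bullet> (\<iota> X \<boxtimes> \<r> Y) = \<r> (X \<otimes> Y)"
proof (rule tten_unit_faithful)
  let ?I = "Unit C"
  have "((\<alpha> X Y ?I \<bullet> (\<iota> X \<boxtimes> \<r> Y)) \<boxtimes> \<iota> ?I) \<bullet> \<alpha> X Y ?I
    = (\<alpha> X Y ?I \<boxtimes> \<iota> ?I) \<bullet> \<alpha> X (Y \<otimes> ?I) ?I \<bullet> (\<iota> X \<boxtimes> (\<r> Y \<boxtimes> \<iota> ?I))"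
    using assms by (simp add: \<alpha>_natural_whisker whisker)
  also have "\<dots> = ((\<alpha> X Y ?I \<boxtimes> \<iota> ?I) \<bullet> \<alpha> X (Y \<otimes> ?I) ?I \<bullet> (\<iota> X \<boxtimes> \<alpha> Y ?I ?I)) \<bullet> (\<iota> X \<boxtimes> (\<iota> Y \<boxtimes> \<l> ?I))"
    using assms by (simp add: whisker flip: \<alpha>_triangle)
  also have "\<dots> = \<alpha> (X \<otimes> Y) ?I ?I \<bullet> (\<iota> (X \<otimes> Y) \<boxtimes> \<l> ?I) \<bullet> \<alpha> X Y ?I"
    unfolding \<alpha>_pentagon[OF assms unit_obj unit_obj] using assms by (simp add: \<alpha>_natural_whisker)
  also have "\<dots> = (\<r> (X \<otimes> Y) \<boxtimes> \<iota> ?I) \<bullet> \<alpha> X Y ?I"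
    using assms by (simp flip: \<alpha>_triangle)
  finally show "(\<alpha> X Y ?I \<bullet> (\<iota> X \<boxtimes> \<r> Y)) \<boxtimes> \<iota> ?I = \<r> (X \<otimes> Y) \<boxtimes> \<iota> ?I"
    using assms by (elim tcomp_iso_mono[rotated 5]) simp_all
qed (use assms in auto)

text \<open>Naturality of \<open>\<l>\<close> at the arrow \<open>\<l> I\<close> gives
  \<open>\<iota> I \<boxtimes> \<l> I = \<l> (I \<otimes> I)\<close>, because \<open>\<l> I\<close>
  can be cancelled. The triangle and \<open>\<l>_tensor\<close> express \<open>\<r> I\<close> and
  \<open>\<l> I\<close>, each tensored with the unit, by these two arrows.\<close>

lemma \<l>_unit: "\<l> (Unit C) = \<r> (Unit C)"
proof (rule tten_unit_faithful)
  let ?I = "Unit C"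
  have "\<iota> ?I \<boxtimes> \<l> ?I = \<l> (?I \<otimes> ?I)"
    by (rule tcomp_iso_mono[OF _ _ _ _ _ \<l>_natural]) simp_all
  then show "\<l> ?I \<boxtimes> \<iota> ?I = \<r> ?I \<boxtimes> \<iota> ?I"
    by (simp flip: \<l>_tensor \<alpha>_triangle)
qed auto

text \<open>Compatibility of the symmetry with the units is not an axiom either. It comes from the
  hexagon at \<open>X, I, I\<close>, after which a final \<open>\<sigma> X I\<close> is
  cancelled.\<close>

lemma \<sigma>_unit:
  assumes "X \<in> Obj C"
  shows "\<sigma> X (Unit C) \<bullet> \<l> X = \<r> X"
proof (rule tten_unit_faithful)
  let ?I = "Unit C"
  have "((\<sigma> X ?I \<bullet> \<l> X) \<boxtimes> \<iota> ?I) \<bullet> \<sigma> X ?I = ((\<sigma> X ?I \<boxtimes> \<iota> ?I) \<bullet> \<alpha> ?I X ?I \<bullet> (\<iota> ?I \<boxtimes> \<sigma> X ?I))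
      \<bullet> \<l> (?I \<otimes> X)"
    using assms by (simp add: whisker \<l>_natural flip: \<l>_tensor)
  also have "\<dots> = \<alpha> X ?I ?I \<bullet> \<sigma> X (?I \<otimes> ?I) \<bullet> (\<l> ?I \<boxtimes> \<iota> X)"
    unfolding \<sigma>_hexagon[OF assms unit_obj unit_obj, symmetric] using assms by (simp add: \<l>_tensor)
  also have "\<dots> = \<alpha> X ?I ?I \<bullet> (\<iota> X \<boxtimes> \<l> ?I) \<bullet> \<sigma> X ?I"
    using assms by (simp add: \<sigma>_natural)
  also have "\<dots> = (\<r> X \<boxtimes> \<iota> ?I) \<bullet> \<sigma> X ?I"
    using assms by (simp flip: \<alpha>_triangle)
  finally show "(\<sigma> X ?I \<bullet> \<l> X) \<boxtimes> \<iota> ?I = \<r> X \<boxtimes> \<iota> ?I"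
    using assms by (elim tcomp_iso_mono[rotated 5]) simp_all
qed (use assms in auto)

end

text \<open>
  All diagrams are kept nested to the right, so that a wire is moved past the next one by \<open>\<tau>\<close>. In
  \<open>f : P \<otimes> X \<rightarrow> Q \<otimes> Y\<close> the wires \<open>P\<close> and \<open>Q\<close> are the state; \<open>ext\<close> adds a wire \<open>Z\<close> at the far end and
  \<open>ins\<close> adds a wire \<open>A\<close> next to the state. The factors of \<open>P \<otimes> X\<close> cannot be recovered from \<open>f\<close>, hence
  the explicit objects.
\<close>

definition tswap :: "('o, 'm, 'z) smc_scheme \<Rightarrow> 'o \<Rightarrow> 'o \<Rightarrow> 'o \<Rightarrow> ('o, 'm) typed" ("\<tau>\<index>") where
  "tswap C A B Z = \<beta>\<^bsub>C\<^esub> A B Z \<bullet>\<^bsub>C\<^esub> (\<sigma>\<^bsub>C\<^esub> A B \<boxtimes>\<^bsub>C\<^esub> \<iota>\<^bsub>C\<^esub> Z) \<bullet>\<^bsub>C\<^esub> \<alpha>\<^bsub>C\<^esub> B A Z"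

definition ext :: "('o, 'm, 'z) smc_scheme \<Rightarrow> 'o \<Rightarrow> 'o \<Rightarrow> 'o \<Rightarrow> 'o \<Rightarrow> 'o \<Rightarrow> ('o, 'm) typed \<Rightarrow> ('o, 'm)
    typed" where
  "ext C P X Q Y Z f = \<beta>\<^bsub>C\<^esub> P X Z \<bullet>\<^bsub>C\<^esub> (f \<boxtimes>\<^bsub>C\<^esub> \<iota>\<^bsub>C\<^esub> Z) \<bullet>\<^bsub>C\<^esub> \<alpha>\<^bsub>C\<^esub> Q Y Z"

definition ins :: "('o, 'm, 'z) smc_scheme \<Rightarrow> 'o \<Rightarrow> 'o \<Rightarrow> 'o \<Rightarrow> 'o \<Rightarrow> 'o \<Rightarrow> ('o, 'm) typed \<Rightarrow> ('o, 'm)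
    typed" where
  "ins C P X Q Y A f = (\<iota>\<^bsub>C\<^esub> P \<boxtimes>\<^bsub>C\<^esub> \<sigma>\<^bsub>C\<^esub> A X) \<bullet>\<^bsub>C\<^esub> ext C P X Q Y A f \<bullet>\<^bsub>C\<^esub> (\<iota>\<^bsub>C\<^esub> Q \<boxtimes>\<^bsub>C\<^esub> \<sigma>\<^bsub>C\<^esub> Y A)"

lemma src_tgt_swap [simp]:
  "src (\<tau>\<^bsub>C\<^esub> A B Z) = A \<otimes>\<^bsub>C\<^esub> (B \<otimes>\<^bsub>C\<^esub> Z)" "tgt (\<tau>\<^bsub>C\<^esub> A B Z) = B \<otimes>\<^bsub>C\<^esub> (A \<otimes>\<^bsub>C\<^esub> Z)"
  "src (ext C P X Q Y Z f) = P \<otimes>\<^bsub>C\<^esub> (X \<otimes>\<^bsub>C\<^esub> Z)" "tgt (ext C P X Q Y Z f) = Q \<otimes>\<^bsub>C\<^esub> (Y \<otimes>\<^bsub>C\<^esub> Z)"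
  "src (ins C P X Q Y A f) = P \<otimes>\<^bsub>C\<^esub> (A \<otimes>\<^bsub>C\<^esub> X)" "tgt (ins C P X Q Y A f) = Q \<otimes>\<^bsub>C\<^esub> (A \<otimes>\<^bsub>C\<^esub> Y)"
  by (simp_all add: tswap_def ext_def ins_def)

context symmetric_monoidal_category
begin

lemma ok_swap [simp]: "\<lbrakk>A \<in> Obj C; B \<in> Obj C; Z \<in> Obj C\<rbrakk> \<Longrightarrow> ok C (\<tau> A B Z)"
  and tiso_swap [simp]: "\<lbrakk>A \<in> Obj C; B \<in> Obj C; Z \<in> Obj C\<rbrakk> \<Longrightarrow> tiso C (\<tau> A B Z)"
  by (simp_all add: tswap_def)

lemma ok_ext [simp]:
  "\<lbrakk>ok C f; src f = P \<otimes> X; tgt f = Q \<otimes> Y; P \<in> Obj C; X \<in> Obj C; Q \<in> Obj C; Y \<in> Obj C; Z \<in> Obj C\<rbrakk>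
    \<Longrightarrow> ok C (ext C P X Q Y Z f)"
  and ok_ins [simp]:
  "\<lbrakk>ok C f; src f = P \<otimes> X; tgt f = Q \<otimes> Y; P \<in> Obj C; X \<in> Obj C; Q \<in> Obj C; Y \<in> Obj C; Z \<in> Obj C\<rbrakk>
    \<Longrightarrow> ok C (ins C P X Q Y Z f)"
  by (simp_all add: ext_def ins_def)

lemma \<tau>\<tau> [simp]:
  assumes "A \<in> Obj C" "B \<in> Obj C" "Z \<in> Obj C"
  shows "\<tau> A B Z \<bullet> \<tau> B A Z = \<iota> (A \<otimes> (B \<otimes> Z))"
    "\<lbrakk>ok C k; src k = A \<otimes> (B \<otimes> Z)\<rbrakk> \<Longrightarrow> \<tau> A B Z \<bullet> \<tau> B A Z \<bullet> k = k"
  using assms by (simp_all add: tswap_def)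

lemma tinv_swap [simp]: "\<lbrakk>A \<in> Obj C; B \<in> Obj C; Z \<in> Obj C\<rbrakk> \<Longrightarrow> tinv C (\<tau> A B Z) = \<tau> B A Z"
  using tisoI[of "\<tau> A B Z" "\<tau> B A Z"] by auto

text \<open>The hexagon read on wires: to cross \<open>P\<close> alone, \<open>A\<close> crosses
  \<open>P \<otimes> X\<close> and then goes back over \<open>X\<close>. The first equation is the
  inverse of the second, since the inverse of a symmetry is again a symmetry.\<close>

lemma \<sigma>_swap:
  assumes "P \<in> Obj C" "X \<in> Obj C" "A \<in> Obj C"
  shows "\<tau> P A X = (\<iota> P \<boxtimes> \<sigma> A X) \<bullet> \<beta> P X A \<bullet> \<sigma> (P \<otimes> X) A"
    "\<tau> A P X = \<sigma> A (P \<otimes> X) \<bullet> \<alpha> P X A \<bullet> (\<iota> P \<boxtimes> \<sigma> X A)"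
proof -
  have "\<beta> A P X \<bullet> (\<alpha> A P X \<bullet> \<sigma> A (P \<otimes> X) \<bullet> \<alpha> P X A) \<bullet> (\<iota> P \<boxtimes> \<sigma> X A) = \<tau> A P X"
    unfolding \<sigma>_hexagon[OF assms(3,1,2)] using assms by (simp add: tswap_def)
  then show *: "\<tau> A P X = \<sigma> A (P \<otimes> X) \<bullet> \<alpha> P X A \<bullet> (\<iota> P \<boxtimes> \<sigma> X A)"
    using assms by simp
  have "\<tau> P A X = tinv C (\<tau> A P X)" using assms by simp
  also have "\<dots> = (\<iota> P \<boxtimes> \<sigma> A X) \<bullet> \<beta> P X A \<bullet> \<sigma> (P \<otimes> X) A"
    unfolding * using assms by (simp add: tinv_comp tinv_ten)
  finally show "\<tau> P A X = (\<iota> P \<boxtimes> \<sigma> A X) \<bullet> \<beta> P X A \<bullet> \<sigma> (P \<otimes> X) A" .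
qed

text \<open>The hexagon splits the crossing of \<open>A \<otimes> B\<close> into two. It leaves
  associators under a whiskering, which the pentagon brings out.\<close>

lemma \<tau>_hexagon:
  assumes "P \<in> Obj C" "A \<in> Obj C" "B \<in> Obj C" "X \<in> Obj C"
  shows "\<tau> P (A \<otimes> B) X \<bullet> \<alpha> A B (P \<otimes> X) = (\<iota> P \<boxtimes> \<alpha> A B X) \<bullet> \<tau> P A (B \<otimes> X) \<bullet> (\<iota> A \<boxtimes> \<tau> P B X)"
proof -
  have "\<sigma> P (A \<otimes> B) = \<beta> P A B \<bullet> (\<alpha> P A B \<bullet> \<sigma> P (A \<otimes> B) \<bullet> \<alpha> A B P) \<bullet> \<beta> A B P"
    using assms by simp
  also have "\<dots> = \<beta> P A B \<bullet> (\<sigma> P A \<boxtimes> \<iota> B) \<bullet> \<alpha> A P B \<bullet> (\<iota> A \<boxtimes> \<sigma> P B) \<bullet> \<beta> A B P"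
    using assms by (simp add: \<sigma>_hexagon)
  finally have \<sigma>: "\<sigma> P (A \<otimes> B) = \<dots>" .
  have "\<tau> P (A \<otimes> B) X \<bullet> \<alpha> A B (P \<otimes> X) = \<beta> P (A \<otimes> B) X \<bullet> (\<beta> P A B \<boxtimes> \<iota> X) \<bullet> ((\<sigma> P A \<boxtimes> \<iota> B) \<boxtimes> \<iota> X)
      \<bullet> (\<alpha> A P B \<boxtimes> \<iota> X) \<bullet> ((\<iota> A \<boxtimes> \<sigma> P B) \<boxtimes> \<iota> X) \<bullet> (\<beta> A B P \<boxtimes> \<iota> X) \<bullet> \<alpha> (A \<otimes> B) P X \<bullet> \<alpha> A B (P \<otimes> X)"
    unfolding tswap_def \<sigma> using assms by (simp add: whisker)
  also have "\<dots> = \<beta> P (A \<otimes> B) X \<bullet> (\<beta> P A B \<boxtimes> \<iota> X) \<bullet> ((\<sigma> P A \<boxtimes> \<iota> B) \<boxtimes> \<iota> X)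
      \<bullet> (\<alpha> A P B \<boxtimes> \<iota> X) \<bullet> ((\<iota> A \<boxtimes> \<sigma> P B) \<boxtimes> \<iota> X) \<bullet> \<alpha> A (B \<otimes> P) X \<bullet> (\<iota> A \<boxtimes> \<alpha> B P X)"
    using assms by (simp flip: \<alpha>_pentagon)
  also have "\<dots> = \<beta> P (A \<otimes> B) X \<bullet> (\<beta> P A B \<boxtimes> \<iota> X) \<bullet> ((\<sigma> P A \<boxtimes> \<iota> B) \<boxtimes> \<iota> X)
      \<bullet> (\<alpha> A P B \<boxtimes> \<iota> X) \<bullet> \<alpha> A (P \<otimes> B) X \<bullet> (\<iota> A \<boxtimes> \<alpha> P B X) \<bullet> (\<iota> A \<boxtimes> \<tau> P B X)"
    using assms by (simp add: \<alpha>_natural_whisker[THEN tcomp_reassoc] tswap_def whisker)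
  also have "\<dots> = \<beta> P (A \<otimes> B) X \<bullet> (\<beta> P A B \<boxtimes> \<iota> X) \<bullet> ((\<sigma> P A \<boxtimes> \<iota> B) \<boxtimes> \<iota> X)
      \<bullet> \<alpha> (A \<otimes> P) B X \<bullet> \<alpha> A P (B \<otimes> X) \<bullet> (\<iota> A \<boxtimes> \<tau> P B X)"
    using assms \<alpha>_pentagon[of A P B X, THEN tcomp_reassoc, of "\<iota> A \<boxtimes> \<tau> P B X"] by simp
  also have "\<dots> = (\<iota> P \<boxtimes> \<alpha> A B X) \<bullet> \<tau> P A (B \<otimes> X) \<bullet> (\<iota> A \<boxtimes> \<tau> P B X)"
    using assms pentagons(1)[of P A B X, THEN tcomp_reassoc]
    by (simp add: \<alpha>_natural_whisker[THEN tcomp_reassoc] tswap_def[of C P A])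
  finally show ?thesis .
qed

text \<open>The exchanged wires both lie before \<open>Z\<close>, so only the bracketing changes.
  This is the part of \<open>ext_ins\<close> that concerns the crossings.\<close>

lemma \<tau>_ext:
  assumes "P \<in> Obj C" "A \<in> Obj C" "X \<in> Obj C" "Z \<in> Obj C"
  shows "ext C P (A \<otimes> X) A (P \<otimes> X) Z (\<tau> P A X) = (\<iota> P \<boxtimes> \<alpha> A X Z) \<bullet> \<tau> P A (X \<otimes> Z) \<bullet> (\<iota> A \<boxtimes> \<beta> P X Z)"
proof -
  have "ext C P (A \<otimes> X) A (P \<otimes> X) Z (\<tau> P A X) = \<beta> P (A \<otimes> X) Z \<bullet> (\<beta> P A X \<boxtimes> \<iota> Z)
      \<bullet> ((\<sigma> P A \<boxtimes> \<iota> X) \<boxtimes> \<iota> Z)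
      \<bullet> (\<alpha> A P X \<boxtimes> \<iota> Z) \<bullet> \<alpha> A (P \<otimes> X) Z"
    using assms by (simp add: ext_def tswap_def whisker)
  also have "\<dots> = \<beta> P (A \<otimes> X) Z \<bullet> (\<beta> P A X \<boxtimes> \<iota> Z) \<bullet> ((\<sigma> P A \<boxtimes> \<iota> X) \<boxtimes> \<iota> Z)
      \<bullet> \<alpha> (A \<otimes> P) X Z \<bullet> \<alpha> A P (X \<otimes> Z) \<bullet> (\<iota> A \<boxtimes> \<beta> P X Z)"
    using assms \<alpha>_pentagon[of A P X Z, THEN tcomp_reassoc, of "\<iota> A \<boxtimes> \<beta> P X Z"] by simp
  also have "\<dots> = (\<iota> P \<boxtimes> \<alpha> A X Z) \<bullet> \<tau> P A (X \<otimes> Z) \<bullet> (\<iota> A \<boxtimes> \<beta> P X Z)"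
    using assms pentagons(1)[of P A X Z, THEN tcomp_reassoc]
    by (simp add: \<alpha>_natural_whisker[THEN tcomp_reassoc] tswap_def[of C P A])
  finally show ?thesis .
qed

end

text \<open>Composition of two bodies with states \<open>P \<rightarrow> Q\<close> and
  \<open>P' \<rightarrow> Q'\<close>: \<open>ins\<close> carries the state \<open>P'\<close> of
  \<open>g\<close> past \<open>f\<close>, and \<open>g\<close> acts while \<open>Q\<close> waits.
  Incoming and outgoing states are separate parameters, so that \<open>F S\<close> and
  \<open>S\<close> can be put in and each can be varied alone.\<close>

definition star :: "('o, 'm, 'z) smc_scheme \<Rightarrow> 'o \<Rightarrow> 'o \<Rightarrow> 'o \<Rightarrow> 'o \<Rightarrow> 'o \<Rightarrow> 'o \<Rightarrow> 'o \<Rightarrow>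
  ('o, 'm) typed \<Rightarrow> ('o, 'm) typed \<Rightarrow> ('o, 'm) typed" where
  "star C P X Q Y P' Q' Z f g =
    \<alpha>\<^bsub>C\<^esub> P P' X \<bullet>\<^bsub>C\<^esub> ins C P X Q Y P' f \<bullet>\<^bsub>C\<^esub> (\<iota>\<^bsub>C\<^esub> Q \<boxtimes>\<^bsub>C\<^esub> g) \<bullet>\<^bsub>C\<^esub> \<beta>\<^bsub>C\<^esub> Q Q' Z"

lemma src_tgt_star [simp]:
  "src (star C P X Q Y P' Q' Z f g) = (P \<otimes>\<^bsub>C\<^esub> P') \<otimes>\<^bsub>C\<^esub> X"
  "tgt (star C P X Q Y P' Q' Z f g) = (Q \<otimes>\<^bsub>C\<^esub> Q') \<otimes>\<^bsub>C\<^esub> Z"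
  by (simp_all add: star_def)

section \<open>Naturality, whiskering and sequential composition of bodies\<close>

context symmetric_monoidal_category
begin

text \<open>Naturality in the appended wire: \<open>f\<close> and \<open>z\<close> act on disjoint
  factors.\<close>

lemma ext_tail:
  assumes [simp]: "ok C f" "src f = P \<otimes> X" "tgt f = Q \<otimes> Y"
      "P \<in> Obj C" "X \<in> Obj C" "Q \<in> Obj C" "Y \<in> Obj C" and "ok C z" "src z = Z" "tgt z = Z'"
  shows "(\<iota> P \<boxtimes> (\<iota> X \<boxtimes> z)) \<bullet> ext C P X Q Y Z' f = ext C P X Q Y Z f \<bullet> (\<iota> Q \<boxtimes> (\<iota> Y \<boxtimes> z))"
proof -
  have o [simp]: "Z \<in> Obj C" "Z' \<in> Obj C" using assms(8-10) ok_obj by auto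
  have "(f \<boxtimes> \<iota> Z) \<bullet> (\<iota> (Q \<otimes> Y) \<boxtimes> z) = (\<iota> (P \<otimes> X) \<boxtimes> z) \<bullet> (f \<boxtimes> \<iota> Z')"
    using assms by (simp add: interchange)
  from this[THEN tcomp_reassoc] show ?thesis
    using assms(8-10) by (simp add: ext_def \<beta>_natural_whisker[THEN tcomp_reassoc]
        flip: \<alpha>_natural_whisker)
qed

lemma ext_natural:
  assumes [simp]: "ok C f" "src f = P \<otimes> X" "tgt f = Q \<otimes> Y"
      "P \<in> Obj C" "X \<in> Obj C" "Q \<in> Obj C" "Y \<in> Obj C" and [simp]: "Z \<in> Obj C"
      "ok C p" "ok C u" "ok C q" "ok C v" "src p = P'" "tgt p = P" "src u = X'" "tgt u = X"
      "src q = Q" "tgt q = Q'" "src v = Y" "tgt v = Y'"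
  shows "ext C P' X' Q' Y' Z ((p \<boxtimes> u) \<bullet> f \<bullet> (q \<boxtimes> v))
    = (p \<boxtimes> (u \<boxtimes> \<iota> Z)) \<bullet> ext C P X Q Y Z f \<bullet> (q \<boxtimes> (v \<boxtimes> \<iota> Z))"
proof -
  have o: "P' \<in> Obj C" "X' \<in> Obj C" "Q' \<in> Obj C" "Y' \<in> Obj C"
    using ok_obj(1)[of p] ok_obj(1)[of u] ok_obj(2)[of q] ok_obj(2)[of v] by simp_all
  have 2: "(p \<boxtimes> (u \<boxtimes> \<iota> Z)) \<bullet> \<beta> P X Z = \<beta> P' X' Z \<bullet> ((p \<boxtimes> u) \<boxtimes> \<iota> Z)"
    "((q \<boxtimes> v) \<boxtimes> \<iota> Z) \<bullet> \<alpha> Q' Y' Z = \<alpha> Q Y Z \<bullet> (q \<boxtimes> (v \<boxtimes> \<iota> Z))" by (simp_all add: \<alpha>_natural \<beta>_natural)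
  show ?thesis using o 2 2(1)[THEN tcomp_reassoc] by (simp add: ext_def whisker)
qed

lemma ext_comp:
  assumes [simp]: "ok C f" "src f = P \<otimes> X" "tgt f = Q \<otimes> Y" "ok C g" "src g = Q \<otimes> Y" "tgt g = R \<otimes> Z"
    "P \<in> Obj C" "X \<in> Obj C" "Q \<in> Obj C" "Y \<in> Obj C" "R \<in> Obj C" "Z \<in> Obj C" "W \<in> Obj C"
  shows "ext C P X R Z W (f \<bullet> g) = ext C P X Q Y W f \<bullet> ext C Q Y R Z W g"
  by (simp add: ext_def whisker)

lemma ext_id [simp]: "\<lbrakk>P \<in> Obj C; X \<in> Obj C; Z \<in> Obj C; PX = P \<otimes> X\<rbrakk> \<Longrightarrow> ext C P X P X Z (\<iota> PX)
    = \<iota> (P \<otimes> (X \<otimes> Z))"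
  and ins_id [simp]: "\<lbrakk>P \<in> Obj C; X \<in> Obj C; Z \<in> Obj C; PX = P \<otimes> X\<rbrakk> \<Longrightarrow> ins C P X P X Z (\<iota> PX)
      = \<iota> (P \<otimes> (Z \<otimes> X))"
  by (simp_all add: ext_def ins_def)

lemma ins_natural:
  assumes [simp]: "ok C f" "src f = P \<otimes> X" "tgt f = Q \<otimes> Y"
      "P \<in> Obj C" "X \<in> Obj C" "Q \<in> Obj C" "Y \<in> Obj C" and [simp]: "A \<in> Obj C"
      "ok C p" "ok C u" "ok C q" "ok C v" "src p = P'" "tgt p = P" "src u = X'" "tgt u = X"
      "src q = Q" "tgt q = Q'" "src v = Y" "tgt v = Y'"
  shows "ins C P' X' Q' Y' A ((p \<boxtimes> u) \<bullet> f \<bullet> (q \<boxtimes> v))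
    = (p \<boxtimes> (\<iota> A \<boxtimes> u)) \<bullet> ins C P X Q Y A f \<bullet> (q \<boxtimes> (\<iota> A \<boxtimes> v))"
proof -
  have o: "P' \<in> Obj C" "X' \<in> Obj C" "Q' \<in> Obj C" "Y' \<in> Obj C"
    using ok_obj(1)[of p] ok_obj(1)[of u] ok_obj(2)[of q] ok_obj(2)[of v] by simp_all
  have 1: "(\<iota> P' \<boxtimes> \<sigma> A X') \<bullet> (p \<boxtimes> (u \<boxtimes> \<iota> A)) = (p \<boxtimes> (\<iota> A \<boxtimes> u)) \<bullet> (\<iota> P \<boxtimes> \<sigma> A X)"
    "(q \<boxtimes> (v \<boxtimes> \<iota> A)) \<bullet> (\<iota> Q' \<boxtimes> \<sigma> Y' A) = (\<iota> Q \<boxtimes> \<sigma> Y A) \<bullet> (q \<boxtimes> (\<iota> A \<boxtimes> v))"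
    using o by (simp_all add: \<sigma>_natural flip: tten_comp)
  show ?thesis using o 1[THEN tcomp_reassoc] 1 by (simp add: ins_def ext_natural[of f P X Q Y])
qed

text \<open>Naturality in the inserted wire. It is \<open>ext_tail\<close> transported by the
  symmetries that move the wire next to the state.\<close>

lemma ins_param:
  assumes [simp]: "ok C f" "src f = P \<otimes> X" "tgt f = Q \<otimes> Y"
      "P \<in> Obj C" "X \<in> Obj C" "Q \<in> Obj C" "Y \<in> Obj C" and "ok C a" "src a = A" "tgt a = A'"
  shows "(\<iota> P \<boxtimes> (a \<boxtimes> \<iota> X)) \<bullet> ins C P X Q Y A' f = ins C P X Q Y A f \<bullet> (\<iota> Q \<boxtimes> (a \<boxtimes> \<iota> Y))"
proof -
  have o [simp]: "A \<in> Obj C" "A' \<in> Obj C" using assms(8-10) ok_obj by auto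
  have 1: "(\<iota> P \<boxtimes> (a \<boxtimes> \<iota> X)) \<bullet> (\<iota> P \<boxtimes> \<sigma> A' X) = (\<iota> P \<boxtimes> \<sigma> A X) \<bullet> (\<iota> P \<boxtimes> (\<iota> X \<boxtimes> a))"
    "(\<iota> Q \<boxtimes> (\<iota> Y \<boxtimes> a)) \<bullet> (\<iota> Q \<boxtimes> \<sigma> Y A') = (\<iota> Q \<boxtimes> \<sigma> Y A) \<bullet> (\<iota> Q \<boxtimes> (a \<boxtimes> \<iota> Y))"
    using assms(8-10) by (simp_all add: \<sigma>_natural flip: tten_comp)
  show ?thesis using assms(8-10) 1 1(1)[THEN tcomp_reassoc] ext_tail[of f P X Q Y a A A', THEN
      tcomp_reassoc]
    by (simp add: ins_def)
qed

text \<open>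
  By the hexagon, \<open>A\<close> may equally be pulled out past the state. This form is the one compatible with
  operations on the state, the definition the one compatible with operations on \<open>X\<close> and \<open>Y\<close>.
\<close>

lemma ins_alt:
  assumes [simp]: "ok C f" "src f = P \<otimes> X" "tgt f = Q \<otimes> Y"
      "P \<in> Obj C" "X \<in> Obj C" "Q \<in> Obj C" "Y \<in> Obj C" and [simp]: "A \<in> Obj C"
  shows "ins C P X Q Y A f = \<tau> P A X \<bullet> (\<iota> A \<boxtimes> f) \<bullet> \<tau> A Q Y"
proof -
  have "(\<iota> A \<boxtimes> f) \<bullet> \<sigma> A (Q \<otimes> Y) = \<sigma> A (P \<otimes> X) \<bullet> (f \<boxtimes> \<iota> A)" by (simp add: \<sigma>_natural)
  from this[THEN tcomp_reassoc] show ?thesis by (simp add: ins_def ext_def \<sigma>_swap(1)[of P X A]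
      \<sigma>_swap(2)[of Q Y A])
qed

lemma ext_ext:
  assumes [simp]: "ok C f" "src f = P \<otimes> X" "tgt f = Q \<otimes> Y"
      "P \<in> Obj C" "X \<in> Obj C" "Q \<in> Obj C" "Y \<in> Obj C" and [simp]: "A \<in> Obj C" "B \<in> Obj C"
  shows "ext C P (X \<otimes> A) Q (Y \<otimes> A) B (ext C P X Q Y A f)
    = (\<iota> P \<boxtimes> \<alpha> X A B) \<bullet> ext C P X Q Y (A \<otimes> B) f \<bullet> (\<iota> Q \<boxtimes> \<beta> Y A B)"
proof -
  have "ext C P (X \<otimes> A) Q (Y \<otimes> A) B (ext C P X Q Y A f)
    = \<beta> P (X \<otimes> A) B \<bullet> (\<beta> P X A \<boxtimes> \<iota> B) \<bullet> ((f \<boxtimes> \<iota> A) \<boxtimes> \<iota> B) \<bullet> (\<alpha> Q Y A \<boxtimes> \<iota> B) \<bullet> \<alpha> Q (Y \<otimes> A) B"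
    by (simp add: ext_def whisker)
  also have "(\<alpha> Q Y A \<boxtimes> \<iota> B) \<bullet> \<alpha> Q (Y \<otimes> A) B = \<alpha> (Q \<otimes> Y) A B \<bullet> \<alpha> Q Y (A \<otimes> B) \<bullet> (\<iota> Q \<boxtimes> \<beta> Y A B)"
    using \<alpha>_pentagon[of Q Y A B, THEN tcomp_reassoc, of "\<iota> Q \<boxtimes> \<beta> Y A B"] by simp
  finally show ?thesis
    using pentagons(1)[of P X A B, THEN tcomp_reassoc] by
        (simp add: ext_def \<alpha>_natural_whisker[THEN tcomp_reassoc])
qed

text \<open>In the form of \<open>ins_alt\<close> the factors are a crossing,
  \<open>\<iota> A \<boxtimes> f\<close> and a crossing. \<open>ext\<close> respects composites, and
  \<open>\<tau>_ext\<close> handles the crossings.\<close>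

lemma ext_ins:
  assumes [simp]: "ok C f" "src f = P \<otimes> X" "tgt f = Q \<otimes> Y"
      "P \<in> Obj C" "X \<in> Obj C" "Q \<in> Obj C" "Y \<in> Obj C" and [simp]: "A \<in> Obj C" "Z \<in> Obj C"
  shows "ext C P (A \<otimes> X) Q (A \<otimes> Y) Z (ins C P X Q Y A f)
    = (\<iota> P \<boxtimes> \<alpha> A X Z) \<bullet> ins C P (X \<otimes> Z) Q (Y \<otimes> Z) A (ext C P X Q Y Z f) \<bullet> (\<iota> Q \<boxtimes> \<beta> A Y Z)"
proof -
  have 1: "ext C A (P \<otimes> X) A (Q \<otimes> Y) Z (\<iota> A \<boxtimes> f) = \<iota> A \<boxtimes> (f \<boxtimes> \<iota> Z)"
    by (simp add: ext_def \<alpha>_natural_whisker)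
  have "ext C P (A \<otimes> X) Q (A \<otimes> Y) Z (\<tau> P A X \<bullet> (\<iota> A \<boxtimes> f) \<bullet> \<tau> A Q Y)
    = ext C P (A \<otimes> X) A (P \<otimes> X) Z (\<tau> P A X) \<bullet> ext C A (P \<otimes> X) A (Q \<otimes> Y) Z (\<iota> A \<boxtimes> f)
      \<bullet> ext C A (Q \<otimes> Y) Q (A \<otimes> Y) Z (\<tau> A Q Y)"
    by (simp add: ext_comp[of _ P "A \<otimes> X" A "P \<otimes> X"] ext_comp[of _ A "P \<otimes> X" A "Q \<otimes> Y"])
  also have "\<dots> = (\<iota> P \<boxtimes> \<alpha> A X Z) \<bullet> \<tau> P A (X \<otimes> Z) \<bullet> (\<iota> A \<boxtimes> (\<beta> P X Z \<bullet> (f \<boxtimes> \<iota> Z) \<bullet> \<alpha> Q Y Z))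
      \<bullet> \<tau> A Q (Y \<otimes> Z) \<bullet> (\<iota> Q \<boxtimes> \<beta> A Y Z)"
    by (simp add: \<tau>_ext 1 whisker)
  moreover have "ins C P X Q Y A f = \<tau> P A X \<bullet> (\<iota> A \<boxtimes> f) \<bullet> \<tau> A Q Y"
    "ins C P (X \<otimes> Z) Q (Y \<otimes> Z) A (ext C P X Q Y Z f) = \<tau> P A (X \<otimes> Z) \<bullet> (\<iota> A \<boxtimes> ext C P X Q Y Z f)
        \<bullet> \<tau> A Q (Y \<otimes> Z)"
    by (simp_all add: ins_alt)
  ultimately show ?thesis by (simp add: ext_def[of C P X Q Y Z f])
qed

lemma \<tau>_hexagon':
  assumes "P \<in> Obj C" "A \<in> Obj C" "B \<in> Obj C" "X \<in> Obj C"
  shows "\<tau> (A \<otimes> B) P X \<bullet> (\<iota> P \<boxtimes> \<alpha> A B X) = \<alpha> A B (P \<otimes> X) \<bullet> (\<iota> A \<boxtimes> \<tau> B P X) \<bullet> \<tau> A P (B \<otimes> X)"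
proof -
  have "\<tau> P (A \<otimes> B) X = (\<iota> P \<boxtimes> \<alpha> A B X) \<bullet> \<tau> P A (B \<otimes> X) \<bullet> (\<iota> A \<boxtimes> \<tau> P B X) \<bullet> \<beta> A B (P \<otimes> X)"
    using assms \<tau>_hexagon[OF assms, THEN tcomp_reassoc, of "\<beta> A B (P \<otimes> X)"] by simp
  then have "tinv C (\<tau> P (A \<otimes> B) X) = tinv C \<dots>" by simp
  then show ?thesis using assms by (simp add: tinv_comp tinv_ten)
qed

text \<open>In the form of \<open>ins_alt\<close> both crossings of \<open>A \<otimes> B\<close> are
  split by the hexagon; the associators that remain around \<open>f\<close> cancel by
  naturality.\<close>

lemma ins_tensor:
  assumes [simp]: "ok C f" "src f = P \<otimes> X" "tgt f = Q \<otimes> Y"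
      "P \<in> Obj C" "X \<in> Obj C" "Q \<in> Obj C" "Y \<in> Obj C" and [simp]: "A \<in> Obj C" "B \<in> Obj C"
  shows "ins C P X Q Y (A \<otimes> B) f
    = (\<iota> P \<boxtimes> \<alpha> A B X) \<bullet> ins C P (B \<otimes> X) Q (B \<otimes> Y) A (ins C P X Q Y B f) \<bullet> (\<iota> Q \<boxtimes> \<beta> A B Y)"
proof -
  have 1: "\<tau> P (A \<otimes> B) X = (\<iota> P \<boxtimes> \<alpha> A B X) \<bullet> \<tau> P A (B \<otimes> X) \<bullet> (\<iota> A \<boxtimes> \<tau> P B X) \<bullet> \<beta> A B (P \<otimes> X)"
    using \<tau>_hexagon[of P A B X, THEN tcomp_reassoc, of "\<beta> A B (P \<otimes> X)"] by simp
  have 2: "\<tau> (A \<otimes> B) Q Y = \<alpha> A B (Q \<otimes> Y) \<bullet> (\<iota> A \<boxtimes> \<tau> B Q Y) \<bullet> \<tau> A Q (B \<otimes> Y) \<bullet> (\<iota> Q \<boxtimes> \<beta> A B Y)"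
    using \<tau>_hexagon'[of Q A B Y, THEN tcomp_reassoc, of "\<iota> Q \<boxtimes> \<beta> A B Y"] by simp
  have "\<beta> A B (P \<otimes> X) \<bullet> (\<iota> (A \<otimes> B) \<boxtimes> f) \<bullet> \<alpha> A B (Q \<otimes> Y) = \<iota> A \<boxtimes> (\<iota> B \<boxtimes> f)"
    by (simp add: \<alpha>_natural_whisker)
  from this[THEN tcomp_reassoc] show ?thesis
    by (simp add: ins_alt[of f P X Q Y] ins_alt[of "_ \<bullet> _" P "B \<otimes> X" Q] 1 2 whisker)
qed

lemma ext_unit:
  assumes [simp]: "ok C f" "src f = P \<otimes> X" "tgt f = Q \<otimes> Y"
      "P \<in> Obj C" "X \<in> Obj C" "Q \<in> Obj C" "Y \<in> Obj C"
  shows "ext C P X Q Y (Unit C) f \<bullet> (\<iota> Q \<boxtimes> \<r> Y) = (\<iota> P \<boxtimes> \<r> X) \<bullet> f"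
proof -
  have "\<beta> P X (Unit C) \<bullet> \<r> (P \<otimes> X) = \<iota> P \<boxtimes> \<r> X" by (simp flip: \<r>_tensor)
  from this[THEN tcomp_reassoc] show ?thesis by (simp add: ext_def \<r>_tensor \<r>_natural)
qed

lemma ins_unit:
  assumes [simp]: "ok C f" "src f = P \<otimes> X" "tgt f = Q \<otimes> Y"
      "P \<in> Obj C" "X \<in> Obj C" "Q \<in> Obj C" "Y \<in> Obj C"
  shows "ins C P X Q Y (Unit C) f \<bullet> (\<iota> Q \<boxtimes> \<l> Y) = (\<iota> P \<boxtimes> \<l> X) \<bullet> f"
proof -
  have "(\<iota> Q \<boxtimes> \<sigma> Y (Unit C)) \<bullet> (\<iota> Q \<boxtimes> \<l> Y) = \<iota> Q \<boxtimes> \<r> Y" by (simp add: \<sigma>_unit flip: whisker)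
  moreover have "(\<iota> P \<boxtimes> \<sigma> (Unit C) X) \<bullet> (\<iota> P \<boxtimes> \<r> X) = \<iota> P \<boxtimes> \<l> X" by (simp flip: whisker \<sigma>_unit)
  note this[THEN tcomp_reassoc]
  ultimately show ?thesis using ext_unit[of f P X Q Y, simplified] by (simp add: ins_def)
qed

text \<open>A diagram with one wire inserted and one appended becomes a single \<open>ext\<close>
  over both wires, to which \<open>ext_tail\<close> applies.\<close>

lemma ins_ext:
  assumes [simp]: "ok C f" "src f = P \<otimes> X" "tgt f = Q \<otimes> Y"
      "P \<in> Obj C" "X \<in> Obj C" "Q \<in> Obj C" "Y \<in> Obj C" and [simp]: "A \<in> Obj C" "Z \<in> Obj C"
  shows "ins C P (X \<otimes> Z) Q (Y \<otimes> Z) A (ext C P X Q Y Z f)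
    = (\<iota> P \<boxtimes> \<tau> A X Z) \<bullet> ext C P X Q Y (A \<otimes> Z) f \<bullet> (\<iota> Q \<boxtimes> \<tau> Y A Z)"
proof -
  have "ext C P (A \<otimes> X) Q (A \<otimes> Y) Z (ins C P X Q Y A f) = (\<iota> P \<boxtimes> (\<sigma> A X \<boxtimes> \<iota> Z))
      \<bullet> ext C P (X \<otimes> A) Q (Y \<otimes> A) Z (ext C P X Q Y A f) \<bullet> (\<iota> Q \<boxtimes> (\<sigma> Y A \<boxtimes> \<iota> Z))"
    unfolding ins_def by (rule ext_natural) simp_all
  then have "(\<iota> P \<boxtimes> \<beta> A X Z) \<bullet> ext C P (A \<otimes> X) Q (A \<otimes> Y) Z (ins C P X Q Y A f) \<bullet> (\<iota> Q \<boxtimes> \<alpha> A Y Z)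
    = (\<iota> P \<boxtimes> \<beta> A X Z) \<bullet> (\<iota> P \<boxtimes> (\<sigma> A X \<boxtimes> \<iota> Z))
      \<bullet> ext C P (X \<otimes> A) Q (Y \<otimes> A) Z (ext C P X Q Y A f) \<bullet> (\<iota> Q \<boxtimes> (\<sigma> Y A \<boxtimes> \<iota> Z)) \<bullet> (\<iota> Q \<boxtimes> \<alpha> A Y Z)"
    by simp
  then show ?thesis by (simp add: ext_ins ext_ext tswap_def whisker)
qed

text \<open>The independence of two bodies, and the diagrammatic core of the interchange law. By
  \<open>ins_ext\<close> the body \<open>f\<close> is extended by the whole block on which
  \<open>g\<close> acts, and \<open>ext_tail\<close> moves \<open>g\<close> past it.\<close>

lemma ins_interchange:
  assumes [simp]: "ok C f" "src f = P \<otimes> X" "tgt f = Q \<otimes> Y"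
      "P \<in> Obj C" "X \<in> Obj C" "Q \<in> Obj C" "Y \<in> Obj C"
    and [simp]: "ok C g" "src g = P' \<otimes> X'" "tgt g = Q' \<otimes> Y'" "P' \<in> Obj C" "X' \<in> Obj C"
        "Q' \<in> Obj C" "Y' \<in> Obj C"
  shows "(\<iota> P \<boxtimes> ins C P' X' Q' Y' X g) \<bullet> ins C P (X \<otimes> Y') Q (Y \<otimes> Y') Q' (ext C P X Q Y Y' f)
    = ins C P (X \<otimes> X') Q (Y \<otimes> X') P' (ext C P X Q Y X' f) \<bullet> (\<iota> Q \<boxtimes> ins C P' X' Q' Y' Y g)"
proof -
  have *: "(\<iota> P \<boxtimes> \<tau> X Q' Y') \<bullet> (\<iota> P \<boxtimes> \<tau> Q' X Y') = \<iota> (P \<otimes> (X \<otimes> (Q' \<otimes> Y')))"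
    "(\<iota> Q \<boxtimes> \<tau> Y P' X') \<bullet> (\<iota> Q \<boxtimes> \<tau> P' Y X') = \<iota> (Q \<otimes> (Y \<otimes> (P' \<otimes> X')))"
    by (simp_all flip: whisker)
  show ?thesis
    using *[THEN tcomp_reassoc] ext_tail[of f P X Q Y g "P' \<otimes> X'" "Q' \<otimes> Y'", THEN tcomp_reassoc]
    by (simp add: ins_ext) (simp add: ins_alt[of g] whisker)
qed

text \<open>After feedback a state has two factors. A new wire is then inserted next to the old
  factor \<open>P\<close> and crosses the added factor \<open>P'\<close> separately; this is
  \<open>\<tau>_hexagon\<close> on both ends of \<open>ins_alt\<close>.\<close>

lemma ins_pair:
  assumes [simp]: "ok C k" "src k = P \<otimes> (P' \<otimes> X)" "tgt k = Q \<otimes> (Q' \<otimes> Y)"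
      "P \<in> Obj C" "P' \<in> Obj C" "X \<in> Obj C" "Q \<in> Obj C" "Q' \<in> Obj C" "Y \<in> Obj C" "A \<in> Obj C"
  shows "ins C (P \<otimes> P') X (Q \<otimes> Q') Y A (\<alpha> P P' X \<bullet> k \<bullet> \<beta> Q Q' Y)
    = \<alpha> P P' (A \<otimes> X) \<bullet> (\<iota> P \<boxtimes> \<tau> P' A X) \<bullet> ins C P (P' \<otimes> X) Q (Q' \<otimes> Y) A k
      \<bullet> (\<iota> Q \<boxtimes> \<tau> A Q' Y) \<bullet> \<beta> Q Q' (A \<otimes> Y)"
proof -
  have "(\<iota> A \<boxtimes> \<beta> Q Q' Y) \<bullet> \<tau> A (Q \<otimes> Q') Y = \<tau> A Q (Q' \<otimes> Y) \<bullet> (\<iota> Q \<boxtimes> \<tau> A Q' Y) \<bullet> \<beta> Q Q' (A \<otimes> Y)"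
  proof -
    have "(\<iota> A \<boxtimes> \<beta> Q Q' Y) \<bullet> (\<tau> A (Q \<otimes> Q') Y \<bullet> \<alpha> Q Q' (A \<otimes> Y)) \<bullet> \<beta> Q Q' (A \<otimes> Y)
      = \<tau> A Q (Q' \<otimes> Y) \<bullet> (\<iota> Q \<boxtimes> \<tau> A Q' Y) \<bullet> \<beta> Q Q' (A \<otimes> Y)"
      unfolding \<tau>_hexagon[OF \<open>A \<in> Obj C\<close> \<open>Q \<in> Obj C\<close> \<open>Q' \<in> Obj C\<close> \<open>Y \<in> Obj C\<close>] by simp
    then show ?thesis by simp
  qed
  then show ?thesis
    using \<tau>_hexagon'[of A P P' X, THEN tcomp_reassoc] by (simp add: ins_alt whisker)
qed

lemma ok_star [simp]:
  assumes [simp]: "ok C f" "src f = P \<otimes> X" "tgt f = Q \<otimes> Y"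
      "P \<in> Obj C" "X \<in> Obj C" "Q \<in> Obj C" "Y \<in> Obj C" and [simp]: "ok C g" "src g = P' \<otimes> Y" "tgt g
          = Q' \<otimes> Z" "P' \<in> Obj C" "Q' \<in> Obj C" "Z \<in> Obj C"
  shows "ok C (star C P X Q Y P' Q' Z f g)"
  by (simp add: star_def)

text \<open>The appended wire does not touch the states, so whiskering respects composition without
  any sliding; only the bracketing of inputs and outputs has to be adjusted, by the
  pentagon.\<close>

lemma ext_star:
  assumes [simp]: "ok C f" "src f = P \<otimes> X" "tgt f = Q \<otimes> Y"
      "P \<in> Obj C" "X \<in> Obj C" "Q \<in> Obj C" "Y \<in> Obj C" and [simp]: "ok C g" "src g = P' \<otimes> Y" "tgt g
          = Q' \<otimes> Z" "P' \<in> Obj C" "Q' \<in> Obj C" "Z \<in> Obj C" "W \<in> Obj C"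
  shows "ext C (P \<otimes> P') X (Q \<otimes> Q') Z W (star C P X Q Y P' Q' Z f g)
    = star C P (X \<otimes> W) Q (Y \<otimes> W) P' Q' (Z \<otimes> W) (ext C P X Q Y W f) (ext C P' Y Q' Z W g)"
proof -
  have 1: "(ins C P X Q Y P' f \<boxtimes> \<iota> W) = \<alpha> P (P' \<otimes> X) W \<bullet> (\<iota> P \<boxtimes> \<alpha> P' X W)
    \<bullet> ins C P (X \<otimes> W) Q (Y \<otimes> W) P' (ext C P X Q Y W f) \<bullet> (\<iota> Q \<boxtimes> \<beta> P' Y W) \<bullet> \<beta> Q (P' \<otimes> Y) W"
  proof -
    have "\<alpha> P (P' \<otimes> X) W \<bullet> ext C P (P' \<otimes> X) Q (P' \<otimes> Y) W (ins C P X Q Y P' f) \<bullet> \<beta> Q (P' \<otimes> Y) W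
      = ins C P X Q Y P' f \<boxtimes> \<iota> W" by (simp add: ext_def)
    then show ?thesis by (simp add: ext_ins)
  qed
  have "ext C (P \<otimes> P') X (Q \<otimes> Q') Z W (star C P X Q Y P' Q' Z f g)
    = (\<beta> (P \<otimes> P') X W \<bullet> (\<alpha> P P' X \<boxtimes> \<iota> W) \<bullet> \<alpha> P (P' \<otimes> X) W) \<bullet> (\<iota> P \<boxtimes> \<alpha> P' X W)
    \<bullet> ins C P (X \<otimes> W) Q (Y \<otimes> W) P' (ext C P X Q Y W f) \<bullet> (\<iota> Q \<boxtimes> \<beta> P' Y W)
    \<bullet> (\<beta> Q (P' \<otimes> Y) W \<bullet> ((\<iota> Q \<boxtimes> g) \<boxtimes> \<iota> W)) \<bullet> (\<beta> Q Q' Z \<boxtimes> \<iota> W) \<bullet> \<alpha> (Q \<otimes> Q') Z W"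
    unfolding ext_def[of C "P \<otimes> P'"] star_def by (simp add: whisker 1)
  also have "\<beta> Q (P' \<otimes> Y) W \<bullet> ((\<iota> Q \<boxtimes> g) \<boxtimes> \<iota> W) = (\<iota> Q \<boxtimes> (g \<boxtimes> \<iota> W)) \<bullet> \<beta> Q (Q' \<otimes> Z) W"
    by (simp add: \<beta>_natural_whisker)
  finally show ?thesis
    using pentagons(1)[of Q Q' Z W] pentagons(2)[of P P' X W]
    by (simp add: star_def ext_def[of C P' Y Q' Z W g] whisker)
qed

lemma ins_star:
  assumes [simp]: "ok C f" "src f = P \<otimes> X" "tgt f = Q \<otimes> Y"
      "P \<in> Obj C" "X \<in> Obj C" "Q \<in> Obj C" "Y \<in> Obj C" and [simp]: "ok C g" "src g = P' \<otimes> Y" "tgt g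
          = Q' \<otimes> Z" "P' \<in> Obj C" "Q' \<in> Obj C" "Z \<in> Obj C" "A \<in> Obj C"
  shows "ins C (P \<otimes> P') X (Q \<otimes> Q') Z A (star C P X Q Y P' Q' Z f g)
    = star C P (A \<otimes> X) Q (A \<otimes> Y) P' Q' (A \<otimes> Z) (ins C P X Q Y A f) (ins C P' Y Q' Z A g)"
proof -
  have 1: "ins C P (A \<otimes> X) Q (A \<otimes> Y) P' (ins C P X Q Y A f) = (\<iota> P \<boxtimes> (\<iota> P' \<boxtimes> \<sigma> A X))
      \<bullet> ins C P (X \<otimes> A) Q (Y \<otimes> A) P' (ext C P X Q Y A f) \<bullet> (\<iota> Q \<boxtimes> (\<iota> P' \<boxtimes> \<sigma> Y A))"
    unfolding ins_def[of C P X] by (rule ins_natural) simp_all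
  have "\<iota> Q \<boxtimes> ins C P' Y Q' Z A g = (\<iota> Q \<boxtimes> (\<iota> P' \<boxtimes> \<sigma> A Y)) \<bullet> (\<iota> Q \<boxtimes> ext C P' Y Q' Z A g)
      \<bullet> (\<iota> Q \<boxtimes> (\<iota> Q' \<boxtimes> \<sigma> Z A))"
    by (simp add: ins_def whisker)
  moreover have "(\<iota> Q \<boxtimes> (\<iota> P' \<boxtimes> \<sigma> Y A)) \<bullet> (\<iota> Q \<boxtimes> (\<iota> P' \<boxtimes> \<sigma> A Y)) = \<iota> (Q \<otimes> (P' \<otimes> (Y \<otimes> A)))"
    by (simp flip: whisker)
  note this[THEN tcomp_reassoc]
  ultimately show ?thesis
    by (simp add: ins_def[of C "P \<otimes> P'"] ext_star) (simp add: star_def 1 \<alpha>_natural_whisker[THEN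
        tcomp_reassoc] \<beta>_natural_whisker)
qed

text \<open>The states are bracketed differently on the two sides, so associativity is a square with
  associators on the states; classes later absorb it by a slide. \<open>ins_tensor\<close> carries
  the compound state of \<open>g\<close> and \<open>h\<close> past \<open>f\<close> one factor at a
  time.\<close>

lemma star_assoc:
  assumes [simp]: "ok C f" "src f = P \<otimes> X" "tgt f = Q \<otimes> Y"
      "P \<in> Obj C" "X \<in> Obj C" "Q \<in> Obj C" "Y \<in> Obj C" and [simp]: "ok C g" "src g = P' \<otimes> Y" "tgt g
          = Q' \<otimes> Z" "P' \<in> Obj C" "Q' \<in> Obj C" "Z \<in> Obj C"
    and [simp]: "ok C h" "src h = P'' \<otimes> Z" "tgt h = Q'' \<otimes> W" "P'' \<in> Obj C" "Q'' \<in> Obj C" "W \<in> Obj C"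
  shows "(\<alpha> P P' P'' \<boxtimes> \<iota> X) \<bullet> star C P X Q Y (P' \<otimes> P'') (Q' \<otimes> Q'') W f (star C P' Y Q' Z P'' Q'' W
      g h)
    = star C (P \<otimes> P') X (Q \<otimes> Q') Z P'' Q'' W (star C P X Q Y P' Q' Z f g) h \<bullet> (\<alpha> Q Q' Q'' \<boxtimes> \<iota> W)"
proof -
  have r: "\<beta> Q Q' (Q'' \<otimes> W) \<bullet> \<beta> (Q \<otimes> Q') Q'' W \<bullet> (\<alpha> Q Q' Q'' \<boxtimes> \<iota> W) = (\<iota> Q \<boxtimes> \<beta> Q' Q'' W)
      \<bullet> \<beta> Q (Q' \<otimes> Q'') W"
    using pentagons(4)[of Q Q' Q'' W, THEN tcomp_reassoc, of "\<alpha> Q Q' Q'' \<boxtimes> \<iota> W"] by simp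
  have "star C (P \<otimes> P') X (Q \<otimes> Q') Z P'' Q'' W (star C P X Q Y P' Q' Z f g) h \<bullet> (\<alpha> Q Q' Q'' \<boxtimes> \<iota> W)
    = \<alpha> (P \<otimes> P') P'' X \<bullet> \<alpha> P P' (P'' \<otimes> X) \<bullet> ins C P (P'' \<otimes> X) Q (P'' \<otimes> Y) P' (ins C P X Q Y P'' f)
     \<bullet> (\<iota> Q \<boxtimes> ins C P' Y Q' Z P'' g) \<bullet> (\<beta> Q Q' (P'' \<otimes> Z) \<bullet> (\<iota> (Q \<otimes> Q') \<boxtimes> h)) \<bullet> \<beta> (Q \<otimes> Q') Q'' W
         \<bullet> (\<alpha> Q Q' Q'' \<boxtimes> \<iota> W)"
    unfolding star_def[of C "P \<otimes> P'"] by (simp add: ins_star) (simp add: star_def)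
  also have "\<beta> Q Q' (P'' \<otimes> Z) \<bullet> (\<iota> (Q \<otimes> Q') \<boxtimes> h) = (\<iota> Q \<boxtimes> (\<iota> Q' \<boxtimes> h)) \<bullet> \<beta> Q Q' (Q'' \<otimes> W)"
    by (simp add: \<beta>_natural_whisker)
  finally have 1: "star C (P \<otimes> P') X (Q \<otimes> Q') Z P'' Q'' W (star C P X Q Y P' Q' Z f g) h
      \<bullet> (\<alpha> Q Q' Q'' \<boxtimes> \<iota> W)
    = \<alpha> (P \<otimes> P') P'' X \<bullet> \<alpha> P P' (P'' \<otimes> X) \<bullet> ins C P (P'' \<otimes> X) Q (P'' \<otimes> Y) P' (ins C P X Q Y P'' f)
     \<bullet> (\<iota> Q \<boxtimes> ins C P' Y Q' Z P'' g) \<bullet> (\<iota> Q \<boxtimes> (\<iota> Q' \<boxtimes> h)) \<bullet> (\<iota> Q \<boxtimes> \<beta> Q' Q'' W) \<bullet> \<beta> Q (Q' \<otimes> Q'') W"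
    by (simp add: r)
  show ?thesis
    unfolding 1 using \<alpha>_pentagon[of P P' P'' X, THEN tcomp_reassoc]
    by (simp add: star_def ins_tensor[of f P X Q Y] whisker)
qed

text \<open>A stateless arrow has a body \<open>e \<boxtimes> v\<close> whose state vanishes through
  \<open>e\<close>, the inverse of the unit map of \<open>F\<close>. \<open>ins_param\<close> lets
  \<open>e\<close> act before \<open>f\<close>; the inserted wire is then a unit, which
  \<open>ins_unit\<close> removes.\<close>

lemma star_unit_right:
  assumes [simp]: "ok C f" "src f = P \<otimes> X" "tgt f = Q \<otimes> Y"
      "P \<in> Obj C" "X \<in> Obj C" "Q \<in> Obj C" "Y \<in> Obj C" and [simp]: "ok C e" "src e = E" "tgt e
          = Unit C" "ok C v" "src v = Y" "tgt v = Z"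
  shows "star C P X Q Y E (Unit C) Z f (e \<boxtimes> v) \<bullet> (\<r> Q \<boxtimes> \<iota> Z)
    = (((\<iota> P \<boxtimes> e) \<bullet> \<r> P) \<boxtimes> \<iota> X) \<bullet> f \<bullet> (\<iota> Q \<boxtimes> v)"
proof -
  let ?I = "Unit C"
  have o [simp]: "E \<in> Obj C" "Z \<in> Obj C" using ok_obj(1)[of e] ok_obj(2)[of v] by simp_all
  have "(\<iota> Q \<boxtimes> (e \<boxtimes> v)) \<bullet> (\<iota> Q \<boxtimes> \<l> Z) = (\<iota> Q \<boxtimes> (e \<boxtimes> \<iota> Y)) \<bullet> (\<iota> Q \<boxtimes> \<l> Y) \<bullet> (\<iota> Q \<boxtimes> v)"
    using \<l>_natural[of v Y Z] interchange(1)[of v Y e ?I E Z, symmetric] by (simp flip: whisker)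
  then have 1: "star C P X Q Y E (Unit C) Z f (e \<boxtimes> v) \<bullet> (\<r> Q \<boxtimes> \<iota> Z)
    = \<alpha> P E X \<bullet> (ins C P X Q Y E f \<bullet> (\<iota> Q \<boxtimes> (e \<boxtimes> \<iota> Y))) \<bullet> (\<iota> Q \<boxtimes> \<l> Y) \<bullet> (\<iota> Q \<boxtimes> v)"
    by (simp add: star_def flip: \<alpha>_triangle)
  show ?thesis
    unfolding 1 ins_param[of f P X Q Y e E ?I, simplified, symmetric]
    using ins_unit[of f P X Q Y, THEN tcomp_reassoc]
    by (simp add: whisker \<alpha>_natural_whisker[THEN tcomp_reassoc] flip: \<alpha>_triangle)
qed

lemma ins_tten:
  assumes [simp]: "ok C p" "ok C u" "src p = P" "tgt p = Q" "src u = X" "tgt u = Y" "A \<in> Obj C"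
  shows "ins C P X Q Y A (p \<boxtimes> u) = p \<boxtimes> (\<iota> A \<boxtimes> u)"
    and "ext C P X Q Y A (p \<boxtimes> u) = p \<boxtimes> (u \<boxtimes> \<iota> A)"
proof -
  have "P \<in> Obj C" "Q \<in> Obj C" "X \<in> Obj C" "Y \<in> Obj C" using ok_obj[of p] ok_obj[of u] by simp_all
  then show "ins C P X Q Y A (p \<boxtimes> u) = p \<boxtimes> (\<iota> A \<boxtimes> u)" "ext C P X Q Y A (p \<boxtimes> u) = p \<boxtimes> (u \<boxtimes> \<iota> A)"
    using ins_natural[of "\<iota> (Q \<otimes> Y)" Q Y Q Y A p u "\<iota> Q" "\<iota> Y" P X Q Y]
      ext_natural[of "\<iota> (Q \<otimes> Y)" Q Y Q Y A p u "\<iota> Q" "\<iota> Y" P X Q Y] by simp_all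
qed

text \<open>Inserting a wire into a tensor of arrows only adds an identity factor
  (\<open>ins_tten\<close>). So \<open>e\<close> can act at the start, and naturality of
  \<open>\<l>\<close> removes the unit that it produces.\<close>

lemma star_unit_left:
  assumes [simp]: "ok C f" "src f = P \<otimes> X" "tgt f = Q \<otimes> Y"
      "P \<in> Obj C" "X \<in> Obj C" "Q \<in> Obj C" "Y \<in> Obj C" and [simp]: "ok C e" "src e = E" "tgt e
          = Unit C" "ok C u" "src u = W" "tgt u = X"
  shows "star C E W (Unit C) X P Q Y (e \<boxtimes> u) f \<bullet> (\<l> Q \<boxtimes> \<iota> Y)
    = (((e \<boxtimes> \<iota> P) \<bullet> \<l> P) \<boxtimes> \<iota> W) \<bullet> (\<iota> P \<boxtimes> u) \<bullet> f"
proof -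
  let ?I = "Unit C"
  have o [simp]: "E \<in> Obj C" "W \<in> Obj C" using ok_obj(1)[of e] ok_obj(1)[of u] by simp_all
  have 1: "e \<boxtimes> (\<iota> P \<boxtimes> u) = (e \<boxtimes> \<iota> (P \<otimes> W)) \<bullet> (\<iota> ?I \<boxtimes> (\<iota> P \<boxtimes> u))"
    by (simp add: interchange)
  have 2: "(\<iota> ?I \<boxtimes> f) \<bullet> \<l> (Q \<otimes> Y) = \<l> (P \<otimes> X) \<bullet> f"
    "(\<iota> ?I \<boxtimes> (\<iota> P \<boxtimes> u)) \<bullet> \<l> (P \<otimes> X) = \<l> (P \<otimes> W) \<bullet> (\<iota> P \<boxtimes> u)" by (simp_all add: \<l>_natural)
  have "star C E W (Unit C) X P Q Y (e \<boxtimes> u) f \<bullet> (\<l> Q \<boxtimes> \<iota> Y)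
    = \<alpha> E P W \<bullet> (e \<boxtimes> \<iota> (P \<otimes> W)) \<bullet> \<l> (P \<otimes> W) \<bullet> (\<iota> P \<boxtimes> u) \<bullet> f"
    using 2[THEN tcomp_reassoc] 2 by (simp add: star_def ins_tten 1 flip: \<l>_tensor)
  then show ?thesis
    by (simp add: whisker \<alpha>_natural_whisker[THEN tcomp_reassoc] flip: \<l>_tensor)
qed

end

section \<open>Monoidal functors on typed arrows\<close>

definition tmap :: "('o, 'm, 'z) smc_scheme \<Rightarrow> ('o, 'm, 'p, 'q) mfun \<Rightarrow> ('o, 'm) typed \<Rightarrow> ('p, 'q)
    typed" where
  "tmap C F a = Typed (OMap F (src a)) (OMap F (tgt a)) (if ok C a then Some (AMap F (raw a)) else
      None)"

definition tmu :: "('o, 'm, 'y) smc_scheme \<Rightarrow> ('p, 'q, 'z) smc_scheme \<Rightarrow> ('o, 'm, 'p, 'q) mfun \<Rightarrow>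
    'o \<Rightarrow> 'o \<Rightarrow> ('p, 'q) typed" where
  "tmu C D F X Y = mk D (OMap F X \<otimes>\<^bsub>D\<^esub> OMap F Y) (OMap F (X \<otimes>\<^bsub>C\<^esub> Y)) (TenMap F X Y)"

definition teps :: "('o, 'm, 'y) smc_scheme \<Rightarrow> ('p, 'q, 'z) smc_scheme \<Rightarrow> ('o, 'm, 'p, 'q) mfun \<Rightarrow>
    ('p, 'q) typed" where
  "teps C D F = mk D (Unit D) (OMap F (Unit C)) (UnitMap F)"

text \<open>The image of a body with its ends split again into state and remaining wires. A functor
  will send \<open>[S, f]\<close> to the class of this arrow with state \<open>F S\<close> in place
  of \<open>S\<close>.\<close>

definition tconj :: "('o, 'm, 'y) smc_scheme \<Rightarrow> ('p, 'q, 'z) smc_scheme \<Rightarrow> ('o, 'm, 'p, 'q) mfun \<Rightarrow>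
    'o \<Rightarrow> 'o \<Rightarrow> 'o \<Rightarrow> 'o \<Rightarrow> ('o, 'm) typed \<Rightarrow> ('p, 'q) typed" where
  "tconj C D F P X Q Y f = tmu C D F P X \<bullet>\<^bsub>D\<^esub> tmap C F f \<bullet>\<^bsub>D\<^esub> tinv D (tmu C D F Q Y)"

lemma src_tgt_functor [simp]:
  "src (tmap C F a) = OMap F (src a)" "tgt (tmap C F a) = OMap F (tgt a)"
  "src (tmu C D F X Y) = OMap F X \<otimes>\<^bsub>D\<^esub> OMap F Y" "tgt (tmu C D F X Y) = OMap F (X \<otimes>\<^bsub>C\<^esub> Y)"
  "src (teps C D F) = Unit D" "tgt (teps C D F) = OMap F (Unit C)"
  "src (tconj C D F P X Q Y f) = OMap F P \<otimes>\<^bsub>D\<^esub> OMap F X"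
  "tgt (tconj C D F P X Q Y f) = OMap F Q \<otimes>\<^bsub>D\<^esub> OMap F Y"
  by (simp_all add: tmap_def tmu_def teps_def tconj_def)

context symmetric_monoidal_functor
begin

abbreviation "\<mu> \<equiv> tmu C D F"
abbreviation "\<epsilon> \<equiv> teps C D F"
abbreviation "\<Phi> \<equiv> tmap C F"

lemmas [simp] = map_obj

lemma ok_tmap [simp]: "ok C a \<Longrightarrow> ok D (\<Phi> a)"
  using map_hom raw_hom by (fastforce simp: ok_def tmap_def)

lemma raw_tmap: "ok C a \<Longrightarrow> raw (\<Phi> a) = AMap F (raw a)"
  by (simp add: tmap_def raw_def)

lemma tmap_comp:
  assumes "tgt a = src b" "ok C a" "ok C b"
  shows "\<Phi> (a \<bullet>\<^bsub>C\<^esub> b) = \<Phi> a \<bullet>\<^bsub>D\<^esub> \<Phi> b"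
  using assms raw_hom[of C a] raw_hom[of C b]
  by (intro typed_eqI[where C = D]) (auto simp: raw_tmap D.raw_comp C.raw_comp intro: map_comp)

lemma tmap_id [simp]: "X \<in> Obj C \<Longrightarrow> \<Phi> (\<iota>\<^bsub>C\<^esub> X) = \<iota>\<^bsub>D\<^esub> (OMap F X)"
  by (intro typed_eqI[where C = D]) (auto simp: raw_tmap D.raw_id C.raw_id map_id)

lemma tiso_tmap [simp]: "tiso C a \<Longrightarrow> tiso D (\<Phi> a)"
  and tmap_inv: "tiso C a \<Longrightarrow> \<Phi> (tinv C a) = tinv D (\<Phi> a)"
  using D.tisoI[of "\<Phi> a" "\<Phi> (tinv C a)"] C.tiso_ok[of a] C.tinv[of a] C.ok_obj[of a]
  by (auto simp flip: tmap_comp)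

lemma tiso_mu [simp]: "\<lbrakk>X \<in> Obj C; Y \<in> Obj C\<rbrakk> \<Longrightarrow> tiso D (\<mu> X Y)"
  and tiso_eps [simp]: "tiso D \<epsilon>"
  using ten_map_iso unit_map_iso by (simp_all add: tmu_def teps_def D.tiso_mk)

lemma ok_mu [simp]: "\<lbrakk>X \<in> Obj C; Y \<in> Obj C\<rbrakk> \<Longrightarrow> ok D (\<mu> X Y)"
  and ok_eps [simp]: "ok D \<epsilon>"
  by (simp_all add: D.tiso_ok)

lemma raw_mu: "\<lbrakk>X \<in> Obj C; Y \<in> Obj C\<rbrakk> \<Longrightarrow> raw (\<mu> X Y) = TenMap F X Y"
  and raw_eps: "raw \<epsilon> = UnitMap F"
  using ten_map_iso unit_map_iso by (simp_all add: tmu_def teps_def raw_mk iso_def)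

lemma ok_tinv [simp]: "tiso D a \<Longrightarrow> ok D (tinv D a)"
  by (rule D.tinv)

lemma mu_natural:
  assumes "ok C f" "ok C g" "src f = X" "tgt f = X'" "src g = Y" "tgt g = Y'"
  shows "(\<Phi> f \<boxtimes>\<^bsub>D\<^esub> \<Phi> g) \<bullet>\<^bsub>D\<^esub> \<mu> X' Y' = \<mu> X Y \<bullet>\<^bsub>D\<^esub> \<Phi> (f \<boxtimes>\<^bsub>C\<^esub> g)"
  using assms raw_hom[of C f] raw_hom[of C g] ten_map_nat[of "raw f" X X' "raw g" Y Y']
  by (auto intro!: typed_eqI[where C = D] simp: raw_tmap D.raw_comp D.raw_ten C.raw_ten raw_mu
      C.ok_obj)

lemma mu_assoc:
  assumes "X \<in> Obj C" "Y \<in> Obj C" "Z \<in> Obj C"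
  shows "(\<mu> X Y \<boxtimes>\<^bsub>D\<^esub> \<iota>\<^bsub>D\<^esub> (OMap F Z)) \<bullet>\<^bsub>D\<^esub> \<mu> (X \<otimes>\<^bsub>C\<^esub> Y) Z \<bullet>\<^bsub>D\<^esub> \<Phi> (\<alpha>\<^bsub>C\<^esub> X Y Z)
    = \<alpha>\<^bsub>D\<^esub> (OMap F X) (OMap F Y) (OMap F Z) \<bullet>\<^bsub>D\<^esub> (\<iota>\<^bsub>D\<^esub> (OMap F X) \<boxtimes>\<^bsub>D\<^esub> \<mu> Y Z) \<bullet>\<^bsub>D\<^esub> \<mu> X (Y \<otimes>\<^bsub>C\<^esub> Z)"
proof -
  have "raw (((\<mu> X Y \<boxtimes>\<^bsub>D\<^esub> \<iota>\<^bsub>D\<^esub> (OMap F Z)) \<bullet>\<^bsub>D\<^esub> \<mu> (X \<otimes>\<^bsub>C\<^esub> Y) Z) \<bullet>\<^bsub>D\<^esub> \<Phi> (\<alpha>\<^bsub>C\<^esub> X Y Z))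
    = raw ((\<alpha>\<^bsub>D\<^esub> (OMap F X) (OMap F Y) (OMap F Z) \<bullet>\<^bsub>D\<^esub> (\<iota>\<^bsub>D\<^esub> (OMap F X) \<boxtimes>\<^bsub>D\<^esub> \<mu> Y Z))
        \<bullet>\<^bsub>D\<^esub> \<mu> X (Y \<otimes>\<^bsub>C\<^esub> Z))"
    using assms map_assoc[OF assms]
    by (simp add: raw_tmap D.raw_comp D.raw_ten raw_mu C.raw_structure D.raw_structure D.raw_id
        del: D.tcomp_assoc)
  then show ?thesis using assms by (intro typed_eqI[where C = D]) auto
qed

lemma mu_lunit:
  assumes "X \<in> Obj C"
  shows "(\<epsilon> \<boxtimes>\<^bsub>D\<^esub> \<iota>\<^bsub>D\<^esub> (OMap F X)) \<bullet>\<^bsub>D\<^esub> \<mu> (Unit C) X \<bullet>\<^bsub>D\<^esub> \<Phi> (\<l>\<^bsub>C\<^esub> X) = \<l>\<^bsub>D\<^esub> (OMap F X)"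
proof -
  have "raw (((\<epsilon> \<boxtimes>\<^bsub>D\<^esub> \<iota>\<^bsub>D\<^esub> (OMap F X)) \<bullet>\<^bsub>D\<^esub> \<mu> (Unit C) X) \<bullet>\<^bsub>D\<^esub> \<Phi> (\<l>\<^bsub>C\<^esub> X)) = raw (\<l>\<^bsub>D\<^esub> (OMap F X))"
    using assms map_lunit[OF assms]
    by (simp add: raw_tmap D.raw_comp D.raw_ten raw_mu raw_eps C.raw_structure D.raw_structure
        D.raw_id del: D.tcomp_assoc)
  then show ?thesis using assms by (intro typed_eqI[where C = D]) auto
qed

lemma mu_runit:
  assumes "X \<in> Obj C"
  shows "(\<iota>\<^bsub>D\<^esub> (OMap F X) \<boxtimes>\<^bsub>D\<^esub> \<epsilon>) \<bullet>\<^bsub>D\<^esub> \<mu> X (Unit C) \<bullet>\<^bsub>D\<^esub> \<Phi> (\<r>\<^bsub>C\<^esub> X) = \<r>\<^bsub>D\<^esub> (OMap F X)"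
proof -
  have "raw (((\<iota>\<^bsub>D\<^esub> (OMap F X) \<boxtimes>\<^bsub>D\<^esub> \<epsilon>) \<bullet>\<^bsub>D\<^esub> \<mu> X (Unit C)) \<bullet>\<^bsub>D\<^esub> \<Phi> (\<r>\<^bsub>C\<^esub> X)) = raw (\<r>\<^bsub>D\<^esub> (OMap F X))"
    using assms map_runit[OF assms]
    by (simp add: raw_tmap D.raw_comp D.raw_ten raw_mu raw_eps C.raw_structure D.raw_structure
        D.raw_id del: D.tcomp_assoc)
  then show ?thesis using assms by (intro typed_eqI[where C = D]) auto
qed

lemma mu_sym:
  assumes "X \<in> Obj C" "Y \<in> Obj C"
  shows "\<mu> X Y \<bullet>\<^bsub>D\<^esub> \<Phi> (\<sigma>\<^bsub>C\<^esub> X Y) = \<sigma>\<^bsub>D\<^esub> (OMap F X) (OMap F Y) \<bullet>\<^bsub>D\<^esub> \<mu> Y X"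
  using assms map_sym[OF assms]
  by (intro typed_eqI[where C = D])
    (auto simp: raw_tmap D.raw_comp raw_mu C.raw_structure D.raw_structure)

lemma ok_tconj [simp]:
  "\<lbrakk>ok C f; src f = P \<otimes>\<^bsub>C\<^esub> X; tgt f = Q \<otimes>\<^bsub>C\<^esub> Y; P \<in> Obj C; X \<in> Obj C; Q \<in> Obj C; Y \<in> Obj C\<rbrakk>
    \<Longrightarrow> ok D (tconj C D F P X Q Y f)"
  by (simp add: tconj_def)

lemma tconj_comp:
  assumes "ok C f" "src f = P \<otimes>\<^bsub>C\<^esub> X" "tgt f = Q \<otimes>\<^bsub>C\<^esub> Y" "ok C g" "src g = Q \<otimes>\<^bsub>C\<^esub> Y" "tgt g
      = R \<otimes>\<^bsub>C\<^esub> Z"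
    "P \<in> Obj C" "X \<in> Obj C" "Q \<in> Obj C" "Y \<in> Obj C" "R \<in> Obj C" "Z \<in> Obj C"
  shows "tconj C D F P X R Z (f \<bullet>\<^bsub>C\<^esub> g) = tconj C D F P X Q Y f \<bullet>\<^bsub>D\<^esub> tconj C D F Q Y R Z g"
  using assms by (simp add: tconj_def tmap_comp)

lemma tconj_tten:
  assumes "ok C p" "ok C u" "src p = P" "tgt p = Q" "src u = X" "tgt u = Y"
  shows "tconj C D F P X Q Y (p \<boxtimes>\<^bsub>C\<^esub> u) = \<Phi> p \<boxtimes>\<^bsub>D\<^esub> \<Phi> u"
proof -
  have o: "P \<in> Obj C" "Q \<in> Obj C" "X \<in> Obj C" "Y \<in> Obj C" using assms C.ok_obj by auto
  show ?thesis
    using assms o mu_natural[of p u P Q X Y, THEN D.tcomp_reassoc, of "tinv D (\<mu> Q Y)"]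
    by (simp add: tconj_def)
qed

lemma tconj_id [simp]:
  "\<lbrakk>P \<in> Obj C; X \<in> Obj C; PX = P \<otimes>\<^bsub>C\<^esub> X\<rbrakk> \<Longrightarrow> tconj C D F P X P X (\<iota>\<^bsub>C\<^esub> PX)
      = \<iota>\<^bsub>D\<^esub> (OMap F P \<otimes>\<^bsub>D\<^esub> OMap F X)"
  by (simp add: tconj_def)

text \<open>This lemma and those that follow have one shape: a structure map before the image of a
  construction equals the construction on images, followed by a structure map. Chained, they pass
  the structure maps through a composite from left to right.\<close>

lemma tconj_whisker_left:
  assumes "ok C f" "src f = P \<otimes>\<^bsub>C\<^esub> X" "tgt f = Q \<otimes>\<^bsub>C\<^esub> Y"
    "P \<in> Obj C" "X \<in> Obj C" "Q \<in> Obj C" "Y \<in> Obj C" "A \<in> Obj C"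
  shows "(\<iota>\<^bsub>D\<^esub> (OMap F A) \<boxtimes>\<^bsub>D\<^esub> \<mu> P X) \<bullet>\<^bsub>D\<^esub> tconj C D F A (P \<otimes>\<^bsub>C\<^esub> X) A (Q \<otimes>\<^bsub>C\<^esub> Y) (\<iota>\<^bsub>C\<^esub> A \<boxtimes>\<^bsub>C\<^esub> f)
    = (\<iota>\<^bsub>D\<^esub> (OMap F A) \<boxtimes>\<^bsub>D\<^esub> tconj C D F P X Q Y f) \<bullet>\<^bsub>D\<^esub> (\<iota>\<^bsub>D\<^esub> (OMap F A) \<boxtimes>\<^bsub>D\<^esub> \<mu> Q Y)"
  using assms tconj_tten[of "\<iota>\<^bsub>C\<^esub> A" f A A "P \<otimes>\<^bsub>C\<^esub> X" "Q \<otimes>\<^bsub>C\<^esub> Y"]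
  by (simp add: tconj_def[of C D F P] flip: D.whisker)

lemma tconj_\<alpha>:
  assumes "X \<in> Obj C" "Y \<in> Obj C" "Z \<in> Obj C"
  shows "(\<mu> X Y \<boxtimes>\<^bsub>D\<^esub> \<iota>\<^bsub>D\<^esub> (OMap F Z)) \<bullet>\<^bsub>D\<^esub> tconj C D F (X \<otimes>\<^bsub>C\<^esub> Y) Z X (Y \<otimes>\<^bsub>C\<^esub> Z) (\<alpha>\<^bsub>C\<^esub> X Y Z)
    = \<alpha>\<^bsub>D\<^esub> (OMap F X) (OMap F Y) (OMap F Z) \<bullet>\<^bsub>D\<^esub> (\<iota>\<^bsub>D\<^esub> (OMap F X) \<boxtimes>\<^bsub>D\<^esub> \<mu> Y Z)"
  using assms mu_assoc[OF assms, THEN D.tcomp_reassoc] by (simp add: tconj_def)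

lemma tconj_\<beta>:
  assumes "X \<in> Obj C" "Y \<in> Obj C" "Z \<in> Obj C"
  shows "(\<iota>\<^bsub>D\<^esub> (OMap F X) \<boxtimes>\<^bsub>D\<^esub> \<mu> Y Z) \<bullet>\<^bsub>D\<^esub> tconj C D F X (Y \<otimes>\<^bsub>C\<^esub> Z) (X \<otimes>\<^bsub>C\<^esub> Y) Z (\<beta>\<^bsub>C\<^esub> X Y Z)
    = \<beta>\<^bsub>D\<^esub> (OMap F X) (OMap F Y) (OMap F Z) \<bullet>\<^bsub>D\<^esub> (\<mu> X Y \<boxtimes>\<^bsub>D\<^esub> \<iota>\<^bsub>D\<^esub> (OMap F Z))"
proof -
  let ?t = "tconj C D F (X \<otimes>\<^bsub>C\<^esub> Y) Z X (Y \<otimes>\<^bsub>C\<^esub> Z) (\<alpha>\<^bsub>C\<^esub> X Y Z)"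
  let ?t' = "tconj C D F X (Y \<otimes>\<^bsub>C\<^esub> Z) (X \<otimes>\<^bsub>C\<^esub> Y) Z (\<beta>\<^bsub>C\<^esub> X Y Z)"
  have t: "?t \<bullet>\<^bsub>D\<^esub> ?t' = \<iota>\<^bsub>D\<^esub> (OMap F (X \<otimes>\<^bsub>C\<^esub> Y) \<otimes>\<^bsub>D\<^esub> OMap F Z)"
    using assms by (simp flip: tconj_comp)
  have "\<beta>\<^bsub>D\<^esub> (OMap F X) (OMap F Y) (OMap F Z) \<bullet>\<^bsub>D\<^esub> ((\<mu> X Y \<boxtimes>\<^bsub>D\<^esub> \<iota>\<^bsub>D\<^esub> (OMap F Z)) \<bullet>\<^bsub>D\<^esub> ?t) \<bullet>\<^bsub>D\<^esub> ?t'
    = \<beta>\<^bsub>D\<^esub> (OMap F X) (OMap F Y) (OMap F Z) \<bullet>\<^bsub>D\<^esub> (\<mu> X Y \<boxtimes>\<^bsub>D\<^esub> \<iota>\<^bsub>D\<^esub> (OMap F Z))"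
    using assms t by simp
  then show ?thesis unfolding tconj_\<alpha>[OF assms] using assms by simp
qed

lemma tconj_ext:
  assumes [simp]: "ok C f" "src f = P \<otimes>\<^bsub>C\<^esub> X" "tgt f = Q \<otimes>\<^bsub>C\<^esub> Y"
    "P \<in> Obj C" "X \<in> Obj C" "Q \<in> Obj C" "Y \<in> Obj C" "Z \<in> Obj C"
  shows "(\<iota>\<^bsub>D\<^esub> (OMap F P) \<boxtimes>\<^bsub>D\<^esub> \<mu> X Z) \<bullet>\<^bsub>D\<^esub> tconj C D F P (X \<otimes>\<^bsub>C\<^esub> Z) Q (Y \<otimes>\<^bsub>C\<^esub> Z) (ext C P X Q Y Z f)
    = ext D (OMap F P) (OMap F X) (OMap F Q) (OMap F Y) (OMap F Z) (tconj C D F P X Q Y f)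
      \<bullet>\<^bsub>D\<^esub> (\<iota>\<^bsub>D\<^esub> (OMap F Q) \<boxtimes>\<^bsub>D\<^esub> \<mu> Y Z)"
proof -
  have "tconj C D F P (X \<otimes>\<^bsub>C\<^esub> Z) Q (Y \<otimes>\<^bsub>C\<^esub> Z) (ext C P X Q Y Z f)
    = tconj C D F P (X \<otimes>\<^bsub>C\<^esub> Z) (P \<otimes>\<^bsub>C\<^esub> X) Z (\<beta>\<^bsub>C\<^esub> P X Z) \<bullet>\<^bsub>D\<^esub> (\<Phi> f \<boxtimes>\<^bsub>D\<^esub> \<iota>\<^bsub>D\<^esub> (OMap F Z))
      \<bullet>\<^bsub>D\<^esub> tconj C D F (Q \<otimes>\<^bsub>C\<^esub> Y) Z Q (Y \<otimes>\<^bsub>C\<^esub> Z) (\<alpha>\<^bsub>C\<^esub> Q Y Z)"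
    by (simp add: ext_def tconj_tten tconj_comp[of _ P _ "P \<otimes>\<^bsub>C\<^esub> X" Z] tconj_comp[of _
        "P \<otimes>\<^bsub>C\<^esub> X" Z "Q \<otimes>\<^bsub>C\<^esub> Y" Z])
  moreover have "(\<mu> P X \<boxtimes>\<^bsub>D\<^esub> \<iota>\<^bsub>D\<^esub> (OMap F Z)) \<bullet>\<^bsub>D\<^esub> (\<Phi> f \<boxtimes>\<^bsub>D\<^esub> \<iota>\<^bsub>D\<^esub> (OMap F Z))
    = (tconj C D F P X Q Y f \<boxtimes>\<^bsub>D\<^esub> \<iota>\<^bsub>D\<^esub> (OMap F Z)) \<bullet>\<^bsub>D\<^esub> (\<mu> Q Y \<boxtimes>\<^bsub>D\<^esub> \<iota>\<^bsub>D\<^esub> (OMap F Z))"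
    by (simp add: tconj_def flip: D.whisker)
  note this[THEN D.tcomp_reassoc]
  ultimately show ?thesis
    using tconj_\<beta>[of P X Z, THEN D.tcomp_reassoc] by (simp add: tconj_\<alpha> ext_def[of D])
qed

lemma tconj_ins:
  assumes [simp]: "ok C f" "src f = P \<otimes>\<^bsub>C\<^esub> X" "tgt f = Q \<otimes>\<^bsub>C\<^esub> Y"
    "P \<in> Obj C" "X \<in> Obj C" "Q \<in> Obj C" "Y \<in> Obj C" "A \<in> Obj C"
  shows "(\<iota>\<^bsub>D\<^esub> (OMap F P) \<boxtimes>\<^bsub>D\<^esub> \<mu> A X) \<bullet>\<^bsub>D\<^esub> tconj C D F P (A \<otimes>\<^bsub>C\<^esub> X) Q (A \<otimes>\<^bsub>C\<^esub> Y) (ins C P X Q Y A f)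
    = ins D (OMap F P) (OMap F X) (OMap F Q) (OMap F Y) (OMap F A) (tconj C D F P X Q Y f)
      \<bullet>\<^bsub>D\<^esub> (\<iota>\<^bsub>D\<^esub> (OMap F Q) \<boxtimes>\<^bsub>D\<^esub> \<mu> A Y)"
proof -
  have 1: "(\<iota>\<^bsub>D\<^esub> (OMap F P) \<boxtimes>\<^bsub>D\<^esub> \<mu> A X) \<bullet>\<^bsub>D\<^esub> (\<iota>\<^bsub>D\<^esub> (OMap F P) \<boxtimes>\<^bsub>D\<^esub> \<Phi> (\<sigma>\<^bsub>C\<^esub> A X))
    = (\<iota>\<^bsub>D\<^esub> (OMap F P) \<boxtimes>\<^bsub>D\<^esub> \<sigma>\<^bsub>D\<^esub> (OMap F A) (OMap F X)) \<bullet>\<^bsub>D\<^esub> (\<iota>\<^bsub>D\<^esub> (OMap F P) \<boxtimes>\<^bsub>D\<^esub> \<mu> X A)"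
    "(\<iota>\<^bsub>D\<^esub> (OMap F Q) \<boxtimes>\<^bsub>D\<^esub> \<mu> Y A) \<bullet>\<^bsub>D\<^esub> (\<iota>\<^bsub>D\<^esub> (OMap F Q) \<boxtimes>\<^bsub>D\<^esub> \<Phi> (\<sigma>\<^bsub>C\<^esub> Y A))
    = (\<iota>\<^bsub>D\<^esub> (OMap F Q) \<boxtimes>\<^bsub>D\<^esub> \<sigma>\<^bsub>D\<^esub> (OMap F Y) (OMap F A)) \<bullet>\<^bsub>D\<^esub> (\<iota>\<^bsub>D\<^esub> (OMap F Q) \<boxtimes>\<^bsub>D\<^esub> \<mu> A Y)"
    by (simp_all add: mu_sym flip: D.whisker)
  have "tconj C D F P (A \<otimes>\<^bsub>C\<^esub> X) Q (A \<otimes>\<^bsub>C\<^esub> Y) (ins C P X Q Y A f)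
    = (\<iota>\<^bsub>D\<^esub> (OMap F P) \<boxtimes>\<^bsub>D\<^esub> \<Phi> (\<sigma>\<^bsub>C\<^esub> A X))
      \<bullet>\<^bsub>D\<^esub> tconj C D F P (X \<otimes>\<^bsub>C\<^esub> A) Q (Y \<otimes>\<^bsub>C\<^esub> A) (ext C P X Q Y A f)
          \<bullet>\<^bsub>D\<^esub> (\<iota>\<^bsub>D\<^esub> (OMap F Q) \<boxtimes>\<^bsub>D\<^esub> \<Phi> (\<sigma>\<^bsub>C\<^esub> Y A))"
    by (simp add: ins_def tconj_tten tconj_comp[of _ P _ P "X \<otimes>\<^bsub>C\<^esub> A"] tconj_comp[of _ P
        "X \<otimes>\<^bsub>C\<^esub> A" Q "Y \<otimes>\<^bsub>C\<^esub> A"])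
  then show ?thesis
    using 1(2) 1(1)[THEN D.tcomp_reassoc] tconj_ext[of f P X Q Y A, THEN D.tcomp_reassoc] by
        (simp add: ins_def[of D])
qed

text \<open>A monoidal functor respects composition of bodies up to its structure maps on the two
  states. For classes that discrepancy is a slide along \<open>\<mu>\<close>.\<close>

lemma tconj_star:
  assumes [simp]: "ok C f" "src f = P \<otimes>\<^bsub>C\<^esub> X" "tgt f = Q \<otimes>\<^bsub>C\<^esub> Y"
    "P \<in> Obj C" "X \<in> Obj C" "Q \<in> Obj C" "Y \<in> Obj C"
    "ok C g" "src g = P' \<otimes>\<^bsub>C\<^esub> Y" "tgt g = Q' \<otimes>\<^bsub>C\<^esub> Z" "P' \<in> Obj C" "Q' \<in> Obj C" "Z \<in> Obj C"
  shows "(\<mu> P P' \<boxtimes>\<^bsub>D\<^esub> \<iota>\<^bsub>D\<^esub> (OMap F X)) \<bullet>\<^bsub>D\<^esub> tconj C D F (P \<otimes>\<^bsub>C\<^esub> P') X (Q \<otimes>\<^bsub>C\<^esub> Q') Z (star C P X Q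
      Y P' Q' Z f g)
    = star D (OMap F P) (OMap F X) (OMap F Q) (OMap F Y) (OMap F P') (OMap F Q') (OMap F Z)
        (tconj C D F P X Q Y f) (tconj C D F P' Y Q' Z g) \<bullet>\<^bsub>D\<^esub> (\<mu> Q Q' \<boxtimes>\<^bsub>D\<^esub> \<iota>\<^bsub>D\<^esub> (OMap F Z))"
proof -
  have "tconj C D F (P \<otimes>\<^bsub>C\<^esub> P') X (Q \<otimes>\<^bsub>C\<^esub> Q') Z (star C P X Q Y P' Q' Z f g)
    = tconj C D F (P \<otimes>\<^bsub>C\<^esub> P') X P (P' \<otimes>\<^bsub>C\<^esub> X) (\<alpha>\<^bsub>C\<^esub> P P' X)
    \<bullet>\<^bsub>D\<^esub> tconj C D F P (P' \<otimes>\<^bsub>C\<^esub> X) Q (P' \<otimes>\<^bsub>C\<^esub> Y) (ins C P X Q Y P' f)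
    \<bullet>\<^bsub>D\<^esub> tconj C D F Q (P' \<otimes>\<^bsub>C\<^esub> Y) Q (Q' \<otimes>\<^bsub>C\<^esub> Z) (\<iota>\<^bsub>C\<^esub> Q \<boxtimes>\<^bsub>C\<^esub> g)
    \<bullet>\<^bsub>D\<^esub> tconj C D F Q (Q' \<otimes>\<^bsub>C\<^esub> Z) (Q \<otimes>\<^bsub>C\<^esub> Q') Z (\<beta>\<^bsub>C\<^esub> Q Q' Z)"
    by (simp add: star_def tconj_comp[of _ "P \<otimes>\<^bsub>C\<^esub> P'" X P "P' \<otimes>\<^bsub>C\<^esub> X"] tconj_comp[of _ P
        "P' \<otimes>\<^bsub>C\<^esub> X" Q "P' \<otimes>\<^bsub>C\<^esub> Y"]
      tconj_comp[of _ Q "P' \<otimes>\<^bsub>C\<^esub> Y" Q "Q' \<otimes>\<^bsub>C\<^esub> Z"])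
  then show ?thesis
    using tconj_\<alpha>[of P P' X, THEN D.tcomp_reassoc] tconj_ins[of f P X Q Y P', THEN D.tcomp_reassoc]
      tconj_whisker_left[of g P' Y Q' Z Q, THEN D.tcomp_reassoc] tconj_\<beta>[of Q Q' Z]
    by (simp add: star_def[of D])
qed

end

section \<open>The category of stateful morphisms\<close>

definition stateful :: "('o, 'm, 'z) smc_scheme \<Rightarrow> ('o, 'm, 'o, 'm) mfun \<Rightarrow> 'o \<Rightarrow> 'o \<Rightarrow> 'o \<Rightarrow> ('o, 'm)
    typed \<Rightarrow> bool" where
  "stateful D F X Y S t \<longleftrightarrow> X \<in> Obj D \<and> Y \<in> Obj D \<and> S \<in> Obj D \<and>
    ok D t \<and> src t = OMap F S \<otimes>\<^bsub>D\<^esub> X \<and> tgt t = S \<otimes>\<^bsub>D\<^esub> Y"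

type_synonym ('o, 'm) starr = "'o \<times> 'o \<times> ('o \<times> 'm) set"

text \<open>The endpoints are stored with the class: since \<open>\<otimes>\<close> need not be
  injective on objects, \<open>X\<close> and \<open>Y\<close> cannot be recovered from arrows
  between tensor products.\<close>

definition cls :: "('o, 'm, 'z) smc_scheme \<Rightarrow> ('o, 'm, 'o, 'm) mfun \<Rightarrow> 'o \<Rightarrow> 'o \<Rightarrow> 'o \<Rightarrow> ('o, 'm) typed \<Rightarrow>
    ('o, 'm) starr" where
  "cls D F X Y S t = (X, Y, St_rel D F X Y `` {(S, raw t)})"

text \<open>
  The choice of representative is harmless only for \<open>G\<close> constant along the generating steps
  (\<open>lift_cls\<close> below).
\<close>

definition lift :: "('o, 'm, 'z) smc_scheme \<Rightarrow> ('o, 'm, 'o, 'm) mfun \<Rightarrow>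
    ('o \<Rightarrow> 'o \<Rightarrow> 'o \<Rightarrow> ('o, 'm) typed \<Rightarrow> 'c) \<Rightarrow> ('o, 'm) starr \<Rightarrow> 'c" where
  "lift D F G e = (case SOME (S, t). stateful D F (fst e) (fst (snd e)) S t \<and> e
      = cls D F (fst e) (fst (snd e)) S t
    of (S, t) \<Rightarrow> G (fst e) (fst (snd e)) S t)"

text \<open>The state of the composite arrives as \<open>F (S \<otimes> T)\<close> while
  \<open>star\<close> expects \<open>F S \<otimes> F T\<close>; hence the inverse structure map in
  front.\<close>

definition scomp :: "('o, 'm, 'z) smc_scheme \<Rightarrow> ('o, 'm, 'o, 'm) mfun \<Rightarrow>
    ('o, 'm) starr \<Rightarrow> ('o, 'm) starr \<Rightarrow> ('o, 'm) starr" where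
  "scomp D F d e = lift D F (\<lambda>X Y S f. lift D F (\<lambda>Y' Z T g. cls D F X Z (S \<otimes>\<^bsub>D\<^esub> T)
     ((tinv D (tmu D D F S T) \<boxtimes>\<^bsub>D\<^esub> \<iota>\<^bsub>D\<^esub> X) \<bullet>\<^bsub>D\<^esub>
       star D (OMap F S) X S Y (OMap F T) T Z f g)) e) d"

definition sext :: "('o, 'm, 'z) smc_scheme \<Rightarrow> ('o, 'm, 'o, 'm) mfun \<Rightarrow> 'o \<Rightarrow>
    ('o, 'm) starr \<Rightarrow> ('o, 'm) starr" where
  "sext D F Z e = lift D F (\<lambda>X Y S f. cls D F (X \<otimes>\<^bsub>D\<^esub> Z) (Y \<otimes>\<^bsub>D\<^esub> Z) S (ext D (OMap F S) X S Y Z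
      f)) e"

definition sins :: "('o, 'm, 'z) smc_scheme \<Rightarrow> ('o, 'm, 'o, 'm) mfun \<Rightarrow> 'o \<Rightarrow>
    ('o, 'm) starr \<Rightarrow> ('o, 'm) starr" where
  "sins D F A e = lift D F (\<lambda>X Y S f. cls D F (A \<otimes>\<^bsub>D\<^esub> X) (A \<otimes>\<^bsub>D\<^esub> Y) S (ins D (OMap F S) X S Y A
      f)) e"

text \<open>One of two possible orders is chosen: \<open>d\<close> acts before \<open>e\<close>. The
  interchange law for whiskerings makes the other order equal.\<close>

definition sten :: "('o, 'm, 'z) smc_scheme \<Rightarrow> ('o, 'm, 'o, 'm) mfun \<Rightarrow>
    ('o, 'm) starr \<Rightarrow> ('o, 'm) starr \<Rightarrow> ('o, 'm) starr" where
  "sten D F d e = scomp D F (sext D F (fst e) d) (sins D F (fst (snd d)) e)"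

text \<open>The trivial state arrives as \<open>F I\<close> and leaves as \<open>I\<close>, so the
  inverse of the unit map acts on it.\<close>

definition spure :: "('o, 'm, 'z) smc_scheme \<Rightarrow> ('o, 'm, 'o, 'm) mfun \<Rightarrow> ('o, 'm) typed \<Rightarrow> ('o, 'm)
    starr" where
  "spure D F t = cls D F (src t) (tgt t) (Unit D) (tinv D (teps D D F) \<boxtimes>\<^bsub>D\<^esub> t)"

text \<open>No loop is formed: the wires \<open>F S\<close> and \<open>S\<close> are merely declared
  to be state, placed after the state \<open>T\<close> already present.\<close>

definition sfbk :: "('o, 'm, 'z) smc_scheme \<Rightarrow> ('o, 'm, 'o, 'm) mfun \<Rightarrow> 'o \<Rightarrow> 'o \<Rightarrow> 'o \<Rightarrow>
    ('o, 'm) starr \<Rightarrow> ('o, 'm) starr" where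
  "sfbk D F S X Y e = lift D F (\<lambda>_ _ T g. cls D F X Y (T \<otimes>\<^bsub>D\<^esub> S)
     ((tinv D (tmu D D F T S) \<boxtimes>\<^bsub>D\<^esub> \<iota>\<^bsub>D\<^esub> X) \<bullet>\<^bsub>D\<^esub> \<alpha>\<^bsub>D\<^esub> (OMap F T) (OMap F S) X
       \<bullet>\<^bsub>D\<^esub> g \<bullet>\<^bsub>D\<^esub> \<beta>\<^bsub>D\<^esub> T S Y)) e"

definition sfun :: "('o, 'm, 'y) smc_scheme \<Rightarrow> ('o, 'm, 'o, 'm) mfun \<Rightarrow>
    ('p, 'q, 'z) smc_scheme \<Rightarrow> ('p, 'q, 'p, 'q) mfun \<Rightarrow> ('o, 'm, 'p, 'q) mfun \<Rightarrow>
    ('o, ('o, 'm) starr, 'p, ('p, 'q) starr) mfun" where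
  "sfun D F D' F' N =
    \<lparr>OMap = OMap N,
     AMap = lift D F (\<lambda>X Y S f. cls D' F' (OMap N X) (OMap N Y) (OMap N S) (tconj D D' N (OMap F
         S) X S Y f)),
     UnitMap = spure D' F' (teps D D' N),
     TenMap = (\<lambda>X Y. spure D' F' (tmu D D' N X Y))\<rparr>"

definition scat :: "('o, 'm, 'z) smc_scheme \<Rightarrow> ('o, 'm, 'o, 'm) mfun \<Rightarrow> ('o, ('o, 'm) starr) fbc"
    where
  "scat D F =
    \<lparr>Obj = Obj D,
     Arr = {(X, Y, c). X \<in> Obj D \<and> Y \<in> Obj D \<and> c \<in> St D F X Y},
     Dom = fst,
     Cod = (\<lambda>e. fst (snd e)),
     Id = (\<lambda>X. spure D F (\<iota>\<^bsub>D\<^esub> X)),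
     Comp = scomp D F,
     Unit = Unit D,
     TenO = TenO D,
     TenA = sten D F,
     Assoc = (\<lambda>X Y Z. spure D F (\<alpha>\<^bsub>D\<^esub> X Y Z)),
     Lunit = (\<lambda>X. spure D F (\<l>\<^bsub>D\<^esub> X)),
     Runit = (\<lambda>X. spure D F (\<r>\<^bsub>D\<^esub> X)),
     Sym = (\<lambda>X Y. spure D F (\<sigma>\<^bsub>D\<^esub> X Y)),
     Endo = sfun D F D F F,
     Fbk = sfbk D F\<rparr>"

context symmetric_monoidal_category
begin

text \<open>Together with \<open>star_natural_right\<close> this makes composition independent of
  representatives, and it draws structure maps on the states out of \<open>star\<close>.\<close>

lemma star_natural_left:
  assumes [simp]: "ok C f" "src f = P \<otimes> X" "tgt f = Q \<otimes> Y" "P \<in> Obj C" "X \<in> Obj C" "Q \<in> Obj C"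
      "Y \<in> Obj C"
    "ok C g" "src g = P' \<otimes> Y" "tgt g = Q' \<otimes> Z" "P' \<in> Obj C" "Q' \<in> Obj C" "Z \<in> Obj C"
    "ok C p" "src p = P0" "tgt p = P" "ok C q" "src q = Q" "tgt q = Q0"
  shows "star C P0 X Q0 Y P' Q' Z ((p \<boxtimes> \<iota> X) \<bullet> f \<bullet> (q \<boxtimes> \<iota> Y)) g
    = ((p \<boxtimes> \<iota> P') \<boxtimes> \<iota> X) \<bullet> star C P X Q Y P' Q' Z f g \<bullet> ((q \<boxtimes> \<iota> Q') \<boxtimes> \<iota> Z)"
proof -
  have o [simp]: "P0 \<in> Obj C" "Q0 \<in> Obj C" using ok_obj(1)[of p] ok_obj(2)[of q] by simp_all
  have "(q \<boxtimes> \<iota> (P' \<otimes> Y)) \<bullet> (\<iota> Q0 \<boxtimes> g) = (\<iota> Q \<boxtimes> g) \<bullet> (q \<boxtimes> \<iota> (Q' \<otimes> Z))"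
    by (simp add: interchange)
  from this[THEN tcomp_reassoc] show ?thesis
    by (simp add: star_def ins_natural[of f P X Q Y] \<alpha>_natural_whisker[THEN tcomp_reassoc]
        \<beta>_natural_whisker)
qed

lemma star_natural_right:
  assumes [simp]: "ok C f" "src f = P \<otimes> X" "tgt f = Q \<otimes> Y" "P \<in> Obj C" "X \<in> Obj C" "Q \<in> Obj C"
      "Y \<in> Obj C"
    "ok C g" "src g = P' \<otimes> Y" "tgt g = Q' \<otimes> Z" "P' \<in> Obj C" "Q' \<in> Obj C" "Z \<in> Obj C"
    "ok C p" "src p = P0" "tgt p = P'" "ok C q" "src q = Q'" "tgt q = Q0"
  shows "star C P X Q Y P0 Q0 Z f ((p \<boxtimes> \<iota> Y) \<bullet> g \<bullet> (q \<boxtimes> \<iota> Z))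
    = ((\<iota> P \<boxtimes> p) \<boxtimes> \<iota> X) \<bullet> star C P X Q Y P' Q' Z f g \<bullet> ((\<iota> Q \<boxtimes> q) \<boxtimes> \<iota> Z)"
proof -
  have o [simp]: "P0 \<in> Obj C" "Q0 \<in> Obj C" using ok_obj(1)[of p] ok_obj(2)[of q] by simp_all
  show ?thesis
    using ins_param[of f P X Q Y p P0 P', THEN tcomp_reassoc]
    by (simp add: star_def whisker \<alpha>_natural_whisker[THEN tcomp_reassoc] \<beta>_natural_whisker)
qed

end

section \<open>Classes of bodies under sliding, and operations defined on representatives\<close>

locale monoidal_endofunctor = symmetric_monoidal_category D + symmetric_monoidal_functor D D F
  for D :: "('o, 'm, 'z) smc_scheme" (structure) and F :: "('o, 'm, 'o, 'm) mfun"
begin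

abbreviation "cl \<equiv> cls D F"
abbreviation "sf \<equiv> stateful D F"

lemma statefulD:
  assumes "sf X Y S t"
  shows "X \<in> Obj D" "Y \<in> Obj D" "S \<in> Obj D" "ok D t" "src t = OMap F S \<otimes> X" "tgt t = S \<otimes> Y"
  using assms by (auto simp: stateful_def)

lemma stateful_carrier: "sf X Y S t \<Longrightarrow> (S, raw t) \<in> St_carrier D F X Y"
  using raw_hom[of D t] by (auto simp: stateful_def St_carrier_def)

lemma equiv_St_rel: "equiv (St_carrier D F X Y) (St_rel D F X Y)"
  unfolding St_rel_def
  by (intro equivI refl_onI symI transI) (auto intro: equivclp_sym equivclp_trans)

lemma cls_eq_iff:
  assumes "sf X Y S f" "sf X Y T g"
  shows "cl X Y S f = cl X Y T g \<longleftrightarrow> equivclp (St_step D F X Y) (S, raw f) (T, raw g)"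
  using eq_equiv_class_iff[OF equiv_St_rel stateful_carrier[OF assms(1)] stateful_carrier[OF
      assms(2)]]
    stateful_carrier[OF assms(1)] stateful_carrier[OF assms(2)]
  by (simp add: cls_def St_rel_def)

lemma slide:
  assumes "X \<in> Obj D" "Y \<in> Obj D" "ok D r" "src r = S" "tgt r = T" "ok D h" "src h = OMap F T \<otimes> X"
      "tgt h = S \<otimes> Y"
  shows "cl X Y S ((\<Phi> r \<boxtimes> \<iota> X) \<bullet> h) = cl X Y T (h \<bullet> (r \<boxtimes> \<iota> Y))"
proof -
  have o: "S \<in> Obj D" "T \<in> Obj D" using assms ok_obj by auto
  have "St_step D F X Y (S, raw ((\<Phi> r \<boxtimes> \<iota> X) \<bullet> h)) (T, raw (h \<bullet> (r \<boxtimes> \<iota> Y)))"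
    unfolding St_step_def using assms o raw_hom[of D r] raw_hom[of D h]
    by (intro bexI[of _ S] bexI[of _ T] bexI[of _ "raw r"] bexI[of _ "raw h"])
      (auto simp: raw_comp raw_ten raw_tmap raw_id)
  then show ?thesis
    using assms o by (subst cls_eq_iff) (auto simp: stateful_def)
qed

text \<open>A generating step needs a common factor \<open>h\<close> of both bodies. For invertible
  \<open>r\<close> it always exists, namely \<open>g\<close> followed by the inverse of
  \<open>r\<close> on the state, so a commuting square suffices. Coherence laws for classes are
  proved in this way.\<close>

lemma slide_iso:
  assumes "sf X Y S f" "sf X Y T g" "tiso D r" "src r = S" "tgt r = T"
    and "(\<Phi> r \<boxtimes> \<iota> X) \<bullet> g = f \<bullet> (r \<boxtimes> \<iota> Y)"
  shows "cl X Y S f = cl X Y T g"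
proof -
  note [simp] = statefulD[OF assms(1)] statefulD[OF assms(2)] assms(3-5) tiso_ok[OF assms(3)]
      whisker_cancel
  have "f = (\<Phi> r \<boxtimes> \<iota> X) \<bullet> (g \<bullet> (tinv D r \<boxtimes> \<iota> Y))"
    using assms(6)[THEN tcomp_reassoc, of "tinv D r \<boxtimes> \<iota> Y"] by simp
  then have "cl X Y S f = cl X Y T ((g \<bullet> (tinv D r \<boxtimes> \<iota> Y)) \<bullet> (r \<boxtimes> \<iota> Y))"
    using slide[of X Y r S T "g \<bullet> (tinv D r \<boxtimes> \<iota> Y)"] by simp
  then show ?thesis by simp
qed

definition invariant :: "('o \<Rightarrow> ('o, 'm) typed \<Rightarrow> 'c) \<Rightarrow> 'o \<Rightarrow> 'o \<Rightarrow> bool" where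
  "invariant G X Y \<longleftrightarrow> (\<forall>r h. ok D r \<longrightarrow> ok D h \<longrightarrow> src h = OMap F (tgt r) \<otimes> X \<longrightarrow> tgt h = src r \<otimes> Y \<longrightarrow>
    G (src r) ((\<Phi> r \<boxtimes> \<iota> X) \<bullet> h) = G (tgt r) (h \<bullet> (r \<boxtimes> \<iota> Y)))"

lemma invariant_cls_eq:
  assumes "invariant G X Y" "sf X Y S f" "sf X Y T g" "cl X Y S f = cl X Y T g"
  shows "G S f = G T g"
proof -
  \<comment> \<open>The generating steps relate untyped pairs, and a chain between two
    representatives runs through such pairs. \<open>G'\<close> is \<open>G\<close> read on
    them.\<close>
  define G' where "G' = (\<lambda>(S, m). G S (mk D (OMap F S \<otimes> X) (S \<otimes> Y) m))"
  have XY: "X \<in> Obj D" "Y \<in> Obj D" using statefulD[OF assms(2)] by simp_all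
  have step: "G' p = G' q" if st: "St_step D F X Y p q" for p q
  proof -
    obtain S T r h where *: "S \<in> Obj D" "T \<in> Obj D" "r \<in> hom D S T"
        "h \<in> hom D (OMap F T \<otimes> X) (S \<otimes> Y)"
      "p = (S, (AMap F r \<odot> Id D X) \<Zcomp> h)" "q = (T, h \<Zcomp> (r \<odot> Id D Y))"
      using st unfolding St_step_def by blast
    let ?r = "mk D S T r" and ?h = "mk D (OMap F T \<otimes> X) (S \<otimes> Y) h"
    have o [simp]: "ok D ?r" "ok D ?h" "raw ?r = r" "raw ?h = h" using * by
        (simp_all add: ok_mk raw_mk)
    have "mk D (OMap F S \<otimes> X) (S \<otimes> Y) ((AMap F r \<odot> Id D X) \<Zcomp> h) = (\<Phi> ?r \<boxtimes> \<iota> X) \<bullet> ?h"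
      using XY * mk_raw[of D "(\<Phi> ?r \<boxtimes> \<iota> X) \<bullet> ?h"] by (simp add: raw_comp raw_ten raw_tmap raw_id)
    moreover have "mk D (OMap F T \<otimes> X) (T \<otimes> Y) (h \<Zcomp> (r \<odot> Id D Y)) = ?h \<bullet> (?r \<boxtimes> \<iota> Y)"
      using XY * mk_raw[of D "?h \<bullet> (?r \<boxtimes> \<iota> Y)"] by (simp add: raw_comp raw_ten raw_tmap raw_id)
    ultimately show ?thesis
      using assms(1)[unfolded invariant_def, rule_format, of ?r ?h] * by (simp add: G'_def)
  qed
  have "equivclp (St_step D F X Y) (S, raw f) (T, raw g)" using assms cls_eq_iff by blast
  then have "G' (S, raw f) = G' (T, raw g)"
    by (induction rule: equivclp_induct) (auto dest: step)
  then show ?thesis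
    using mk_raw[of D f] mk_raw[of D g] statefulD[OF assms(2)] statefulD[OF assms(3)] by
        (simp add: G'_def)
qed

lemma lift_cls:
  assumes "sf X Y S f" "invariant (G X Y) X Y"
  shows "lift D F G (cl X Y S f) = G X Y S f"
proof -
  let ?P = "\<lambda>(T, t). sf X Y T t \<and> cl X Y S f = cl X Y T t"
  obtain T t where *: "(SOME p. ?P p) = (T, t)" by (cases "SOME p. ?P p")
  have "?P (SOME p. ?P p)" by (rule someI[of ?P "(S, f)"]) (simp add: assms)
  then have "sf X Y T t" "cl X Y S f = cl X Y T t" unfolding * by auto
  then have "G X Y T t = G X Y S f" using invariant_cls_eq assms by metis
  then show ?thesis
    using * by (simp add: lift_def cls_def)
qed

lemma fst_cls [simp]: "fst (cl X Y S f) = X" "fst (snd (cl X Y S f)) = Y"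
  by (simp_all add: cls_def)

abbreviation "\<mu>' S T \<equiv> tinv D (\<mu> S T)"

lemma mu_inv_natural:
  assumes "ok D f" "ok D g" "src f = X" "tgt f = X'" "src g = Y" "tgt g = Y'"
  shows "\<Phi> (f \<boxtimes> g) \<bullet> \<mu>' X' Y' = \<mu>' X Y \<bullet> (\<Phi> f \<boxtimes> \<Phi> g)"
proof -
  have o: "X \<in> Obj D" "X' \<in> Obj D" "Y \<in> Obj D" "Y' \<in> Obj D" using assms ok_obj by auto
  have "\<mu>' X Y \<bullet> ((\<Phi> f \<boxtimes> \<Phi> g) \<bullet> \<mu> X' Y') \<bullet> \<mu>' X' Y' = \<mu>' X Y \<bullet> (\<Phi> f \<boxtimes> \<Phi> g)"
    using assms o by simp
  then show ?thesis unfolding mu_natural[OF assms] using assms o by simp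
qed

lemma mu_inv_natural_whisker:
  assumes "ok D f" "src f = X" "tgt f = X'" "Y \<in> Obj D" "Z \<in> Obj D"
  shows "(\<Phi> (f \<boxtimes> \<iota> Y) \<boxtimes> \<iota> Z) \<bullet> (\<mu>' X' Y \<boxtimes> \<iota> Z) = (\<mu>' X Y \<boxtimes> \<iota> Z) \<bullet> ((\<Phi> f \<boxtimes> \<iota> (OMap F Y)) \<boxtimes> \<iota> Z)"
    "(\<Phi> (\<iota> Y \<boxtimes> f) \<boxtimes> \<iota> Z) \<bullet> (\<mu>' Y X' \<boxtimes> \<iota> Z) = (\<mu>' Y X \<boxtimes> \<iota> Z) \<bullet> ((\<iota> (OMap F Y) \<boxtimes> \<Phi> f) \<boxtimes> \<iota> Z)"
  using assms ok_obj[of f] mu_inv_natural[of f "\<iota> Y" X X' Y Y] mu_inv_natural[of "\<iota> Y" f Y Y X X']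
  by (simp_all flip: whisker)

lemma mu_inv_\<alpha>:
  assumes [simp]: "S \<in> Obj D" "T \<in> Obj D" "U \<in> Obj D"
  shows "\<Phi> (\<alpha> S T U) \<bullet> \<mu>' S (T \<otimes> U) \<bullet> (\<iota> (OMap F S) \<boxtimes> \<mu>' T U)
    = \<mu>' (S \<otimes> T) U \<bullet> (\<mu>' S T \<boxtimes> \<iota> (OMap F U)) \<bullet> \<alpha> (OMap F S) (OMap F T) (OMap F U)" (is ?a)
  and "\<Phi> (\<beta> S T U) \<bullet> \<mu>' (S \<otimes> T) U \<bullet> (\<mu>' S T \<boxtimes> \<iota> (OMap F U))
    = \<mu>' S (T \<otimes> U) \<bullet> (\<iota> (OMap F S) \<boxtimes> \<mu>' T U) \<bullet> \<beta> (OMap F S) (OMap F T) (OMap F U)" (is ?b)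
proof -
  have "\<mu>' (S \<otimes> T) U \<bullet> (\<mu>' S T \<boxtimes> \<iota> (OMap F U)) \<bullet> \<alpha> (OMap F S) (OMap F T) (OMap F U)
     = \<mu>' (S \<otimes> T) U \<bullet> (\<mu>' S T \<boxtimes> \<iota> (OMap F U)) \<bullet> (\<alpha> (OMap F S) (OMap F T) (OMap F U) \<bullet>
        (\<iota> (OMap F S) \<boxtimes> \<mu> T U) \<bullet> \<mu> S (T \<otimes> U)) \<bullet> \<mu>' S (T \<otimes> U) \<bullet> (\<iota> (OMap F S) \<boxtimes> \<mu>' T U)"
    by (simp add: whisker_cancel)
  also have "\<dots> = \<Phi> (\<alpha> S T U) \<bullet> \<mu>' S (T \<otimes> U) \<bullet> (\<iota> (OMap F S) \<boxtimes> \<mu>' T U)"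
    unfolding mu_assoc[of S T U, simplified, symmetric] by (simp add: whisker_cancel)
  finally show a: ?a ..
  have "\<Phi> (\<beta> S T U) \<bullet> \<Phi> (\<alpha> S T U) = \<iota> (OMap F (S \<otimes> (T \<otimes> U)))" by (simp flip: tmap_comp)
  from this[THEN tcomp_reassoc]
  have "\<Phi> (\<beta> S T U) \<bullet> (\<Phi> (\<alpha> S T U) \<bullet> \<mu>' S (T \<otimes> U) \<bullet> (\<iota> (OMap F S) \<boxtimes> \<mu>' T U))
      \<bullet> \<beta> (OMap F S) (OMap F T) (OMap F U)
    = \<mu>' S (T \<otimes> U) \<bullet> (\<iota> (OMap F S) \<boxtimes> \<mu>' T U) \<bullet> \<beta> (OMap F S) (OMap F T) (OMap F U)" by simp
  then show ?b unfolding a by simp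
qed

lemma mu_inv_\<sigma>:
  assumes [simp]: "S \<in> Obj D" "T \<in> Obj D"
  shows "\<Phi> (\<sigma> S T) \<bullet> \<mu>' T S = \<mu>' S T \<bullet> \<sigma> (OMap F S) (OMap F T)"
proof -
  have "\<mu>' S T \<bullet> (\<mu> S T \<bullet> \<Phi> (\<sigma> S T)) \<bullet> \<mu>' T S = \<mu>' S T \<bullet> \<sigma> (OMap F S) (OMap F T)"
    unfolding mu_sym[OF assms] by simp
  then show ?thesis by simp
qed

lemma tmap_\<r>:
  assumes [simp]: "S \<in> Obj D"
  shows "\<Phi> (\<r> S) = \<mu>' S (Unit D) \<bullet> (\<iota> (OMap F S) \<boxtimes> tinv D \<epsilon>) \<bullet> \<r> (OMap F S)"
  using whisker_cancel(6)[of \<epsilon> "OMap F S" "\<mu> S (Unit D) \<bullet> \<Phi> (\<r> S)"] mu_runit[of S] by simp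

lemma tmap_\<l>:
  assumes [simp]: "S \<in> Obj D"
  shows "\<Phi> (\<l> S) = \<mu>' (Unit D) S \<bullet> (tinv D \<epsilon> \<boxtimes> \<iota> (OMap F S)) \<bullet> \<l> (OMap F S)"
  using whisker_cancel(8)[of \<epsilon> "OMap F S" "\<mu> (Unit D) S \<bullet> \<Phi> (\<l> S)"] mu_lunit[of S] by simp

lemma stateful_comp [simp]:
  assumes "sf X Y S f" "sf Y Z T g"
  shows "sf X Z (S \<otimes> T) ((\<mu>' S T \<boxtimes> \<iota> X) \<bullet> star D (OMap F S) X S Y (OMap F T) T Z f g)"
  using assms by (simp add: stateful_def)

text \<open>Independence of the second representative is settled for an arbitrary first one
  (\<open>1\<close>), because the inner \<open>lift\<close> has to be evaluated before the outer one
  can be compared. In either argument, sliding along \<open>r\<close> becomes sliding along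
  \<open>r\<close> tensored with the other state.\<close>

lemma scomp_cls:
  assumes "sf X Y S f" "sf Y Z T g"
  shows "scomp D F (cl X Y S f) (cl Y Z T g) = cl X Z (S \<otimes> T) ((\<mu>' S T \<boxtimes> \<iota> X)
      \<bullet> star D (OMap F S) X S Y (OMap F T) T Z f g)"
proof -
  let ?G = "\<lambda>X Z S Y f T g. cl X Z (S \<otimes> T) ((\<mu>' S T \<boxtimes> \<iota> X)
      \<bullet> star D (OMap F S) X S Y (OMap F T) T Z f g)"
  have 1: "lift D F (\<lambda>Y' Z T g. ?G X Z S Y f T g) (cl Y Z T g) = ?G X Z S Y f T g" if f:
      "sf X Y S f" for S f
  proof (rule lift_cls[OF assms(2)])
    show "invariant (?G X Z S Y f) Y Z"
      unfolding invariant_def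
    proof (intro allI impI)
      fix r h assume A [simp]: "ok D r" "ok D h" "src h = OMap F (tgt r) \<otimes> Y" "tgt h = src r \<otimes> Z"
      note [simp] = statefulD[OF f] statefulD[OF assms(2)] ok_obj[of r]
      have [simp]: "star D (OMap F S) X S Y (OMap F (src r)) (src r) Z f ((\<Phi> r \<boxtimes> \<iota> Y) \<bullet> h)
          = ((\<iota> (OMap F S) \<boxtimes> \<Phi> r) \<boxtimes> \<iota> X) \<bullet> star D (OMap F S) X S Y (OMap F (tgt r)) (src r) Z f h"
        using star_natural_right[of f "OMap F S" X S Y h "OMap F (tgt r)" "src r" Z "\<Phi> r"
            "OMap F (src r)" "\<iota> (src r)" "src r"]
        by simp
      have [simp]: "star D (OMap F S) X S Y (OMap F (tgt r)) (tgt r) Z f (h \<bullet> (r \<boxtimes> \<iota> Z))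
          = star D (OMap F S) X S Y (OMap F (tgt r)) (src r) Z f h \<bullet> ((\<iota> S \<boxtimes> r) \<boxtimes> \<iota> Z)"
        using star_natural_right[of f "OMap F S" X S Y h "OMap F (tgt r)" "src r" Z
            "\<iota> (OMap F (tgt r))" "OMap F (tgt r)" "r" "tgt r"]
        by simp
      show "?G X Z S Y f (src r) ((\<Phi> r \<boxtimes> \<iota> Y) \<bullet> h) = ?G X Z S Y f (tgt r) (h \<bullet> (r \<boxtimes> \<iota> Z))"
        using slide[of X Z "\<iota> S \<boxtimes> r" "S \<otimes> src r" "S \<otimes> tgt r" "(\<mu>' S (tgt r) \<boxtimes> \<iota> X)
            \<bullet> star D (OMap F S) X S Y (OMap F (tgt r)) (src r) Z f h"]
          mu_inv_natural_whisker(2)[of r "src r" "tgt r" S X, THEN tcomp_reassoc]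
        by simp
    qed
  qed
  have "lift D F (\<lambda>X W S f. lift D F (\<lambda>Y' Z T g. ?G X Z S W f T g) (cl Y Z T g)) (cl X Y S f)
      = lift D F (\<lambda>Y' Z T g. ?G X Z S Y f T g) (cl Y Z T g)"
  proof (rule lift_cls[OF assms(1)], unfold invariant_def, intro allI impI)
    fix r h assume A [simp]: "ok D r" "ok D h" "src h = OMap F (tgt r) \<otimes> X" "tgt h = src r \<otimes> Y"
    note [simp] = statefulD[OF assms(1)] statefulD[OF assms(2)] ok_obj[of r]
    have [simp]: "star D (OMap F (src r)) X (src r) Y (OMap F T) T Z ((\<Phi> r \<boxtimes> \<iota> X) \<bullet> h) g
        = ((\<Phi> r \<boxtimes> \<iota> (OMap F T)) \<boxtimes> \<iota> X) \<bullet> star D (OMap F (tgt r)) X (src r) Y (OMap F T) T Z h g"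
      using star_natural_left[of h "OMap F (tgt r)" X "src r" Y g "OMap F T" T Z "\<Phi> r"
          "OMap F (src r)" "\<iota> (src r)" "src r"]
      by simp
    have [simp]: "star D (OMap F (tgt r)) X (tgt r) Y (OMap F T) T Z (h \<bullet> (r \<boxtimes> \<iota> Y)) g
        = star D (OMap F (tgt r)) X (src r) Y (OMap F T) T Z h g \<bullet> ((r \<boxtimes> \<iota> T) \<boxtimes> \<iota> Z)"
      using star_natural_left[of h "OMap F (tgt r)" X "src r" Y g "OMap F T" T Z
          "\<iota> (OMap F (tgt r))" "OMap F (tgt r)" "r" "tgt r"]
      by simp
    have "sf X Y (src r) ((\<Phi> r \<boxtimes> \<iota> X) \<bullet> h)" "sf X Y (tgt r) (h \<bullet> (r \<boxtimes> \<iota> Y))"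
      by (simp_all add: stateful_def)
    note [simp] = this[THEN 1]
    show "lift D F (\<lambda>Y' Z T g. ?G X Z (src r) Y ((\<Phi> r \<boxtimes> \<iota> X) \<bullet> h) T g) (cl Y Z T g)
      = lift D F (\<lambda>Y' Z T g. ?G X Z (tgt r) Y (h \<bullet> (r \<boxtimes> \<iota> Y)) T g) (cl Y Z T g)"
      using slide[of X Z "r \<boxtimes> \<iota> T" "src r \<otimes> T" "tgt r \<otimes> T" "(\<mu>' (tgt r) T \<boxtimes> \<iota> X)
          \<bullet> star D (OMap F (tgt r)) X (src r) Y (OMap F T) T Z h g"]
        mu_inv_natural_whisker(1)[of r "src r" "tgt r" T X, THEN tcomp_reassoc]
      by simp
  qed
  then show ?thesis by (simp add: scomp_def 1[OF assms(1)])
qed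

lemma stateful_ext [simp]:
    "\<lbrakk>sf X Y S f; Z \<in> Obj D\<rbrakk> \<Longrightarrow> sf (X \<otimes> Z) (Y \<otimes> Z) S (ext D (OMap F S) X S Y Z f)"
  and stateful_ins [simp]:
    "\<lbrakk>sf X Y S f; Z \<in> Obj D\<rbrakk> \<Longrightarrow> sf (Z \<otimes> X) (Z \<otimes> Y) S (ins D (OMap F S) X S Y Z f)"
  by (simp_all add: stateful_def)

lemma sext_cls:
  assumes "sf X Y S f" "Z \<in> Obj D"
  shows "sext D F Z (cl X Y S f) = cl (X \<otimes> Z) (Y \<otimes> Z) S (ext D (OMap F S) X S Y Z f)"
  unfolding sext_def
proof (rule lift_cls[OF assms(1)], unfold invariant_def, intro allI impI)
  fix r h assume A [simp]: "ok D r" "ok D h" "src h = OMap F (tgt r) \<otimes> X" "tgt h = src r \<otimes> Y"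
  note [simp] = statefulD[OF assms(1)] assms(2) ok_obj[of r]
  show "cl (X \<otimes> Z) (Y \<otimes> Z) (src r) (ext D (OMap F (src r)) X (src r) Y Z ((\<Phi> r \<boxtimes> \<iota> X) \<bullet> h))
    = cl (X \<otimes> Z) (Y \<otimes> Z) (tgt r) (ext D (OMap F (tgt r)) X (tgt r) Y Z (h \<bullet> (r \<boxtimes> \<iota> Y)))"
    using ext_natural[of h "OMap F (tgt r)" X "src r" Y Z "\<Phi> r" "\<iota> X" "\<iota> (src r)" "\<iota> Y"
        "OMap F (src r)" X "src r" Y]
      ext_natural[of h "OMap F (tgt r)" X "src r" Y Z "\<iota> (OMap F (tgt r))" "\<iota> X" r "\<iota> Y"
          "OMap F (tgt r)" X "tgt r" Y]
      slide[of "X \<otimes> Z" "Y \<otimes> Z" r "src r" "tgt r" "ext D (OMap F (tgt r)) X (src r) Y Z h"]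
    by simp
qed

lemma sins_cls:
  assumes "sf X Y S f" "Z \<in> Obj D"
  shows "sins D F Z (cl X Y S f) = cl (Z \<otimes> X) (Z \<otimes> Y) S (ins D (OMap F S) X S Y Z f)"
  unfolding sins_def
proof (rule lift_cls[OF assms(1)], unfold invariant_def, intro allI impI)
  fix r h assume A [simp]: "ok D r" "ok D h" "src h = OMap F (tgt r) \<otimes> X" "tgt h = src r \<otimes> Y"
  note [simp] = statefulD[OF assms(1)] assms(2) ok_obj[of r]
  show "cl (Z \<otimes> X) (Z \<otimes> Y) (src r) (ins D (OMap F (src r)) X (src r) Y Z ((\<Phi> r \<boxtimes> \<iota> X) \<bullet> h))
    = cl (Z \<otimes> X) (Z \<otimes> Y) (tgt r) (ins D (OMap F (tgt r)) X (tgt r) Y Z (h \<bullet> (r \<boxtimes> \<iota> Y)))"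
    using ins_natural[of h "OMap F (tgt r)" X "src r" Y Z "\<Phi> r" "\<iota> X" "\<iota> (src r)" "\<iota> Y"
        "OMap F (src r)" X "src r" Y]
      ins_natural[of h "OMap F (tgt r)" X "src r" Y Z "\<iota> (OMap F (tgt r))" "\<iota> X" r "\<iota> Y"
          "OMap F (tgt r)" X "tgt r" Y]
      slide[of "Z \<otimes> X" "Z \<otimes> Y" r "src r" "tgt r" "ins D (OMap F (tgt r)) X (src r) Y Z h"]
    by simp
qed

lemma stateful_pure [simp]: "\<lbrakk>ok D t; src t = X; tgt t = Y\<rbrakk> \<Longrightarrow> sf X Y (Unit D) (tinv D \<epsilon> \<boxtimes> t)"
  using ok_obj by (auto simp: stateful_def)

text \<open>Composition adds a unit to the state; sliding along \<open>\<l> S\<close> removes it.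
  \<open>tmap_\<l>\<close> expresses the image of \<open>\<l> S\<close> by the maps that
  \<open>star_unit_left\<close> produces.\<close>

lemma pure_comp_left:
  assumes [simp]: "sf X Y S f" "ok D u" "src u = W" "tgt u = X"
  shows "scomp D F (spure D F u) (cl X Y S f) = cl W Y S ((\<iota> (OMap F S) \<boxtimes> u) \<bullet> f)"
proof -
  have o [simp]: "W \<in> Obj D" using ok_obj[of u] by simp
  note [simp] = statefulD[OF assms(1)]
  have "scomp D F (spure D F u) (cl X Y S f) = cl W Y (Unit D \<otimes> S)
    ((\<mu>' (Unit D) S \<boxtimes> \<iota> W) \<bullet> star D (OMap F (Unit D)) W (Unit D) X (OMap F S) S Y (tinv D \<epsilon> \<boxtimes> u) f)"
    unfolding spure_def using scomp_cls[of W X "Unit D" "tinv D \<epsilon> \<boxtimes> u" Y S f] by simp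
  also have "\<dots> = cl W Y S ((\<iota> (OMap F S) \<boxtimes> u) \<bullet> f)"
  proof (rule slide_iso[where r = "\<l> S"])
    show "sf W Y (Unit D \<otimes> S) ((\<mu>' (Unit D) S \<boxtimes> \<iota> W) \<bullet> star D (OMap F (Unit D)) W (Unit D) X (OMap
        F S) S Y (tinv D \<epsilon> \<boxtimes> u) f)"
      by (rule stateful_comp) simp_all
    show "(\<Phi> (\<l> S) \<boxtimes> \<iota> W) \<bullet> (\<iota> (OMap F S) \<boxtimes> u) \<bullet> f
      = ((\<mu>' (Unit D) S \<boxtimes> \<iota> W) \<bullet> star D (OMap F (Unit D)) W (Unit D) X (OMap F S) S Y (tinv D \<epsilon> \<boxtimes>
          u) f) \<bullet> (\<l> S \<boxtimes> \<iota> Y)"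
      by (simp add: star_unit_left[of f "OMap F S" X S Y] tmap_\<l> whisker)
  qed (simp_all add: stateful_def)
  finally show ?thesis .
qed

lemma pure_comp_right:
  assumes [simp]: "sf X Y S f" "ok D v" "src v = Y" "tgt v = Z"
  shows "scomp D F (cl X Y S f) (spure D F v) = cl X Z S (f \<bullet> (\<iota> S \<boxtimes> v))"
proof -
  have o [simp]: "Z \<in> Obj D" using ok_obj[of v] by simp
  note [simp] = statefulD[OF assms(1)]
  have "scomp D F (cl X Y S f) (spure D F v) = cl X Z (S \<otimes> Unit D)
    ((\<mu>' S (Unit D) \<boxtimes> \<iota> X) \<bullet> star D (OMap F S) X S Y (OMap F (Unit D)) (Unit D) Z f (tinv D \<epsilon> \<boxtimes> v))"
    unfolding spure_def using scomp_cls[of X Y S f Z "Unit D" "tinv D \<epsilon> \<boxtimes> v"] by simp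
  also have "\<dots> = cl X Z S (f \<bullet> (\<iota> S \<boxtimes> v))"
  proof (rule slide_iso[where r = "\<r> S"])
    show "sf X Z (S \<otimes> Unit D) ((\<mu>' S (Unit D) \<boxtimes> \<iota> X) \<bullet> star D (OMap F S) X S Y (OMap F (Unit D))
        (Unit D) Z f (tinv D \<epsilon> \<boxtimes> v))"
      by (rule stateful_comp) simp_all
    show "(\<Phi> (\<r> S) \<boxtimes> \<iota> X) \<bullet> f \<bullet> (\<iota> S \<boxtimes> v)
      = ((\<mu>' S (Unit D) \<boxtimes> \<iota> X) \<bullet> star D (OMap F S) X S Y (OMap F (Unit D)) (Unit D) Z f (tinv D \<epsilon>
          \<boxtimes> v)) \<bullet> (\<r> S \<boxtimes> \<iota> Z)"
      by (simp add: star_unit_right[of f "OMap F S" X S Y] tmap_\<r> whisker)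
  qed (simp_all add: stateful_def)
  finally show ?thesis .
qed

text \<open>The two states are matched by sliding along \<open>\<alpha> S T U\<close>. On the
  incoming side, the inner structure maps of \<open>F\<close> are drawn out of \<open>star\<close>
  (\<open>1\<close>, \<open>2\<close>) and compared by monoidality of \<open>F\<close>
  (\<open>3\<close>); what remains is \<open>star_assoc\<close>.\<close>

lemma scomp_assoc:
  assumes [simp]: "sf W X S f" "sf X Y T g" "sf Y Z U h"
  shows "scomp D F (scomp D F (cl W X S f) (cl X Y T g)) (cl Y Z U h)
    = scomp D F (cl W X S f) (scomp D F (cl X Y T g) (cl Y Z U h))"
proof -
  note [simp] = statefulD[OF assms(1)] statefulD[OF assms(2)] statefulD[OF assms(3)]
  let ?fg = "star D (OMap F S) W S X (OMap F T) T Y f g"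
  let ?gh = "star D (OMap F T) X T Y (OMap F U) U Z g h"
  have fg: "sf W Y (S \<otimes> T) ((\<mu>' S T \<boxtimes> \<iota> W) \<bullet> ?fg)" and gh: "sf X Z (T \<otimes> U) ((\<mu>' T U \<boxtimes> \<iota> X) \<bullet> ?gh)"
    by simp_all
  have 1: "star D (OMap F (S \<otimes> T)) W (S \<otimes> T) Y (OMap F U) U Z ((\<mu>' S T \<boxtimes> \<iota> W) \<bullet> ?fg) h
    = ((\<mu>' S T \<boxtimes> \<iota> (OMap F U)) \<boxtimes> \<iota> W) \<bullet> star D (OMap F S \<otimes> OMap F T) W (S \<otimes> T) Y (OMap F U) U Z
        ?fg h"
    using star_natural_left[of ?fg "OMap F S \<otimes> OMap F T" W "S \<otimes> T" Y h "OMap F U" U Z "\<mu>' S T"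
        "OMap F (S \<otimes> T)" "\<iota> (S \<otimes> T)" "S \<otimes> T"]
    by simp
  have 2: "star D (OMap F S) W S X (OMap F (T \<otimes> U)) (T \<otimes> U) Z f ((\<mu>' T U \<boxtimes> \<iota> X) \<bullet> ?gh)
    = ((\<iota> (OMap F S) \<boxtimes> \<mu>' T U) \<boxtimes> \<iota> W) \<bullet> star D (OMap F S) W S X (OMap F T \<otimes> OMap F U) (T \<otimes> U) Z f
        ?gh"
    using star_natural_right[of f "OMap F S" W S X ?gh "OMap F T \<otimes> OMap F U" "T \<otimes> U" Z "\<mu>' T U"
        "OMap F (T \<otimes> U)" "\<iota> (T \<otimes> U)" "T \<otimes> U"]
    by simp
  have 3: "(\<Phi> (\<alpha> S T U) \<boxtimes> \<iota> W) \<bullet> (\<mu>' S (T \<otimes> U) \<boxtimes> \<iota> W) \<bullet> ((\<iota> (OMap F S) \<boxtimes> \<mu>' T U) \<boxtimes> \<iota> W)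
    = (\<mu>' (S \<otimes> T) U \<boxtimes> \<iota> W) \<bullet> ((\<mu>' S T \<boxtimes> \<iota> (OMap F U)) \<boxtimes> \<iota> W)
        \<bullet> (\<alpha> (OMap F S) (OMap F T) (OMap F U) \<boxtimes> \<iota> W)"
    by (simp add: mu_inv_\<alpha> flip: whisker)
  show ?thesis
    unfolding scomp_cls[OF assms(1,2)] scomp_cls[OF assms(2,3)] scomp_cls[OF fg assms(3)]
        scomp_cls[OF assms(1) gh]
  proof (rule slide_iso[where r = "\<alpha> S T U"])
    show "(\<Phi> (\<alpha> S T U) \<boxtimes> \<iota> W) \<bullet> (\<mu>' S (T \<otimes> U) \<boxtimes> \<iota> W) \<bullet>
        star D (OMap F S) W S X (OMap F (T \<otimes> U)) (T \<otimes> U) Z f ((\<mu>' T U \<boxtimes> \<iota> X) \<bullet> ?gh)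
      = ((\<mu>' (S \<otimes> T) U \<boxtimes> \<iota> W) \<bullet>
        star D (OMap F (S \<otimes> T)) W (S \<otimes> T) Y (OMap F U) U Z ((\<mu>' S T \<boxtimes> \<iota> W) \<bullet> ?fg) h)
            \<bullet> (\<alpha> S T U \<boxtimes> \<iota> Z)"
      unfolding 1 2 using 3[THEN tcomp_reassoc]
      by (simp add: star_assoc[of f "OMap F S" W S X g "OMap F T" T Y h "OMap F U" U Z, symmetric])
  qed simp_all
qed

end

text \<open>Arrows of the category of classes are not wrapped as typed arrows, so reassociation is
  not automatic for them. This lemma and \<open>comp_middle\<close> are the patterns in which it is
  used.\<close>

lemma (in category) square_paste:
  assumes "a \<in> hom C X Y" "b \<in> hom C Y Z" "a' \<in> hom C X' Y'" "b' \<in> hom C Y' Z'"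
    and "p \<in> hom C X X'" "q \<in> hom C Y Y'" "r \<in> hom C Z Z'"
    and "a \<Zcomp> q = p \<Zcomp> a'" "b \<Zcomp> r = q \<Zcomp> b'"
  shows "(a \<Zcomp> b) \<Zcomp> r = p \<Zcomp> (a' \<Zcomp> b')"
proof -
  have "(a \<Zcomp> b) \<Zcomp> r = a \<Zcomp> (q \<Zcomp> b')"
    unfolding comp_assoc[OF assms(1,2,7)] assms(9) ..
  also have "\<dots> = (p \<Zcomp> a') \<Zcomp> b'"
    unfolding comp_assoc[OF assms(1,6,4), symmetric] assms(8) ..
  also have "\<dots> = p \<Zcomp> (a' \<Zcomp> b')" by (rule comp_assoc[OF assms(5,3,4)])
  finally show ?thesis .
qed

lemma (in category) comp_middle:
  assumes "a \<in> hom C V W" "b \<in> hom C W X" "c \<in> hom C X Y" "d \<in> hom C Y Z"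
    and "c' \<in> hom C W X'" "b' \<in> hom C X' Y" "b \<Zcomp> c = c' \<Zcomp> b'"
  shows "(a \<Zcomp> b) \<Zcomp> (c \<Zcomp> d) = (a \<Zcomp> c') \<Zcomp> (b' \<Zcomp> d)"
proof -
  have "(a \<Zcomp> b) \<Zcomp> (c \<Zcomp> d) = a \<Zcomp> ((b \<Zcomp> c) \<Zcomp> d)"
    unfolding comp_assoc[OF assms(1,2) comp_hom[OF assms(3,4)]] comp_assoc[OF assms(2-4)] ..
  also have "\<dots> = (a \<Zcomp> c') \<Zcomp> (b' \<Zcomp> d)"
    unfolding assms(7) comp_assoc[OF assms(5,6,4)] comp_assoc[OF assms(1,5) comp_hom[OF
        assms(6,4)]] ..
  finally show ?thesis .
qed

lemma scat_simps [simp]: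
  "Obj (scat D F) = Obj D" "Dom (scat D F) = fst" "Cod (scat D F) = (\<lambda>e. fst (snd e))"
  "Id (scat D F) = (\<lambda>X. spure D F (\<iota>\<^bsub>D\<^esub> X))" "Comp (scat D F) = scomp D F" "Unit (scat D F)
      = Unit D"
  "TenO (scat D F) = TenO D" "TenA (scat D F) = sten D F"
  "Assoc (scat D F) = (\<lambda>X Y Z. spure D F (\<alpha>\<^bsub>D\<^esub> X Y Z))" "Lunit (scat D F)
      = (\<lambda>X. spure D F (\<l>\<^bsub>D\<^esub> X))"
  "Runit (scat D F) = (\<lambda>X. spure D F (\<r>\<^bsub>D\<^esub> X))" "Sym (scat D F) = (\<lambda>X Y. spure D F (\<sigma>\<^bsub>D\<^esub> X Y))"
  "Endo (scat D F) = sfun D F D F F" "Fbk (scat D F) = sfbk D F"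
  by (simp_all add: scat_def)

section \<open>The symmetric monoidal category of classes\<close>

context monoidal_endofunctor
begin

abbreviation "E \<equiv> scat D F"
abbreviation "J \<equiv> spure D F"

lemma cls_hom: "sf X Y S f \<Longrightarrow> cl X Y S f \<in> hom E X Y"
  using stateful_carrier[of X Y S f]
  by (auto simp: hom_def cls_def scat_def St_def stateful_def intro: quotientI)

lemma hom_cls:
  assumes "e \<in> hom E X Y"
  obtains S f where "sf X Y S f" "e = cl X Y S f"
proof -
  obtain c where e: "e = (X, Y, c)" "X \<in> Obj D" "Y \<in> Obj D" "c \<in> St D F X Y"
    using assms by (auto simp: hom_def scat_def)
  then obtain S m where *: "(S, m) \<in> St_carrier D F X Y" "c = St_rel D F X Y `` {(S, m)}"
    by (auto simp: St_def elim: quotientE)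
  let ?f = "mk D (OMap F S \<otimes> X) (S \<otimes> Y) m"
  have m: "S \<in> Obj D" "m \<in> hom D (OMap F S \<otimes> X) (S \<otimes> Y)" using * by (auto simp: St_carrier_def)
  then have "sf X Y S ?f" "e = cl X Y S ?f"
    using e * by (simp_all add: stateful_def ok_mk cls_def raw_mk)
  then show thesis by (rule that)
qed

lemma pure_hom: "\<lbrakk>ok D t; src t = X; tgt t = Y\<rbrakk> \<Longrightarrow> J t \<in> hom E X Y"
  unfolding spure_def by (auto intro: cls_hom)

lemma scomp_hom: "\<lbrakk>d \<in> hom E X Y; e \<in> hom E Y Z\<rbrakk> \<Longrightarrow> scomp D F d e \<in> hom E X Z"
  by (elim hom_cls) (simp add: scomp_cls cls_hom)

lemma sext_hom: "\<lbrakk>e \<in> hom E X Y; Z \<in> Obj D\<rbrakk> \<Longrightarrow> sext D F Z e \<in> hom E (X \<otimes> Z) (Y \<otimes> Z)"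
  by (elim hom_cls) (simp add: sext_cls cls_hom)

lemma sins_hom: "\<lbrakk>e \<in> hom E X Y; Z \<in> Obj D\<rbrakk> \<Longrightarrow> sins D F Z e \<in> hom E (Z \<otimes> X) (Z \<otimes> Y)"
  by (elim hom_cls) (simp add: sins_cls cls_hom)

lemma fst_hom: "e \<in> hom E X Y \<Longrightarrow> fst e = X" "e \<in> hom E X Y \<Longrightarrow> fst (snd e) = Y"
  "e \<in> hom E X Y \<Longrightarrow> X \<in> Obj D" "e \<in> hom E X Y \<Longrightarrow> Y \<in> Obj D"
  by (auto simp: hom_def scat_def)

lemma pure_id_left: "e \<in> hom E X Y \<Longrightarrow> scomp D F (J (\<iota> X)) e = e"
  by (elim hom_cls) (simp add: pure_comp_left statefulD)

lemma pure_id_right: "e \<in> hom E X Y \<Longrightarrow> scomp D F e (J (\<iota> Y)) = e"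
  by (elim hom_cls) (simp add: pure_comp_right statefulD)

lemma pure_comp:
  assumes "ok D t" "ok D u" "tgt t = src u"
  shows "scomp D F (J t) (J u) = J (t \<bullet> u)"
proof -
  have "(\<iota> (OMap F (Unit D)) \<boxtimes> t) \<bullet> (tinv D \<epsilon> \<boxtimes> u) = tinv D \<epsilon> \<boxtimes> (t \<bullet> u)"
    using assms by (simp flip: tten_comp)
  then show ?thesis
    using pure_comp_left[of "src u" "tgt u" "Unit D" "tinv D \<epsilon> \<boxtimes> u" t "src t"] assms
    by (simp add: spure_def)
qed

lemma sext_pure: "\<lbrakk>ok D t; Z \<in> Obj D\<rbrakk> \<Longrightarrow> sext D F Z (J t) = J (t \<boxtimes> \<iota> Z)"
  and sins_pure: "\<lbrakk>ok D t; Z \<in> Obj D\<rbrakk> \<Longrightarrow> sins D F Z (J t) = J (\<iota> Z \<boxtimes> t)"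
  by (simp_all add: spure_def sext_cls sins_cls ins_tten)

lemma scategory: "category E"
proof
  fix X Y Z W f g h
  show "f \<in> Arr E \<Longrightarrow> Dom E f \<in> Obj E" "f \<in> Arr E \<Longrightarrow> Cod E f \<in> Obj E"
    by (auto simp: scat_def)
  show "\<lbrakk>f \<in> hom E W X; g \<in> hom E X Y; h \<in> hom E Y Z\<rbrakk> \<Longrightarrow> (f \<Zcomp>\<^bsub>E\<^esub> g) \<Zcomp>\<^bsub>E\<^esub> h = f \<Zcomp>\<^bsub>E\<^esub> (g \<Zcomp>\<^bsub>E\<^esub> h)"
    by (elim hom_cls) (simp add: scomp_assoc)
qed (simp_all add: pure_hom scomp_hom pure_id_left pure_id_right)

lemma sext_comp:
  assumes "d \<in> hom E X Y" "e \<in> hom E Y Z" "W \<in> Obj D"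
  shows "sext D F W (scomp D F d e) = scomp D F (sext D F W d) (sext D F W e)"
proof -
  obtain S f T g where *: "sf X Y S f" "d = cl X Y S f" "sf Y Z T g" "e = cl Y Z T g"
    using assms by (elim hom_cls)
  note [simp] = assms(3) statefulD[OF *(1)] statefulD[OF *(3)]
  have "ext D (OMap F (S \<otimes> T)) X (S \<otimes> T) Z W ((\<mu>' S T \<boxtimes> \<iota> X)
      \<bullet> star D (OMap F S) X S Y (OMap F T) T Z f g)
     = (\<mu>' S T \<boxtimes> \<iota> (X \<otimes> W)) \<bullet> ext D (OMap F S \<otimes> OMap F T) X (S \<otimes> T) Z W (star D (OMap F S) X S Y
         (OMap F T) T Z f g)"
    using ext_natural[of "star D (OMap F S) X S Y (OMap F T) T Z f g" "OMap F S \<otimes> OMap F T" X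
        "S \<otimes> T" Z W
        "\<mu>' S T" "\<iota> X" "\<iota> (S \<otimes> T)" "\<iota> Z" "OMap F (S \<otimes> T)" X "S \<otimes> T" Z] by simp
  then show ?thesis
    using * by (simp add: sext_cls scomp_cls ext_star[of f "OMap F S" X S Y])
qed

lemma sins_sext:
  assumes "e \<in> hom E X Y" "Z \<in> Obj D"
  shows "sins D F Z e = scomp D F (J (\<sigma> Z X)) (scomp D F (sext D F Z e) (J (\<sigma> Y Z)))"
proof -
  obtain S f where *: "sf X Y S f" "e = cl X Y S f" using assms by (elim hom_cls)
  note [simp] = assms(2) statefulD[OF *(1)]
  have "sf (X \<otimes> Z) (Z \<otimes> Y) S (ext D (OMap F S) X S Y Z f \<bullet> (\<iota> S \<boxtimes> \<sigma> Y Z))"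
    by (simp add: stateful_def)
  then show ?thesis
    using * by (simp add: sext_cls sins_cls pure_comp_right pure_comp_left ins_def)
qed

lemma sext_sym:
  assumes "e \<in> hom E X Y" "Z \<in> Obj D"
  shows "scomp D F (sext D F Z e) (J (\<sigma> Y Z)) = scomp D F (J (\<sigma> X Z)) (sins D F Z e)"
    "scomp D F (sins D F Z e) (J (\<sigma> Z Y)) = scomp D F (J (\<sigma> Z X)) (sext D F Z e)"
proof -
  obtain S f where *: "sf X Y S f" "e = cl X Y S f" using assms by (elim hom_cls)
  note [simp] = assms(2) statefulD[OF *(1)]
  show "scomp D F (sext D F Z e) (J (\<sigma> Y Z)) = scomp D F (J (\<sigma> X Z)) (sins D F Z e)"
    "scomp D F (sins D F Z e) (J (\<sigma> Z Y)) = scomp D F (J (\<sigma> Z X)) (sext D F Z e)"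
    using * by (simp_all add: sext_cls sins_cls pure_comp_right pure_comp_left)
        (simp_all add: ins_def)
qed

text \<open>Left whiskering is right whiskering conjugated by stateless symmetries, so
  \<open>sext_comp\<close> is transported and the two symmetries left over cancel.\<close>

lemma sins_comp:
  assumes "d \<in> hom E X Y" "e \<in> hom E Y Z" "W \<in> Obj D"
  shows "sins D F W (scomp D F d e) = scomp D F (sins D F W d) (sins D F W e)"
proof -
  interpret E: category E by (rule scategory)
  note o = fst_hom[OF assms(1)] fst_hom[OF assms(2)]
  have h: "J (\<sigma> W X) \<in> hom E (W \<otimes> X) (X \<otimes> W)" "J (\<sigma> X W) \<in> hom E (X \<otimes> W) (W \<otimes> X)"
    "J (\<sigma> Y W) \<in> hom E (Y \<otimes> W) (W \<otimes> Y)" "J (\<sigma> Z W) \<in> hom E (Z \<otimes> W) (W \<otimes> Z)"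
    using assms o by (auto intro!: pure_hom)
  have a: "sext D F W d \<in> hom E (X \<otimes> W) (Y \<otimes> W)" "sext D F W e \<in> hom E (Y \<otimes> W) (Z \<otimes> W)"
    "sins D F W d \<in> hom E (W \<otimes> X) (W \<otimes> Y)" "sins D F W e \<in> hom E (W \<otimes> Y) (W \<otimes> Z)"
    using assms by (auto intro!: sext_hom sins_hom)
  have "sins D F W (scomp D F d e) = scomp D F (J (\<sigma> W X)) (scomp D F (scomp D F (sext D F W d)
      (sext D F W e)) (J (\<sigma> Z W)))"
    using assms by (simp add: sins_sext[OF scomp_hom[OF assms(1,2)]] sext_comp)
  also have "\<dots> = scomp D F (J (\<sigma> W X)) (scomp D F (J (\<sigma> X W)) (scomp D F (sins D F W d) (sins D F
      W e)))"
    using E.square_paste[OF a(1,2) a(3,4) h(2,3,4)] sext_sym[OF assms(1,3)] sext_sym[OF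
        assms(2,3)] by simp
  also have "\<dots> = scomp D F (scomp D F (J (\<sigma> W X)) (J (\<sigma> X W))) (scomp D F (sins D F W d) (sins D F
      W e))"
    using E.comp_assoc[OF h(1,2) E.comp_hom[OF a(3,4)]] by simp
  also have "\<dots> = scomp D F (sins D F W d) (sins D F W e)"
    using assms o pure_id_left[OF scomp_hom[OF a(3,4)]] by (simp add: pure_comp)
  finally show ?thesis .
qed

text \<open>The two orders of composition produce the states \<open>S \<otimes> T\<close> and
  \<open>T \<otimes> S\<close>, so the equality holds up to sliding along
  \<open>\<sigma> S T\<close>. On the incoming side \<open>F\<close> turns this into the symmetry of
  \<open>F S\<close> and \<open>F T\<close>, as it preserves symmetries;
  \<open>ins_interchange\<close> supplies the diagram.\<close>

lemma sinterchange:
  assumes "d \<in> hom E X Y" "e \<in> hom E X' Y'"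
  shows "scomp D F (sext D F X' d) (sins D F Y e) = scomp D F (sins D F X e) (sext D F Y' d)"
proof -
  obtain S f T g where *: "sf X Y S f" "d = cl X Y S f" "sf X' Y' T g" "e = cl X' Y' T g"
    using assms by (elim hom_cls)
  note [simp] = statefulD[OF *(1)] statefulD[OF *(3)]
  let ?f = "ext D (OMap F S) X S Y" and ?g = "\<lambda>A. ins D (OMap F T) X' T Y' A g"
  have 1: "(\<sigma> (OMap F S) (OMap F T) \<boxtimes> \<iota> (X \<otimes> X')) \<bullet> \<alpha> (OMap F T) (OMap F S) (X \<otimes> X')
    = \<alpha> (OMap F S) (OMap F T) (X \<otimes> X') \<bullet> \<tau> (OMap F S) (OMap F T) (X \<otimes> X')"
    "\<beta> S T (Y \<otimes> Y') \<bullet> (\<sigma> S T \<boxtimes> \<iota> (Y \<otimes> Y')) = \<tau> S T (Y \<otimes> Y') \<bullet> \<beta> T S (Y \<otimes> Y')"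
    by (simp_all add: tswap_def)
  \<comment> \<open>The crossing of the outgoing states is moved to the other side, where it
    completes one occurrence of \<open>f\<close> to the form of \<open>ins_alt\<close>.\<close>
  have 2: "(\<iota> (OMap F S) \<boxtimes> ?g X) \<bullet> \<tau> (OMap F S) T (X \<otimes> Y') \<bullet> (\<iota> T \<boxtimes> ?f Y' f)
    = ins D (OMap F S) (X \<otimes> X') S (Y \<otimes> X') (OMap F T) (?f X' f) \<bullet> (\<iota> S \<boxtimes> ?g Y) \<bullet> \<tau> S T (Y \<otimes> Y')"
    using ins_interchange[of f "OMap F S" X S Y g "OMap F T" X' T Y', symmetric, THEN
        tcomp_reassoc, of "\<tau> S T (Y \<otimes> Y')"]
    by (simp add: ins_alt[of "?f Y' f" "OMap F S" "X \<otimes> Y'" S "Y \<otimes> Y'" T])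
  have 3: "(\<sigma> (OMap F S) (OMap F T) \<boxtimes> \<iota> (X \<otimes> X')) \<bullet> star D (OMap F T) (X \<otimes> X') T (X \<otimes> Y') (OMap F
      S) S (Y \<otimes> Y') (?g X) (?f Y' f)
    = star D (OMap F S) (X \<otimes> X') S (Y \<otimes> X') (OMap F T) T (Y \<otimes> Y') (?f X' f) (?g Y)
        \<bullet> (\<sigma> S T \<boxtimes> \<iota> (Y \<otimes> Y'))"
    unfolding star_def ins_alt[of "?g X" "OMap F T" "X \<otimes> X'" T "X \<otimes> Y'" "OMap F S", simplified]
    using 1(1)[THEN tcomp_reassoc] 2[THEN tcomp_reassoc] by (simp add: 1(2))
  have m: "\<mu> S T \<bullet> \<Phi> (\<sigma> S T) \<bullet> \<mu>' T S = \<sigma> (OMap F S) (OMap F T)"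
    using mu_sym[of S T, THEN tcomp_reassoc, of "\<mu>' T S"] by simp
  have "\<Phi> (\<sigma> S T) \<bullet> \<mu>' T S = \<mu>' S T \<bullet> \<sigma> (OMap F S) (OMap F T)"
    unfolding m[symmetric] by simp
  then have 4: "(\<Phi> (\<sigma> S T) \<boxtimes> \<iota> (X \<otimes> X')) \<bullet> (\<mu>' T S \<boxtimes> \<iota> (X \<otimes> X'))
    = (\<mu>' S T \<boxtimes> \<iota> (X \<otimes> X')) \<bullet> (\<sigma> (OMap F S) (OMap F T) \<boxtimes> \<iota> (X \<otimes> X'))"
    by (simp flip: whisker)
  have s: "sf (X \<otimes> X') (Y \<otimes> X') S (?f X' f)" "sf (Y \<otimes> X') (Y \<otimes> Y') T (?g Y)"
    "sf (X \<otimes> X') (X \<otimes> Y') T (?g X)" "sf (X \<otimes> Y') (Y \<otimes> Y') S (?f Y' f)"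
    using * by simp_all
  have "cl (X \<otimes> X') (Y \<otimes> Y') (S \<otimes> T) ((\<mu>' S T \<boxtimes> \<iota> (X \<otimes> X'))
      \<bullet> star D (OMap F S) (X \<otimes> X') S (Y \<otimes> X') (OMap F T) T (Y \<otimes> Y') (?f X' f) (?g Y))
    = cl (X \<otimes> X') (Y \<otimes> Y') (T \<otimes> S) ((\<mu>' T S \<boxtimes> \<iota> (X \<otimes> X'))
        \<bullet> star D (OMap F T) (X \<otimes> X') T (X \<otimes> Y') (OMap F S) S (Y \<otimes> Y') (?g X) (?f Y' f))"
    by (rule slide_iso[where r = "\<sigma> S T"])
      (use s 4[THEN tcomp_reassoc] in \<open>simp_all add: 3\<close>)
  then show ?thesis
    using * s by (simp add: sext_cls sins_cls scomp_cls)
qed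

lemma sten_hom: "\<lbrakk>d \<in> hom E X Y; e \<in> hom E X' Y'\<rbrakk> \<Longrightarrow> sten D F d e \<in> hom E (X \<otimes> X') (Y \<otimes> Y')"
  by (auto simp: sten_def fst_hom intro!: scomp_hom sext_hom sins_hom)

lemma pure_ten:
  assumes "ok D t" "ok D u"
  shows "sten D F (J t) (J u) = J (t \<boxtimes> u)"
  using assms ok_obj[of t] ok_obj[of u] interchange(1)[of u "src u" t "tgt t" "src t" "tgt u"]
    fst_hom[OF pure_hom[OF assms(1) refl refl]] fst_hom[OF pure_hom[OF assms(2) refl refl]]
  by (simp add: sten_def sext_pure sins_pure pure_comp)

lemma sten_id_left: "\<lbrakk>e \<in> hom E X Y; Z \<in> Obj D\<rbrakk> \<Longrightarrow> sten D F (J (\<iota> Z)) e = sins D F Z e"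
  using fst_hom[OF pure_hom[of "\<iota> Z" Z Z]] pure_id_left[OF sins_hom]
  by (simp add: sten_def fst_hom sext_pure)

lemma sten_id_right: "\<lbrakk>e \<in> hom E X Y; Z \<in> Obj D\<rbrakk> \<Longrightarrow> sten D F e (J (\<iota> Z)) = sext D F Z e"
  using fst_hom[OF pure_hom[of "\<iota> Z" Z Z]] pure_id_right[OF sext_hom]
  by (simp add: sten_def fst_hom sins_pure)

text \<open>Both sides compose whiskerings of the same four arrows, and differ in the order of the
  middle two, which the interchange law exchanges.\<close>

lemma sten_comp:
  assumes "f \<in> hom E X X'" "f' \<in> hom E X' X''" "g \<in> hom E Y Y'" "g' \<in> hom E Y' Y''"
  shows "sten D F (scomp D F f f') (scomp D F g g') = scomp D F (sten D F f g) (sten D F f' g')"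
proof -
  interpret E: category E by (rule scategory)
  have "sten D F (scomp D F f f') (scomp D F g g')
    = scomp D F (scomp D F (sext D F Y f) (sext D F Y f')) (scomp D F (sins D F X'' g) (sins D F
        X'' g'))"
    using assms by (simp add: sten_def fst_hom[OF scomp_hom[of f X X' f' X'']] fst_hom[OF
        scomp_hom[of g Y Y' g' Y'']]
        sext_comp[of f X X' f' X''] sins_comp[of g Y Y' g' Y''] fst_hom)
  also have "\<dots> = scomp D F (scomp D F (sext D F Y f) (sins D F X' g)) (scomp D F (sext D F Y' f')
      (sins D F X'' g'))"
  proof -
    have h: "sext D F Y f \<in> hom E (X \<otimes> Y) (X' \<otimes> Y)" "sext D F Y f' \<in> hom E (X' \<otimes> Y) (X'' \<otimes> Y)"
       "sins D F X'' g \<in> hom E (X'' \<otimes> Y) (X'' \<otimes> Y')" "sins D F X'' g' \<in> hom E (X'' \<otimes> Y') (X'' \<otimes>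
           Y'')"
       "sins D F X' g \<in> hom E (X' \<otimes> Y) (X' \<otimes> Y')" "sext D F Y' f' \<in> hom E (X' \<otimes> Y') (X'' \<otimes> Y')"
      using assms fst_hom[OF assms(1)] fst_hom[OF assms(2)] fst_hom[OF assms(3)] fst_hom[OF
          assms(4)]
      by (auto intro!: sext_hom sins_hom)
    show ?thesis using E.comp_middle[OF h] sinterchange[OF assms(2,3)] by simp
  qed
  also have "\<dots> = scomp D F (sten D F f g) (sten D F f' g')"
    using assms by (simp add: sten_def fst_hom)
  finally show ?thesis .
qed

text \<open>Naturality of the associator in one argument at a time. On representatives these are
  \<open>ext_ext\<close>, \<open>ext_ins\<close> and \<open>ins_tensor\<close>;
  \<open>sassoc_natural\<close> pastes the three squares.\<close>

lemma sassoc_whisker: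
  assumes "e \<in> hom E X Y" "A \<in> Obj D" "B \<in> Obj D"
  shows "scomp D F (sext D F B (sext D F A e)) (J (\<alpha> Y A B))
      = scomp D F (J (\<alpha> X A B)) (sext D F (A \<otimes> B) e)"
    "scomp D F (sext D F B (sins D F A e)) (J (\<alpha> A Y B))
        = scomp D F (J (\<alpha> A X B)) (sins D F A (sext D F B e))"
    "scomp D F (sins D F (A \<otimes> B) e) (J (\<alpha> A B Y)) = scomp D F (J (\<alpha> A B X)) (sins D F A (sins D F
        B e))"
proof -
  obtain S f where *: "sf X Y S f" "e = cl X Y S f" using assms by (elim hom_cls)
  note [simp] = assms(2,3) statefulD[OF *(1)]
  show "scomp D F (sext D F B (sext D F A e)) (J (\<alpha> Y A B))
      = scomp D F (J (\<alpha> X A B)) (sext D F (A \<otimes> B) e)"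
    "scomp D F (sext D F B (sins D F A e)) (J (\<alpha> A Y B))
        = scomp D F (J (\<alpha> A X B)) (sins D F A (sext D F B e))"
    "scomp D F (sins D F (A \<otimes> B) e) (J (\<alpha> A B Y)) = scomp D F (J (\<alpha> A B X)) (sins D F A (sins D F
        B e))"
    using * by (simp_all add: sext_cls sins_cls pure_comp_right pure_comp_left)
      (simp_all add: ext_ext ext_ins ins_tensor)
qed

lemma sassoc_natural:
  assumes "f \<in> hom E X X'" "g \<in> hom E Y Y'" "h \<in> hom E Z Z'"
  shows "scomp D F (sten D F (sten D F f g) h) (J (\<alpha> X' Y' Z'))
      = scomp D F (J (\<alpha> X Y Z)) (sten D F f (sten D F g h))"
proof -
  interpret E: category E by (rule scategory)
  note o = fst_hom[OF assms(1)] fst_hom[OF assms(2)] fst_hom[OF assms(3)]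
  have 1: "sext D F Y f \<in> hom E (X \<otimes> Y) (X' \<otimes> Y)" "sins D F X' g \<in> hom E (X' \<otimes> Y) (X' \<otimes> Y')"
    "sext D F Z g \<in> hom E (Y \<otimes> Z) (Y' \<otimes> Z)" "sins D F Y' h \<in> hom E (Y' \<otimes> Z) (Y' \<otimes> Z')"
    using assms o by (auto intro!: sext_hom sins_hom)
  have h: "sext D F Z (sext D F Y f) \<in> hom E ((X \<otimes> Y) \<otimes> Z) ((X' \<otimes> Y) \<otimes> Z)"
    "sext D F Z (sins D F X' g) \<in> hom E ((X' \<otimes> Y) \<otimes> Z) ((X' \<otimes> Y') \<otimes> Z)"
    "sins D F (X' \<otimes> Y') h \<in> hom E ((X' \<otimes> Y') \<otimes> Z) ((X' \<otimes> Y') \<otimes> Z')"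
    "sext D F (Y \<otimes> Z) f \<in> hom E (X \<otimes> (Y \<otimes> Z)) (X' \<otimes> (Y \<otimes> Z))"
    "sins D F X' (sext D F Z g) \<in> hom E (X' \<otimes> (Y \<otimes> Z)) (X' \<otimes> (Y' \<otimes> Z))"
    "sins D F X' (sins D F Y' h) \<in> hom E (X' \<otimes> (Y' \<otimes> Z)) (X' \<otimes> (Y' \<otimes> Z'))"
    using assms o 1 by (auto intro!: sext_hom sins_hom)
  have a: "J (\<alpha> X Y Z) \<in> hom E ((X \<otimes> Y) \<otimes> Z) (X \<otimes> (Y \<otimes> Z))"
      "J (\<alpha> X' Y Z) \<in> hom E ((X' \<otimes> Y) \<otimes> Z) (X' \<otimes> (Y \<otimes> Z))"
    "J (\<alpha> X' Y' Z) \<in> hom E ((X' \<otimes> Y') \<otimes> Z) (X' \<otimes> (Y' \<otimes> Z))"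
        "J (\<alpha> X' Y' Z') \<in> hom E ((X' \<otimes> Y') \<otimes> Z') (X' \<otimes> (Y' \<otimes> Z'))"
    using o by (auto intro!: pure_hom)
  have l: "sten D F (sten D F f g) h = scomp D F (scomp D F (sext D F Z (sext D F Y f)) (sext D F
      Z (sins D F X' g))) (sins D F (X' \<otimes> Y') h)"
    using o fst_hom[OF scomp_hom[OF 1(1,2)]] sext_comp[OF 1(1,2)] by (simp add: sten_def)
  have r: "sten D F f (sten D F g h) = scomp D F (scomp D F (sext D F (Y \<otimes> Z) f) (sins D F X'
      (sext D F Z g))) (sins D F X' (sins D F Y' h))"
    using o fst_hom[OF scomp_hom[OF 1(3,4)]] sins_comp[OF 1(3,4)] E.comp_assoc[OF h(4,5,6)] by
        (simp add: sten_def)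
  have "scomp D F (scomp D F (sext D F Z (sext D F Y f)) (sext D F Z (sins D F X' g))) (J (\<alpha> X' Y'
      Z))
    = scomp D F (J (\<alpha> X Y Z)) (scomp D F (sext D F (Y \<otimes> Z) f) (sins D F X' (sext D F Z g)))"
    using E.square_paste[OF h(1,2,4,5) a(1,2,3)] sassoc_whisker(1)[OF assms(1)]
        sassoc_whisker(2)[OF assms(2)] o by simp
  then show ?thesis
    unfolding l r
    using E.square_paste[OF E.comp_hom[OF h(1,2)] h(3) E.comp_hom[OF h(4,5)] h(6) a(1,3,4)]
        sassoc_whisker(3)[OF assms(3)] o by simp
qed

lemma sunit_natural:
  assumes "e \<in> hom E X Y"
  shows "scomp D F (sins D F (Unit D) e) (J (\<l> Y)) = scomp D F (J (\<l> X)) e"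
    "scomp D F (sext D F (Unit D) e) (J (\<r> Y)) = scomp D F (J (\<r> X)) e"
proof -
  obtain S f where *: "sf X Y S f" "e = cl X Y S f" using assms by (elim hom_cls)
  note [simp] = statefulD[OF *(1)]
  show "scomp D F (sins D F (Unit D) e) (J (\<l> Y)) = scomp D F (J (\<l> X)) e"
    "scomp D F (sext D F (Unit D) e) (J (\<r> Y)) = scomp D F (J (\<r> X)) e"
    using * by (simp_all add: sext_cls sins_cls pure_comp_right pure_comp_left ext_unit ins_unit)
qed

lemma ssym_natural:
  assumes "f \<in> hom E X X'" "g \<in> hom E Y Y'"
  shows "scomp D F (sten D F f g) (J (\<sigma> X' Y')) = scomp D F (J (\<sigma> X Y)) (sten D F g f)"
proof -
  interpret E: category E by (rule scategory)
  note o = fst_hom[OF assms(1)] fst_hom[OF assms(2)]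
  have h: "sext D F Y f \<in> hom E (X \<otimes> Y) (X' \<otimes> Y)" "sins D F X' g \<in> hom E (X' \<otimes> Y) (X' \<otimes> Y')"
    "sins D F Y f \<in> hom E (Y \<otimes> X) (Y \<otimes> X')" "sext D F X' g \<in> hom E (Y \<otimes> X') (Y' \<otimes> X')"
    using assms o by (auto intro!: sext_hom sins_hom)
  have a: "J (\<sigma> X Y) \<in> hom E (X \<otimes> Y) (Y \<otimes> X)" "J (\<sigma> X' Y) \<in> hom E (X' \<otimes> Y) (Y \<otimes> X')"
    "J (\<sigma> X' Y') \<in> hom E (X' \<otimes> Y') (Y' \<otimes> X')" using o by (auto intro!: pure_hom)
  show ?thesis
    using E.square_paste[OF h a] sext_sym[of f X X' Y] sext_sym[of g Y Y' X'] sinterchange[OF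
        assms(2,1)] assms o
    by (simp add: sten_def)
qed

lemma pure_iso:
  assumes "tiso D t" "src t = X" "tgt t = Y"
  shows "J t \<in> iso E X Y" "arr_inv E (J t) = J (tinv D t)"
proof -
  interpret E: category E by (rule scategory)
  have t: "ok D t" "ok D (tinv D t)" using assms tiso_ok by auto
  have i: "is_inverse E (J t) (J (tinv D t))"
    using assms t pure_hom[of t X Y] pure_hom[of "tinv D t" Y X] fst_hom[OF pure_hom[of t X Y]]
    by (simp add: is_inverse_def pure_comp)
  then show "J t \<in> iso E X Y" using assms t pure_hom[of t X Y] unfolding iso_def by blast
  have h: "J t \<in> hom E X Y" using assms t pure_hom by auto
  then have "Dom E (J t) = X" "Cod E (J t) = Y" by (simp_all add: fst_hom)
  then have *: "h \<in> hom E Y X \<and> scomp D F (J t) h = Id E X \<and> scomp D F h (J t) = Id E Y" if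
      "is_inverse E (J t) h" for h
    using that by (simp add: is_inverse_def)
  have "h = J (tinv D t)" if "is_inverse E (J t) h" for h
  proof -
    note H = *[OF that] *[OF i]
    have "h = scomp D F h (scomp D F (J t) (J (tinv D t)))" using H E.id_right[of h Y X] by simp
    also have "\<dots> = J (tinv D t)" using H h E.comp_assoc[of h Y X "J t" Y
        "J (tinv D t)" X] E.id_left[of "J (tinv D t)" Y X] by simp
    finally show ?thesis .
  qed
  then show "arr_inv E (J t) = J (tinv D t)" unfolding arr_inv_def using i by blast
qed

text \<open>\<open>J\<close> respects composition and tensor, so the coherence axioms, which involve
  only stateless arrows, are inherited from \<open>D\<close>. The axioms with arbitrary arrows come
  from the whiskering lemmas.\<close>

theorem symmetric_monoidal_scat: "symmetric_monoidal_category E"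
proof -
  interpret E: category E by (rule scategory)
  show ?thesis
    by unfold_locales
      (simp_all add: pure_hom sten_hom pure_ten sten_comp pure_iso pure_comp sten_id_left
          sten_id_right
        sassoc_natural sunit_natural ssym_natural \<alpha>_pentagon \<alpha>_triangle \<sigma>_hexagon)
qed

end

section \<open>Functoriality of the construction\<close>

lemma sfun_simps [simp]:
  "OMap (sfun D F D' F' N) = OMap N" "UnitMap (sfun D F D' F' N) = spure D' F' (teps D D' N)"
  "TenMap (sfun D F D' F' N) = (\<lambda>X Y. spure D' F' (tmu D D' N X Y))"
  by (simp_all add: sfun_def)

locale commuting_functor =
  D: monoidal_endofunctor D F + D': monoidal_endofunctor D' F' + symmetric_monoidal_functor D D' N
  for D :: "('o, 'm, 'y) smc_scheme" and F and D' :: "('p, 'q, 'z) smc_scheme" and F' and N +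
  assumes comm: "commutes_with D F D' F' N"
begin

abbreviation "M \<equiv> AMap (sfun D F D' F' N)"

lemma comm_obj: "S \<in> Obj D \<Longrightarrow> OMap N (OMap F S) = OMap F' (OMap N S)"
  using comm by (simp add: commutes_with_def mfun_eq_def mfun_comp_def)

lemma comm_arr: "ok D r \<Longrightarrow> tmap D N (tmap D F r) = tmap D' F' (tmap D N r)"
proof (rule typed_eqI[where C = D'])
  assume r: "ok D r"
  then have "AMap N (AMap F (raw r)) = AMap F' (AMap N (raw r))"
    using comm raw_hom[OF r] by (auto simp: commutes_with_def mfun_eq_def mfun_comp_def hom_def)
  then show "raw (tmap D N (tmap D F r)) = raw (tmap D' F' (tmap D N r))"
    using r by (simp add: raw_tmap D.raw_tmap D'.raw_tmap)
qed (simp_all add: comm_obj D.ok_obj)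

lemma comm_eps: "teps D D' N \<bullet>\<^bsub>D'\<^esub> tmap D N (teps D D F) = teps D' D' F'
    \<bullet>\<^bsub>D'\<^esub> tmap D' F' (teps D D' N)"
  using comm by (intro typed_eqI[where C = D'])
    (auto simp: commutes_with_def mfun_eq_def mfun_comp_def D'.raw_comp raw_tmap D'.raw_tmap
        raw_eps D.raw_eps D'.raw_eps comm_obj)

lemma comm_mu:
  assumes "X \<in> Obj D" "Y \<in> Obj D"
  shows "tmu D D' N (OMap F X) (OMap F Y) \<bullet>\<^bsub>D'\<^esub> tmap D N (tmu D D F X Y)
    = tmu D' D' F' (OMap N X) (OMap N Y) \<bullet>\<^bsub>D'\<^esub> tmap D' F' (tmu D D' N X Y)"
  using comm assms by (intro typed_eqI[where C = D'])
    (auto simp: commutes_with_def mfun_eq_def mfun_comp_def D'.raw_comp raw_tmap D'.raw_tmap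
        raw_mu D.raw_mu D'.raw_mu comm_obj)

lemma comm_mu_inv:
  assumes [simp]: "X \<in> Obj D" "Y \<in> Obj D"
  shows "tmap D' F' (tmu D D' N X Y) \<bullet>\<^bsub>D'\<^esub> tmap D N (tinv D (tmu D D F X Y))
    = tinv D' (tmu D' D' F' (OMap N X) (OMap N Y)) \<bullet>\<^bsub>D'\<^esub> tmu D D' N (OMap F X) (OMap F Y)"
proof -
  let ?i = "tinv D' (tmu D' D' F' (OMap N X) (OMap N Y))"
  have "?i \<bullet>\<^bsub>D'\<^esub> (tmu D' D' F' (OMap N X) (OMap N Y) \<bullet>\<^bsub>D'\<^esub> tmap D' F' (tmu D D' N X Y))
      \<bullet>\<^bsub>D'\<^esub> tmap D N (tinv D (tmu D D F X Y))
    = ?i \<bullet>\<^bsub>D'\<^esub> tmu D D' N (OMap F X) (OMap F Y)"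
    unfolding comm_mu[OF assms, symmetric] by (simp add: tmap_inv comm_obj)
  then show ?thesis by (simp add: comm_obj)
qed

lemma comm_eps_inv:
  "tmap D' F' (teps D D' N) \<bullet>\<^bsub>D'\<^esub> tmap D N (tinv D (teps D D F)) = tinv D' (teps D' D' F')
      \<bullet>\<^bsub>D'\<^esub> teps D D' N"
proof -
  let ?i = "tinv D' (teps D' D' F')"
  have "?i \<bullet>\<^bsub>D'\<^esub> (teps D' D' F' \<bullet>\<^bsub>D'\<^esub> tmap D' F' (teps D D' N))
      \<bullet>\<^bsub>D'\<^esub> tmap D N (tinv D (teps D D F)) = ?i \<bullet>\<^bsub>D'\<^esub> teps D D' N"
    unfolding comm_eps[symmetric] by (simp add: tmap_inv comm_obj)
  then show ?thesis by (simp add: comm_obj)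
qed

lemma stateful_conj [simp]:
  "D.sf X Y S f \<Longrightarrow> D'.sf (OMap N X) (OMap N Y) (OMap N S) (tconj D D' N (OMap F S) X S Y f)"
  by (simp add: stateful_def comm_obj)

text \<open>A slide along \<open>r\<close> is mapped to a slide along \<open>N r\<close>, because
  \<open>N (F r) = F' (N r)\<close>.\<close>

lemma map_cls:
  assumes "D.sf X Y S f"
  shows "M (D.cl X Y S f) = D'.cl (OMap N X) (OMap N Y) (OMap N S) (tconj D D' N (OMap F S) X S Y
      f)"
proof -
  let ?G = "\<lambda>X Y S f. D'.cl (OMap N X) (OMap N Y) (OMap N S) (tconj D D' N (OMap F S) X S Y f)"
  have "lift D F ?G (D.cl X Y S f) = ?G X Y S f"
  proof (rule D.lift_cls[OF assms], unfold D.invariant_def, intro allI impI)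
    fix r h assume A [simp]: "ok D r" "ok D h" "src h = OMap F (tgt r) \<otimes>\<^bsub>D\<^esub> X" "tgt h
        = src r \<otimes>\<^bsub>D\<^esub> Y"
    note [simp] = D.statefulD[OF assms] D.ok_obj[of r]
    have "tconj D D' N (OMap F (src r)) X (src r) Y ((tmap D F r \<boxtimes>\<^bsub>D\<^esub> \<iota>\<^bsub>D\<^esub> X) \<bullet>\<^bsub>D\<^esub> h)
      = (tmap D' F' (tmap D N r) \<boxtimes>\<^bsub>D'\<^esub> \<iota>\<^bsub>D'\<^esub> (OMap N X))
          \<bullet>\<^bsub>D'\<^esub> tconj D D' N (OMap F (tgt r)) X (src r) Y h"
      "tconj D D' N (OMap F (tgt r)) X (tgt r) Y (h \<bullet>\<^bsub>D\<^esub> (r \<boxtimes>\<^bsub>D\<^esub> \<iota>\<^bsub>D\<^esub> Y))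
      = tconj D D' N (OMap F (tgt r)) X (src r) Y h \<bullet>\<^bsub>D'\<^esub> (tmap D N r \<boxtimes>\<^bsub>D'\<^esub> \<iota>\<^bsub>D'\<^esub> (OMap N Y))"
      by (simp_all add: tconj_comp[of _ _ _ "OMap F (tgt r)" X] tconj_comp[of _ _ _
          "src r" Y] tconj_tten comm_arr)
    then show "?G X Y (src r) ((tmap D F r \<boxtimes>\<^bsub>D\<^esub> \<iota>\<^bsub>D\<^esub> X) \<bullet>\<^bsub>D\<^esub> h) = ?G X Y (tgt r) (h
        \<bullet>\<^bsub>D\<^esub> (r \<boxtimes>\<^bsub>D\<^esub> \<iota>\<^bsub>D\<^esub> Y))"
      using D'.slide[of "OMap N X" "OMap N Y" "tmap D N r" "OMap N (src r)" "OMap N (tgt r)"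
          "tconj D D' N (OMap F (tgt r)) X (src r) Y h"]
      by (simp add: comm_obj)
  qed
  then show ?thesis by (simp add: sfun_def)
qed

lemma map_hom_cls: "e \<in> hom D.E X Y \<Longrightarrow> M e \<in> hom D'.E (OMap N X) (OMap N Y)"
  by (elim D.hom_cls) (simp add: map_cls D'.cls_hom)

text \<open>The image has state \<open>N I\<close> where a stateless arrow has \<open>I\<close>; the
  slide is along the unit map of \<open>N\<close>, and commutation of the unit maps with the
  endofunctors makes the square commute.\<close>

lemma map_pure: "ok D t \<Longrightarrow> M (D.J t) = D'.J (tmap D N t)"
proof -
  assume t [simp]: "ok D t"
  note [simp] = D.ok_obj[OF t]
  have s: "D.sf (src t) (tgt t) (Unit D) (tinv D (teps D D F) \<boxtimes>\<^bsub>D\<^esub> t)" by simp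
  have "D'.cl (OMap N (src t)) (OMap N (tgt t)) (Unit D') (tinv D' (teps D' D' F') \<boxtimes>\<^bsub>D'\<^esub> tmap D N t)
    = D'.cl (OMap N (src t)) (OMap N (tgt t)) (OMap N (Unit D)) (tconj D D' N (OMap F (Unit D))
        (src t) (Unit D) (tgt t) (tinv D (teps D D F) \<boxtimes>\<^bsub>D\<^esub> t))"
  proof (rule D'.slide_iso[OF _ stateful_conj[OF s], where r = "teps D D' N"])
    show "(tmap D' F' (teps D D' N) \<boxtimes>\<^bsub>D'\<^esub> \<iota>\<^bsub>D'\<^esub> (OMap N (src t))) \<bullet>\<^bsub>D'\<^esub>
       tconj D D' N (OMap F (Unit D)) (src t) (Unit D) (tgt t) (tinv D (teps D D F) \<boxtimes>\<^bsub>D\<^esub> t)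
      = (tinv D' (teps D' D' F') \<boxtimes>\<^bsub>D'\<^esub> tmap D N t) \<bullet>\<^bsub>D'\<^esub> (teps D D' N \<boxtimes>\<^bsub>D'\<^esub> \<iota>\<^bsub>D'\<^esub> (OMap N (tgt t)))"
      using comm_eps_inv by (simp add: tconj_tten comm_obj flip: D'.tten_comp)
  qed simp_all
  then show ?thesis using map_cls[OF s] by (simp add: spure_def)
qed

text \<open>The composite of the images has state \<open>N S \<otimes> N T\<close>, the image of the
  composite \<open>N (S \<otimes> T)\<close>. The slide is along the structure map of
  \<open>N\<close>; \<open>comm_mu_inv\<close> treats the incoming state and
  \<open>tconj_star\<close> the bodies.\<close>

lemma map_scomp:
  assumes "d \<in> hom D.E X Y" "e \<in> hom D.E Y Z"
  shows "M (scomp D F d e) = scomp D' F' (M d) (M e)"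
proof -
  obtain S f T g where *: "D.sf X Y S f" "d = D.cl X Y S f" "D.sf Y Z T g" "e = D.cl Y Z T g"
    using assms by (elim D.hom_cls)
  note [simp] = D.statefulD[OF *(1)] D.statefulD[OF *(3)]
  let ?s = "star D (OMap F S) X S Y (OMap F T) T Z f g"
  let ?N = "tconj D D' N"
  have c: "?N (OMap F (S \<otimes>\<^bsub>D\<^esub> T)) X (S \<otimes>\<^bsub>D\<^esub> T) Z ((D.\<mu>' S T \<boxtimes>\<^bsub>D\<^esub> \<iota>\<^bsub>D\<^esub> X) \<bullet>\<^bsub>D\<^esub> ?s)
    = (tmap D N (D.\<mu>' S T) \<boxtimes>\<^bsub>D'\<^esub> \<iota>\<^bsub>D'\<^esub> (OMap N X)) \<bullet>\<^bsub>D'\<^esub> ?N (OMap F S \<otimes>\<^bsub>D\<^esub> OMap F T) X (S \<otimes>\<^bsub>D\<^esub> T)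
        Z ?s"
    by (simp add: tconj_comp[of _ _ _ "OMap F S \<otimes>\<^bsub>D\<^esub> OMap F T" X] tconj_tten)
  have m: "(tmap D' F' (tmu D D' N S T) \<boxtimes>\<^bsub>D'\<^esub> \<iota>\<^bsub>D'\<^esub> (OMap N X))
      \<bullet>\<^bsub>D'\<^esub> (tmap D N (D.\<mu>' S T) \<boxtimes>\<^bsub>D'\<^esub> \<iota>\<^bsub>D'\<^esub> (OMap N X))
    = (D'.\<mu>' (OMap N S) (OMap N T) \<boxtimes>\<^bsub>D'\<^esub> \<iota>\<^bsub>D'\<^esub> (OMap N X))
        \<bullet>\<^bsub>D'\<^esub> (tmu D D' N (OMap F S) (OMap F T) \<boxtimes>\<^bsub>D'\<^esub> \<iota>\<^bsub>D'\<^esub> (OMap N X))"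
    by (simp add: comm_obj comm_mu_inv flip: D'.whisker)
  have s: "D.sf X Z (S \<otimes>\<^bsub>D\<^esub> T) ((D.\<mu>' S T \<boxtimes>\<^bsub>D\<^esub> \<iota>\<^bsub>D\<^esub> X) \<bullet>\<^bsub>D\<^esub> ?s)"
    using * by simp
  let ?s' = "star D' (OMap F' (OMap N S)) (OMap N X) (OMap N S) (OMap N Y) (OMap F' (OMap N T))
      (OMap N T) (OMap N Z)
        (?N (OMap F S) X S Y f) (?N (OMap F T) Y T Z g)"
  have "D'.cl (OMap N X) (OMap N Z) (OMap N S \<otimes>\<^bsub>D'\<^esub> OMap N T)
      ((D'.\<mu>' (OMap N S) (OMap N T) \<boxtimes>\<^bsub>D'\<^esub> \<iota>\<^bsub>D'\<^esub> (OMap N X)) \<bullet>\<^bsub>D'\<^esub> ?s')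
    = D'.cl (OMap N X) (OMap N Z) (OMap N (S \<otimes>\<^bsub>D\<^esub> T)) (?N (OMap F (S \<otimes>\<^bsub>D\<^esub> T)) X (S \<otimes>\<^bsub>D\<^esub> T) Z
        ((D.\<mu>' S T \<boxtimes>\<^bsub>D\<^esub> \<iota>\<^bsub>D\<^esub> X) \<bullet>\<^bsub>D\<^esub> ?s))"
  proof (rule D'.slide_iso[OF _ stateful_conj[OF s], where r = "tmu D D' N S T"])
    show "(tmap D' F' (tmu D D' N S T) \<boxtimes>\<^bsub>D'\<^esub> \<iota>\<^bsub>D'\<^esub> (OMap N X)) \<bullet>\<^bsub>D'\<^esub>
        ?N (OMap F (S \<otimes>\<^bsub>D\<^esub> T)) X (S \<otimes>\<^bsub>D\<^esub> T) Z ((D.\<mu>' S T \<boxtimes>\<^bsub>D\<^esub> \<iota>\<^bsub>D\<^esub> X) \<bullet>\<^bsub>D\<^esub> ?s)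
      = ((D'.\<mu>' (OMap N S) (OMap N T) \<boxtimes>\<^bsub>D'\<^esub> \<iota>\<^bsub>D'\<^esub> (OMap N X)) \<bullet>\<^bsub>D'\<^esub> ?s')
          \<bullet>\<^bsub>D'\<^esub> (tmu D D' N S T \<boxtimes>\<^bsub>D'\<^esub> \<iota>\<^bsub>D'\<^esub> (OMap N Z))"
      unfolding c using m[THEN D'.tcomp_reassoc] tconj_star[of f "OMap F S" X S Y g "OMap F T" T Z]
      by (simp add: comm_obj)
  qed (use * in simp_all)
  then show ?thesis
    using * s by (simp add: D.scomp_cls map_cls D'.scomp_cls)
qed

text \<open>Naturality of the structure map in each argument alone, to be pasted into naturality for
  \<open>sten\<close>. Whiskering leaves the state unchanged, so the bodies already agree by
  \<open>tconj_ext\<close> and \<open>tconj_ins\<close>.\<close>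

lemma map_whisker:
  assumes "e \<in> hom D.E X Y" "Z \<in> Obj D"
  shows "scomp D' F' (sext D' F' (OMap N Z) (M e)) (D'.J (tmu D D' N Y Z))
      = scomp D' F' (D'.J (tmu D D' N X Z)) (M (sext D F Z e))"
    "scomp D' F' (sins D' F' (OMap N Z) (M e)) (D'.J (tmu D D' N Z Y))
        = scomp D' F' (D'.J (tmu D D' N Z X)) (M (sins D F Z e))"
proof -
  obtain S f where *: "D.sf X Y S f" "e = D.cl X Y S f" using assms by (elim D.hom_cls)
  note [simp] = assms(2) D.statefulD[OF *(1)]
  show "scomp D' F' (sext D' F' (OMap N Z) (M e)) (D'.J (tmu D D' N Y Z))
      = scomp D' F' (D'.J (tmu D D' N X Z)) (M (sext D F Z e))"
    "scomp D' F' (sins D' F' (OMap N Z) (M e)) (D'.J (tmu D D' N Z Y))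
        = scomp D' F' (D'.J (tmu D D' N Z X)) (M (sins D F Z e))"
    using * tconj_ext[of f "OMap F S" X S Y Z] tconj_ins[of f "OMap F S" X S Y Z]
    by (simp_all add: D.sext_cls D.sins_cls map_cls D'.sext_cls D'.sins_cls D'.pure_comp_left
        D'.pure_comp_right comm_obj)
qed

theorem symmetric_monoidal_sfun: "symmetric_monoidal_functor D.E D'.E (sfun D F D' F' N)"
proof -
  interpret E: symmetric_monoidal_category D.E by (rule D.symmetric_monoidal_scat)
  interpret E': symmetric_monoidal_category D'.E by (rule D'.symmetric_monoidal_scat)
  show ?thesis
  proof
    show "(M f \<odot>\<^bsub>D'.E\<^esub> M g) \<Zcomp>\<^bsub>D'.E\<^esub> TenMap (sfun D F D' F' N) X' Y'
        = TenMap (sfun D F D' F' N) X Y \<Zcomp>\<^bsub>D'.E\<^esub> M (f \<odot>\<^bsub>D.E\<^esub> g)"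
      if f: "f \<in> hom D.E X X'" and g: "g \<in> hom D.E Y Y'" for f X X' g Y Y'
    proof -
      note o = D.fst_hom[OF f] D.fst_hom[OF g]
      note Mf = map_hom_cls[OF f] and Mg = map_hom_cls[OF g]
      have h: "sext D' F' (OMap N Y) (M f) \<in> hom D'.E (OMap N X \<otimes>\<^bsub>D'\<^esub> OMap N Y) (OMap N X' \<otimes>\<^bsub>D'\<^esub>
          OMap N Y)"
        "sins D' F' (OMap N X') (M g) \<in> hom D'.E (OMap N X' \<otimes>\<^bsub>D'\<^esub> OMap N Y) (OMap N X' \<otimes>\<^bsub>D'\<^esub> OMap
            N Y')"
        "M (sext D F Y f) \<in> hom D'.E (OMap N (X \<otimes>\<^bsub>D\<^esub> Y)) (OMap N (X' \<otimes>\<^bsub>D\<^esub> Y))"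
        "M (sins D F X' g) \<in> hom D'.E (OMap N (X' \<otimes>\<^bsub>D\<^esub> Y)) (OMap N (X' \<otimes>\<^bsub>D\<^esub> Y'))"
        using f g Mf Mg o by (auto intro!: map_hom_cls D.sext_hom D.sins_hom D'.sext_hom
            D'.sins_hom)
      have m: "D'.J (tmu D D' N X Y) \<in> hom D'.E (OMap N X \<otimes>\<^bsub>D'\<^esub> OMap N Y) (OMap N (X \<otimes>\<^bsub>D\<^esub> Y))"
        "D'.J (tmu D D' N X' Y) \<in> hom D'.E (OMap N X' \<otimes>\<^bsub>D'\<^esub> OMap N Y) (OMap N (X' \<otimes>\<^bsub>D\<^esub> Y))"
        "D'.J (tmu D D' N X' Y') \<in> hom D'.E (OMap N X' \<otimes>\<^bsub>D'\<^esub> OMap N Y') (OMap N (X' \<otimes>\<^bsub>D\<^esub> Y'))"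
        using o by (auto intro!: D'.pure_hom)
      show ?thesis
        using E'.square_paste[OF h m] map_whisker(1)[OF f] map_whisker(2)[OF g] o
          map_scomp[OF D.sext_hom[OF f] D.sins_hom[OF g]]
        by (simp add: sten_def D'.fst_hom[OF Mf] D'.fst_hom[OF Mg])
    qed
  qed (simp_all add: map_hom_cls map_pure map_scomp D'.pure_iso D'.pure_ten D'.pure_comp mu_assoc
      mu_lunit mu_runit mu_sym)
qed

end

text \<open>The two composites to be compared are the same. Functoriality of the construction
  therefore applies to \<open>F\<close> and yields the endofunctor of the category of
  classes.\<close>

lemma (in monoidal_endofunctor) commuting_self: "commuting_functor D F D F F"
  by unfold_locales (simp add: commutes_with_def mfun_eq_def)

context commuting_functor
begin

text \<open>By \<open>comm_mu\<close> the two double structure maps agree, hence so do their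
  inverses (\<open>i\<close>), and conjugating by \<open>F\<close> and by \<open>N\<close> can be
  done in either order.\<close>

lemma comm_conj:
  assumes "D.sf X Y S f"
  shows "tconj D D' N (OMap F (OMap F S)) (OMap F X) (OMap F S) (OMap F Y) (tconj D D F (OMap F S)
      X S Y f)
    = tconj D' D' F' (OMap F' (OMap N S)) (OMap N X) (OMap N S) (OMap N Y) (tconj D D' N (OMap F
        S) X S Y f)"
proof -
  note [simp] = D.statefulD[OF assms]
  have "tinv D' (tmap D' F' (tmu D D' N S Y)) \<bullet>\<^bsub>D'\<^esub> tinv D' (tmu D' D' F' (OMap N S) (OMap N Y))
    = tinv D' (tmu D' D' F' (OMap N S) (OMap N Y) \<bullet>\<^bsub>D'\<^esub> tmap D' F' (tmu D D' N S Y))"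
    by (simp add: D'.tinv_comp)
  also have "\<dots> = tinv D' (tmap D N (tmu D D F S Y)) \<bullet>\<^bsub>D'\<^esub> tinv D' (tmu D D' N (OMap F S) (OMap F
      Y))"
    by (simp add: D'.tinv_comp flip: comm_mu)
  finally have i: "tinv D' (tmap D N (tmu D D F S Y)) \<bullet>\<^bsub>D'\<^esub> tinv D' (tmu D D' N (OMap F S) (OMap F
      Y))
    = tinv D' (tmap D' F' (tmu D D' N S Y)) \<bullet>\<^bsub>D'\<^esub> tinv D' (tmu D' D' F' (OMap N S) (OMap N Y))" ..
  show ?thesis
    using comm_mu[of "OMap F S" X, THEN D'.tcomp_reassoc]
    by (simp add: tconj_def tmap_comp D'.tmap_comp tmap_inv D'.tmap_inv i comm_obj
        comm_arr[symmetric])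
qed

lemma map_commutes: "commutes_with D.E (sfun D F D F F) D'.E (sfun D' F' D' F' F') (sfun D F D' F'
    N)"
proof -
  interpret FF: commuting_functor D F D F F by (rule D.commuting_self)
  interpret FF': commuting_functor D' F' D' F' F' by (rule D'.commuting_self)
  have arr: "M (AMap (sfun D F D F F) e) = AMap (sfun D' F' D' F' F') (M e)" if "e \<in> Arr D.E" for e
  proof -
    have "e \<in> hom D.E (Dom D.E e) (Cod D.E e)" using that by (simp add: hom_def)
    then obtain X Y S f where *: "D.sf X Y S f" "e = D.cl X Y S f" by (metis D.hom_cls)
    then show ?thesis
      by (simp add: FF.map_cls FF'.map_cls map_cls comm_conj)
        (simp add: comm_obj D.statefulD[OF *(1)])
  qed
  then show ?thesis
    by (simp add: commutes_with_def mfun_eq_def mfun_comp_def comm_obj map_pure FF'.map_pure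
        D'.pure_comp comm_eps comm_mu)
qed

end

section \<open>Feedback\<close>

context symmetric_monoidal_category
begin

lemma ext_pair:
  assumes [simp]: "ok C k" "src k = P \<otimes> (P' \<otimes> X)" "tgt k = Q \<otimes> (Q' \<otimes> Y)"
      "P \<in> Obj C" "P' \<in> Obj C" "X \<in> Obj C" "Q \<in> Obj C" "Q' \<in> Obj C" "Y \<in> Obj C" "Z \<in> Obj C"
  shows "ext C (P \<otimes> P') X (Q \<otimes> Q') Y Z (\<alpha> P P' X \<bullet> k \<bullet> \<beta> Q Q' Y)
    = \<alpha> P P' (X \<otimes> Z) \<bullet> (\<iota> P \<boxtimes> \<beta> P' X Z) \<bullet> ext C P (P' \<otimes> X) Q (Q' \<otimes> Y) Z k
      \<bullet> (\<iota> Q \<boxtimes> \<alpha> Q' Y Z) \<bullet> \<beta> Q Q' (Y \<otimes> Z)"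
proof -
  have 1: "\<beta> (P \<otimes> P') X Z \<bullet> (\<alpha> P P' X \<boxtimes> \<iota> Z) = \<alpha> P P' (X \<otimes> Z) \<bullet> (\<iota> P \<boxtimes> \<beta> P' X Z) \<bullet> \<beta> P (P' \<otimes> X) Z"
    by (simp add: pentagons)
  have 2: "(\<beta> Q Q' Y \<boxtimes> \<iota> Z) \<bullet> \<alpha> (Q \<otimes> Q') Y Z = \<alpha> Q (Q' \<otimes> Y) Z \<bullet> (\<iota> Q \<boxtimes> \<alpha> Q' Y Z) \<bullet> \<beta> Q Q' (Y \<otimes> Z)"
    by (simp add: pentagons)
  show ?thesis using 1[THEN tcomp_reassoc] by (simp add: ext_def whisker 2)
qed

text \<open>The diagram of left tightening. Composing \<open>p\<close> with a body whose wire
  \<open>P''\<close> has joined the state is, up to bracketing, the same as carrying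
  \<open>P''\<close> past \<open>p\<close> as an input and letting it join the state
  afterwards.\<close>

lemma star_pair:
  assumes [simp]: "ok C p" "src p = P \<otimes> W" "tgt p = Q \<otimes> X"
      "P \<in> Obj C" "W \<in> Obj C" "Q \<in> Obj C" "X \<in> Obj C"
      "ok C g" "src g = P' \<otimes> (P'' \<otimes> X)" "tgt g = Q' \<otimes> (Q'' \<otimes> Y)"
      "P' \<in> Obj C" "P'' \<in> Obj C" "Q' \<in> Obj C" "Q'' \<in> Obj C" "Y \<in> Obj C"
  shows "(\<alpha> P P' P'' \<boxtimes> \<iota> W) \<bullet>
      star C P W Q X (P' \<otimes> P'') (Q' \<otimes> Q'') Y p (\<alpha> P' P'' X \<bullet> g \<bullet> \<beta> Q' Q'' Y)
    = \<alpha> (P \<otimes> P') P'' W \<bullet> star C P (P'' \<otimes> W) Q (P'' \<otimes> X) P' Q' (Q'' \<otimes> Y) (ins C P W Q X P'' p) g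
      \<bullet> \<beta> (Q \<otimes> Q') Q'' Y \<bullet> (\<alpha> Q Q' Q'' \<boxtimes> \<iota> Y)"
proof -
  have r: "\<beta> Q Q' (Q'' \<otimes> Y) \<bullet> \<beta> (Q \<otimes> Q') Q'' Y \<bullet> (\<alpha> Q Q' Q'' \<boxtimes> \<iota> Y) = (\<iota> Q \<boxtimes> \<beta> Q' Q'' Y)
      \<bullet> \<beta> Q (Q' \<otimes> Q'') Y"
    using pentagons(4)[of Q Q' Q'' Y, THEN tcomp_reassoc, of "\<alpha> Q Q' Q'' \<boxtimes> \<iota> Y"] by simp
  show ?thesis
    using \<alpha>_pentagon[of P P' P'' W, THEN tcomp_reassoc]
    by (simp add: star_def ins_tensor[of p P W Q X] whisker r)
qed

text \<open>The exchange of the last two factors of a compound state, expressed by the crossing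
  \<open>\<tau>\<close>, which is how it appears in diagrams nested to the right. The second
  equation is the first one solved for the outgoing side.\<close>

lemma swap_coherence:
  assumes [simp]: "P \<in> Obj C" "P' \<in> Obj C" "P'' \<in> Obj C" "X \<in> Obj C"
  shows "((\<alpha> P P' P'' \<bullet> (\<iota> P \<boxtimes> \<sigma> P' P'') \<bullet> \<beta> P P'' P') \<boxtimes> \<iota> X) \<bullet> \<alpha> (P \<otimes> P'') P' X \<bullet> \<alpha> P P'' (P' \<otimes> X)
    = \<alpha> (P \<otimes> P') P'' X \<bullet> \<alpha> P P' (P'' \<otimes> X) \<bullet> (\<iota> P \<boxtimes> \<tau> P' P'' X)" (is ?a)
  and "\<beta> P P' (P'' \<otimes> X) \<bullet> \<beta> (P \<otimes> P') P'' X \<bullet> ((\<alpha> P P' P'' \<bullet> (\<iota> P \<boxtimes> \<sigma> P' P'') \<bullet> \<beta> P P'' P') \<boxtimes> \<iota> X)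
    = (\<iota> P \<boxtimes> \<tau> P' P'' X) \<bullet> \<beta> P P'' (P' \<otimes> X) \<bullet> \<beta> (P \<otimes> P'') P' X" (is ?b)
proof -
  have 1: "(\<beta> P P'' P' \<boxtimes> \<iota> X) \<bullet> \<alpha> (P \<otimes> P'') P' X \<bullet> \<alpha> P P'' (P' \<otimes> X) = \<alpha> P (P'' \<otimes> P') X
      \<bullet> (\<iota> P \<boxtimes> \<alpha> P'' P' X)"
    by (simp flip: \<alpha>_pentagon)
  have 2: "(\<alpha> P P' P'' \<boxtimes> \<iota> X) \<bullet> \<alpha> P (P' \<otimes> P'') X = \<alpha> (P \<otimes> P') P'' X \<bullet> \<alpha> P P' (P'' \<otimes> X)
      \<bullet> (\<iota> P \<boxtimes> \<beta> P' P'' X)"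
    using \<alpha>_pentagon[of P P' P'' X, THEN tcomp_reassoc, of "\<iota> P \<boxtimes> \<beta> P' P'' X"] by simp
  show ?a
    using 2[THEN tcomp_reassoc]
    by (simp add: whisker 1 \<alpha>_natural_whisker[THEN tcomp_reassoc] tswap_def)
  from this[THEN tcomp_reassoc, of "\<beta> P P'' (P' \<otimes> X) \<bullet> \<beta> (P \<otimes> P'') P' X"]
  show ?b by simp
qed

text \<open>The diagram of right tightening. The wire that is fed back stands before the state of
  \<open>q\<close> if feedback is taken first and after it if composition is, so both ends carry an
  exchange.\<close>

lemma star_pair_swap:
  assumes [simp]: "ok C g" "src g = P \<otimes> (P' \<otimes> X)" "tgt g = Q \<otimes> (Q' \<otimes> Y)"
      "P \<in> Obj C" "P' \<in> Obj C" "X \<in> Obj C" "Q \<in> Obj C" "Q' \<in> Obj C" "Y \<in> Obj C"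
      "ok C q" "src q = P'' \<otimes> Y" "tgt q = Q'' \<otimes> Z" "P'' \<in> Obj C" "Q'' \<in> Obj C" "Z \<in> Obj C"
  shows "((\<alpha> P P' P'' \<bullet> (\<iota> P \<boxtimes> \<sigma> P' P'') \<bullet> \<beta> P P'' P') \<boxtimes> \<iota> X) \<bullet> \<alpha> (P \<otimes> P'') P' X
      \<bullet> star C P (P' \<otimes> X) Q (Q' \<otimes> Y) P'' Q'' (Q' \<otimes> Z) g (ins C P'' Y Q'' Z Q' q) \<bullet> \<beta> (Q \<otimes> Q'') Q' Z
    = star C (P \<otimes> P') X (Q \<otimes> Q') Y P'' Q'' Z (\<alpha> P P' X \<bullet> g \<bullet> \<beta> Q Q' Y) q
      \<bullet> ((\<alpha> Q Q' Q'' \<bullet> (\<iota> Q \<boxtimes> \<sigma> Q' Q'') \<bullet> \<beta> Q Q'' Q') \<boxtimes> \<iota> Z)"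
proof -
  have i: "\<iota> Q \<boxtimes> ins C P'' Y Q'' Z Q' q = (\<iota> Q \<boxtimes> \<tau> P'' Q' Y) \<bullet> (\<iota> Q \<boxtimes> (\<iota> Q' \<boxtimes> q))
      \<bullet> (\<iota> Q \<boxtimes> \<tau> Q' Q'' Z)"
    by (simp add: ins_alt whisker)
  have b: "\<beta> Q Q' (P'' \<otimes> Y) \<bullet> (\<iota> (Q \<otimes> Q') \<boxtimes> q) = (\<iota> Q \<boxtimes> (\<iota> Q' \<boxtimes> q)) \<bullet> \<beta> Q Q' (Q'' \<otimes> Z)"
    by (simp add: \<beta>_natural_whisker)
  show ?thesis
    unfolding star_def i using ins_pair[of g P P' X Q Q' Y P''] swap_coherence(1)[of P P' P'' X,
        THEN tcomp_reassoc] b[THEN tcomp_reassoc] swap_coherence(2)[of Q Q' Q'' Z]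
    by simp
qed

text \<open>The arrow on the left, before \<open>Y\<close> is added, is the one along which the
  sliding axiom is slid. With the further wire \<open>Y\<close> it becomes a crossing of states
  followed by the whiskering of \<open>p\<close> by \<open>Y\<close>.\<close>

lemma whisker_swap_coherence:
  assumes [simp]: "ok C p" "src p = B \<otimes> S" "tgt p = U \<otimes> T" "B \<in> Obj C" "S \<in> Obj C" "U \<in> Obj C"
      "T \<in> Obj C"
      "V \<in> Obj C" "Y \<in> Obj C"
  shows "(((\<sigma> B V \<boxtimes> \<iota> S) \<bullet> \<alpha> V B S \<bullet> (\<iota> V \<boxtimes> p) \<bullet> \<beta> V U T) \<boxtimes> \<iota> Y) \<bullet> \<alpha> (V \<otimes> U) T Y \<bullet> \<alpha> V U (T \<otimes> Y)
    = \<alpha> (B \<otimes> V) S Y \<bullet> \<alpha> B V (S \<otimes> Y) \<bullet> \<tau> B V (S \<otimes> Y) \<bullet> (\<iota> V \<boxtimes> ext C B S U T Y p)"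
proof -
  have 1: "(\<beta> V U T \<boxtimes> \<iota> Y) \<bullet> \<alpha> (V \<otimes> U) T Y \<bullet> \<alpha> V U (T \<otimes> Y) = \<alpha> V (U \<otimes> T) Y \<bullet> (\<iota> V \<boxtimes> \<alpha> U T Y)"
    by (simp flip: \<alpha>_pentagon)
  have 2: "(\<alpha> V B S \<boxtimes> \<iota> Y) \<bullet> \<alpha> V (B \<otimes> S) Y = \<alpha> (V \<otimes> B) S Y \<bullet> \<alpha> V B (S \<otimes> Y) \<bullet> (\<iota> V \<boxtimes> \<beta> B S Y)"
    using \<alpha>_pentagon[of V B S Y, THEN tcomp_reassoc, of "\<iota> V \<boxtimes> \<beta> B S Y"] by simp
  show ?thesis
    using 2[THEN tcomp_reassoc]
    by (simp add: whisker 1 \<alpha>_natural_whisker[THEN tcomp_reassoc] tswap_def ext_def)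
qed

end

section \<open>Feedback on classes\<close>

context monoidal_endofunctor
begin

lemma stateful_fbk [simp]:
  assumes "sf (OMap F S \<otimes> X) (S \<otimes> Y) T g" "S \<in> Obj D" "X \<in> Obj D" "Y \<in> Obj D"
  shows "sf X Y (T \<otimes> S) ((\<mu>' T S \<boxtimes> \<iota> X) \<bullet> \<alpha> (OMap F T) (OMap F S) X \<bullet> g \<bullet> \<beta> T S Y)"
  using assms by (simp add: stateful_def)

lemma fbk_cls:
  assumes "sf (OMap F S \<otimes> X) (S \<otimes> Y) T g" "S \<in> Obj D" "X \<in> Obj D" "Y \<in> Obj D"
  shows "sfbk D F S X Y (cl (OMap F S \<otimes> X) (S \<otimes> Y) T g)
    = cl X Y (T \<otimes> S) ((\<mu>' T S \<boxtimes> \<iota> X) \<bullet> \<alpha> (OMap F T) (OMap F S) X \<bullet> g \<bullet> \<beta> T S Y)"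
  unfolding sfbk_def
proof (rule lift_cls[OF assms(1)], unfold invariant_def, intro allI impI)
  fix r h assume A [simp]: "ok D r" "ok D h" "src h = OMap F (tgt r) \<otimes> (OMap F S \<otimes> X)" "tgt h
      = src r \<otimes> (S \<otimes> Y)"
  note [simp] = statefulD[OF assms(1)] assms(2-) ok_obj[of r]
  let ?h = "(\<mu>' (tgt r) S \<boxtimes> \<iota> X) \<bullet> \<alpha> (OMap F (tgt r)) (OMap F S) X \<bullet> h \<bullet> \<beta> (src r) S Y"
  have "(\<mu>' (src r) S \<boxtimes> \<iota> X) \<bullet> \<alpha> (OMap F (src r)) (OMap F S) X \<bullet> ((\<Phi> r \<boxtimes> \<iota> (OMap F S \<otimes> X)) \<bullet> h)
      \<bullet> \<beta> (src r) S Y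
    = (\<Phi> (r \<boxtimes> \<iota> S) \<boxtimes> \<iota> X) \<bullet> ?h"
    using mu_inv_natural_whisker(1)[of r "src r" "tgt r" S X, THEN tcomp_reassoc]
      \<alpha>_natural_whisker(1)[of "\<Phi> r" "OMap F S" X "OMap F (tgt r)"
          "OMap F (src r)", THEN tcomp_reassoc]
    by simp
  moreover have "(\<mu>' (tgt r) S \<boxtimes> \<iota> X) \<bullet> \<alpha> (OMap F (tgt r)) (OMap F S) X \<bullet> (h \<bullet> (r \<boxtimes> \<iota> (S \<otimes> Y)))
      \<bullet> \<beta> (tgt r) S Y
    = ?h \<bullet> ((r \<boxtimes> \<iota> S) \<boxtimes> \<iota> Y)"
    by (simp add: \<beta>_natural_whisker)
  ultimately show "cl X Y (src r \<otimes> S) ((\<mu>' (src r) S \<boxtimes> \<iota> X) \<bullet> \<alpha> (OMap F (src r)) (OMap F S) X \<bullet>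
      ((\<Phi> r \<boxtimes> \<iota> (OMap F S \<otimes> X)) \<bullet> h) \<bullet> \<beta> (src r) S Y)
    = cl X Y (tgt r \<otimes> S) ((\<mu>' (tgt r) S \<boxtimes> \<iota> X) \<bullet> \<alpha> (OMap F (tgt r)) (OMap F S) X \<bullet>
      (h \<bullet> (r \<boxtimes> \<iota> (S \<otimes> Y))) \<bullet> \<beta> (tgt r) S Y)"
    using slide[of X Y "r \<boxtimes> \<iota> S" "src r \<otimes> S" "tgt r \<otimes> S" ?h] by simp
qed

lemma sfbk_hom:
  "\<lbrakk>e \<in> hom E (OMap F S \<otimes> X) (S \<otimes> Y); S \<in> Obj D; X \<in> Obj D; Y \<in> Obj D\<rbrakk>
      \<Longrightarrow> sfbk D F S X Y e \<in> hom E X Y"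
  by (elim hom_cls) (simp add: fbk_cls cls_hom)

text \<open>The states are \<open>U \<otimes> (T \<otimes> S)\<close> if feedback is taken first and
  \<open>(U \<otimes> T) \<otimes> S\<close> if composition is. The slide is along the associator,
  and \<open>star_pair\<close> is its square.\<close>

lemma sfbk_tight_left:
  assumes "e \<in> hom E (OMap F S \<otimes> X) (S \<otimes> Y)" "u \<in> hom E W X" "S \<in> Obj D" "Y \<in> Obj D"
  shows "scomp D F u (sfbk D F S X Y e) = sfbk D F S W Y (scomp D F (sins D F (OMap F S) u) e)"
proof -
  obtain T g U p where *: "sf (OMap F S \<otimes> X) (S \<otimes> Y) T g" "e = cl (OMap F S \<otimes> X) (S \<otimes> Y) T g"
    "sf W X U p" "u = cl W X U p" using assms(1,2) by (elim hom_cls)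
  note [simp] = statefulD[OF *(1)] statefulD[OF *(3)] assms(3,4)
  let ?g = "\<alpha> (OMap F T) (OMap F S) X \<bullet> g \<bullet> \<beta> T S Y"
  let ?p = "ins D (OMap F U) W U X (OMap F S) p"
  have f: "sf X Y (T \<otimes> S) ((\<mu>' T S \<boxtimes> \<iota> X) \<bullet> ?g)" and p: "sf (OMap F S \<otimes> W) (OMap F S \<otimes> X) U ?p"
    using * by simp_all
  have n: "star D (OMap F U) W U X (OMap F (T \<otimes> S)) (T \<otimes> S) Y p ((\<mu>' T S \<boxtimes> \<iota> X) \<bullet> ?g)
    = ((\<iota> (OMap F U) \<boxtimes> \<mu>' T S) \<boxtimes> \<iota> W) \<bullet> star D (OMap F U) W U X (OMap F T \<otimes> OMap F S) (T \<otimes> S) Y p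
        ?g"
    using star_natural_right[of p "OMap F U" W U X ?g "OMap F T \<otimes> OMap F S" "T \<otimes> S" Y "\<mu>' T S"
        "OMap F (T \<otimes> S)" "\<iota> (T \<otimes> S)" "T \<otimes> S"]
    by simp
  have m: "(\<Phi> (\<alpha> U T S) \<boxtimes> \<iota> W) \<bullet> (\<mu>' U (T \<otimes> S) \<boxtimes> \<iota> W) \<bullet> ((\<iota> (OMap F U) \<boxtimes> \<mu>' T S) \<boxtimes> \<iota> W)
    = (\<mu>' (U \<otimes> T) S \<boxtimes> \<iota> W) \<bullet> ((\<mu>' U T \<boxtimes> \<iota> (OMap F S)) \<boxtimes> \<iota> W)
        \<bullet> (\<alpha> (OMap F U) (OMap F T) (OMap F S) \<boxtimes> \<iota> W)"
    by (simp add: mu_inv_\<alpha> flip: whisker)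
  have s: "sf (OMap F S \<otimes> W) (S \<otimes> Y) (U \<otimes> T) ((\<mu>' U T \<boxtimes> \<iota> (OMap F S \<otimes> W)) \<bullet>
       star D (OMap F U) (OMap F S \<otimes> W) U (OMap F S \<otimes> X) (OMap F T) T (S \<otimes> Y) ?p g)"
    using p *(1) by simp
  have "cl W Y ((U \<otimes> T) \<otimes> S) ((\<mu>' (U \<otimes> T) S \<boxtimes> \<iota> W) \<bullet> \<alpha> (OMap F (U \<otimes> T)) (OMap F S) W
      \<bullet> ((\<mu>' U T \<boxtimes> \<iota> (OMap F S \<otimes> W)) \<bullet>
       star D (OMap F U) (OMap F S \<otimes> W) U (OMap F S \<otimes> X) (OMap F T) T (S \<otimes> Y) ?p g) \<bullet> \<beta> (U \<otimes> T) S Y)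
    = cl W Y (U \<otimes> (T \<otimes> S)) ((\<mu>' U (T \<otimes> S) \<boxtimes> \<iota> W) \<bullet> star D (OMap F U) W U X (OMap F (T \<otimes> S)) (T \<otimes>
        S) Y p ((\<mu>' T S \<boxtimes> \<iota> X) \<bullet> ?g))"
  proof (rule slide_iso[OF stateful_fbk[OF s] stateful_comp[OF *(3) f], where r = "\<alpha> U T S"])
    show "(\<Phi> (\<alpha> U T S) \<boxtimes> \<iota> W) \<bullet> (\<mu>' U (T \<otimes> S) \<boxtimes> \<iota> W) \<bullet> star D (OMap F U) W U X (OMap F (T \<otimes> S)) (T
        \<otimes> S) Y p ((\<mu>' T S \<boxtimes> \<iota> X) \<bullet> ?g)
      = ((\<mu>' (U \<otimes> T) S \<boxtimes> \<iota> W) \<bullet> \<alpha> (OMap F (U \<otimes> T)) (OMap F S) W \<bullet> ((\<mu>' U T \<boxtimes> \<iota> (OMap F S \<otimes> W)) \<bullet>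
       star D (OMap F U) (OMap F S \<otimes> W) U (OMap F S \<otimes> X) (OMap F T) T (S \<otimes> Y) ?p g)
           \<bullet> \<beta> (U \<otimes> T) S Y) \<bullet> (\<alpha> U T S \<boxtimes> \<iota> Y)"
      unfolding n using m[THEN tcomp_reassoc] star_pair[of p "OMap F U" W U X g "OMap F T"
          "OMap F S" T S Y]
        \<alpha>_natural_whisker(1)[of "\<mu>' U T" "OMap F S" W "OMap F U \<otimes> OMap F T"
            "OMap F (U \<otimes> T)", symmetric, THEN tcomp_reassoc]
      by simp
  qed simp_all
  then show ?thesis
    using * f p s by (simp add: fbk_cls scomp_cls sins_cls)
qed

text \<open>The states are \<open>(T \<otimes> S) \<otimes> V\<close> if feedback is taken first and
  \<open>(T \<otimes> V) \<otimes> S\<close> if composition is. The slide is along the exchange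
  \<open>?k\<close>; monoidality and symmetry of \<open>F\<close> identify its image with the
  exchange \<open>?k'\<close> of the incoming states.\<close>

lemma sfbk_tight_right:
  assumes "e \<in> hom E (OMap F S \<otimes> X) (S \<otimes> Y)" "v \<in> hom E Y Z" "S \<in> Obj D" "X \<in> Obj D"
  shows "scomp D F (sfbk D F S X Y e) v = sfbk D F S X Z (scomp D F e (sins D F S v))"
proof -
  obtain T g V q where *: "sf (OMap F S \<otimes> X) (S \<otimes> Y) T g" "e = cl (OMap F S \<otimes> X) (S \<otimes> Y) T g"
    "sf Y Z V q" "v = cl Y Z V q" using assms(1,2) by (elim hom_cls)
  note [simp] = statefulD[OF *(1)] statefulD[OF *(3)] assms(3,4)
  let ?g = "\<alpha> (OMap F T) (OMap F S) X \<bullet> g \<bullet> \<beta> T S Y"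
  let ?q = "ins D (OMap F V) Y V Z S q"
  let ?s = "star D (OMap F T) (OMap F S \<otimes> X) T (S \<otimes> Y) (OMap F V) V (S \<otimes> Z) g ?q"
  let ?k = "\<alpha> T S V \<bullet> (\<iota> T \<boxtimes> \<sigma> S V) \<bullet> \<beta> T V S"
  let ?k' = "\<alpha> (OMap F T) (OMap F S) (OMap F V) \<bullet> (\<iota> (OMap F T) \<boxtimes> \<sigma> (OMap F S) (OMap F V))
      \<bullet> \<beta> (OMap F T) (OMap F V) (OMap F S)"
  have f: "sf X Y (T \<otimes> S) ((\<mu>' T S \<boxtimes> \<iota> X) \<bullet> ?g)" and q: "sf (S \<otimes> Y) (S \<otimes> Z) V ?q"
    using * by simp_all
  have s: "sf (OMap F S \<otimes> X) (S \<otimes> Z) (T \<otimes> V) ((\<mu>' T V \<boxtimes> \<iota> (OMap F S \<otimes> X)) \<bullet> ?s)"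
    using q *(1) by simp
  have n: "star D (OMap F (T \<otimes> S)) X (T \<otimes> S) Y (OMap F V) V Z ((\<mu>' T S \<boxtimes> \<iota> X) \<bullet> ?g) q
    = ((\<mu>' T S \<boxtimes> \<iota> (OMap F V)) \<boxtimes> \<iota> X) \<bullet> star D (OMap F T \<otimes> OMap F S) X (T \<otimes> S) Y (OMap F V) V Z ?g
        q"
    using star_natural_left[of ?g "OMap F T \<otimes> OMap F S" X "T \<otimes> S" Y q "OMap F V" V Z "\<mu>' T S"
        "OMap F (T \<otimes> S)" "\<iota> (T \<otimes> S)" "T \<otimes> S"]
    by simp
  have "\<Phi> (\<iota> T \<boxtimes> \<sigma> S V) \<bullet> \<mu>' T (V \<otimes> S) \<bullet> (\<iota> (OMap F T) \<boxtimes> \<mu>' V S)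
    = \<mu>' T (S \<otimes> V) \<bullet> (\<iota> (OMap F T) \<boxtimes> \<mu>' S V) \<bullet> (\<iota> (OMap F T) \<boxtimes> \<sigma> (OMap F S) (OMap F V))"
    using mu_inv_natural[of "\<iota> T" "\<sigma> S V" T T "S \<otimes> V" "V \<otimes> S", THEN tcomp_reassoc]
    by (simp add: mu_inv_\<sigma> flip: whisker)
  note m1 = this[THEN tcomp_reassoc]
  have "\<Phi> ?k \<bullet> \<mu>' (T \<otimes> V) S \<bullet> (\<mu>' T V \<boxtimes> \<iota> (OMap F S)) = \<mu>' (T \<otimes> S) V \<bullet> (\<mu>' T S \<boxtimes> \<iota> (OMap F V))
      \<bullet> ?k'"
    using m1 mu_inv_\<alpha>(1)[of T S V, THEN tcomp_reassoc] by (simp add: tmap_comp mu_inv_\<alpha>(2))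
  then have m: "(\<Phi> ?k \<boxtimes> \<iota> X) \<bullet> (\<mu>' (T \<otimes> V) S \<boxtimes> \<iota> X) \<bullet> ((\<mu>' T V \<boxtimes> \<iota> (OMap F S)) \<boxtimes> \<iota> X)
    = (\<mu>' (T \<otimes> S) V \<boxtimes> \<iota> X) \<bullet> ((\<mu>' T S \<boxtimes> \<iota> (OMap F V)) \<boxtimes> \<iota> X) \<bullet> (?k' \<boxtimes> \<iota> X)"
    by (simp flip: whisker)
  have "cl X Z ((T \<otimes> S) \<otimes> V) ((\<mu>' (T \<otimes> S) V \<boxtimes> \<iota> X) \<bullet> star D (OMap F (T \<otimes> S)) X (T \<otimes> S) Y (OMap F
      V) V Z ((\<mu>' T S \<boxtimes> \<iota> X) \<bullet> ?g) q)
    = cl X Z ((T \<otimes> V) \<otimes> S) ((\<mu>' (T \<otimes> V) S \<boxtimes> \<iota> X) \<bullet> \<alpha> (OMap F (T \<otimes> V)) (OMap F S) X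
        \<bullet> ((\<mu>' T V \<boxtimes> \<iota> (OMap F S \<otimes> X)) \<bullet> ?s)
      \<bullet> \<beta> (T \<otimes> V) S Z)"
  proof (rule slide_iso[OF stateful_comp[OF f *(3)] stateful_fbk[OF s], where r = ?k])
    show "(\<Phi> ?k \<boxtimes> \<iota> X) \<bullet> (\<mu>' (T \<otimes> V) S \<boxtimes> \<iota> X) \<bullet> \<alpha> (OMap F (T \<otimes> V)) (OMap F S) X
        \<bullet> ((\<mu>' T V \<boxtimes> \<iota> (OMap F S \<otimes> X)) \<bullet> ?s)
      \<bullet> \<beta> (T \<otimes> V) S Z
      = ((\<mu>' (T \<otimes> S) V \<boxtimes> \<iota> X) \<bullet> star D (OMap F (T \<otimes> S)) X (T \<otimes> S) Y (OMap F V) V Z ((\<mu>' T S \<boxtimes> \<iota> X)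
          \<bullet> ?g) q) \<bullet> (?k \<boxtimes> \<iota> Z)"
      unfolding n
      using m[THEN tcomp_reassoc] star_pair_swap[of g "OMap F T" "OMap F S" X T S Y q
          "OMap F V" V Z]
        \<alpha>_natural_whisker(1)[of "\<mu>' T V" "OMap F S" X "OMap F T \<otimes> OMap F V"
            "OMap F (T \<otimes> V)", symmetric, THEN tcomp_reassoc]
      by simp
  qed simp_all
  then show ?thesis
    using * f q s by (simp add: fbk_cls scomp_cls sins_cls)
qed

text \<open>Feedback over the unit leaves the state \<open>T \<otimes> I\<close>, and sliding along
  \<open>\<r> T\<close> removes the unit. The unit map in the conclusion cancels the inverse unit
  map contained in the image of \<open>\<r> T\<close>.\<close>

lemma sfbk_vanish:
  assumes "e \<in> hom E (OMap F (Unit D) \<otimes> X) (Unit D \<otimes> Y)" "X \<in> Obj D" "Y \<in> Obj D"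
  shows "sfbk D F (Unit D) X Y e = scomp D F (scomp D F (J (tinv D (\<l> X) \<bullet> (\<epsilon> \<boxtimes> \<iota> X))) e) (J (\<l> Y))"
proof -
  obtain T g where *: "sf (OMap F (Unit D) \<otimes> X) (Unit D \<otimes> Y) T g" "e
      = cl (OMap F (Unit D) \<otimes> X) (Unit D \<otimes> Y) T g"
    using assms(1) by (elim hom_cls)
  note [simp] = statefulD[OF *(1)] assms(2,3)
  let ?u = "tinv D (\<l> X) \<bullet> (\<epsilon> \<boxtimes> \<iota> X)"
  have s: "sf X (Unit D \<otimes> Y) T ((\<iota> (OMap F T) \<boxtimes> ?u) \<bullet> g)" by (simp add: stateful_def)
  have "((\<iota> (OMap F T) \<boxtimes> tinv D \<epsilon>) \<boxtimes> \<iota> X) \<bullet> (\<r> (OMap F T) \<boxtimes> \<iota> X) \<bullet> (\<iota> (OMap F T) \<boxtimes> ?u)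
    = \<alpha> (OMap F T) (OMap F (Unit D)) X"
  proof -
    have "(\<iota> (OMap F T) \<boxtimes> (tinv D \<epsilon> \<boxtimes> \<iota> X)) \<bullet> (\<iota> (OMap F T) \<boxtimes> (\<epsilon> \<boxtimes> \<iota> X))
      = \<iota> (OMap F T \<otimes> (OMap F (Unit D) \<otimes> X))"
      by (simp flip: whisker)
    then show ?thesis
      by (simp add: \<alpha>_natural_whisker[THEN tcomp_reassoc] whisker_cancel whisker flip: \<alpha>_triangle)
  qed
  note r = this[THEN tcomp_reassoc]
  have "cl X Y (T \<otimes> Unit D) ((\<mu>' T (Unit D) \<boxtimes> \<iota> X) \<bullet> \<alpha> (OMap F T) (OMap F (Unit D)) X \<bullet> g
      \<bullet> \<beta> T (Unit D) Y)
    = cl X Y T ((\<iota> (OMap F T) \<boxtimes> ?u) \<bullet> g \<bullet> (\<iota> T \<boxtimes> \<l> Y))"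
  proof (rule slide_iso[OF stateful_fbk[OF *(1)], where r = "\<r> T"])
    show "(\<Phi> (\<r> T) \<boxtimes> \<iota> X) \<bullet> (\<iota> (OMap F T) \<boxtimes> ?u) \<bullet> g \<bullet> (\<iota> T \<boxtimes> \<l> Y)
      = ((\<mu>' T (Unit D) \<boxtimes> \<iota> X) \<bullet> \<alpha> (OMap F T) (OMap F (Unit D)) X \<bullet> g \<bullet> \<beta> T (Unit D) Y)
          \<bullet> (\<r> T \<boxtimes> \<iota> Y)"
      unfolding tmap_\<r>[OF statefulD(3)[OF *(1)]] whisker_right_comp using r by
          (simp add: whisker_right_comp flip: \<alpha>_triangle)
  qed (simp_all add: stateful_def)
  then show ?thesis
    using * s by (simp add: fbk_cls pure_comp_left pure_comp_right)
qed

text \<open>Nested feedback appends the wires one by one to \<open>U\<close>, joint feedback appends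
  \<open>S \<otimes> T\<close> at once; the slide is along the associator.\<close>

lemma sfbk_join:
  assumes "e \<in> hom E (OMap F S \<otimes> (OMap F T \<otimes> X)) (S \<otimes> (T \<otimes> Y))" "S \<in> Obj D" "T \<in> Obj D"
      "X \<in> Obj D" "Y \<in> Obj D"
  shows "sfbk D F T X Y (sfbk D F S (OMap F T \<otimes> X) (T \<otimes> Y) e)
    = sfbk D F (S \<otimes> T) X Y (scomp D F (scomp D F (J ((\<mu>' S T \<boxtimes> \<iota> X)
        \<bullet> \<alpha> (OMap F S) (OMap F T) X)) e) (J (\<beta> S T Y)))"
proof -
  obtain U g where *: "sf (OMap F S \<otimes> (OMap F T \<otimes> X)) (S \<otimes> (T \<otimes> Y)) U g"
    "e = cl (OMap F S \<otimes> (OMap F T \<otimes> X)) (S \<otimes> (T \<otimes> Y)) U g"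
    using assms(1) by (elim hom_cls)
  note [simp] = statefulD[OF *(1)] assms(2-)
  let ?u = "(\<mu>' S T \<boxtimes> \<iota> X) \<bullet> \<alpha> (OMap F S) (OMap F T) X"
  have s: "sf (OMap F (S \<otimes> T) \<otimes> X) (S \<otimes> (T \<otimes> Y)) U ((\<iota> (OMap F U) \<boxtimes> ?u) \<bullet> g)"
    "sf (OMap F (S \<otimes> T) \<otimes> X) ((S \<otimes> T) \<otimes> Y) U ((\<iota> (OMap F U) \<boxtimes> ?u) \<bullet> g \<bullet> (\<iota> U \<boxtimes> \<beta> S T Y))"
    by (simp_all add: stateful_def)
  have f: "sf (OMap F T \<otimes> X) (T \<otimes> Y) (U \<otimes> S) ((\<mu>' U S \<boxtimes> \<iota> (OMap F T \<otimes> X))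
      \<bullet> \<alpha> (OMap F U) (OMap F S) (OMap F T \<otimes> X)
      \<bullet> g \<bullet> \<beta> U S (T \<otimes> Y))"
    using * by simp
  have m: "(\<Phi> (\<alpha> U S T) \<boxtimes> \<iota> X) \<bullet> (\<mu>' U (S \<otimes> T) \<boxtimes> \<iota> X) \<bullet> ((\<iota> (OMap F U) \<boxtimes> \<mu>' S T) \<boxtimes> \<iota> X)
    = (\<mu>' (U \<otimes> S) T \<boxtimes> \<iota> X) \<bullet> ((\<mu>' U S \<boxtimes> \<iota> (OMap F T)) \<boxtimes> \<iota> X)
        \<bullet> (\<alpha> (OMap F U) (OMap F S) (OMap F T) \<boxtimes> \<iota> X)"
    by (simp add: mu_inv_\<alpha> flip: whisker)
  have r: "\<beta> U S (T \<otimes> Y) \<bullet> \<beta> (U \<otimes> S) T Y \<bullet> (\<alpha> U S T \<boxtimes> \<iota> Y) = (\<iota> U \<boxtimes> \<beta> S T Y) \<bullet> \<beta> U (S \<otimes> T) Y"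
    using pentagons(4)[of U S T Y, THEN tcomp_reassoc, of "\<alpha> U S T \<boxtimes> \<iota> Y"] by simp
  have "cl X Y ((U \<otimes> S) \<otimes> T) ((\<mu>' (U \<otimes> S) T \<boxtimes> \<iota> X) \<bullet> \<alpha> (OMap F (U \<otimes> S)) (OMap F T) X \<bullet>
      ((\<mu>' U S \<boxtimes> \<iota> (OMap F T \<otimes> X)) \<bullet> \<alpha> (OMap F U) (OMap F S) (OMap F T \<otimes> X) \<bullet> g \<bullet> \<beta> U S (T \<otimes> Y))
          \<bullet> \<beta> (U \<otimes> S) T Y)
    = cl X Y (U \<otimes> (S \<otimes> T)) ((\<mu>' U (S \<otimes> T) \<boxtimes> \<iota> X) \<bullet> \<alpha> (OMap F U) (OMap F (S \<otimes> T)) X \<bullet>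
      ((\<iota> (OMap F U) \<boxtimes> ?u) \<bullet> g \<bullet> (\<iota> U \<boxtimes> \<beta> S T Y)) \<bullet> \<beta> U (S \<otimes> T) Y)"
  proof (rule slide_iso[OF stateful_fbk[OF f] stateful_fbk[OF s(2)], where r = "\<alpha> U S T"])
    show "(\<Phi> (\<alpha> U S T) \<boxtimes> \<iota> X) \<bullet> (\<mu>' U (S \<otimes> T) \<boxtimes> \<iota> X) \<bullet> \<alpha> (OMap F U) (OMap F (S \<otimes> T)) X \<bullet>
      ((\<iota> (OMap F U) \<boxtimes> ?u) \<bullet> g \<bullet> (\<iota> U \<boxtimes> \<beta> S T Y)) \<bullet> \<beta> U (S \<otimes> T) Y
     = ((\<mu>' (U \<otimes> S) T \<boxtimes> \<iota> X) \<bullet> \<alpha> (OMap F (U \<otimes> S)) (OMap F T) X \<bullet>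
      ((\<mu>' U S \<boxtimes> \<iota> (OMap F T \<otimes> X)) \<bullet> \<alpha> (OMap F U) (OMap F S) (OMap F T \<otimes> X) \<bullet> g \<bullet> \<beta> U S (T \<otimes> Y))
          \<bullet> \<beta> (U \<otimes> S) T Y)
        \<bullet> (\<alpha> U S T \<boxtimes> \<iota> Y)"
      using m[THEN tcomp_reassoc] \<alpha>_pentagon[of "OMap F U" "OMap F S"
          "OMap F T" X, THEN tcomp_reassoc]
        \<alpha>_natural_whisker(2)[of "\<mu>' S T" "OMap F U" X "OMap F S \<otimes> OMap F T"
            "OMap F (S \<otimes> T)", symmetric, THEN tcomp_reassoc]
        \<alpha>_natural_whisker(1)[of "\<mu>' U S" "OMap F T" X "OMap F U \<otimes> OMap F S"
            "OMap F (U \<otimes> S)", symmetric, THEN tcomp_reassoc]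
      by (simp add: whisker_left_comp r)
  qed simp_all
  then show ?thesis
    using * s f by (simp add: fbk_cls pure_comp_left pure_comp_right)
qed

text \<open>Strength for an identity on the right. Both sides have state
  \<open>T \<otimes> S\<close> and equal bodies by \<open>ext_pair\<close>, so nothing is slid. A
  general arrow on the right is added later by tightening.\<close>

lemma sfbk_ext:
  assumes "e \<in> hom E (OMap F S \<otimes> X) (S \<otimes> Y)" "S \<in> Obj D" "X \<in> Obj D" "Y \<in> Obj D" "Z \<in> Obj D"
  shows "sext D F Z (sfbk D F S X Y e)
    = sfbk D F S (X \<otimes> Z) (Y \<otimes> Z) (scomp D F (scomp D F (J (\<beta> (OMap F S) X Z)) (sext D F Z e)) (J
        (\<alpha> S Y Z)))"
proof -
  obtain T g where *: "sf (OMap F S \<otimes> X) (S \<otimes> Y) T g" "e = cl (OMap F S \<otimes> X) (S \<otimes> Y) T g"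
    using assms(1) by (elim hom_cls)
  note [simp] = statefulD[OF *(1)] assms(2-)
  let ?e = "ext D (OMap F T) (OMap F S \<otimes> X) T (S \<otimes> Y) Z g"
  have s: "sf (OMap F S \<otimes> (X \<otimes> Z)) ((S \<otimes> Y) \<otimes> Z) T ((\<iota> (OMap F T) \<boxtimes> \<beta> (OMap F S) X Z) \<bullet> ?e)"
    "sf (OMap F S \<otimes> (X \<otimes> Z)) (S \<otimes> (Y \<otimes> Z)) T ((\<iota> (OMap F T) \<boxtimes> \<beta> (OMap F S) X Z) \<bullet> ?e
        \<bullet> (\<iota> T \<boxtimes> \<alpha> S Y Z))"
    by (simp_all add: stateful_def)
  have f: "sf X Y (T \<otimes> S) ((\<mu>' T S \<boxtimes> \<iota> X) \<bullet> \<alpha> (OMap F T) (OMap F S) X \<bullet> g \<bullet> \<beta> T S Y)"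
    using * by simp
  have "ext D (OMap F (T \<otimes> S)) X (T \<otimes> S) Y Z ((\<mu>' T S \<boxtimes> \<iota> X) \<bullet> \<alpha> (OMap F T) (OMap F S) X \<bullet> g
      \<bullet> \<beta> T S Y)
    = (\<mu>' T S \<boxtimes> \<iota> (X \<otimes> Z)) \<bullet> ext D (OMap F T \<otimes> OMap F S) X (T \<otimes> S) Y Z (\<alpha> (OMap F T) (OMap F S) X
        \<bullet> g \<bullet> \<beta> T S Y)"
    using ext_natural[of "\<alpha> (OMap F T) (OMap F S) X \<bullet> g \<bullet> \<beta> T S Y" "OMap F T \<otimes> OMap F S" X
        "T \<otimes> S" Y Z
      "\<mu>' T S" "\<iota> X" "\<iota> (T \<otimes> S)" "\<iota> Y" "OMap F (T \<otimes> S)" X "T \<otimes> S" Y] by simp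
  then show ?thesis
    using * f s by (simp add: fbk_cls sext_cls pure_comp_left pure_comp_right ext_pair)
qed

text \<open>The arrow \<open>h\<close> has a state \<open>U\<close> of its own, with body
  \<open>p : F U \<otimes> S \<rightarrow> U \<otimes> T\<close>. Its image under the endofunctor
  has state \<open>F U\<close>, written \<open>?B\<close>, so \<open>p\<close> itself is an arrow
  from the states on the left to those on the right. It need not be invertible:
  \<open>slide_iso\<close> is of no help and the common factor has to be given explicitly.\<close>

lemma sfbk_slide:
  assumes "h \<in> hom E S T" "e \<in> hom E (OMap F T \<otimes> X) (S \<otimes> Y)" "X \<in> Obj D" "Y \<in> Obj D"
  shows "sfbk D F S X Y (scomp D F (sext D F X (AMap (sfun D F D F F) h)) e)
      = sfbk D F T X Y (scomp D F e (sext D F Y h))"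
proof -
  interpret FF: commuting_functor D F D F F by (rule commuting_self)
  obtain U p V q where *: "sf S T U p" "h = cl S T U p"
    "sf (OMap F T \<otimes> X) (S \<otimes> Y) V q" "e = cl (OMap F T \<otimes> X) (S \<otimes> Y) V q"
    using assms(1,2) by (elim hom_cls)
  note [simp] = statefulD[OF *(1)] statefulD[OF *(3)] assms(3,4)
  let ?B = "OMap F U"
  let ?p = "tconj D D F ?B S U T p"
  let ?ep = "ext D (OMap F ?B) (OMap F S) ?B (OMap F T) X ?p"
  let ?eq = "ext D ?B S U T Y p"
  have s: "sf (OMap F S) (OMap F T) ?B ?p" using FF.stateful_conj[OF *(1)] .
  have ep: "sf (OMap F S \<otimes> X) (OMap F T \<otimes> X) ?B ?ep" using s by simp
  have eq: "sf (S \<otimes> Y) (T \<otimes> Y) U ?eq" using * by simp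
  have l: "sf (OMap F S \<otimes> X) (S \<otimes> Y) (?B \<otimes> V) ((\<mu>' ?B V \<boxtimes> \<iota> (OMap F S \<otimes> X)) \<bullet>
      star D (OMap F ?B) (OMap F S \<otimes> X) ?B (OMap F T \<otimes> X) (OMap F V) V (S \<otimes> Y) ?ep q)"
    using ep * by simp
  have r: "sf (OMap F T \<otimes> X) (T \<otimes> Y) (V \<otimes> U) ((\<mu>' V U \<boxtimes> \<iota> (OMap F T \<otimes> X)) \<bullet>
      star D (OMap F V) (OMap F T \<otimes> X) V (S \<otimes> Y) ?B U (T \<otimes> Y) q ?eq)"
    using eq * by simp
  \<comment> \<open>Up to coherence the two sides differ by sliding \<open>p\<close>, whiskered by the state \<open>V\<close> of \<open>e\<close>.\<close>
  let ?r = "(\<sigma> ?B V \<boxtimes> \<iota> S) \<bullet> \<alpha> V ?B S \<bullet> (\<iota> V \<boxtimes> p) \<bullet> \<beta> V U T"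
  let ?r' = "(\<sigma> (OMap F ?B) (OMap F V) \<boxtimes> \<iota> (OMap F S)) \<bullet> \<alpha> (OMap F V) (OMap F ?B) (OMap F S)
      \<bullet> (\<iota> (OMap F V) \<boxtimes> ?p)
    \<bullet> \<beta> (OMap F V) ?B (OMap F T)"
  let ?c = "ins D (OMap F V) (OMap F T \<otimes> X) V (S \<otimes> Y) ?B q \<bullet> \<tau> V ?B (S \<otimes> Y) \<bullet> \<beta> ?B V (S \<otimes> Y)
      \<bullet> \<beta> (?B \<otimes> V) S Y"
  \<comment> \<open>The common factor: \<open>L\<close> and \<open>R\<close> show that the two
    bodies are \<open>?h\<close> preceded by the image of \<open>?r\<close> and \<open>?h\<close>
    followed by \<open>?r\<close>.\<close>
  let ?h = "(\<mu>' (V \<otimes> U) T \<boxtimes> \<iota> X) \<bullet> ((\<mu>' V U \<boxtimes> \<iota> (OMap F T)) \<boxtimes> \<iota> X) \<bullet> \<alpha> (OMap F V \<otimes> ?B) (OMap F T) X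
    \<bullet> \<alpha> (OMap F V) ?B (OMap F T \<otimes> X) \<bullet> ?c"
  have 1: "\<Phi> p \<bullet> \<mu>' U T = \<mu>' ?B S \<bullet> ?p" by (simp add: tconj_def)
  have 2: "\<Phi> (\<iota> V \<boxtimes> p) \<bullet> \<mu>' V (U \<otimes> T) \<bullet> (\<iota> (OMap F V) \<boxtimes> \<mu>' U T)
    = \<mu>' V (?B \<otimes> S) \<bullet> (\<iota> (OMap F V) \<boxtimes> \<mu>' ?B S) \<bullet> (\<iota> (OMap F V) \<boxtimes> ?p)"
    using mu_inv_natural[of "\<iota> V" p V V "?B \<otimes> S" "U \<otimes> T", THEN tcomp_reassoc] by (simp add: 1
        flip: whisker)
  have 3: "\<Phi> (\<sigma> ?B V \<boxtimes> \<iota> S) \<bullet> \<mu>' (V \<otimes> ?B) S \<bullet> (\<mu>' V ?B \<boxtimes> \<iota> (OMap F S))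
    = \<mu>' (?B \<otimes> V) S \<bullet> (\<mu>' ?B V \<boxtimes> \<iota> (OMap F S)) \<bullet> (\<sigma> (OMap F ?B) (OMap F V) \<boxtimes> \<iota> (OMap F S))"
    using mu_inv_natural[of "\<sigma> ?B V" "\<iota> S" "?B \<otimes> V" "V \<otimes> ?B" S S, THEN tcomp_reassoc] by
        (simp add: mu_inv_\<sigma> flip: whisker)
  have "\<Phi> ?r \<bullet> \<mu>' (V \<otimes> U) T \<bullet> (\<mu>' V U \<boxtimes> \<iota> (OMap F T)) = \<mu>' (?B \<otimes> V) S \<bullet> (\<mu>' ?B V \<boxtimes> \<iota> (OMap F S))
      \<bullet> ?r'"
    using 2[THEN tcomp_reassoc] 3[THEN tcomp_reassoc] mu_inv_\<alpha>(1)[of V ?B S, THEN tcomp_reassoc]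
    by (simp add: tmap_comp mu_inv_\<alpha>(2))
  then have m: "(\<Phi> ?r \<boxtimes> \<iota> X) \<bullet> (\<mu>' (V \<otimes> U) T \<boxtimes> \<iota> X) \<bullet> ((\<mu>' V U \<boxtimes> \<iota> (OMap F T)) \<boxtimes> \<iota> X)
    = (\<mu>' (?B \<otimes> V) S \<boxtimes> \<iota> X) \<bullet> ((\<mu>' ?B V \<boxtimes> \<iota> (OMap F S)) \<boxtimes> \<iota> X) \<bullet> (?r' \<boxtimes> \<iota> X)"
    by (simp flip: whisker)
  have i: "\<tau> (OMap F V) ?B (OMap F T \<otimes> X) \<bullet> (\<iota> ?B \<boxtimes> q) = ins D (OMap F V) (OMap F T \<otimes> X) V (S \<otimes> Y)
      ?B q \<bullet> \<tau> V ?B (S \<otimes> Y)"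
    by (simp add: ins_alt)
  have L: "(\<Phi> ?r \<boxtimes> \<iota> X) \<bullet> ?h = (\<mu>' (?B \<otimes> V) S \<boxtimes> \<iota> X) \<bullet> \<alpha> (OMap F (?B \<otimes> V)) (OMap F S) X
      \<bullet> ((\<mu>' ?B V \<boxtimes> \<iota> (OMap F S \<otimes> X)) \<bullet>
      star D (OMap F ?B) (OMap F S \<otimes> X) ?B (OMap F T \<otimes> X) (OMap F V) V (S \<otimes> Y) ?ep q)
          \<bullet> \<beta> (?B \<otimes> V) S Y"
    using m[THEN tcomp_reassoc] i[THEN tcomp_reassoc]
      whisker_swap_coherence[of ?p "OMap F ?B" "OMap F S" ?B "OMap F T"
          "OMap F V" X, THEN tcomp_reassoc]
      \<alpha>_natural_whisker(1)[of "\<mu>' ?B V" "OMap F S" X "OMap F ?B \<otimes> OMap F V"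
          "OMap F (?B \<otimes> V)", symmetric, THEN tcomp_reassoc]
    by (simp add: star_def[of _ _ _ ?B] ins_alt[of ?ep "OMap F ?B" "OMap F S \<otimes> X" ?B
        "OMap F T \<otimes> X"])
  have c: "?c \<bullet> (?r \<boxtimes> \<iota> Y) = ins D (OMap F V) (OMap F T \<otimes> X) V (S \<otimes> Y) ?B q \<bullet> (\<iota> V \<boxtimes> ?eq)
      \<bullet> \<beta> V U (T \<otimes> Y) \<bullet> \<beta> (V \<otimes> U) T Y"
  proof -
    have "?r \<boxtimes> \<iota> Y = ((?r \<boxtimes> \<iota> Y) \<bullet> \<alpha> (V \<otimes> U) T Y \<bullet> \<alpha> V U (T \<otimes> Y)) \<bullet> \<beta> V U (T \<otimes> Y) \<bullet> \<beta> (V \<otimes> U) T Y"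
      by simp
    also have "\<dots> = \<alpha> (?B \<otimes> V) S Y \<bullet> \<alpha> ?B V (S \<otimes> Y) \<bullet> \<tau> ?B V (S \<otimes> Y) \<bullet> (\<iota> V \<boxtimes> ?eq) \<bullet> \<beta> V U (T \<otimes> Y)
        \<bullet> \<beta> (V \<otimes> U) T Y"
      by (simp add: whisker_swap_coherence[of p ?B S U T V Y])
    finally show ?thesis by simp
  qed
  have R: "?h \<bullet> (?r \<boxtimes> \<iota> Y) = (\<mu>' (V \<otimes> U) T \<boxtimes> \<iota> X) \<bullet> \<alpha> (OMap F (V \<otimes> U)) (OMap F T) X
      \<bullet> ((\<mu>' V U \<boxtimes> \<iota> (OMap F T \<otimes> X)) \<bullet>
      star D (OMap F V) (OMap F T \<otimes> X) V (S \<otimes> Y) ?B U (T \<otimes> Y) q ?eq) \<bullet> \<beta> (V \<otimes> U) T Y"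
    using c \<alpha>_natural_whisker(1)[of "\<mu>' V U" "OMap F T" X "OMap F V \<otimes> ?B"
        "OMap F (V \<otimes> U)", symmetric, THEN tcomp_reassoc]
    by (simp add: star_def)
  have "cl X Y ((?B \<otimes> V) \<otimes> S) ((\<Phi> ?r \<boxtimes> \<iota> X) \<bullet> ?h) = cl X Y ((V \<otimes> U) \<otimes> T) (?h \<bullet> (?r \<boxtimes> \<iota> Y))"
    by (rule slide) simp_all
  then show ?thesis
    unfolding L R using * s ep eq l r by (simp add: FF.map_cls sext_cls scomp_cls fbk_cls)
qed

end

section \<open>Composition of monoidal functors\<close>

text \<open>The typing and functoriality conditions stay on plain arrows; the monoidal equations are
  asked for on typed arrows, where diagrams can be normalised.\<close>

lemma symmetric_monoidal_functorI_typed: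
  assumes "symmetric_monoidal_category C" "symmetric_monoidal_category D"
    and obj: "\<And>X. X \<in> Obj C \<Longrightarrow> OMap F X \<in> Obj D"
    and hom: "\<And>f X Y. f \<in> hom C X Y \<Longrightarrow> AMap F f \<in> hom D (OMap F X) (OMap F Y)"
    and id: "\<And>X. X \<in> Obj C \<Longrightarrow> AMap F (Id C X) = Id D (OMap F X)"
    and comp: "\<And>f g X Y Z. \<lbrakk>f \<in> hom C X Y; g \<in> hom C Y Z\<rbrakk> \<Longrightarrow>
      AMap F (f \<Zcomp>\<^bsub>C\<^esub> g) = AMap F f \<Zcomp>\<^bsub>D\<^esub> AMap F g"
    and unit: "UnitMap F \<in> iso D (Unit D) (OMap F (Unit C))"
    and ten: "\<And>X Y. \<lbrakk>X \<in> Obj C; Y \<in> Obj C\<rbrakk> \<Longrightarrow>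
      TenMap F X Y \<in> iso D (OMap F X \<otimes>\<^bsub>D\<^esub> OMap F Y) (OMap F (X \<otimes>\<^bsub>C\<^esub> Y))"
    and natural: "\<And>f g. \<lbrakk>ok C f; ok C g\<rbrakk> \<Longrightarrow>
      (tmap C F f \<boxtimes>\<^bsub>D\<^esub> tmap C F g) \<bullet>\<^bsub>D\<^esub> tmu C D F (tgt f) (tgt g)
        = tmu C D F (src f) (src g) \<bullet>\<^bsub>D\<^esub> tmap C F (f \<boxtimes>\<^bsub>C\<^esub> g)"
    and assoc: "\<And>X Y Z. \<lbrakk>X \<in> Obj C; Y \<in> Obj C; Z \<in> Obj C\<rbrakk> \<Longrightarrow>
      (tmu C D F X Y \<boxtimes>\<^bsub>D\<^esub> \<iota>\<^bsub>D\<^esub> (OMap F Z)) \<bullet>\<^bsub>D\<^esub> tmu C D F (X \<otimes>\<^bsub>C\<^esub> Y) Z \<bullet>\<^bsub>D\<^esub> tmap C F (\<alpha>\<^bsub>C\<^esub> X Y Z)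
        = \<alpha>\<^bsub>D\<^esub> (OMap F X) (OMap F Y) (OMap F Z) \<bullet>\<^bsub>D\<^esub> (\<iota>\<^bsub>D\<^esub> (OMap F X) \<boxtimes>\<^bsub>D\<^esub> tmu C D F Y Z)
          \<bullet>\<^bsub>D\<^esub> tmu C D F X (Y \<otimes>\<^bsub>C\<^esub> Z)"
    and lunit: "\<And>X. X \<in> Obj C \<Longrightarrow>
      (teps C D F \<boxtimes>\<^bsub>D\<^esub> \<iota>\<^bsub>D\<^esub> (OMap F X)) \<bullet>\<^bsub>D\<^esub> tmu C D F (Unit C) X \<bullet>\<^bsub>D\<^esub> tmap C F (\<l>\<^bsub>C\<^esub> X)
          = \<l>\<^bsub>D\<^esub> (OMap F X)"
    and runit: "\<And>X. X \<in> Obj C \<Longrightarrow>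
      (\<iota>\<^bsub>D\<^esub> (OMap F X) \<boxtimes>\<^bsub>D\<^esub> teps C D F) \<bullet>\<^bsub>D\<^esub> tmu C D F X (Unit C) \<bullet>\<^bsub>D\<^esub> tmap C F (\<r>\<^bsub>C\<^esub> X)
          = \<r>\<^bsub>D\<^esub> (OMap F X)"
    and sym: "\<And>X Y. \<lbrakk>X \<in> Obj C; Y \<in> Obj C\<rbrakk> \<Longrightarrow>
      tmu C D F X Y \<bullet>\<^bsub>D\<^esub> tmap C F (\<sigma>\<^bsub>C\<^esub> X Y) = \<sigma>\<^bsub>D\<^esub> (OMap F X) (OMap F Y) \<bullet>\<^bsub>D\<^esub> tmu C D F Y X"
  shows "symmetric_monoidal_functor C D F"
proof -
  interpret C: symmetric_monoidal_category C by fact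
  interpret D: symmetric_monoidal_category D by fact
  have okm [simp]: "ok C a \<Longrightarrow> ok D (tmap C F a)" and rm [simp]: "ok C a \<Longrightarrow> raw (tmap C F a)
      = AMap F (raw a)" for a
    using hom[OF raw_hom[of C a]] by (auto simp: ok_def tmap_def raw_def)
  have ot [simp]: "\<lbrakk>X \<in> Obj C; Y \<in> Obj C\<rbrakk> \<Longrightarrow> ok D (tmu C D F X Y)"
    "\<lbrakk>X \<in> Obj C; Y \<in> Obj C\<rbrakk> \<Longrightarrow> raw (tmu C D F X Y) = TenMap F X Y" for X Y
    using ten[of X Y] by (auto simp: tmu_def ok_mk raw_mk iso_def)
  have oe [simp]: "ok D (teps C D F)" "raw (teps C D F) = UnitMap F"
    using unit by (auto simp: teps_def ok_mk raw_mk iso_def)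
  note raws = D.raw_comp D.raw_ten C.raw_ten D.raw_id C.raw_structure D.raw_structure obj
  show ?thesis
  proof
    show "(AMap F f \<odot>\<^bsub>D\<^esub> AMap F g) \<Zcomp>\<^bsub>D\<^esub> TenMap F X' Y' = TenMap F X Y \<Zcomp>\<^bsub>D\<^esub> AMap F (f \<odot>\<^bsub>C\<^esub> g)"
      if "f \<in> hom C X X'" "g \<in> hom C Y Y'" for f X X' g Y Y'
    proof -
      have o: "X \<in> Obj C" "X' \<in> Obj C" "Y \<in> Obj C" "Y' \<in> Obj C"
        using that C.ok_obj[of "mk C X X' f"] C.ok_obj[of "mk C Y Y' g"] by (simp_all add: ok_mk)
      have "raw ((tmap C F (mk C X X' f) \<boxtimes>\<^bsub>D\<^esub> tmap C F (mk C Y Y' g)) \<bullet>\<^bsub>D\<^esub> tmu C D F X' Y')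
        = raw (tmu C D F X Y \<bullet>\<^bsub>D\<^esub> tmap C F (mk C X X' f \<boxtimes>\<^bsub>C\<^esub> mk C Y Y' g))"
        using natural[of "mk C X X' f" "mk C Y Y' g"] that by (simp add: ok_mk)
      then show ?thesis using that o by (simp add: raws ok_mk raw_mk)
    qed
    fix X Y Z assume o [simp]: "X \<in> Obj C" "Y \<in> Obj C" "Z \<in> Obj C"
    show "(TenMap F X Y \<odot>\<^bsub>D\<^esub> Id D (OMap F Z)) \<Zcomp>\<^bsub>D\<^esub> TenMap F (X \<otimes>\<^bsub>C\<^esub> Y) Z \<Zcomp>\<^bsub>D\<^esub> AMap F (Assoc C X Y Z)
        = Assoc D (OMap F X) (OMap F Y) (OMap F Z) \<Zcomp>\<^bsub>D\<^esub>
            (Id D (OMap F X) \<odot>\<^bsub>D\<^esub> TenMap F Y Z) \<Zcomp>\<^bsub>D\<^esub> TenMap F X (Y \<otimes>\<^bsub>C\<^esub> Z)"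
      using arg_cong[OF assoc[OF o], of raw] by (simp add: raws del: D.tcomp_assoc
          flip: D.tcomp_assoc)
  next
    fix X assume [simp]: "X \<in> Obj C"
    show "(UnitMap F \<odot>\<^bsub>D\<^esub> Id D (OMap F X)) \<Zcomp>\<^bsub>D\<^esub> TenMap F (Unit C) X \<Zcomp>\<^bsub>D\<^esub> AMap F (Lunit C X)
        = Lunit D (OMap F X)"
      using arg_cong[OF lunit[of X], of raw] by (simp add: raws del: D.tcomp_assoc
          flip: D.tcomp_assoc)
    show "(Id D (OMap F X) \<odot>\<^bsub>D\<^esub> UnitMap F) \<Zcomp>\<^bsub>D\<^esub> TenMap F X (Unit C) \<Zcomp>\<^bsub>D\<^esub> AMap F (Runit C X)
        = Runit D (OMap F X)"
      using arg_cong[OF runit[of X], of raw] by (simp add: raws del: D.tcomp_assoc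
          flip: D.tcomp_assoc)
  next
    fix X Y assume [simp]: "X \<in> Obj C" "Y \<in> Obj C"
    show "TenMap F X Y \<Zcomp>\<^bsub>D\<^esub> AMap F (Sym C X Y) = Sym D (OMap F X) (OMap F Y) \<Zcomp>\<^bsub>D\<^esub> TenMap F Y X"
      using arg_cong[OF sym[of X Y], of raw] by (simp add: raws)
  qed (use assms in auto)
qed

lemma mfun_comp_simps [simp]:
  "OMap (mfun_comp E F G) X = OMap G (OMap F X)" "AMap (mfun_comp E F G) f = AMap G (AMap F f)"
  "UnitMap (mfun_comp E F G) = UnitMap G \<Zcomp>\<^bsub>E\<^esub> AMap G (UnitMap F)"
  "TenMap (mfun_comp E F G) X Y = TenMap G (OMap F X) (OMap F Y) \<Zcomp>\<^bsub>E\<^esub> AMap G (TenMap F X Y)"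
  by (simp_all add: mfun_comp_def)

locale functor_pair =
  G: symmetric_monoidal_functor C D G + H: symmetric_monoidal_functor D E H for C D E G H
begin

abbreviation "K \<equiv> mfun_comp E G H"

lemma tmap_comp_functor: "ok C a \<Longrightarrow> tmap C K a = tmap D H (tmap C G a)"
  by (simp add: tmap_def[of C K] tmap_def[of D H] G.raw_tmap)

lemma teps_comp_functor: "teps C E K = teps D E H \<bullet>\<^bsub>E\<^esub> tmap D H (teps C D G)"
proof -
  have "raw (teps D E H \<bullet>\<^bsub>E\<^esub> tmap D H (teps C D G)) = UnitMap K"
    by (simp add: G.D.raw_comp H.D.raw_comp H.raw_tmap G.raw_eps H.raw_eps)
  then show ?thesis
    using mk_raw[of E "teps D E H \<bullet>\<^bsub>E\<^esub> tmap D H (teps C D G)"] by (simp add: teps_def[of C E])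
qed

lemma tmu_comp_functor:
  assumes [simp]: "X \<in> Obj C" "Y \<in> Obj C"
  shows "tmu C E K X Y = tmu D E H (OMap G X) (OMap G Y) \<bullet>\<^bsub>E\<^esub> tmap D H (tmu C D G X Y)"
proof -
  have "raw (tmu D E H (OMap G X) (OMap G Y) \<bullet>\<^bsub>E\<^esub> tmap D H (tmu C D G X Y)) = TenMap K X Y"
    by (simp add: H.D.raw_comp H.raw_tmap G.raw_mu H.raw_mu)
  then show ?thesis
    using mk_raw[of E "tmu D E H (OMap G X) (OMap G Y) \<bullet>\<^bsub>E\<^esub> tmap D H (tmu C D G X Y)"] by
        (simp add: tmu_def[of C E])
qed

text \<open>Each coherence law pastes the law for \<open>H\<close> at the objects \<open>G X\<close>
  to the image under \<open>H\<close> of the law for \<open>G\<close>, with naturality of the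
  structure maps of \<open>H\<close> in between.\<close>

lemma symmetric_monoidal_comp: "symmetric_monoidal_functor C E K"
proof (rule symmetric_monoidal_functorI_typed)
  show "symmetric_monoidal_category C" "symmetric_monoidal_category E" by unfold_locales
  show "X \<in> Obj C \<Longrightarrow> OMap K X \<in> Obj E" for X by simp
  show "f \<in> hom C X Y \<Longrightarrow> AMap K f \<in> hom E (OMap K X) (OMap K Y)" for f X Y
    by (simp add: G.map_hom H.map_hom)
  show "X \<in> Obj C \<Longrightarrow> AMap K (Id C X) = Id E (OMap K X)" for X
    by (simp add: G.map_id H.map_id)
  show "\<lbrakk>f \<in> hom C X Y; g \<in> hom C Y Z\<rbrakk> \<Longrightarrow> AMap K (f \<Zcomp>\<^bsub>C\<^esub> g) = AMap K f \<Zcomp>\<^bsub>E\<^esub> AMap K g" for f g X Y Z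
    using H.map_comp[OF G.map_hom G.map_hom] by (simp add: G.map_comp)
  have "tiso E (teps C E K)" by (simp add: teps_comp_functor)
  then show "UnitMap K \<in> iso E (Unit E) (OMap K (Unit C))"
    unfolding teps_def by (simp add: H.D.tiso_mk)
  show "TenMap K X Y \<in> iso E (OMap K X \<otimes>\<^bsub>E\<^esub> OMap K Y) (OMap K (X \<otimes>\<^bsub>C\<^esub> Y))" if "X \<in> Obj C"
      "Y \<in> Obj C" for X Y
  proof -
    have "tiso E (tmu C E K X Y)" using that by (simp add: tmu_comp_functor)
    then show ?thesis unfolding tmu_def by (simp add: H.D.tiso_mk)
  qed
  show "(tmap C K f \<boxtimes>\<^bsub>E\<^esub> tmap C K g) \<bullet>\<^bsub>E\<^esub> tmu C E K (tgt f) (tgt g) = tmu C E K (src f) (src g)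
      \<bullet>\<^bsub>E\<^esub> tmap C K (f \<boxtimes>\<^bsub>C\<^esub> g)"
    if [simp]: "ok C f" "ok C g" for f g
    using H.mu_natural[OF _ _ refl refl refl refl, of "tmap C G f"
        "tmap C G g", THEN H.D.tcomp_reassoc] G.mu_natural[OF _ _ refl refl refl refl, of f g]
    by (simp add: tmap_comp_functor tmu_comp_functor G.C.ok_obj flip: H.tmap_comp)
  show "(tmu C E K X Y \<boxtimes>\<^bsub>E\<^esub> \<iota>\<^bsub>E\<^esub> (OMap K Z)) \<bullet>\<^bsub>E\<^esub> tmu C E K (X \<otimes>\<^bsub>C\<^esub> Y) Z \<bullet>\<^bsub>E\<^esub> tmap C K (\<alpha>\<^bsub>C\<^esub> X Y Z)
      = \<alpha>\<^bsub>E\<^esub> (OMap K X) (OMap K Y) (OMap K Z) \<bullet>\<^bsub>E\<^esub> (\<iota>\<^bsub>E\<^esub> (OMap K X) \<boxtimes>\<^bsub>E\<^esub> tmu C E K Y Z)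
          \<bullet>\<^bsub>E\<^esub> tmu C E K X (Y \<otimes>\<^bsub>C\<^esub> Z)"
    if [simp]: "X \<in> Obj C" "Y \<in> Obj C" "Z \<in> Obj C" for X Y Z
  proof -
    have 1: "(tmap D H (tmu C D G X Y) \<boxtimes>\<^bsub>E\<^esub> \<iota>\<^bsub>E\<^esub> (OMap K Z))
        \<bullet>\<^bsub>E\<^esub> tmu D E H (OMap G (X \<otimes>\<^bsub>C\<^esub> Y)) (OMap G Z)
      = tmu D E H (OMap G X \<otimes>\<^bsub>D\<^esub> OMap G Y) (OMap G Z) \<bullet>\<^bsub>E\<^esub> tmap D H (tmu C D G X Y \<boxtimes>\<^bsub>D\<^esub> \<iota>\<^bsub>D\<^esub> (OMap
          G Z))"
      using H.mu_natural[OF _ _ refl refl refl refl, of "tmu C D G X Y" "\<iota>\<^bsub>D\<^esub> (OMap G Z)"] by simp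
    have 2: "(\<iota>\<^bsub>E\<^esub> (OMap K X) \<boxtimes>\<^bsub>E\<^esub> tmap D H (tmu C D G Y Z))
        \<bullet>\<^bsub>E\<^esub> tmu D E H (OMap G X) (OMap G (Y \<otimes>\<^bsub>C\<^esub> Z))
      = tmu D E H (OMap G X) (OMap G Y \<otimes>\<^bsub>D\<^esub> OMap G Z) \<bullet>\<^bsub>E\<^esub> tmap D H (\<iota>\<^bsub>D\<^esub> (OMap G X) \<boxtimes>\<^bsub>D\<^esub> tmu C D
          G Y Z)"
      using H.mu_natural[OF _ _ refl refl refl refl, of "\<iota>\<^bsub>D\<^esub> (OMap G X)" "tmu C D G Y Z"] by simp
    have "tmap D H (tmu C D G X Y \<boxtimes>\<^bsub>D\<^esub> \<iota>\<^bsub>D\<^esub> (OMap G Z)) \<bullet>\<^bsub>E\<^esub> tmap D H (tmu C D G (X \<otimes>\<^bsub>C\<^esub> Y) Z)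
        \<bullet>\<^bsub>E\<^esub> tmap D H (tmap C G (\<alpha>\<^bsub>C\<^esub> X Y Z))
      = tmap D H (\<alpha>\<^bsub>D\<^esub> (OMap G X) (OMap G Y) (OMap G Z))
          \<bullet>\<^bsub>E\<^esub> tmap D H (\<iota>\<^bsub>D\<^esub> (OMap G X) \<boxtimes>\<^bsub>D\<^esub> tmu C D G Y Z)
        \<bullet>\<^bsub>E\<^esub> tmap D H (tmu C D G X (Y \<otimes>\<^bsub>C\<^esub> Z))"
      by (simp add: G.mu_assoc flip: H.tmap_comp)
    then show ?thesis
      using 1[THEN H.D.tcomp_reassoc] 2[THEN H.D.tcomp_reassoc] H.mu_assoc[of "OMap G X"
          "OMap G Y" "OMap G Z", THEN H.D.tcomp_reassoc]
      by (simp add: tmu_comp_functor tmap_comp_functor H.D.whisker)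
  qed
  show "(teps C E K \<boxtimes>\<^bsub>E\<^esub> \<iota>\<^bsub>E\<^esub> (OMap K X)) \<bullet>\<^bsub>E\<^esub> tmu C E K (Unit C) X \<bullet>\<^bsub>E\<^esub> tmap C K (\<l>\<^bsub>C\<^esub> X)
      = \<l>\<^bsub>E\<^esub> (OMap K X)"
    if [simp]: "X \<in> Obj C" for X
  proof -
    have 1: "(tmap D H (teps C D G) \<boxtimes>\<^bsub>E\<^esub> \<iota>\<^bsub>E\<^esub> (OMap K X))
        \<bullet>\<^bsub>E\<^esub> tmu D E H (OMap G (Unit C)) (OMap G X)
      = tmu D E H (Unit D) (OMap G X) \<bullet>\<^bsub>E\<^esub> tmap D H (teps C D G \<boxtimes>\<^bsub>D\<^esub> \<iota>\<^bsub>D\<^esub> (OMap G X))"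
      using H.mu_natural[OF _ _ refl refl refl refl, of "teps C D G" "\<iota>\<^bsub>D\<^esub> (OMap G X)"] by simp
    have "tmap D H (teps C D G \<boxtimes>\<^bsub>D\<^esub> \<iota>\<^bsub>D\<^esub> (OMap G X)) \<bullet>\<^bsub>E\<^esub> tmap D H (tmu C D G (Unit C) X)
        \<bullet>\<^bsub>E\<^esub> tmap D H (tmap C G (\<l>\<^bsub>C\<^esub> X))
      = tmap D H (\<l>\<^bsub>D\<^esub> (OMap G X))"
      by (simp add: G.mu_lunit flip: H.tmap_comp)
    then show ?thesis
      using 1[THEN H.D.tcomp_reassoc] H.mu_lunit[of "OMap G X"]
      by (simp add: tmu_comp_functor tmap_comp_functor teps_comp_functor H.D.whisker)
  qed
  show "(\<iota>\<^bsub>E\<^esub> (OMap K X) \<boxtimes>\<^bsub>E\<^esub> teps C E K) \<bullet>\<^bsub>E\<^esub> tmu C E K X (Unit C) \<bullet>\<^bsub>E\<^esub> tmap C K (\<r>\<^bsub>C\<^esub> X)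
      = \<r>\<^bsub>E\<^esub> (OMap K X)"
    if [simp]: "X \<in> Obj C" for X
  proof -
    have 1: "(\<iota>\<^bsub>E\<^esub> (OMap K X) \<boxtimes>\<^bsub>E\<^esub> tmap D H (teps C D G))
        \<bullet>\<^bsub>E\<^esub> tmu D E H (OMap G X) (OMap G (Unit C))
      = tmu D E H (OMap G X) (Unit D) \<bullet>\<^bsub>E\<^esub> tmap D H (\<iota>\<^bsub>D\<^esub> (OMap G X) \<boxtimes>\<^bsub>D\<^esub> teps C D G)"
      using H.mu_natural[OF _ _ refl refl refl refl, of "\<iota>\<^bsub>D\<^esub> (OMap G X)" "teps C D G"] by simp
    have "tmap D H (\<iota>\<^bsub>D\<^esub> (OMap G X) \<boxtimes>\<^bsub>D\<^esub> teps C D G) \<bullet>\<^bsub>E\<^esub> tmap D H (tmu C D G X (Unit C))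
        \<bullet>\<^bsub>E\<^esub> tmap D H (tmap C G (\<r>\<^bsub>C\<^esub> X))
      = tmap D H (\<r>\<^bsub>D\<^esub> (OMap G X))"
      by (simp add: G.mu_runit flip: H.tmap_comp)
    then show ?thesis
      using 1[THEN H.D.tcomp_reassoc] H.mu_runit[of "OMap G X"]
      by (simp add: tmu_comp_functor tmap_comp_functor teps_comp_functor H.D.whisker)
  qed
  show "tmu C E K X Y \<bullet>\<^bsub>E\<^esub> tmap C K (\<sigma>\<^bsub>C\<^esub> X Y) = \<sigma>\<^bsub>E\<^esub> (OMap K X) (OMap K Y) \<bullet>\<^bsub>E\<^esub> tmu C E K Y X"
    if [simp]: "X \<in> Obj C" "Y \<in> Obj C" for X Y
  proof -
    have "tmap D H (tmu C D G X Y) \<bullet>\<^bsub>E\<^esub> tmap D H (tmap C G (\<sigma>\<^bsub>C\<^esub> X Y))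
        = tmap D H (\<sigma>\<^bsub>D\<^esub> (OMap G X) (OMap G Y)) \<bullet>\<^bsub>E\<^esub> tmap D H (tmu C D G Y X)"
      by (simp add: G.mu_sym flip: H.tmap_comp)
    then show ?thesis
      using H.mu_sym[of "OMap G X" "OMap G Y", THEN H.D.tcomp_reassoc]
      by (simp add: tmu_comp_functor tmap_comp_functor)
  qed
qed

lemma tconj_comp_functor:
  assumes [simp]: "ok C f" "src f = P \<otimes>\<^bsub>C\<^esub> X" "tgt f = Q \<otimes>\<^bsub>C\<^esub> Y" "P \<in> Obj C" "X \<in> Obj C"
      "Q \<in> Obj C" "Y \<in> Obj C"
  shows "tconj C E K P X Q Y f = tconj D E H (OMap G P) (OMap G X) (OMap G Q) (OMap G Y) (tconj C
      D G P X Q Y f)"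
  by (simp add: tconj_def tmu_comp_functor tmap_comp_functor H.tmap_comp H.D.tinv_comp H.tmap_inv)

end

text \<open>The square for \<open>K\<close> is pasted to the image under \<open>K\<close> of the
  square for \<open>N\<close>; this has to be done for the structure maps as well as for objects and
  arrows.\<close>

lemma commuting_functor_comp:
  assumes "commuting_functor D F D' F' N" "commuting_functor D' F' D'' F'' K"
  shows "commuting_functor D F D'' F'' (mfun_comp D'' N K)"
proof -
  interpret N: commuting_functor D F D' F' N by fact
  interpret K: commuting_functor D' F' D'' F'' K by fact
  interpret NK: functor_pair D D' D'' N K by unfold_locales
  interpret L: symmetric_monoidal_functor D D'' "mfun_comp D'' N K"
      by (rule NK.symmetric_monoidal_comp)
  have 1: "AMap K (AMap N (AMap F f)) = AMap F'' (AMap K (AMap N f))" if "f \<in> Arr D" for f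
  proof -
    have f: "f \<in> hom D (Dom D f) (Cod D f)" using that by (simp add: hom_def)
    then have "AMap N f \<in> Arr D'" using N.map_hom[OF f] by (simp add: hom_def)
    then show ?thesis
      using N.comm K.comm that by (simp add: commutes_with_def mfun_eq_def)
  qed
  let ?L = "mfun_comp D'' N K"
  have e: "teps D D'' ?L \<bullet>\<^bsub>D''\<^esub> tmap D ?L (teps D D F) = teps D'' D'' F''
      \<bullet>\<^bsub>D''\<^esub> tmap D'' F'' (teps D D'' ?L)"
    using K.comm_eps[THEN K.D'.tcomp_reassoc, of "tmap D'' F'' (tmap D' K (teps D D' N))"]
    by (simp add: NK.teps_comp_functor NK.tmap_comp_functor N.comm_obj K.comm_obj K.D'.tmap_comp
        flip: K.comm_arr) (simp add: N.comm_eps N.comm_obj flip: K.tmap_comp)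
  have m: "tmu D D'' ?L (OMap F X) (OMap F Y) \<bullet>\<^bsub>D''\<^esub> tmap D ?L (tmu D D F X Y)
    = tmu D'' D'' F'' (OMap ?L X) (OMap ?L Y) \<bullet>\<^bsub>D''\<^esub> tmap D'' F'' (tmu D D'' ?L X Y)"
    if [simp]: "X \<in> Obj D" "Y \<in> Obj D" for X Y
    using K.comm_mu[of "OMap N X" "OMap N Y", THEN K.D'.tcomp_reassoc, of
        "tmap D'' F'' (tmap D' K (tmu D D' N X Y))"]
    by (simp add: NK.tmu_comp_functor NK.tmap_comp_functor N.comm_obj K.comm_obj K.D'.tmap_comp
        flip: K.comm_arr) (simp add: N.comm_mu[unfolded N.comm_obj[OF that(1)] N.comm_obj[OF
            that(2)]] N.comm_obj flip: K.tmap_comp)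
  show ?thesis
  proof (unfold_locales, unfold commutes_with_def mfun_eq_def, intro conjI ballI)
    show "OMap (mfun_comp D'' F ?L) X = OMap (mfun_comp D'' ?L F'') X" if "X \<in> Obj D" for X
      using that by (simp add: N.comm_obj K.comm_obj)
    show "AMap (mfun_comp D'' F ?L) f = AMap (mfun_comp D'' ?L F'') f" if "f \<in> Arr D" for f
      using that 1 by simp
    show "UnitMap (mfun_comp D'' F ?L) = UnitMap (mfun_comp D'' ?L F'')"
      using arg_cong[OF e, of raw]
      by (simp add: K.D'.raw_comp L.raw_tmap L.raw_eps N.D.raw_eps K.D'.raw_eps K.D'.raw_tmap
          N.comm_obj K.comm_obj)
    show "TenMap (mfun_comp D'' F ?L) X Y = TenMap (mfun_comp D'' ?L F'') X Y" if "X \<in> Obj D"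
        "Y \<in> Obj D" for X Y
      using arg_cong[OF m[OF that], of raw] that
      by (simp add: K.D'.raw_comp L.raw_tmap L.raw_mu N.D.raw_mu K.D'.raw_mu K.D'.raw_tmap
          N.comm_obj K.comm_obj)
  qed
qed

lemma (in feedback_category) monoidal_endofunctor: "monoidal_endofunctor E (Endo E)"
  by unfold_locales

lemma (in feedback_functor) commuting_functor: "commuting_functor E (Endo E) B (Endo B) G"
  using E.monoidal_endofunctor B.monoidal_endofunctor symmetric_monoidal_functor_axioms commutes
  by (simp add: commuting_functor_def commuting_functor_axioms_def)

text \<open>The conjugated arrow in \<open>map_fbk\<close> is \<open>tconj\<close>. This lemma and
  \<open>feedback_functorI\<close> translate between the definition and the calculus of
  bodies.\<close>

lemma (in feedback_functor) map_fbk_typed: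
  assumes "stateful E (Endo E) X Y S f"
  shows "AMap G (Fbk E S X Y (raw f)) = Fbk B (OMap G S) (OMap G X) (OMap G Y) (raw (tconj E B G
      (OMap (Endo E) S) X S Y f))"
proof -
  have [simp]: "X \<in> Obj E" "Y \<in> Obj E" "S \<in> Obj E" "ok E f" "src f = OMap (Endo E) S \<otimes>\<^bsub>E\<^esub> X"
      "tgt f = S \<otimes>\<^bsub>E\<^esub> Y"
    using assms by (auto simp: stateful_def)
  have o [simp]: "OMap (Endo E) S \<in> Obj E" by (rule E.Endo.map_obj) simp
  have "raw (tconj E B G (OMap (Endo E) S) X S Y f)
    = TenMap G (OMap (Endo E) S) X \<Zcomp>\<^bsub>B\<^esub> AMap G (raw f) \<Zcomp>\<^bsub>B\<^esub> arr_inv B (TenMap G S Y)"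
    using B.arr_inv_raw[of "tmu E B G S Y"]
    by (simp add: tconj_def B.raw_comp raw_tmap raw_mu del: B.tcomp_assoc flip: B.tcomp_assoc)
  then show ?thesis
    using map_fbk[of S X Y "raw f"] raw_hom[of E f] by simp
qed

lemma feedback_functorI:
  assumes "feedback_category E" "feedback_category B" "commuting_functor E (Endo E) B (Endo B) G"
    and fbk: "\<And>S X Y f. stateful E (Endo E) X Y S f \<Longrightarrow>
      AMap G (Fbk E S X Y (raw f)) = Fbk B (OMap G S) (OMap G X) (OMap G Y) (raw (tconj E B G
          (OMap (Endo E) S) X S Y f))"
  shows "feedback_functor E B G"
proof -
  interpret E: feedback_category E by fact
  interpret B: feedback_category B by fact
  interpret G: commuting_functor E "Endo E" B "Endo B" G by fact
  show ?thesis
  proof (unfold_locales)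
    show "commutes_with E (Endo E) B (Endo B) G" by (rule G.comm)
    fix S X Y f assume a: "S \<in> Obj E" "X \<in> Obj E" "Y \<in> Obj E"
        "f \<in> hom E (OMap (Endo E) S \<otimes>\<^bsub>E\<^esub> X) (S \<otimes>\<^bsub>E\<^esub> Y)"
    let ?f = "mk E (OMap (Endo E) S \<otimes>\<^bsub>E\<^esub> X) (S \<otimes>\<^bsub>E\<^esub> Y) f"
    have [simp]: "OMap (Endo E) S \<in> Obj E" "ok E ?f" "raw ?f = f" "S \<in> Obj E" "X \<in> Obj E"
        "Y \<in> Obj E"
      using a E.Endo.map_obj by (auto simp: ok_mk raw_mk)
    have "raw (tconj E B G (OMap (Endo E) S) X S Y ?f)
      = TenMap G (OMap (Endo E) S) X \<Zcomp>\<^bsub>B\<^esub> AMap G f \<Zcomp>\<^bsub>B\<^esub> arr_inv B (TenMap G S Y)"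
      using B.arr_inv_raw[of "tmu E B G S Y"]
      by (simp add: tconj_def B.raw_comp G.raw_tmap G.raw_mu del: B.tcomp_assoc flip: B.tcomp_assoc)
    then show "AMap G (Fbk E S X Y f) = Fbk B (OMap G S) (OMap G X) (OMap G Y)
            (TenMap G (OMap (Endo E) S) X \<Zcomp>\<^bsub>B\<^esub> AMap G f \<Zcomp>\<^bsub>B\<^esub> arr_inv B (TenMap G S Y))"
      using fbk[of X Y S ?f] by (simp add: stateful_def)
  qed
qed

lemma feedback_functor_comp:
  assumes "feedback_functor E B G" "feedback_functor B A H"
  shows "feedback_functor E A (mfun_comp A G H)"
proof -
  interpret G: feedback_functor E B G by fact
  interpret H: feedback_functor B A H by fact
  interpret GH: functor_pair E B A G H by unfold_locales
  show ?thesis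
  proof (rule feedback_functorI)
    show "feedback_category E" "feedback_category A" by unfold_locales
    show "commuting_functor E (Endo E) A (Endo A) (mfun_comp A G H)"
      by (rule commuting_functor_comp[OF G.commuting_functor H.commuting_functor])
    fix S X Y f assume f: "stateful E (Endo E) X Y S f"
    interpret C: commuting_functor E "Endo E" B "Endo B" G by (rule G.commuting_functor)
    have o: "X \<in> Obj E" "Y \<in> Obj E" "S \<in> Obj E" "ok E f" "src f = OMap (Endo E) S \<otimes>\<^bsub>E\<^esub> X" "tgt f
        = S \<otimes>\<^bsub>E\<^esub> Y"
      using f by (auto simp: stateful_def)
    show "AMap (mfun_comp A G H) (Fbk E S X Y (raw f)) = Fbk A (OMap (mfun_comp A G H) S) (OMap
        (mfun_comp A G H) X)
        (OMap (mfun_comp A G H) Y) (raw (tconj E A (mfun_comp A G H) (OMap (Endo E) S) X S Y f))"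
      using o H.map_fbk_typed[OF C.stateful_conj[OF f]] G.E.Endo.map_obj[of S]
      by (simp add: G.map_fbk_typed[OF f] GH.tconj_comp_functor C.comm_obj)
  qed
qed

section \<open>The embedding of the base category, and the feedback axioms for classes\<close>

definition spure_fun :: "('o, 'm, 'z) smc_scheme \<Rightarrow> ('o, 'm, 'o, 'm) mfun \<Rightarrow> ('o, 'm, 'o, ('o, 'm)
    starr) mfun" where
  "spure_fun D F =
    \<lparr>OMap = (\<lambda>X. X),
     AMap = (\<lambda>f. spure D F (mk D (Dom D f) (Cod D f) f)),
     UnitMap = spure D F (\<iota>\<^bsub>D\<^esub> (Unit D)),
     TenMap = (\<lambda>X Y. spure D F (\<iota>\<^bsub>D\<^esub> (X \<otimes>\<^bsub>D\<^esub> Y)))\<rparr>"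

lemma spure_fun_simps [simp]:
  "OMap (spure_fun D F) X = X" "UnitMap (spure_fun D F) = spure D F (\<iota>\<^bsub>D\<^esub> (Unit D))"
  "TenMap (spure_fun D F) X Y = spure D F (\<iota>\<^bsub>D\<^esub> (X \<otimes>\<^bsub>D\<^esub> Y))"
  by (simp_all add: spure_fun_def)

lemma spure_fun_arr: "f \<in> hom D X Y \<Longrightarrow> AMap (spure_fun D F) f = spure D F (mk D X Y f)"
  by (simp add: spure_fun_def hom_def)

context monoidal_endofunctor
begin

text \<open>Two axioms have to be assembled. Tightening is its left and right versions in turn.
  Strength for a general \<open>g\<close> is \<open>sfbk_ext\<close> followed by right tightening
  with \<open>g\<close> whiskered, after naturality of the associator has put \<open>g\<close> in
  place.\<close>

theorem feedback_scat: "feedback_category E"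
proof -
  interpret E: symmetric_monoidal_category E by (rule symmetric_monoidal_scat)
  interpret FF: commuting_functor D F D F F by (rule commuting_self)
  interpret EF: symmetric_monoidal_functor E E "Endo E" using FF.symmetric_monoidal_sfun by simp
  show ?thesis
  proof
    show "\<lbrakk>S \<in> Obj E; X \<in> Obj E; Y \<in> Obj E; f \<in> hom E (OMap (Endo E) S \<otimes>\<^bsub>E\<^esub> X) (S \<otimes>\<^bsub>E\<^esub> Y)\<rbrakk>
      \<Longrightarrow> Fbk E S X Y f \<in> hom E X Y" for S X Y f
      by (simp add: sfbk_hom)
    show "u \<Zcomp>\<^bsub>E\<^esub> Fbk E S X Y f \<Zcomp>\<^bsub>E\<^esub> v
        = Fbk E S X' Y' ((Id E (OMap (Endo E) S) \<odot>\<^bsub>E\<^esub> u) \<Zcomp>\<^bsub>E\<^esub> f \<Zcomp>\<^bsub>E\<^esub> (Id E S \<odot>\<^bsub>E\<^esub> v))"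
      if S: "S \<in> Obj E" and f: "f \<in> hom E (OMap (Endo E) S \<otimes>\<^bsub>E\<^esub> X) (S \<otimes>\<^bsub>E\<^esub> Y)"
        and u: "u \<in> hom E X' X" and v: "v \<in> hom E Y Y'" for S X Y X' Y' f u v
    proof -
      have f: "f \<in> hom E (OMap F S \<otimes> X) (S \<otimes> Y)" and S: "S \<in> Obj D" using f S by simp_all
      note o = fst_hom[OF u] fst_hom[OF v]
      have "sins D F (OMap F S) u \<in> hom E (OMap F S \<otimes> X') (OMap F S \<otimes> X)" using u S by
          (simp add: sins_hom)
      then show ?thesis
        using sfbk_tight_left[OF f u S o(7)] sfbk_tight_right[OF scomp_hom[OF _ f] v S o(3)] S
        by (simp add: sten_id_left[OF u] sten_id_left[OF v])
    qed
    show "Fbk E (Unit E) X Y f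
        = arr_inv E (Lunit E X) \<Zcomp>\<^bsub>E\<^esub> (UnitMap (Endo E) \<odot>\<^bsub>E\<^esub> Id E X) \<Zcomp>\<^bsub>E\<^esub> f \<Zcomp>\<^bsub>E\<^esub> Lunit E Y"
      if "X \<in> Obj E" "Y \<in> Obj E" "f \<in> hom E (OMap (Endo E) (Unit E) \<otimes>\<^bsub>E\<^esub> X) (Unit E \<otimes>\<^bsub>E\<^esub> Y)"
          for X Y f
      using that sfbk_vanish[of f X Y] by (simp add: pure_iso(2) pure_ten pure_comp)
    show "Fbk E T X Y (Fbk E S (OMap (Endo E) T \<otimes>\<^bsub>E\<^esub> X) (T \<otimes>\<^bsub>E\<^esub> Y) f)
        = Fbk E (S \<otimes>\<^bsub>E\<^esub> T) X Y
            ((arr_inv E (TenMap (Endo E) S T) \<odot>\<^bsub>E\<^esub> Id E X) \<Zcomp>\<^bsub>E\<^esub>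
             Assoc E (OMap (Endo E) S) (OMap (Endo E) T) X \<Zcomp>\<^bsub>E\<^esub> f \<Zcomp>\<^bsub>E\<^esub> arr_inv E (Assoc E S T Y))"
      if "S \<in> Obj E" "T \<in> Obj E" "X \<in> Obj E" "Y \<in> Obj E"
        "f \<in> hom E (OMap (Endo E) S \<otimes>\<^bsub>E\<^esub> (OMap (Endo E) T \<otimes>\<^bsub>E\<^esub> X)) (S \<otimes>\<^bsub>E\<^esub> (T \<otimes>\<^bsub>E\<^esub> Y))"
            for S T X Y f
      using that sfbk_join[of f S T X Y] by (simp add: pure_iso(2) pure_ten pure_comp)
    show "Fbk E S X Y f \<odot>\<^bsub>E\<^esub> g
        = Fbk E S (X \<otimes>\<^bsub>E\<^esub> X') (Y \<otimes>\<^bsub>E\<^esub> Y')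
            (arr_inv E (Assoc E (OMap (Endo E) S) X X') \<Zcomp>\<^bsub>E\<^esub> (f \<odot>\<^bsub>E\<^esub> g) \<Zcomp>\<^bsub>E\<^esub> Assoc E S Y Y')"
      if "S \<in> Obj E" "X \<in> Obj E" "Y \<in> Obj E"
        "f \<in> hom E (OMap (Endo E) S \<otimes>\<^bsub>E\<^esub> X) (S \<otimes>\<^bsub>E\<^esub> Y)" and g: "g \<in> hom E X' Y'" for S X Y X' Y' f g
    proof -
      have o [simp]: "S \<in> Obj D" "X \<in> Obj D" "Y \<in> Obj D" and f: "f \<in> hom E (OMap F S \<otimes> X) (S \<otimes> Y)"
        using that by simp_all
      note [simp] = fst_hom(3,4)[OF g]
      have h: "J (\<beta> (OMap F S) X X') \<in> hom E (OMap F S \<otimes> (X \<otimes> X')) ((OMap F S \<otimes> X) \<otimes> X')"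
        "sext D F X' f \<in> hom E ((OMap F S \<otimes> X) \<otimes> X') ((S \<otimes> Y) \<otimes> X')"
        "J (\<alpha> S Y X') \<in> hom E ((S \<otimes> Y) \<otimes> X') (S \<otimes> (Y \<otimes> X'))"
        "sins D F (S \<otimes> Y) g \<in> hom E ((S \<otimes> Y) \<otimes> X') ((S \<otimes> Y) \<otimes> Y')"
        "J (\<alpha> S Y Y') \<in> hom E ((S \<otimes> Y) \<otimes> Y') (S \<otimes> (Y \<otimes> Y'))"
        "sins D F Y g \<in> hom E (Y \<otimes> X') (Y \<otimes> Y')"
        "sins D F S (sins D F Y g) \<in> hom E (S \<otimes> (Y \<otimes> X')) (S \<otimes> (Y \<otimes> Y'))"
        using f g by (auto intro!: pure_hom sext_hom sins_hom)
      have a: "scomp D F (J (\<alpha> S Y X')) (sins D F S (sins D F Y g))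
          = scomp D F (sins D F (S \<otimes> Y) g) (J (\<alpha> S Y Y'))"
        by (rule sassoc_whisker(3)[OF g, symmetric]) simp_all
      have "Fbk E S X Y f \<odot>\<^bsub>E\<^esub> g = scomp D F (sext D F X' (sfbk D F S X Y f)) (sins D F Y g)"
        using fst_hom[OF sfbk_hom[OF f]] by (simp add: sten_def fst_hom[OF g])
      also have "\<dots> = scomp D F (sfbk D F S (X \<otimes> X') (Y \<otimes> X') (scomp D F (scomp D F (J (\<beta> (OMap F
          S) X X')) (sext D F X' f)) (J (\<alpha> S Y X')))) (sins D F Y g)"
        by (simp add: sfbk_ext[OF f])
      also have "\<dots> = sfbk D F S (X \<otimes> X') (Y \<otimes> Y') (scomp D F (scomp D F (scomp D F (J (\<beta> (OMap F
          S) X X')) (sext D F X' f)) (J (\<alpha> S Y X'))) (sins D F S (sins D F Y g)))"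
        by (rule sfbk_tight_right[OF scomp_hom[OF scomp_hom[OF h(1,2)] h(3)] h(6)]) simp_all
      also have "scomp D F (scomp D F (scomp D F (J (\<beta> (OMap F S) X X')) (sext D F X' f)) (J (\<alpha> S
          Y X'))) (sins D F S (sins D F Y g))
        = scomp D F (scomp D F (J (\<beta> (OMap F S) X X')) (sext D F X' f)) (scomp D F (sins D F (S \<otimes>
            Y) g) (J (\<alpha> S Y Y')))"
        using E.comp_assoc[OF E.comp_hom[OF h(1,2)] h(3,7)] a by simp
      also have "\<dots> = scomp D F (scomp D F (J (\<beta> (OMap F S) X X')) (scomp D F (sext D F X' f) (sins
          D F (S \<otimes> Y) g))) (J (\<alpha> S Y Y'))"
        using E.comp_assoc[OF h(1,2,4)] E.comp_assoc[OF E.comp_hom[OF h(1,2)] h(4,5)] by simp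
      finally show ?thesis
        by (simp add: pure_iso(2) sten_def[of D F f g] fst_hom(1,2)[OF f] fst_hom(1,2)[OF g])
    qed
    show "Fbk E S X Y ((AMap (Endo E) h \<odot>\<^bsub>E\<^esub> Id E X) \<Zcomp>\<^bsub>E\<^esub> f) = Fbk E T X Y (f \<Zcomp>\<^bsub>E\<^esub> (h \<odot>\<^bsub>E\<^esub> Id E Y))"
      if "X \<in> Obj E" "Y \<in> Obj E" "h \<in> hom E S T" "f \<in> hom E (OMap (Endo E) T \<otimes>\<^bsub>E\<^esub> X) (S \<otimes>\<^bsub>E\<^esub> Y)"
          for X Y S T h f
      using that sfbk_slide[of h S T f X Y] sten_id_right[OF FF.map_hom_cls[of h S T]]
          sten_id_right[of h S T]
      by simp
  qed
qed

text \<open>The stateless arrow \<open>J f\<close> has state \<open>I\<close>, so its feedback has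
  state \<open>I \<otimes> S\<close>; sliding along \<open>\<l> S\<close> removes the unit.\<close>

lemma cls_fbk_pure:
  assumes "sf X Y S f"
  shows "cl X Y S f = sfbk D F S X Y (J f)"
proof -
  note [simp] = statefulD[OF assms]
  have s: "sf (OMap F S \<otimes> X) (S \<otimes> Y) (Unit D) (tinv D \<epsilon> \<boxtimes> f)" by simp
  have 1: "(tinv D \<epsilon> \<boxtimes> f) \<bullet> \<l> (S \<otimes> Y) = (tinv D \<epsilon> \<boxtimes> \<iota> (OMap F S \<otimes> X)) \<bullet> \<l> (OMap F S \<otimes> X) \<bullet> f"
    using interchange(1)[of f "src f" "tinv D \<epsilon>" "Unit D" "OMap F (Unit D)" "tgt f", symmetric]
    by (simp add: \<l>_natural)
  have 2: "\<beta> (Unit D) S Y \<bullet> (\<l> S \<boxtimes> \<iota> Y) = \<l> (S \<otimes> Y)" by (simp flip: \<l>_tensor)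
  have "cl X Y (Unit D \<otimes> S) ((\<mu>' (Unit D) S \<boxtimes> \<iota> X) \<bullet> \<alpha> (OMap F (Unit D)) (OMap F S) X
      \<bullet> (tinv D \<epsilon> \<boxtimes> f) \<bullet> \<beta> (Unit D) S Y)
    = cl X Y S f"
  proof (rule slide_iso[OF stateful_fbk[OF s] assms, where r = "\<l> S"])
    show "(\<Phi> (\<l> S) \<boxtimes> \<iota> X) \<bullet> f = ((\<mu>' (Unit D) S \<boxtimes> \<iota> X) \<bullet> \<alpha> (OMap F (Unit D)) (OMap F S) X
        \<bullet> (tinv D \<epsilon> \<boxtimes> f) \<bullet> \<beta> (Unit D) S Y) \<bullet> (\<l> S \<boxtimes> \<iota> Y)"
      by (simp add: tmap_\<l> whisker 1 2 \<alpha>_natural_whisker[THEN tcomp_reassoc] flip: \<l>_tensor)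
  qed simp_all
  then show ?thesis using s by (simp add: spure_def fbk_cls)
qed

theorem symmetric_monoidal_pure: "symmetric_monoidal_functor D E (spure_fun D F)"
proof -
  interpret E: symmetric_monoidal_category E by (rule symmetric_monoidal_scat)
  have J: "AMap (spure_fun D F) (raw t) = J t" if "ok D t" for t
    using raw_hom[OF that] mk_raw[OF that] by (simp add: spure_fun_arr)
  have coh: "AMap (spure_fun D F) (Id D X) = J (\<iota> X)"
    "AMap (spure_fun D F) (Assoc D X Y Z) = J (\<alpha> X Y Z)" "AMap (spure_fun D F) (Lunit D X)
        = J (\<l> X)"
    "AMap (spure_fun D F) (Runit D X) = J (\<r> X)" "AMap (spure_fun D F) (Sym D X Y) = J (\<sigma> X Y)"
    if "X \<in> Obj D" "Y \<in> Obj D" "Z \<in> Obj D" for X Y Z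
    using that J[of "\<iota> X"] J[of "\<alpha> X Y Z"] J[of "\<l> X"] J[of "\<r> X"] J[of "\<sigma> X Y"]
    by (simp_all add: raw_id raw_structure)
  show ?thesis
  proof
    show "AMap (spure_fun D F) (f \<Zcomp> g) = AMap (spure_fun D F) f \<Zcomp>\<^bsub>E\<^esub> AMap (spure_fun D F) g"
      if "f \<in> hom D X Y" "g \<in> hom D Y Z" for f g X Y Z
      using that J[of "mk D X Y f \<bullet> mk D Y Z g"] pure_comp[of "mk D X Y f" "mk D Y Z g"]
      by (simp add: spure_fun_arr ok_mk raw_comp raw_mk)
    show "(AMap (spure_fun D F) f \<odot>\<^bsub>E\<^esub> AMap (spure_fun D F) g) \<Zcomp>\<^bsub>E\<^esub> TenMap (spure_fun D F) X' Y'
      = TenMap (spure_fun D F) X Y \<Zcomp>\<^bsub>E\<^esub> AMap (spure_fun D F) (f \<odot> g)"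
      if "f \<in> hom D X X'" "g \<in> hom D Y Y'" for f g X X' Y Y'
    proof -
      have o: "X \<in> Obj D" "X' \<in> Obj D" "Y \<in> Obj D" "Y' \<in> Obj D"
        using that ok_obj[of "mk D X X' f"] ok_obj[of "mk D Y Y' g"] by (simp_all add: ok_mk)
      show ?thesis
        using that o J[of "mk D X X' f \<boxtimes> mk D Y Y' g"]
        by (simp add: spure_fun_arr ok_mk raw_ten raw_mk pure_ten pure_comp)
    qed
  qed (use coh in \<open>simp_all add: spure_fun_arr pure_hom ok_mk pure_iso pure_ten pure_comp\<close>)
qed

lemma pure_commutes: "commutes_with D F E (Endo E) (spure_fun D F)"
proof -
  interpret FF: commuting_functor D F D F F by (rule commuting_self)
  have J: "AMap (spure_fun D F) (raw t) = J t" if "ok D t" for t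
    using raw_hom[OF that] mk_raw[OF that] by (simp add: spure_fun_arr)
  have "AMap (spure_fun D F) (AMap F f) = FF.M (AMap (spure_fun D F) f)" if "f \<in> Arr D" for f
  proof -
    have f: "f \<in> hom D (Dom D f) (Cod D f)" using that by (simp add: hom_def)
    let ?t = "mk D (Dom D f) (Cod D f) f"
    have "ok D ?t" using f by (simp add: ok_mk)
    then show ?thesis
      using J[of "\<Phi> ?t"] J[of ?t] f by (simp add: raw_tmap raw_mk FF.map_pure)
  qed
  moreover have "AMap (spure_fun D F) (TenMap F X Y) = J (\<mu> X Y)" if "X \<in> Obj D" "Y \<in> Obj D" for X Y
    using J[of "\<mu> X Y"] that by (simp add: raw_mu)
  ultimately show ?thesis
    using J[of \<epsilon>]
    by (auto simp: commutes_with_def mfun_eq_def raw_eps raw_mu FF.map_pure pure_comp)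
qed

end

text \<open>Feedback of the image has state \<open>N T \<otimes> N S\<close>, the image of the
  feedback \<open>N (T \<otimes> S)\<close>; the slide is along the structure map of
  \<open>N\<close>.\<close>

theorem (in commuting_functor) feedback_sfun: "feedback_functor D.E D'.E (sfun D F D' F' N)"
proof (rule feedback_functorI)
  show "feedback_category D.E" "feedback_category D'.E" by (rule D.feedback_scat D'.feedback_scat)+
  interpret E: feedback_category D.E by (rule D.feedback_scat)
  interpret E': feedback_category D'.E by (rule D'.feedback_scat)
  interpret S: symmetric_monoidal_functor D.E D'.E "sfun D F D' F' N"
      by (rule symmetric_monoidal_sfun)
  show "commuting_functor D.E (Endo D.E) D'.E (Endo D'.E) (sfun D F D' F' N)"
    using E.monoidal_endofunctor E'.monoidal_endofunctor symmetric_monoidal_sfun map_commutes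
    by (simp add: commuting_functor_def commuting_functor_axioms_def)
  fix S X Y e assume "stateful D.E (Endo D.E) X Y S e"
  then have "raw e \<in> hom D.E (OMap F S \<otimes>\<^bsub>D\<^esub> X) (S \<otimes>\<^bsub>D\<^esub> Y)" and [simp]: "S \<in> Obj D" "X \<in> Obj D"
      "Y \<in> Obj D"
    and e [simp]: "ok D.E e" "src e = OMap F S \<otimes>\<^bsub>D\<^esub> X" "tgt e = S \<otimes>\<^bsub>D\<^esub> Y"
    using raw_hom[of D.E e] by (auto simp: stateful_def)
  then obtain T g where *: "D.sf (OMap F S \<otimes>\<^bsub>D\<^esub> X) (S \<otimes>\<^bsub>D\<^esub> Y) T g" "raw e
      = D.cl (OMap F S \<otimes>\<^bsub>D\<^esub> X) (S \<otimes>\<^bsub>D\<^esub> Y) T g"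
    by (elim D.hom_cls)
  note [simp] = D.statefulD[OF *(1)]
  let ?N = "tconj D D' N"
  let ?g = "?N (OMap F T) (OMap F S \<otimes>\<^bsub>D\<^esub> X) T (S \<otimes>\<^bsub>D\<^esub> Y) g"
  let ?m = "tmu D D' N"
  \<comment> \<open>The body of the image of \<open>raw e\<close> conjugated by the structure maps
    of the new functor. These are stateless, so they act on the body alone and leave the state
    \<open>N T\<close> unchanged.\<close>
  let ?c = "(\<iota>\<^bsub>D'\<^esub> (OMap F' (OMap N T)) \<boxtimes>\<^bsub>D'\<^esub> ?m (OMap F S) X) \<bullet>\<^bsub>D'\<^esub> ?g
      \<bullet>\<^bsub>D'\<^esub> (\<iota>\<^bsub>D'\<^esub> (OMap N T) \<boxtimes>\<^bsub>D'\<^esub> tinv D' (?m S Y))"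
  have m: "tmu D.E D'.E (sfun D F D' F' N) A B = mk D'.E (OMap N A \<otimes>\<^bsub>D'\<^esub> OMap N B) (OMap N (A \<otimes>\<^bsub>D\<^esub>
      B)) (D'.J (?m A B))" for A B
    by (simp add: tmu_def)
  have im: "tinv D'.E (tmu D.E D'.E (sfun D F D' F' N) A B)
    = mk D'.E (OMap N (A \<otimes>\<^bsub>D\<^esub> B)) (OMap N A \<otimes>\<^bsub>D'\<^esub> OMap N B) (D'.J (tinv D' (?m A B)))" if
        "A \<in> Obj D" "B \<in> Obj D" for A B
    unfolding m using that by (simp add: E'.tinv_mk D'.pure_iso)
  have Fo [simp]: "OMap F S \<in> Obj D.E" "S \<in> Obj D.E" "X \<in> Obj D.E" "Y \<in> Obj D.E" by simp_all
  have g': "D'.sf (OMap N (OMap F S \<otimes>\<^bsub>D\<^esub> X)) (OMap N (S \<otimes>\<^bsub>D\<^esub> Y)) (OMap N T) ?g"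
      using stateful_conj[OF *(1)] .
  have c': "D'.sf (OMap F' (OMap N S) \<otimes>\<^bsub>D'\<^esub> OMap N X) (OMap N (S \<otimes>\<^bsub>D\<^esub> Y)) (OMap N T) ((\<iota>\<^bsub>D'\<^esub> (OMap
      F' (OMap N T)) \<boxtimes>\<^bsub>D'\<^esub> ?m (OMap F S) X) \<bullet>\<^bsub>D'\<^esub> ?g)"
    and c: "D'.sf (OMap F' (OMap N S) \<otimes>\<^bsub>D'\<^esub> OMap N X) (OMap N S \<otimes>\<^bsub>D'\<^esub> OMap N Y) (OMap N T) ?c"
    by (simp_all add: stateful_def comm_obj)
  have "raw (tconj D.E D'.E (sfun D F D' F' N) (OMap (Endo D.E) S) X S Y e)
    = scomp D' F' (scomp D' F' (D'.J (?m (OMap F S) X)) (M (raw e))) (D'.J (tinv D' (?m S Y)))"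
  proof -
    have "tconj D.E D'.E (sfun D F D' F' N) (OMap F S) X S Y e =
      (tmu D.E D'.E (sfun D F D' F' N) (OMap F S) X \<bullet>\<^bsub>D'.E\<^esub> tmap D.E (sfun D F D' F' N) e)
          \<bullet>\<^bsub>D'.E\<^esub> tinv D'.E (tmu D.E D'.E (sfun D F D' F' N) S Y)"
      by (simp add: tconj_def)
    also have "raw \<dots> = scomp D' F' (scomp D' F' (D'.J (?m (OMap F S) X)) (M (raw e))) (D'.J (tinv
        D' (?m S Y)))"
    proof -
      have "D'.J (?m (OMap F S) X) \<in> hom D'.E (OMap N (OMap F S) \<otimes>\<^bsub>D'\<^esub> OMap N X) (OMap N (OMap F S
          \<otimes>\<^bsub>D\<^esub> X))"
        "D'.J (tinv D' (?m S Y)) \<in> hom D'.E (OMap N (S \<otimes>\<^bsub>D\<^esub> Y)) (OMap N S \<otimes>\<^bsub>D'\<^esub> OMap N Y)"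
        by (simp_all add: D'.pure_hom)
      then show ?thesis
        using S.ok_tmap[of e] im[of S Y] by (simp add: E'.raw_comp m S.raw_tmap raw_mk ok_mk del:
            E'.tcomp_assoc)
    qed
    finally show ?thesis by simp
  qed
  also have "\<dots> = D'.cl (OMap F' (OMap N S) \<otimes>\<^bsub>D'\<^esub> OMap N X) (OMap N S \<otimes>\<^bsub>D'\<^esub> OMap N Y) (OMap N T) ?c"
    using *(2) map_cls[OF *(1)] D'.pure_comp_left[OF g', of
        "?m (OMap F S) X"] D'.pure_comp_right[OF c', of "tinv D' (?m S Y)"]
    by (simp add: comm_obj)
  finally have r: "raw (tconj D.E D'.E (sfun D F D' F' N) (OMap (Endo D.E) S) X S Y e) = \<dots>" .
  have f: "D.sf X Y (T \<otimes>\<^bsub>D\<^esub> S) ((D.\<mu>' T S \<boxtimes>\<^bsub>D\<^esub> \<iota>\<^bsub>D\<^esub> X) \<bullet>\<^bsub>D\<^esub> \<alpha>\<^bsub>D\<^esub> (OMap F T) (OMap F S) X \<bullet>\<^bsub>D\<^esub> g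
      \<bullet>\<^bsub>D\<^esub> \<beta>\<^bsub>D\<^esub> T S Y)"
    using *(1) by simp
  have 1: "(tmap D' F' (?m T S) \<boxtimes>\<^bsub>D'\<^esub> \<iota>\<^bsub>D'\<^esub> (OMap N X))
      \<bullet>\<^bsub>D'\<^esub> (tmap D N (D.\<mu>' T S) \<boxtimes>\<^bsub>D'\<^esub> \<iota>\<^bsub>D'\<^esub> (OMap N X))
    = (D'.\<mu>' (OMap N T) (OMap N S) \<boxtimes>\<^bsub>D'\<^esub> \<iota>\<^bsub>D'\<^esub> (OMap N X))
        \<bullet>\<^bsub>D'\<^esub> (?m (OMap F T) (OMap F S) \<boxtimes>\<^bsub>D'\<^esub> \<iota>\<^bsub>D'\<^esub> (OMap N X))"
    by (simp add: comm_obj comm_mu_inv flip: D'.whisker)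
  have 2: "?N (OMap F (T \<otimes>\<^bsub>D\<^esub> S)) X (T \<otimes>\<^bsub>D\<^esub> S) Y ((D.\<mu>' T S \<boxtimes>\<^bsub>D\<^esub> \<iota>\<^bsub>D\<^esub> X)
      \<bullet>\<^bsub>D\<^esub> \<alpha>\<^bsub>D\<^esub> (OMap F T) (OMap F S) X \<bullet>\<^bsub>D\<^esub> g \<bullet>\<^bsub>D\<^esub> \<beta>\<^bsub>D\<^esub> T S Y)
    = (tmap D N (D.\<mu>' T S) \<boxtimes>\<^bsub>D'\<^esub> \<iota>\<^bsub>D'\<^esub> (OMap N X)) \<bullet>\<^bsub>D'\<^esub>
      ?N (OMap F T \<otimes>\<^bsub>D\<^esub> OMap F S) X (OMap F T) (OMap F S \<otimes>\<^bsub>D\<^esub> X) (\<alpha>\<^bsub>D\<^esub> (OMap F T) (OMap F S) X)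
          \<bullet>\<^bsub>D'\<^esub> ?g
      \<bullet>\<^bsub>D'\<^esub> ?N T (S \<otimes>\<^bsub>D\<^esub> Y) (T \<otimes>\<^bsub>D\<^esub> S) Y (\<beta>\<^bsub>D\<^esub> T S Y)"
    by (simp add: tconj_comp[of _ _ _ "OMap F T \<otimes>\<^bsub>D\<^esub> OMap F S" X] tconj_comp[of _ _ _ "OMap F T"
        "OMap F S \<otimes>\<^bsub>D\<^esub> X"]
      tconj_comp[of _ _ _ T "S \<otimes>\<^bsub>D\<^esub> Y"] tconj_tten)
  have 3: "?N T (S \<otimes>\<^bsub>D\<^esub> Y) (T \<otimes>\<^bsub>D\<^esub> S) Y (\<beta>\<^bsub>D\<^esub> T S Y) = (\<iota>\<^bsub>D'\<^esub> (OMap N T) \<boxtimes>\<^bsub>D'\<^esub> tinv D' (?m S Y))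
      \<bullet>\<^bsub>D'\<^esub>
      \<beta>\<^bsub>D'\<^esub> (OMap N T) (OMap N S) (OMap N Y) \<bullet>\<^bsub>D'\<^esub> (?m T S \<boxtimes>\<^bsub>D'\<^esub> \<iota>\<^bsub>D'\<^esub> (OMap N Y))"
    by (simp add: D'.whisker_cancel flip: tconj_\<beta>)
  have "D'.cl (OMap N X) (OMap N Y) (OMap N T \<otimes>\<^bsub>D'\<^esub> OMap N S) ((D'.\<mu>' (OMap N T) (OMap N S) \<boxtimes>\<^bsub>D'\<^esub>
      \<iota>\<^bsub>D'\<^esub> (OMap N X)) \<bullet>\<^bsub>D'\<^esub>
      \<alpha>\<^bsub>D'\<^esub> (OMap F' (OMap N T)) (OMap F' (OMap N S)) (OMap N X) \<bullet>\<^bsub>D'\<^esub> ?c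
          \<bullet>\<^bsub>D'\<^esub> \<beta>\<^bsub>D'\<^esub> (OMap N T) (OMap N S) (OMap N Y))
    = D'.cl (OMap N X) (OMap N Y) (OMap N (T \<otimes>\<^bsub>D\<^esub> S))
      (?N (OMap F (T \<otimes>\<^bsub>D\<^esub> S)) X (T \<otimes>\<^bsub>D\<^esub> S) Y ((D.\<mu>' T S \<boxtimes>\<^bsub>D\<^esub> \<iota>\<^bsub>D\<^esub> X)
          \<bullet>\<^bsub>D\<^esub> \<alpha>\<^bsub>D\<^esub> (OMap F T) (OMap F S) X \<bullet>\<^bsub>D\<^esub> g \<bullet>\<^bsub>D\<^esub> \<beta>\<^bsub>D\<^esub> T S Y))"
  proof (rule D'.slide_iso[OF D'.stateful_fbk[OF c] stateful_conj[OF f], where r = "?m T S"])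
    show "(tmap D' F' (?m T S) \<boxtimes>\<^bsub>D'\<^esub> \<iota>\<^bsub>D'\<^esub> (OMap N X)) \<bullet>\<^bsub>D'\<^esub>
      ?N (OMap F (T \<otimes>\<^bsub>D\<^esub> S)) X (T \<otimes>\<^bsub>D\<^esub> S) Y ((D.\<mu>' T S \<boxtimes>\<^bsub>D\<^esub> \<iota>\<^bsub>D\<^esub> X)
          \<bullet>\<^bsub>D\<^esub> \<alpha>\<^bsub>D\<^esub> (OMap F T) (OMap F S) X \<bullet>\<^bsub>D\<^esub> g \<bullet>\<^bsub>D\<^esub> \<beta>\<^bsub>D\<^esub> T S Y)
      = ((D'.\<mu>' (OMap N T) (OMap N S) \<boxtimes>\<^bsub>D'\<^esub> \<iota>\<^bsub>D'\<^esub> (OMap N X)) \<bullet>\<^bsub>D'\<^esub>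
      \<alpha>\<^bsub>D'\<^esub> (OMap F' (OMap N T)) (OMap F' (OMap N S)) (OMap N X) \<bullet>\<^bsub>D'\<^esub> ?c
          \<bullet>\<^bsub>D'\<^esub> \<beta>\<^bsub>D'\<^esub> (OMap N T) (OMap N S) (OMap N Y))
      \<bullet>\<^bsub>D'\<^esub> (?m T S \<boxtimes>\<^bsub>D'\<^esub> \<iota>\<^bsub>D'\<^esub> (OMap N Y))"
      unfolding 2 using 1[THEN D'.tcomp_reassoc] tconj_\<alpha>[of "OMap F T"
          "OMap F S" X, THEN D'.tcomp_reassoc]
      by (simp add: 3 comm_obj)
  qed simp_all
  then show "M (Fbk D.E S X Y (raw e)) = Fbk D'.E (OMap (sfun D F D' F' N) S) (OMap (sfun D F D'
      F' N) X) (OMap (sfun D F D' F' N) Y)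
      (raw (tconj D.E D'.E (sfun D F D' F' N) (OMap (Endo D.E) S) X S Y e))"
    unfolding r using *(2) map_cls[OF f] D.fbk_cls[OF *(1)] D'.fbk_cls[OF c] by simp
qed

section \<open>The universal property\<close>

definition tfbk :: "('o, 'm) fbc \<Rightarrow> 'o \<Rightarrow> 'o \<Rightarrow> 'o \<Rightarrow> ('o, 'm) typed \<Rightarrow> ('o, 'm) typed" where
  "tfbk B S X Y t = mk B X Y (Fbk B S X Y (raw t))"

lemma src_tgt_fbk [simp]: "src (tfbk B S X Y t) = X" "tgt (tfbk B S X Y t) = Y"
  by (simp_all add: tfbk_def)

definition fold_fun :: "('o, 'm) fbc \<Rightarrow> ('o, ('o, 'm) starr, 'o, 'm) mfun" where
  "fold_fun B =
    \<lparr>OMap = (\<lambda>X. X),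
     AMap = lift B (Endo B) (\<lambda>X Y S f. raw (tfbk B S X Y f)),
     UnitMap = Id B (Unit B),
     TenMap = (\<lambda>X Y. Id B (X \<otimes>\<^bsub>B\<^esub> Y))\<rparr>"

lemma fold_fun_simps [simp]:
  "OMap (fold_fun B) X = X" "UnitMap (fold_fun B) = Id B (Unit B)" "TenMap (fold_fun B) X Y
      = Id B (X \<otimes>\<^bsub>B\<^esub> Y)"
  by (simp_all add: fold_fun_def)

text \<open>The construction is applied to a feedback category \<open>B\<close> with its own
  endofunctor: \<open>E\<close> is the category of classes over \<open>B\<close>, and
  \<open>P\<close> evaluates a class by performing its feedback in \<open>B\<close>.\<close>

locale plain_feedback_category = monoidal_endofunctor B "Endo B" + feedback_category B
  for B :: "('o, 'm) fbc" (structure)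
begin

abbreviation "F \<equiv> OMap (Endo B)"
abbreviation "P \<equiv> AMap (fold_fun B)"

section \<open>The feedback axioms on typed arrows\<close>

lemma
  assumes "sf X Y S f"
  shows ok_fbk [simp]: "ok B (tfbk B S X Y f)" and raw_fbk: "raw (tfbk B S X Y f)
      = Fbk B S X Y (raw f)"
  using fbk_hom[of S X Y "raw f"] statefulD[OF assms] raw_hom[of B f]
  by (simp_all add: tfbk_def ok_mk raw_mk)

lemma tfbk_tight:
  assumes [simp]: "sf X Y S f" "ok B u" "src u = W" "tgt u = X" "ok B v" "src v = Y" "tgt v = Z"
  shows "u \<bullet> tfbk B S X Y f \<bullet> v = tfbk B S W Z ((\<iota> (F S) \<boxtimes> u) \<bullet> f \<bullet> (\<iota> S \<boxtimes> v))"
proof -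
  note [simp] = statefulD[OF assms(1)]
  have o: "W \<in> Obj B" "Z \<in> Obj B" using ok_obj(1)[of u] ok_obj(2)[of v] by simp_all
  then have s: "sf W Z S ((\<iota> (F S) \<boxtimes> u) \<bullet> f \<bullet> (\<iota> S \<boxtimes> v))" by (simp add: stateful_def)
  have "raw (u \<bullet> tfbk B S X Y f \<bullet> v) = raw (tfbk B S W Z ((\<iota> (F S) \<boxtimes> u) \<bullet> f \<bullet> (\<iota> S \<boxtimes> v)))"
    unfolding raw_fbk[OF s]
    using fbk_tightening[of S "raw f" X Y "raw u" W "raw v" Z] raw_hom[of B f] raw_hom[of B u]
        raw_hom[of B v]
    by (simp add: raw_comp raw_ten raw_id raw_fbk del: tcomp_assoc flip: tcomp_assoc)
  then show ?thesis using s by (intro typed_eqI[where C = B]) simp_all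
qed

lemma tfbk_tight_left:
  assumes "sf X Y S f" "ok B u" "src u = W" "tgt u = X"
  shows "u \<bullet> tfbk B S X Y f = tfbk B S W Y ((\<iota> (F S) \<boxtimes> u) \<bullet> f)"
  using tfbk_tight[OF assms, of "\<iota> Y" Y] assms statefulD[OF assms(1)] by simp

lemma tfbk_tight_right:
  assumes "sf X Y S f" "ok B v" "src v = Y" "tgt v = Z"
  shows "tfbk B S X Y f \<bullet> v = tfbk B S X Z (f \<bullet> (\<iota> S \<boxtimes> v))"
proof -
  note o = statefulD[OF assms(1)] ok_obj(2)[OF assms(2)]
  have "sf X Z S (f \<bullet> (\<iota> S \<boxtimes> v))" using assms o by (auto simp: stateful_def)
  then show ?thesis using tfbk_tight[OF assms(1) _ _ _ assms(2-), of "\<iota> X" X] assms o by simp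
qed

lemma tfbk_vanish:
  assumes "sf X Y (Unit B) f"
  shows "tfbk B (Unit B) X Y f = tinv B (\<l> X) \<bullet> (\<epsilon> \<boxtimes> \<iota> X) \<bullet> f \<bullet> \<l> Y"
proof (rule typed_eqI[where C = B])
  note [simp] = statefulD[OF assms]
  show "raw (tfbk B (Unit B) X Y f) = raw (tinv B (\<l> X) \<bullet> (\<epsilon> \<boxtimes> \<iota> X) \<bullet> f \<bullet> \<l> Y)"
    using fbk_vanishing[of X Y "raw f"] raw_hom[of B f] arr_inv_raw[of "\<l> X"]
    by (simp add: raw_fbk[OF assms] raw_comp raw_ten raw_id raw_structure raw_eps del: tcomp_assoc
        flip: tcomp_assoc)
qed (use assms statefulD[OF assms] in simp_all)

lemma tfbk_join:
  assumes "sf (F T \<otimes> X) (T \<otimes> Y) S f" "T \<in> Obj B" "X \<in> Obj B" "Y \<in> Obj B"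
  shows "tfbk B T X Y (tfbk B S (F T \<otimes> X) (T \<otimes> Y) f)
    = tfbk B (S \<otimes> T) X Y ((\<mu>' S T \<boxtimes> \<iota> X) \<bullet> \<alpha> (F S) (F T) X \<bullet> f \<bullet> \<beta> S T Y)"
proof (rule typed_eqI[where C = B])
  note [simp] = statefulD[OF assms(1)] assms(2-)
  have s: "sf X Y T (tfbk B S (F T \<otimes> X) (T \<otimes> Y) f)" using assms(1) by
      (simp add: stateful_def[of _ _ X])
  have s': "sf X Y (S \<otimes> T) ((\<mu>' S T \<boxtimes> \<iota> X) \<bullet> \<alpha> (F S) (F T) X \<bullet> f \<bullet> \<beta> S T Y)" by
      (simp add: stateful_def)
  show "raw (tfbk B T X Y (tfbk B S (F T \<otimes> X) (T \<otimes> Y) f))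
      = raw (tfbk B (S \<otimes> T) X Y ((\<mu>' S T \<boxtimes> \<iota> X) \<bullet> \<alpha> (F S) (F T) X \<bullet> f \<bullet> \<beta> S T Y))"
    unfolding raw_fbk[OF s] raw_fbk[OF s'] raw_fbk[OF assms(1)]
    using fbk_joining[of S T X Y "raw f"] raw_hom[of B f] arr_inv_raw[of "\<mu> S T"]
    by (simp add: raw_comp raw_ten raw_id raw_structure raw_unassoc raw_mu del: tcomp_assoc
        flip: tcomp_assoc)
  show "ok B (tfbk B T X Y (tfbk B S (F T \<otimes> X) (T \<otimes> Y) f))" using s by simp
  show "ok B (tfbk B (S \<otimes> T) X Y ((\<mu>' S T \<boxtimes> \<iota> X) \<bullet> \<alpha> (F S) (F T) X \<bullet> f \<bullet> \<beta> S T Y))" using s' by simp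
qed simp_all

lemma tfbk_ext:
  assumes "sf X Y S f" "Z \<in> Obj B"
  shows "tfbk B S (X \<otimes> Z) (Y \<otimes> Z) (ext B (F S) X S Y Z f) = tfbk B S X Y f \<boxtimes> \<iota> Z"
proof (rule typed_eqI[where C = B])
  note [simp] = statefulD[OF assms(1)] assms(2)
  have s: "sf (X \<otimes> Z) (Y \<otimes> Z) S (ext B (F S) X S Y Z f)" using assms by simp
  show "raw (tfbk B S (X \<otimes> Z) (Y \<otimes> Z) (ext B (F S) X S Y Z f)) = raw (tfbk B S X Y f \<boxtimes> \<iota> Z)"
    unfolding raw_fbk[OF s]
    using fbk_strength[of S X Y "raw f" "Id B Z" Z Z] raw_hom[of B f] assms(1) id_hom[of Z]
    by (simp add: raw_comp raw_ten raw_id raw_structure raw_unassoc raw_fbk ext_def del: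
        tcomp_assoc flip: tcomp_assoc)
  show "ok B (tfbk B S (X \<otimes> Z) (Y \<otimes> Z) (ext B (F S) X S Y Z f))" using s by simp
qed (use assms in simp_all)

text \<open>Strength is an axiom for a wire on the right. Tightening with the symmetries at both
  ends gives the version on the left.\<close>

lemma tfbk_ins:
  assumes "sf X Y S f" "A \<in> Obj B"
  shows "tfbk B S (A \<otimes> X) (A \<otimes> Y) (ins B (F S) X S Y A f) = \<iota> A \<boxtimes> tfbk B S X Y f"
proof -
  note [simp] = statefulD[OF assms(1)] assms(2)
  have s: "sf (X \<otimes> A) (Y \<otimes> A) S (ext B (F S) X S Y A f)" using assms by simp
  have "tfbk B S (A \<otimes> X) (A \<otimes> Y) (ins B (F S) X S Y A f) = \<sigma> A X
      \<bullet> tfbk B S (X \<otimes> A) (Y \<otimes> A) (ext B (F S) X S Y A f) \<bullet> \<sigma> Y A"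
    using tfbk_tight[OF s, of "\<sigma> A X" "A \<otimes> X" "\<sigma> Y A" "A \<otimes> Y"] by (simp add: ins_def)
  also have "\<dots> = \<iota> A \<boxtimes> tfbk B S X Y f"
    using assms(1) \<sigma>_natural[of "tfbk B S X Y f" "\<iota> A" Y A X A] by (simp add: tfbk_ext[OF assms])
  finally show ?thesis .
qed

lemma tfbk_slide:
  assumes "X \<in> Obj B" "Y \<in> Obj B" "ok B r" "src r = S" "tgt r = T" "ok B h" "src h = F T \<otimes> X"
      "tgt h = S \<otimes> Y"
  shows "tfbk B S X Y ((\<Phi> r \<boxtimes> \<iota> X) \<bullet> h) = tfbk B T X Y (h \<bullet> (r \<boxtimes> \<iota> Y))"
proof (rule typed_eqI[where C = B])
  have o: "S \<in> Obj B" "T \<in> Obj B" using assms ok_obj by auto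
  have s: "sf X Y S ((\<Phi> r \<boxtimes> \<iota> X) \<bullet> h)" "sf X Y T (h \<bullet> (r \<boxtimes> \<iota> Y))" using assms o by
      (simp_all add: stateful_def)
  show "raw (tfbk B S X Y ((\<Phi> r \<boxtimes> \<iota> X) \<bullet> h)) = raw (tfbk B T X Y (h \<bullet> (r \<boxtimes> \<iota> Y)))"
    unfolding s[THEN raw_fbk]
    using fbk_sliding[of X Y "raw r" S T "raw h"] raw_hom[of B r] raw_hom[of B h] assms o
    by (simp add: raw_comp raw_ten raw_id raw_tmap)
  show "ok B (tfbk B S X Y ((\<Phi> r \<boxtimes> \<iota> X) \<bullet> h))" "ok B (tfbk B T X Y (h \<bullet> (r \<boxtimes> \<iota> Y)))" using s by
      simp_all
qed simp_all

text \<open>Why evaluation is a functor: left tightening brings the first feedback under the second,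
  strength and right tightening combine it with \<open>g\<close>, and joining merges the nested
  feedbacks into one over \<open>S \<otimes> T\<close>.\<close>

lemma tfbk_comp:
  assumes "sf X Y S f" "sf Y Z T g"
  shows "tfbk B S X Y f \<bullet> tfbk B T Y Z g
    = tfbk B (S \<otimes> T) X Z ((\<mu>' S T \<boxtimes> \<iota> X) \<bullet> star B (F S) X S Y (F T) T Z f g)"
proof -
  note [simp] = statefulD[OF assms(1)] statefulD[OF assms(2)]
  have i: "sf (F T \<otimes> X) (F T \<otimes> Y) S (ins B (F S) X S Y (F T) f)" using assms by simp
  have s: "sf (F T \<otimes> X) (T \<otimes> Z) S (ins B (F S) X S Y (F T) f \<bullet> (\<iota> S \<boxtimes> g))" by
      (simp add: stateful_def)
  have "tfbk B S X Y f \<bullet> tfbk B T Y Z g = tfbk B T X Z ((\<iota> (F T) \<boxtimes> tfbk B S X Y f) \<bullet> g)"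
    using assms by (simp add: tfbk_tight_left)
  also have "(\<iota> (F T) \<boxtimes> tfbk B S X Y f) \<bullet> g = tfbk B S (F T \<otimes> X) (T \<otimes> Z) (ins B (F S) X S Y (F T)
      f \<bullet> (\<iota> S \<boxtimes> g))"
    using assms i by (simp add: tfbk_tight_right flip: tfbk_ins)
  finally show ?thesis using tfbk_join[OF s] by (simp add: star_def)
qed

text \<open>The sliding axiom of \<open>B\<close> says precisely that feedback is constant along the
  generating steps of the coend.\<close>

lemma fold_cls:
  assumes "sf X Y S f"
  shows "P (cl X Y S f) = raw (tfbk B S X Y f)"
proof -
  have "invariant (\<lambda>S f. raw (tfbk B S X Y f)) X Y"
    unfolding invariant_def using tfbk_slide statefulD[OF assms] by metis
  then show ?thesis unfolding fold_fun_def using lift_cls[OF assms, of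
      "\<lambda>X Y S f. raw (tfbk B S X Y f)"] by simp
qed

lemma fold_hom: "e \<in> hom E X Y \<Longrightarrow> P e \<in> hom B X Y"
proof (elim hom_cls)
  fix S f assume "sf X Y S f" "e = cl X Y S f"
  then show "P e \<in> hom B X Y" using raw_hom[of B "tfbk B S X Y f"] by (simp add: fold_cls)
qed

text \<open>The vanishing axiom; its unit map cancels the inverse unit map in the representative of
  \<open>J t\<close>.\<close>

lemma fold_pure:
  assumes "ok B t"
  shows "P (J t) = raw t"
proof -
  note [simp] = assms ok_obj[OF assms]
  have s: "sf (src t) (tgt t) (Unit B) (tinv B \<epsilon> \<boxtimes> t)" by simp
  have "(\<epsilon> \<boxtimes> \<iota> (src t)) \<bullet> (tinv B \<epsilon> \<boxtimes> t) = \<iota> (Unit B) \<boxtimes> t" by (simp flip: tten_comp)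
  from this[THEN tcomp_reassoc] show ?thesis
    using fold_cls[OF s] tfbk_vanish[OF s] by (simp add: spure_def \<l>_natural)
qed

lemma fold_comp:
  assumes "d \<in> hom E X Y" "e \<in> hom E Y Z"
  shows "P (scomp B (Endo B) d e) = P d \<Zcomp> P e"
proof -
  obtain S f T g where *: "sf X Y S f" "d = cl X Y S f" "sf Y Z T g" "e = cl Y Z T g"
    using assms by (elim hom_cls)
  have "P (scomp B (Endo B) d e) = raw (tfbk B S X Y f \<bullet> tfbk B T Y Z g)"
    using * by (simp add: scomp_cls fold_cls tfbk_comp)
  then show ?thesis using * by (simp add: fold_cls raw_comp)
qed

lemma fold_ten:
  assumes "d \<in> hom E X Y" "e \<in> hom E X' Y'"
  shows "P (sten B (Endo B) d e) = P d \<odot> P e"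
proof -
  obtain S f T g where *: "sf X Y S f" "d = cl X Y S f" "sf X' Y' T g" "e = cl X' Y' T g"
    using assms by (elim hom_cls)
  note [simp] = statefulD[OF *(1)] statefulD[OF *(3)]
  have h: "sext B (Endo B) X' d \<in> hom E (X \<otimes> X') (Y \<otimes> X')"
      "sins B (Endo B) Y e \<in> hom E (Y \<otimes> X') (Y \<otimes> Y')"
    using assms by (auto intro!: sext_hom sins_hom)
  have "P (sten B (Endo B) d e) = P (sext B (Endo B) X' d) \<Zcomp> P (sins B (Endo B) Y e)"
    using fold_comp[OF h] by (simp add: sten_def fst_hom[OF assms(1)] fst_hom[OF assms(2)])
  also have "\<dots> = raw ((tfbk B S X Y f \<boxtimes> \<iota> X') \<bullet> (\<iota> Y \<boxtimes> tfbk B T X' Y' g))"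
    using * by (simp add: sext_cls sins_cls fold_cls tfbk_ext tfbk_ins raw_comp)
  also have "\<dots> = raw (tfbk B S X Y f \<boxtimes> tfbk B T X' Y' g)"
    by (simp add: interchange)
  finally show ?thesis using * by (simp add: fold_cls raw_ten)
qed

lemma symmetric_monoidal_fold: "symmetric_monoidal_functor E B (fold_fun B)"
proof -
  interpret E: symmetric_monoidal_category E by (rule symmetric_monoidal_scat)
  have i: "Id B X \<in> iso B X X" if "X \<in> Obj B" for X
    using raw_iso[of "\<iota> X"] that by (simp add: raw_id)
  have P: "P (J t) = raw t" if "ok B t" for t by (rule fold_pure[OF that])
  show ?thesis
  proof
    show "(P f \<odot> P g) \<Zcomp> TenMap (fold_fun B) X' Y' = TenMap (fold_fun B) X Y \<Zcomp> P (f \<odot>\<^bsub>E\<^esub> g)"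
      if "f \<in> hom E X X'" "g \<in> hom E Y Y'" for f g X X' Y Y'
    proof -
      have "P f \<odot> P g \<in> hom B (X \<otimes> Y) (X' \<otimes> Y')" using that by (intro ten_hom fold_hom)
      then show ?thesis using fold_ten[OF that] id_left id_right by simp
    qed
    fix X Y Z assume o [simp]: "X \<in> Obj E" "Y \<in> Obj E" "Z \<in> Obj E"
    have "Assoc B X Y Z \<in> hom B ((X \<otimes> Y) \<otimes> Z) (X \<otimes> (Y \<otimes> Z))" using assoc_iso[of X Y Z] o by
        (simp add: iso_def)
    then show "(TenMap (fold_fun B) X Y \<odot> Id B (OMap (fold_fun B) Z))
        \<Zcomp> TenMap (fold_fun B) (X \<otimes>\<^bsub>E\<^esub> Y) Z \<Zcomp> P (Assoc E X Y Z)
      = Assoc B (OMap (fold_fun B) X) (OMap (fold_fun B) Y) (OMap (fold_fun B) Z) \<Zcomp>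
        (Id B (OMap (fold_fun B) X) \<odot> TenMap (fold_fun B) Y Z) \<Zcomp> TenMap (fold_fun B) X (Y \<otimes>\<^bsub>E\<^esub> Z)"
      using o id_left[OF id_hom] id_left id_right by (simp add: P raw_structure ten_id)
  next
    fix X assume o [simp]: "X \<in> Obj E"
    have "Lunit B X \<in> hom B (Unit B \<otimes> X) X" "Runit B X \<in> hom B (X \<otimes> Unit B) X"
      using lunit_iso[of X] runit_iso[of X] o by (simp_all add: iso_def)
    then show "(UnitMap (fold_fun B) \<odot> Id B (OMap (fold_fun B) X))
        \<Zcomp> TenMap (fold_fun B) (Unit E) X \<Zcomp> P (Lunit E X)
        = Lunit B (OMap (fold_fun B) X)"
      "(Id B (OMap (fold_fun B) X) \<odot> UnitMap (fold_fun B)) \<Zcomp> TenMap (fold_fun B) X (Unit E)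
          \<Zcomp> P (Runit E X)
        = Runit B (OMap (fold_fun B) X)"
      using o id_left[OF id_hom] id_left by (simp_all add: P raw_structure ten_id)
  qed (simp_all add: fold_hom fold_comp P raw_id raw_structure i id_left[OF sym_hom] id_right[OF
      sym_hom])
qed

text \<open>Commutation with the endofunctors on arrows is the assumption that \<open>Endo B\<close>
  preserves feedback, and preservation of feedback by the evaluation is the joining axiom of
  \<open>B\<close>.\<close>

lemma feedback_fold:
  assumes "feedback_functor B B (Endo B)"
  shows "feedback_functor E B (fold_fun B)"
proof (rule feedback_functorI)
  interpret BB: feedback_functor B B "Endo B" by fact
  interpret FF: commuting_functor B "Endo B" B "Endo B" "Endo B" by (rule commuting_self)
  show "feedback_category E" "feedback_category B" by (rule feedback_scat) unfold_locales
  interpret E: feedback_category E by (rule feedback_scat)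
  interpret S: symmetric_monoidal_functor E B "fold_fun B" by (rule symmetric_monoidal_fold)
  have "P (FF.M e) = AMap (Endo B) (P e)" if "e \<in> Arr E" for e
  proof -
    have "e \<in> hom E (Dom E e) (Cod E e)" using that by (simp add: hom_def)
    then obtain X Y S f where *: "sf X Y S f" "e = cl X Y S f" by (metis hom_cls)
    then show ?thesis
      using fold_cls[OF FF.stateful_conj[OF *(1)]] BB.map_fbk_typed[OF *(1)] raw_fbk[OF
          FF.stateful_conj[OF *(1)]]
      by (simp add: FF.map_cls fold_cls raw_fbk)
  qed
  moreover have "UnitMap (Endo B) \<Zcomp> AMap (Endo B) (Id B (Unit B)) = Id B (Unit B)
      \<Zcomp> UnitMap (Endo B)"
    using raw_hom[of B \<epsilon>] id_left id_right by (simp add: map_id raw_eps)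
  moreover have "TenMap (Endo B) X Y \<Zcomp> AMap (Endo B) (Id B (X \<otimes> Y)) = Id B (F X \<otimes> F Y)
      \<Zcomp> TenMap (Endo B) X Y"
    if "X \<in> Obj B" "Y \<in> Obj B" for X Y
    using that raw_hom[of B "\<mu> X Y"] id_left id_right by (simp add: map_id raw_mu)
  ultimately have "commutes_with E (Endo E) B (Endo B) (fold_fun B)"
    by (auto simp: commutes_with_def mfun_eq_def fold_pure raw_eps raw_mu)
  then show "commuting_functor E (Endo E) B (Endo B) (fold_fun B)"
    using E.monoidal_endofunctor monoidal_endofunctor symmetric_monoidal_fold
    by (simp add: commuting_functor_def commuting_functor_axioms_def)
  fix S X Y e assume "stateful E (Endo E) X Y S e"
  then have h: "raw e \<in> hom E (F S \<otimes> X) (S \<otimes> Y)" and o [simp]: "S \<in> Obj B" "X \<in> Obj B" "Y \<in> Obj B"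
    and e [simp]: "ok E e" "src e = F S \<otimes> X" "tgt e = S \<otimes> Y"
    using raw_hom[of E e] by (auto simp: stateful_def)
  then obtain T g where *: "sf (F S \<otimes> X) (S \<otimes> Y) T g" "raw e = cl (F S \<otimes> X) (S \<otimes> Y) T g"
    by (elim hom_cls)
  have m: "tmu E B (fold_fun B) A C = \<iota> (A \<otimes> C)" for A C by (simp add: tmu_def tid_def)
  have t: "raw (tconj E B (fold_fun B) (OMap (Endo E) S) X S Y e) = P (raw e)"
    using S.ok_tmap[of e] by (simp add: tconj_def m S.raw_tmap)
  have s: "sf X Y S (tfbk B T (F S \<otimes> X) (S \<otimes> Y) g)"
    using *(1) by (simp add: stateful_def[of _ _ X])
  show "P (Fbk E S X Y (raw e)) = Fbk B (OMap (fold_fun B) S) (OMap (fold_fun B) X) (OMap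
      (fold_fun B) Y)
      (raw (tconj E B (fold_fun B) (OMap (Endo E) S) X S Y e))"
    unfolding t using *(2) fold_cls[OF stateful_fbk[OF *(1)]] tfbk_join[OF *(1)] raw_fbk[OF s]
        fbk_cls[OF *(1)] fold_cls[OF *(1)]
    by simp
qed

end

section \<open>Uniqueness of extensions, and freeness\<close>

context monoidal_endofunctor
begin

lemma feedback_functor_determined:
  assumes "feedback_functor E B H" "feedback_functor E B H'"
    and eq: "mfun_eq D (mfun_comp B (spure_fun D F) H) (mfun_comp B (spure_fun D F) H')"
  shows "mfun_eq E H H'"
proof -
  interpret H: feedback_functor E B H by fact
  interpret H': feedback_functor E B H' by fact
  have J: "AMap (spure_fun D F) (raw t) = J t" if "ok D t" for t
    using raw_hom[OF that] mk_raw[OF that] by (simp add: spure_fun_arr)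
  have obj: "OMap H X = OMap H' X" if "X \<in> Obj D" for X
    using eq that by (simp add: mfun_eq_def)
  have pure: "AMap H (J t) = AMap H' (J t)" if "ok D t" for t
    using eq that J[OF that] raw_hom[OF that] by (auto simp: mfun_eq_def hom_def)
  \<comment> \<open>The hypothesis compares the unit maps only after composition with the images of
    an identity. Those images are identities, so the unit maps agree; the same applies to the tensor
    maps in \<open>m\<close>.\<close>
  have u: "UnitMap H' = UnitMap H"
  proof -
    have "AMap H (J (\<iota> (Unit D))) = Id B (OMap H (Unit D))" "AMap H' (J (\<iota> (Unit D)))
        = Id B (OMap H' (Unit D))"
      using H.map_id[of "Unit D"] H'.map_id[of "Unit D"] by simp_all
    moreover have "UnitMap H \<in> hom B (Unit B) (OMap H (Unit D))"
        "UnitMap H' \<in> hom B (Unit B) (OMap H' (Unit D))"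
      using H.unit_map_iso H'.unit_map_iso by (simp_all add: iso_def)
    ultimately show ?thesis using eq H.B.id_right by (simp add: mfun_eq_def)
  qed
  have m: "TenMap H' X Y = TenMap H X Y" if "X \<in> Obj D" "Y \<in> Obj D" for X Y
  proof -
    have "AMap H (J (\<iota> (X \<otimes> Y))) = Id B (OMap H (X \<otimes> Y))" "AMap H' (J (\<iota> (X \<otimes> Y)))
        = Id B (OMap H' (X \<otimes> Y))"
      using H.map_id[of "X \<otimes> Y"] H'.map_id[of "X \<otimes> Y"] that by simp_all
    moreover have "TenMap H X Y \<in> hom B (OMap H X \<otimes>\<^bsub>B\<^esub> OMap H Y) (OMap H (X \<otimes> Y))"
      "TenMap H' X Y \<in> hom B (OMap H' X \<otimes>\<^bsub>B\<^esub> OMap H' Y) (OMap H' (X \<otimes> Y))"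
      using H.ten_map_iso[of X Y] H'.ten_map_iso[of X Y] that by (simp_all add: iso_def)
    moreover have "TenMap H X Y \<Zcomp>\<^bsub>B\<^esub> AMap H (J (\<iota> (X \<otimes> Y))) = TenMap H' X Y
        \<Zcomp>\<^bsub>B\<^esub> AMap H' (J (\<iota> (X \<otimes> Y)))"
      using eq that by (simp add: mfun_eq_def)
    ultimately show ?thesis using H.B.id_right by simp
  qed
  have "AMap H e = AMap H' e" if "e \<in> Arr E" for e
  proof -
    have "e \<in> hom E (Dom E e) (Cod E e)" using that by (simp add: hom_def)
    then obtain X Y S f where *: "sf X Y S f" "e = cl X Y S f" by (metis hom_cls)
    note [simp] = statefulD[OF *(1)]
    have "e = Fbk E S X Y (J f)" using * by (simp add: cls_fbk_pure)
    moreover have "J f \<in> hom E (OMap (Endo E) S \<otimes>\<^bsub>E\<^esub> X) (S \<otimes>\<^bsub>E\<^esub> Y)" by (simp add: pure_hom)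
    ultimately show ?thesis
      using H.map_fbk[of S X Y "J f"] H'.map_fbk[of S X Y "J f"] by (simp add: obj m pure)
  qed
  then show ?thesis using obj u m by (simp add: mfun_eq_def)
qed

text \<open>The types \<open>'p\<close> and \<open>'q\<close> of the targets are arbitrary in this
  statement, so instances at several types can be used side by side.\<close>

theorem free_scat: "free_feedback_category TYPE(('p, 'q) fbc) D F E (spure_fun D F)"
  unfolding free_feedback_category_def
proof (intro conjI allI impI)
  show "symmetric_monoidal_functor D D F" by unfold_locales
  show "feedback_category E" by (rule feedback_scat)
  interpret FF: commuting_functor D F D F F by (rule commuting_self)
  show "feedback_functor E E (Endo E)" using FF.feedback_sfun by simp
  show "Obj E = Obj D" by simp
  show "symmetric_monoidal_functor D E (spure_fun D F)" by (rule symmetric_monoidal_pure)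
  show "\<forall>X \<in> Obj D. OMap (spure_fun D F) X = X" by simp
  show "commutes_with D F E (Endo E) (spure_fun D F)" by (rule pure_commutes)
  fix B :: "('p, 'q) fbc" and G
  assume a: "feedback_category B \<and> feedback_functor B B (Endo B) \<and> symmetric_monoidal_functor D B
      G \<and>
    commutes_with D F B (Endo B) G"
  interpret B: feedback_category B using a by blast
  interpret B: plain_feedback_category B by unfold_locales
  interpret G: commuting_functor D F B "Endo B" G
    using a monoidal_endofunctor_axioms B.monoidal_endofunctor
    by (simp add: commuting_functor_def commuting_functor_axioms_def)
  let ?H = "mfun_comp B (sfun D F B (Endo B) G) (fold_fun B)"
  have H: "feedback_functor E B ?H"
    by (rule feedback_functor_comp[OF G.feedback_sfun B.feedback_fold]) (use a in blast)
  have J: "AMap ?H (AMap (spure_fun D F) (raw t)) = AMap G (raw t)" if "ok D t" for t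
    using raw_hom[OF that] mk_raw[OF that] G.raw_tmap[OF that] G.ok_tmap[OF that]
    by (simp add: spure_fun_arr G.map_pure that B.fold_pure)
  have "mfun_eq D (mfun_comp B (spure_fun D F) ?H) G"
    unfolding mfun_eq_def
  proof (intro conjI ballI)
    show "OMap (mfun_comp B (spure_fun D F) ?H) X = OMap G X" for X by simp
    show "AMap (mfun_comp B (spure_fun D F) ?H) f = AMap G f" if "f \<in> Arr D" for f
    proof -
      have "f \<in> hom D (Dom D f) (Cod D f)" using that by (simp add: hom_def)
      then show ?thesis using J[of "mk D (Dom D f) (Cod D f) f"] by (simp add: ok_mk raw_mk)
    qed
    have "UnitMap G \<in> hom B (Unit B) (OMap G (Unit D))" using G.unit_map_iso by (simp add: iso_def)
    then show "UnitMap (mfun_comp B (spure_fun D F) ?H) = UnitMap G"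
      using B.id_left B.id_right by (simp add: G.map_pure B.fold_pure G.raw_eps B.raw_id)
    show "TenMap (mfun_comp B (spure_fun D F) ?H) X Y = TenMap G X Y" if "X \<in> Obj D" "Y \<in> Obj D"
        for X Y
    proof -
      have "TenMap G X Y \<in> hom B (OMap G X \<otimes>\<^bsub>B\<^esub> OMap G Y) (OMap G (X \<otimes> Y))"
        using G.ten_map_iso[OF that] by (simp add: iso_def)
      then show ?thesis
        using that B.id_left B.id_right by (simp add: G.map_pure B.fold_pure G.raw_mu B.raw_id)
    qed
  qed
  then have E: "mfun_eq D (mfun_comp B (spure_fun D F) ?H) G" .
  show "\<exists>H. feedback_functor E B H \<and> mfun_eq D (mfun_comp B (spure_fun D F) H) G \<and>
      (\<forall>H'. feedback_functor E B H' \<and> mfun_eq D (mfun_comp B (spure_fun D F) H') G \<longrightarrow> mfun_eq E H'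
          H)"
  proof (intro exI[of _ ?H] conjI allI impI)
    fix H' assume H': "feedback_functor E B H' \<and> mfun_eq D (mfun_comp B (spure_fun D F) H') G"
    then have "mfun_eq D (mfun_comp B (spure_fun D F) H') (mfun_comp B (spure_fun D F) ?H)"
      using E by (simp add: mfun_eq_def)
    then show "mfun_eq E H' ?H" using feedback_functor_determined[OF _ H] H' by blast
  qed (use H E in auto)
qed

end

section \<open>Sequences and dinatural sequences\<close>

definition id_fun :: "('o, 'm, 'z) smc_scheme \<Rightarrow> ('o, 'm, 'o, 'm) mfun" where
  "id_fun A = \<lparr>OMap = (\<lambda>X. X), AMap = (\<lambda>f. f), UnitMap = Id A (Unit A), TenMap
      = (\<lambda>X Y. Id A (X \<otimes>\<^bsub>A\<^esub> Y))\<rparr>"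

lemma id_fun_simps [simp]:
  "OMap (id_fun A) X = X" "AMap (id_fun A) f = f" "UnitMap (id_fun A) = Id A (Unit A)"
  "TenMap (id_fun A) X Y = Id A (X \<otimes>\<^bsub>A\<^esub> Y)"
  by (simp_all add: id_fun_def)

lemma (in symmetric_monoidal_functor) structure_hom:
  "UnitMap F \<in> hom D (Unit D) (OMap F (Unit C))"
  "\<lbrakk>X \<in> Obj C; Y \<in> Obj C\<rbrakk> \<Longrightarrow> TenMap F X Y \<in> hom D (OMap F X \<otimes>\<^bsub>D\<^esub> OMap F Y) (OMap F (X \<otimes>\<^bsub>C\<^esub> Y))"
  using unit_map_iso ten_map_iso by (simp_all add: iso_def)

lemma (in symmetric_monoidal_category) symmetric_monoidal_id:
    "symmetric_monoidal_functor C C (id_fun C)"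
proof (rule symmetric_monoidal_functorI_typed)
  have i: "Id C X \<in> iso C X X" if "X \<in> Obj C" for X
    using raw_iso[of "\<iota> X"] that by (simp add: raw_id)
  show "symmetric_monoidal_category C" "symmetric_monoidal_category C" by unfold_locales
  show "UnitMap (id_fun C) \<in> iso C (Unit C) (OMap (id_fun C) (Unit C))" by (simp add: i)
  show "\<lbrakk>X \<in> Obj C; Y \<in> Obj C\<rbrakk> \<Longrightarrow> TenMap (id_fun C) X Y \<in> iso C (OMap (id_fun C) X \<otimes> OMap (id_fun
      C) Y) (OMap (id_fun C) (X \<otimes> Y))" for X Y
    by (simp add: i)
  have m: "tmu C C (id_fun C) X Y = \<iota> (X \<otimes> Y)" "teps C C (id_fun C) = \<iota> (Unit C)" for X Y
    by (simp_all add: tmu_def teps_def tid_def)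
  have t: "tmap C (id_fun C) a = a" if "ok C a" for a
    using that by (cases a) (auto simp: tmap_def ok_def raw_def)
  note [simp] = m t ok_obj
  show "(tmap C (id_fun C) f \<boxtimes> tmap C (id_fun C) g) \<bullet> tmu C C (id_fun C) (tgt f) (tgt g)
    = tmu C C (id_fun C) (src f) (src g) \<bullet> tmap C (id_fun C) (f \<boxtimes> g)" if "ok C f" "ok C g" for f g
    using that by simp
  fix X Y Z assume [simp]: "X \<in> Obj C" "Y \<in> Obj C" "Z \<in> Obj C"
  show "(tmu C C (id_fun C) X Y \<boxtimes> \<iota> (OMap (id_fun C) Z)) \<bullet> tmu C C (id_fun C) (X \<otimes> Y) Z
      \<bullet> tmap C (id_fun C) (\<alpha> X Y Z)
    = \<alpha> (OMap (id_fun C) X) (OMap (id_fun C) Y) (OMap (id_fun C) Z)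
        \<bullet> (\<iota> (OMap (id_fun C) X) \<boxtimes> tmu C C (id_fun C) Y Z)
      \<bullet> tmu C C (id_fun C) X (Y \<otimes> Z)" by simp
next
  have m: "tmu C C (id_fun C) X Y = \<iota> (X \<otimes> Y)" "teps C C (id_fun C) = \<iota> (Unit C)" for X Y
    by (simp_all add: tmu_def teps_def tid_def)
  have t: "tmap C (id_fun C) a = a" if "ok C a" for a
    using that by (cases a) (auto simp: tmap_def ok_def raw_def)
  fix X assume "X \<in> Obj C"
  then show "(teps C C (id_fun C) \<boxtimes> \<iota> (OMap (id_fun C) X)) \<bullet> tmu C C (id_fun C) (Unit C) X
      \<bullet> tmap C (id_fun C) (\<l> X) = \<l> (OMap (id_fun C) X)"
    "(\<iota> (OMap (id_fun C) X) \<boxtimes> teps C C (id_fun C)) \<bullet> tmu C C (id_fun C) X (Unit C)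
        \<bullet> tmap C (id_fun C) (\<r> X) = \<r> (OMap (id_fun C) X)"
    by (simp_all add: m t)
  fix Y assume "Y \<in> Obj C"
  with \<open>X \<in> Obj C\<close> show "tmu C C (id_fun C) X Y \<bullet> tmap C (id_fun C) (\<sigma> X Y)
      = \<sigma> (OMap (id_fun C) X) (OMap (id_fun C) Y) \<bullet> tmu C C (id_fun C) Y X"
    by (simp add: m t)
qed simp_all

lemma (in feedback_category) feedback_id: "feedback_functor E E (id_fun E)"
proof (rule feedback_functorI)
  show "feedback_category E" "feedback_category E" by unfold_locales
  interpret I: symmetric_monoidal_functor E E "id_fun E" by (rule symmetric_monoidal_id)
  have "commutes_with E (Endo E) E (Endo E) (id_fun E)"
    using Endo.structure_hom
    by (auto simp: commutes_with_def mfun_eq_def Endo.map_id id_left[OF Endo.structure_hom(1)]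
      id_right[OF Endo.structure_hom(1)] id_left[OF Endo.structure_hom(2)] id_right[OF
          Endo.structure_hom(2)])
  then show "commuting_functor E (Endo E) E (Endo E) (id_fun E)"
    using monoidal_endofunctor symmetric_monoidal_id
    by (simp add: commuting_functor_def commuting_functor_axioms_def)
  fix S X Y f assume "stateful E (Endo E) X Y S f"
  then have o [simp]: "ok E f" "src f = OMap (Endo E) S \<otimes> X" "tgt f = S \<otimes> Y" "X \<in> Obj E"
      "Y \<in> Obj E" "S \<in> Obj E"
    by (auto simp: stateful_def)
  have m: "tmu E E (id_fun E) X Y = \<iota> (X \<otimes> Y)" for X Y by (simp add: tmu_def tid_def)
  have "tmap E (id_fun E) f = f"
    using o(1) by (cases f) (auto simp: tmap_def ok_def raw_def)
  then have "tconj E E (id_fun E) (OMap (Endo E) S) X S Y f = f"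
    by (simp add: tconj_def m Endo.map_obj)
  then show "AMap (id_fun E) (Fbk E S X Y (raw f)) = Fbk E (OMap (id_fun E) S) (OMap (id_fun E) X)
      (OMap (id_fun E) Y)
      (raw (tconj E E (id_fun E) (OMap (Endo E) S) X S Y f))" by simp
qed

lemma mfun_eq_sym: "mfun_eq D G G' \<Longrightarrow> mfun_eq D G' G"
  and mfun_eq_trans: "\<lbrakk>mfun_eq D G G'; mfun_eq D G' G''\<rbrakk> \<Longrightarrow> mfun_eq D G G''"
  by (simp_all add: mfun_eq_def)

lemma mfun_eq_comp_left: "mfun_eq D G G' \<Longrightarrow> mfun_eq D (mfun_comp B G K) (mfun_comp B G' K)"
  by (simp add: mfun_eq_def)

text \<open>Objects and arrows agree at once. The structure maps of the two composites differ by a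
  reassociation in \<open>C\<close> and by functoriality of \<open>K\<close>.\<close>

lemma mfun_comp_assoc:
  assumes "symmetric_monoidal_functor D A J" "symmetric_monoidal_functor A B H"
      "symmetric_monoidal_functor B C K"
  shows "mfun_eq D (mfun_comp C J (mfun_comp C H K)) (mfun_comp C (mfun_comp B J H) K)"
proof -
  interpret J: symmetric_monoidal_functor D A J by fact
  interpret H: symmetric_monoidal_functor A B H by fact
  interpret K: symmetric_monoidal_functor B C K by fact
  have u: "UnitMap J \<in> hom A (Unit A) (OMap J (Unit D))"
      "UnitMap H \<in> hom B (Unit B) (OMap H (Unit A))"
    "UnitMap K \<in> hom C (Unit C) (OMap K (Unit B))"
    using J.unit_map_iso H.unit_map_iso K.unit_map_iso by (simp_all add: iso_def)
  have t: "TenMap J X Y \<in> hom A (OMap J X \<otimes>\<^bsub>A\<^esub> OMap J Y) (OMap J (X \<otimes>\<^bsub>D\<^esub> Y))"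
    "TenMap H (OMap J X) (OMap J Y) \<in> hom B (OMap H (OMap J X) \<otimes>\<^bsub>B\<^esub> OMap H (OMap J Y)) (OMap H
        (OMap J X \<otimes>\<^bsub>A\<^esub> OMap J Y))"
    "TenMap K (OMap H (OMap J X)) (OMap H (OMap J Y)) \<in> hom C (OMap K (OMap H (OMap J X)) \<otimes>\<^bsub>C\<^esub>
        OMap K (OMap H (OMap J Y)))
      (OMap K (OMap H (OMap J X) \<otimes>\<^bsub>B\<^esub> OMap H (OMap J Y)))"
    if "X \<in> Obj D" "Y \<in> Obj D" for X Y
    using that J.ten_map_iso H.ten_map_iso K.ten_map_iso by (simp_all add: iso_def)
  have "UnitMap (mfun_comp C J (mfun_comp C H K)) = UnitMap (mfun_comp C (mfun_comp B J H) K)"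
    using K.map_comp[OF u(2) H.map_hom[OF u(1)]] K.D.comp_assoc[OF u(3) K.map_hom[OF u(2)]
        K.map_hom[OF H.map_hom[OF u(1)]]] by simp
  moreover have "TenMap (mfun_comp C J (mfun_comp C H K)) X Y
      = TenMap (mfun_comp C (mfun_comp B J H) K) X Y"
    if "X \<in> Obj D" "Y \<in> Obj D" for X Y
    using K.map_comp[OF t(2) H.map_hom[OF t(1)], OF that that]
      K.D.comp_assoc[OF t(3) K.map_hom[OF t(2)] K.map_hom[OF H.map_hom[OF t(1)]], OF that that
          that] by simp
  ultimately show ?thesis by (simp add: mfun_eq_def)
qed

lemma mfun_comp_id:
  assumes "symmetric_monoidal_functor D A J"
  shows "mfun_eq D (mfun_comp A J (id_fun A)) J"
proof -
  interpret J: symmetric_monoidal_functor D A J by fact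
  show ?thesis
    by (simp add: mfun_eq_def J.D.id_left[OF J.structure_hom(1)] J.D.id_left[OF J.structure_hom(2)])
qed

lemma free_feedbackD:
  fixes B :: "('p, 'q) fbc"
  assumes "free_feedback_category TYPE(('p, 'q) fbc) D F A J"
    and "feedback_category B" "feedback_functor B B (Endo B)" "symmetric_monoidal_functor D B G"
    "commutes_with D F B (Endo B) G"
  obtains H where "feedback_functor A B H" "mfun_eq D (mfun_comp B J H) G"
    "\<And>H'. \<lbrakk>feedback_functor A B H'; mfun_eq D (mfun_comp B J H') G\<rbrakk> \<Longrightarrow> mfun_eq A H' H"
  using assms unfolding free_feedback_category_def by blast

context monoidal_endofunctor
begin

text \<open>\<open>St_map\<close> is a union over all representatives. Composition with stateless
  arrows on both sides sends equal classes to equal classes, so every member of the union is the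
  same class.\<close>

lemma St_map_cls:
  assumes "sf X Y S f" "ok D u" "src u = X'" "tgt u = X" "ok D v" "src v = Y" "tgt v = Y'"
  shows "(X', Y', St_map D F (raw u) (raw v) (snd (snd (cl X Y S f))))
    = cl X' Y' S ((\<iota> (OMap F S) \<boxtimes> u) \<bullet> f \<bullet> (\<iota> S \<boxtimes> v))"
proof -
  note [simp] = statefulD[OF assms(1)] assms(2-)
  have o [simp]: "X' \<in> Obj D" "Y' \<in> Obj D" using ok_obj(1)[of u] ok_obj(2)[of v] by simp_all
  have uv: "Dom D (raw u) = X'" "Cod D (raw v) = Y'"
    using raw_hom[of D u] raw_hom[of D v] by (simp_all add: hom_def)
  let ?g = "\<lambda>T g. (\<iota> (OMap F T) \<boxtimes> u) \<bullet> g \<bullet> (\<iota> T \<boxtimes> v)"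
  have R: "snd (snd (cl X Y S f)) = St_rel D F X Y `` {(S, raw f)}" by (simp add: cls_def)
  have *: "St_rel D F X' Y' `` {(T, (Id D (OMap F T) \<odot> raw u) \<Zcomp> m \<Zcomp> (Id D T \<odot> raw v))}
      = snd (snd (cl X' Y' S (?g S f)))"
    if T: "(T, m) \<in> St_rel D F X Y `` {(S, raw f)}" for T m
  proof -
    have c: "(T, m) \<in> St_carrier D F X Y" using T by (auto simp: St_rel_def)
    let ?m = "mk D (OMap F T \<otimes> X) (T \<otimes> Y) m"
    have m: "sf X Y T ?m" "raw ?m = m" using c by (auto
        simp: St_carrier_def stateful_def ok_mk raw_mk)
    note [simp] = statefulD[OF m(1)]
    have "cl X Y S f = cl X Y T ?m"
      using T cls_eq_iff[OF assms(1) m(1)] m(2) by (simp add: St_rel_def)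
    then have "scomp D F (scomp D F (J u) (cl X Y S f)) (J v)
        = scomp D F (scomp D F (J u) (cl X Y T ?m)) (J v)" by simp
    moreover have "sf X' Y S ((\<iota> (OMap F S) \<boxtimes> u) \<bullet> f)" "sf X' Y T ((\<iota> (OMap F T) \<boxtimes> u) \<bullet> ?m)" by
        (simp_all add: stateful_def)
    ultimately have "cl X' Y' S (?g S f) = cl X' Y' T (?g T ?m)"
      using assms(1) m(1) by (simp add: pure_comp_left pure_comp_right)
    moreover have "raw (?g T ?m) = (Id D (OMap F T) \<odot> raw u) \<Zcomp> m \<Zcomp> (Id D T \<odot> raw v)"
      by (simp add: raw_comp raw_ten raw_id m(2) del: tcomp_assoc flip: tcomp_assoc)
    ultimately show ?thesis by (simp add: cls_def)
  qed
  have ne: "(S, raw f) \<in> St_rel D F X Y `` {(S, raw f)}"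
    using stateful_carrier[OF assms(1)] by (auto simp: St_rel_def)
  have "St_map D F (raw u) (raw v) (snd (snd (cl X Y S f))) = snd (snd (cl X' Y' S (?g S f)))"
    unfolding St_map_def R uv using * ne by (auto simp: split_def)
  then show ?thesis by (simp add: cls_def)
qed

text \<open>\<open>St\<close> provides a functor \<open>K\<close> from \<open>A\<close> to the
  category of classes, \<open>own\<close> makes the composite of \<open>K\<close> with the functor
  \<open>H\<close> back an identity. Freeness of the category of classes is available for every type
  of targets by \<open>free_scat\<close>. The bijection is \<open>K\<close>, and its naturality is
  functoriality of \<open>K\<close> together with \<open>St_map_cls\<close>.\<close>

theorem free_hom_St:
  fixes A :: "('o, 'e) fbc"
  assumes own: "free_feedback_category TYPE(('o, 'e) fbc) D F A J'"
    and St: "free_feedback_category TYPE(('o, ('o, 'm) starr) fbc) D F A J'"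
  shows "\<exists>\<Psi>. (\<forall>X \<in> Obj D. \<forall>Y \<in> Obj D. bij_betw (\<Psi> X Y) (hom A X Y) (St D F X Y)) \<and>
    (\<forall>X X' Y Y' u v e. u \<in> hom D X' X \<and> v \<in> hom D Y Y' \<and> e \<in> hom A X Y \<longrightarrow>
      \<Psi> X' Y' (AMap J' u \<Zcomp>\<^bsub>A\<^esub> e \<Zcomp>\<^bsub>A\<^esub> AMap J' v) = St_map D F u v (\<Psi> X Y e))"
proof -
  let ?P = "spure_fun D F"
  have A: "feedback_category A" "feedback_functor A A (Endo A)" "symmetric_monoidal_functor D A J'"
    "commutes_with D F A (Endo A) J'" "Obj A = Obj D" "\<And>X. X \<in> Obj D \<Longrightarrow> OMap J' X = X"
    using own by (auto simp: free_feedback_category_def)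
  have free: "free_feedback_category TYPE(('o, ('o, 'm) starr) fbc) D F E ?P"
    "free_feedback_category TYPE(('o, 'e) fbc) D F E ?P" by (rule free_scat)+
  have EE: "feedback_functor E E (Endo E)" using free(1) by (simp add: free_feedback_category_def)
  obtain K where K: "feedback_functor A E K" "mfun_eq D (mfun_comp E J' K) ?P"
    using free_feedbackD[OF St feedback_scat EE symmetric_monoidal_pure pure_commutes] by metis
  obtain H where H: "feedback_functor E A H" "mfun_eq D (mfun_comp A ?P H) J'"
    using free_feedbackD[OF free(2) A(1-4)] by metis
  interpret A: feedback_category A by fact
  interpret E: feedback_category E by (rule feedback_scat)
  interpret K: feedback_functor A E K by fact
  interpret H: feedback_functor E A H by fact
  interpret J': symmetric_monoidal_functor D A J' by fact
  interpret P: symmetric_monoidal_functor D E ?P by (rule symmetric_monoidal_pure)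
  \<comment> \<open>The composite and the identity both extend \<open>J'\<close> along
    \<open>J'\<close>, and such an extension is unique.\<close>
  have KH: "mfun_eq A (mfun_comp A K H) (id_fun A)"
  proof -
    obtain L where L: "\<And>H'. \<lbrakk>feedback_functor A A H'; mfun_eq D (mfun_comp A J' H') J'\<rbrakk>
        \<Longrightarrow> mfun_eq A H' L"
      using free_feedbackD[OF own A(1-4)] by metis
    have "mfun_eq D (mfun_comp A J' (mfun_comp A K H)) J'"
      using mfun_comp_assoc[OF A(3) K.symmetric_monoidal_functor_axioms
          H.symmetric_monoidal_functor_axioms]
        mfun_eq_comp_left[OF K(2), of A H] H(2) by (meson mfun_eq_trans)
    then show ?thesis
      using L[OF feedback_functor_comp[OF K(1) H(1)]] L[OF A.feedback_id mfun_comp_id[OF A(3)]]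
      by (meson mfun_eq_trans mfun_eq_sym)
  qed
  have HK: "mfun_eq E (mfun_comp E H K) (id_fun E)"
  proof (rule feedback_functor_determined[OF feedback_functor_comp[OF H(1) K(1)] E.feedback_id])
    have "mfun_eq D (mfun_comp E ?P (mfun_comp E H K)) ?P"
      using mfun_comp_assoc[OF symmetric_monoidal_pure H.symmetric_monoidal_functor_axioms
          K.symmetric_monoidal_functor_axioms]
        mfun_eq_comp_left[OF H(2), of E K] K(2) by (meson mfun_eq_trans)
    then show "mfun_eq D (mfun_comp E ?P (mfun_comp E H K)) (mfun_comp E ?P (id_fun E))"
      using mfun_comp_id[OF symmetric_monoidal_pure] by (meson mfun_eq_trans mfun_eq_sym)
  qed
  have Ko: "OMap K X = X" and Ho: "OMap H X = X" if "X \<in> Obj D" for X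
    using K(2) H(2) A(6) that by (simp_all add: mfun_eq_def)
  have obj: "X \<in> Obj D \<and> Y \<in> Obj D" if "e \<in> hom A X Y" for e X Y
    using that A.dom_obj A.cod_obj by (auto simp: hom_def A(5))
  have Kh: "AMap K e \<in> hom E X Y" if "e \<in> hom A X Y" for e X Y
    using K.map_hom[OF that] obj[OF that] by (simp add: Ko)
  have KHe: "AMap H (AMap K e) = e" if "e \<in> hom A X Y" for e X Y
    using KH that by (simp add: mfun_eq_def hom_def)
  \<comment> \<open>\<open>K\<close> is the identity on objects, so the first two components of
    \<open>AMap K e\<close> are the endpoints and only the class remains.\<close>
  define \<Psi> where "\<Psi> = (\<lambda>(X :: 'o) (Y :: 'o) e. snd (snd (AMap K e)))"
  have \<Psi>: "AMap K e = (X, Y, \<Psi> X Y e)" "\<Psi> X Y e \<in> St D F X Y" if "e \<in> hom A X Y" for e X Y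
    using Kh[OF that] by (auto simp: hom_def scat_def \<Psi>_def prod_eq_iff)
  have "bij_betw (\<Psi> X Y) (hom A X Y) (St D F X Y)" if XY: "X \<in> Obj D" "Y \<in> Obj D" for X Y
  proof (rule bij_betw_imageI)
    show "inj_on (\<Psi> X Y) (hom A X Y)"
      by (rule inj_onI) (metis \<Psi>(1) KHe)
    have "c \<in> \<Psi> X Y ` hom A X Y" if "c \<in> St D F X Y" for c
    proof -
      have h: "(X, Y, c) \<in> hom E X Y" using that XY by (simp add: hom_def scat_def)
      then have a: "AMap H (X, Y, c) \<in> hom A X Y" using H.map_hom[OF h] XY by (simp add: Ho)
      have "AMap K (AMap H (X, Y, c)) = (X, Y, c)"
        using HK h by (simp add: mfun_eq_def hom_def)
      then have "c = \<Psi> X Y (AMap H (X, Y, c))" by (simp add: \<Psi>_def)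
      then show ?thesis using a by blast
    qed
    then show "\<Psi> X Y ` hom A X Y = St D F X Y" using \<Psi>(2) by blast
  qed
  moreover have "\<Psi> X' Y' (AMap J' u \<Zcomp>\<^bsub>A\<^esub> e \<Zcomp>\<^bsub>A\<^esub> AMap J' v) = St_map D F u v (\<Psi> X Y e)"
    if u: "u \<in> hom D X' X" and v: "v \<in> hom D Y Y'" and e: "e \<in> hom A X Y" for X X' Y Y' u v e
  proof -
    let ?u = "mk D X' X u" and ?v = "mk D Y Y' v"
    have ok: "ok D ?u" "ok D ?v" "raw ?u = u" "raw ?v = v" using u v by (simp_all add: ok_mk raw_mk)
    note [simp] = ok(1,2) ok_obj[OF ok(1), simplified] ok_obj[OF ok(2), simplified]
    have Ju: "AMap J' u \<in> hom A X' X" "AMap J' v \<in> hom A Y Y'"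
      using J'.map_hom[OF u] J'.map_hom[OF v] by (simp_all add: A(6))
    have KJ: "AMap K (AMap J' u) = J ?u" "AMap K (AMap J' v) = J ?v"
      using K(2) u v by (auto simp: mfun_eq_def hom_def spure_fun_def)
    obtain S f where f: "sf X Y S f" "AMap K e = cl X Y S f" using hom_cls[OF Kh[OF e]] by metis
    note [simp] = statefulD[OF f(1)]
    have s: "sf X' Y S ((\<iota> (OMap F S) \<boxtimes> ?u) \<bullet> f)" by (simp add: stateful_def)
    have "AMap K (AMap J' u \<Zcomp>\<^bsub>A\<^esub> e \<Zcomp>\<^bsub>A\<^esub> AMap J' v) = scomp D F (scomp D F (J ?u) (cl X Y S f)) (J
        ?v)"
      using K.map_comp[OF A.comp_hom[OF Ju(1) e] Ju(2)] K.map_comp[OF Ju(1) e] by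
          (simp add: KJ f(2))
    also have "\<dots> = cl X' Y' S ((\<iota> (OMap F S) \<boxtimes> ?u) \<bullet> f \<bullet> (\<iota> S \<boxtimes> ?v))"
      using s f(1) by (simp add: pure_comp_left pure_comp_right)
    also have "\<dots> = (X', Y', St_map D F u v (\<Psi> X Y e))"
      using St_map_cls[OF f(1), of ?u X' ?v Y'] ok by (simp add: \<Psi>_def f(2))
    finally show ?thesis by (simp add: \<Psi>_def)
  qed
  ultimately show ?thesis by blast
qed

end

section \<open>Componentwise structure on sequences, and the delay functor\<close>

lemma seq_simps [simp]:
  "Obj (seq_category C) = {X. \<forall>n. X n \<in> Obj C}" "Arr (seq_category C) = {f. \<forall>n. f n \<in> Arr C}"
  "Dom (seq_category C) = (\<lambda>f n. Dom C (f n))" "Cod (seq_category C) = (\<lambda>f n. Cod C (f n))"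
  "Id (seq_category C) = (\<lambda>X n. Id C (X n))" "Comp (seq_category C) = (\<lambda>f g n. f n \<Zcomp>\<^bsub>C\<^esub> g n)"
  "Unit (seq_category C) = (\<lambda>n. Unit C)" "TenO (seq_category C) = (\<lambda>X Y n. X n \<otimes>\<^bsub>C\<^esub> Y n)"
  "TenA (seq_category C) = (\<lambda>f g n. f n \<odot>\<^bsub>C\<^esub> g n)"
  "Assoc (seq_category C) = (\<lambda>X Y Z n. Assoc C (X n) (Y n) (Z n))"
  "Lunit (seq_category C) = (\<lambda>X n. Lunit C (X n))" "Runit (seq_category C) = (\<lambda>X n. Runit C (X n))"
  "Sym (seq_category C) = (\<lambda>X Y n. Sym C (X n) (Y n))"
  by (simp_all add: seq_category_def)

lemma delay_simps [simp]:
  "OMap (delay C) = case_nat (Unit C)" "AMap (delay C) = case_nat (Id C (Unit C))"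
  "UnitMap (delay C) = (\<lambda>n. Id C (Unit C))"
  "TenMap (delay C) = (\<lambda>X Y. case_nat (Lunit C (Unit C)) (\<lambda>n. Id C (X n \<otimes>\<^bsub>C\<^esub> Y n)))"
  by (simp_all add: delay_def)

lemma seq_hom: "f \<in> hom (seq_category C) X Y \<longleftrightarrow> (\<forall>n. f n \<in> hom C (X n) (Y n))"
  by (auto simp: hom_def)

lemma seq_iso:
  assumes "\<And>n. f n \<in> iso C (X n) (Y n)"
  shows "f \<in> iso (seq_category C) X Y"
proof -
  \<comment> \<open>An inverse is chosen at every index.\<close>
  obtain g where g: "\<And>n. is_inverse C (f n) (g n)"
    using assms unfolding iso_def by simp metis
  then have "is_inverse (seq_category C) f g"
    by (simp add: is_inverse_def seq_hom)
  then show ?thesis using assms by (auto simp: iso_def seq_hom)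
qed

context symmetric_monoidal_category
begin

theorem symmetric_monoidal_seq: "symmetric_monoidal_category (seq_category C)"
proof
  fix f g h f' g' X X' X'' Y Y' Y'' Z Z' W
  let ?S = "seq_category C"
  let ?hom = "hom ?S"
  show "f \<in> Arr ?S \<Longrightarrow> Dom ?S f \<in> Obj ?S"
    "f \<in> Arr ?S \<Longrightarrow> Cod ?S f \<in> Obj ?S"
    by (simp_all add: dom_obj cod_obj)
  show "f \<Zcomp>\<^bsub>?S\<^esub> g \<in> ?hom X Z" if "f \<in> ?hom X Y" "g \<in> ?hom Y Z"
    using that comp_hom by (fastforce simp: seq_hom)
  show "Id ?S X \<Zcomp>\<^bsub>?S\<^esub> f = f" "f \<Zcomp>\<^bsub>?S\<^esub> Id ?S Y = f" if "f \<in> ?hom X Y"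
    using that id_left id_right by (fastforce simp: seq_hom)+
  show "f \<Zcomp>\<^bsub>?S\<^esub> g \<Zcomp>\<^bsub>?S\<^esub> h = f \<Zcomp>\<^bsub>?S\<^esub> (g \<Zcomp>\<^bsub>?S\<^esub> h)"
    if "f \<in> ?hom W X" "g \<in> ?hom X Y" "h \<in> ?hom Y Z"
    using that comp_assoc[of "f n" "W n" "X n" "g n" "Y n" "h n" "Z n" for n] by (simp add: seq_hom)
  show "f \<odot>\<^bsub>?S\<^esub> g \<in> ?hom (X \<otimes>\<^bsub>?S\<^esub> Y) (X' \<otimes>\<^bsub>?S\<^esub> Y')" if "f \<in> ?hom X X'" "g \<in> ?hom Y Y'"
    using that ten_hom by (simp add: seq_hom)
  show "(f \<Zcomp>\<^bsub>?S\<^esub> f') \<odot>\<^bsub>?S\<^esub> (g \<Zcomp>\<^bsub>?S\<^esub> g')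
      = f \<odot>\<^bsub>?S\<^esub> g \<Zcomp>\<^bsub>?S\<^esub> f' \<odot>\<^bsub>?S\<^esub> g'"
    if "f \<in> ?hom X X'" "f' \<in> ?hom X' X''" "g \<in> ?hom Y Y'" "g' \<in> ?hom Y' Y''"
    using that ten_comp[of "f n" "X n" "X' n" "f' n" "X'' n" "g n" "Y n" "Y' n" "g' n" "Y'' n"
        for n] by (simp add: seq_hom)
  show "(f \<odot>\<^bsub>?S\<^esub> g) \<odot>\<^bsub>?S\<^esub> h \<Zcomp>\<^bsub>?S\<^esub> Assoc ?S X' Y' Z'
      = Assoc ?S X Y Z \<Zcomp>\<^bsub>?S\<^esub> f \<odot>\<^bsub>?S\<^esub> g \<odot>\<^bsub>?S\<^esub> h"
    if "f \<in> ?hom X X'" "g \<in> ?hom Y Y'" "h \<in> ?hom Z Z'"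
    using that assoc_nat[of "f n" "X n" "X' n" "g n" "Y n" "Y' n" "h n" "Z n" "Z' n" for n] by
        (simp add: seq_hom)
  show "Id ?S (Unit ?S) \<odot>\<^bsub>?S\<^esub> f \<Zcomp>\<^bsub>?S\<^esub> Lunit ?S Y
      = Lunit ?S X \<Zcomp>\<^bsub>?S\<^esub> f"
    "f \<odot>\<^bsub>?S\<^esub> Id ?S (Unit ?S) \<Zcomp>\<^bsub>?S\<^esub> Runit ?S Y
      = Runit ?S X \<Zcomp>\<^bsub>?S\<^esub> f" if "f \<in> ?hom X Y"
    using that lunit_nat[of "f n" "X n" "Y n" for n] runit_nat[of "f n" "X n" "Y n" for n] by
        (simp_all add: seq_hom)
  show "f \<odot>\<^bsub>?S\<^esub> g \<Zcomp>\<^bsub>?S\<^esub> Sym ?S X' Y'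
      = Sym ?S X Y \<Zcomp>\<^bsub>?S\<^esub> g \<odot>\<^bsub>?S\<^esub> f" if "f \<in> ?hom X X'" "g \<in> ?hom Y Y'"
    using that sym_nat[of "f n" "X n" "X' n" "g n" "Y n" "Y' n" for n] by (simp add: seq_hom)
qed (simp_all add: seq_hom id_hom ten_id sym_hom sym_inv pentagon triangle hexagon seq_iso
    assoc_iso lunit_iso runit_iso)

text \<open>At successor indices the structure maps are identities. At index \<open>0\<close> all
  objects are \<open>I\<close>, and the associativity, right unit and symmetry laws reduce to
  \<open>tri\<close>, \<open>lr\<close> and \<open>sl\<close>, which rest on the equality of
  \<open>\<l> I\<close> and \<open>\<r> I\<close> and on the unit law of the symmetry.\<close>

theorem symmetric_monoidal_delay: "symmetric_monoidal_functor (seq_category C) (seq_category C)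
    (delay C)"
proof -
  interpret S: symmetric_monoidal_category "seq_category C" by (rule symmetric_monoidal_seq)
  let ?I = "Unit C"
  have i: "Id C X \<in> iso C X X" if "X \<in> Obj C" for X
    using raw_iso[of "\<iota> X"] that by (simp add: raw_id)
  note lunit_hom = lunit_iso[OF unit_obj, unfolded iso_def, simplified, THEN conjunct1]
  have lr: "Lunit C ?I = Runit C ?I"
    using arg_cong[OF \<l>_unit, of raw] by (simp add: raw_structure)
  have sl: "Sym C ?I ?I \<Zcomp> Lunit C ?I = Lunit C ?I"
    using arg_cong[OF \<sigma>_unit[OF unit_obj], of raw] by (simp add: raw_structure raw_comp lr)
  have tri: "Assoc C ?I ?I ?I \<Zcomp> (Id C ?I \<odot> Lunit C ?I) = Lunit C ?I \<odot> Id C ?I"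
    using triangle[of ?I ?I] by (simp add: lr)
  have all: "(\<forall>n. Q n) \<longleftrightarrow> Q 0 \<and> (\<forall>n. Q (Suc n))" for Q :: "nat \<Rightarrow> bool"
    by (metis not0_implies_Suc)
  let ?S = "seq_category C" and ?F = "delay C"
  show ?thesis
  proof
    let ?hom = "hom ?S"
    show "OMap ?F X \<in> Obj ?S" if "X \<in> Obj ?S" for X
      using that by (simp split: nat.split)
    show "AMap ?F f \<in> ?hom (OMap ?F X) (OMap ?F Y)" if "f \<in> ?hom X Y" for f X Y
      using that by (simp add: seq_hom id_hom split: nat.split)
    show "AMap ?F (Id ?S X) = Id ?S (OMap ?F X)" for X
      by (simp add: fun_eq_iff split: nat.split)
    show "AMap ?F (f \<Zcomp>\<^bsub>?S\<^esub> g) = AMap ?F f \<Zcomp>\<^bsub>?S\<^esub> AMap ?F g" for f g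
      by (simp add: fun_eq_iff id_left[OF id_hom] split: nat.split)
    show "UnitMap ?F \<in> iso ?S (Unit ?S) (OMap ?F (Unit ?S))"
      by (auto intro!: seq_iso simp: i split: nat.split)
    show "TenMap ?F X Y \<in> iso ?S (OMap ?F X \<otimes>\<^bsub>?S\<^esub> OMap ?F Y)
        (OMap ?F (X \<otimes>\<^bsub>?S\<^esub> Y))" if "X \<in> Obj ?S" "Y \<in> Obj ?S" for X Y
      using that by (auto intro!: seq_iso simp: i lunit_iso split: nat.split)
    show "AMap ?F f \<odot>\<^bsub>?S\<^esub> AMap ?F g \<Zcomp>\<^bsub>?S\<^esub> TenMap ?F X' Y'
      = TenMap ?F X Y \<Zcomp>\<^bsub>?S\<^esub> AMap ?F (f \<odot>\<^bsub>?S\<^esub> g)"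
      if "f \<in> ?hom X X'" "g \<in> ?hom Y Y'" for f g X X' Y Y'
    proof -
      have "f n \<odot> g n \<in> hom C (X n \<otimes> Y n) (X' n \<otimes> Y' n)" for n
        using that ten_hom by (simp add: seq_hom)
      then show ?thesis
        using id_left[of "f n \<odot> g n" "X n \<otimes> Y n" "X' n \<otimes> Y' n" for n] id_right[of "f n \<odot> g n"
            "X n \<otimes> Y n" "X' n \<otimes> Y' n" for n]
        by (simp add: fun_eq_iff ten_id id_left[OF lunit_hom] id_right[OF lunit_hom] split:
            nat.split)
    qed
    fix X Y Z
    assume "X \<in> Obj ?S" "Y \<in> Obj ?S" "Z \<in> Obj ?S"
    then have [simp]: "X n \<in> Obj C" "Y n \<in> Obj C" "Z n \<in> Obj C" for n by simp_all
    have a: "Assoc C (X n) (Y n) (Z n) \<in> hom C ((X n \<otimes> Y n) \<otimes> Z n) (X n \<otimes> (Y n \<otimes> Z n))" for n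
      using assoc_iso[of "X n" "Y n" "Z n"] by (simp add: iso_def)
    show "TenMap ?F X Y \<odot>\<^bsub>?S\<^esub> Id ?S (OMap ?F Z) \<Zcomp>\<^bsub>?S\<^esub>
        TenMap ?F (X \<otimes>\<^bsub>?S\<^esub> Y) Z \<Zcomp>\<^bsub>?S\<^esub> AMap ?F (Assoc ?S X Y Z)
      = Assoc ?S (OMap ?F X) (OMap ?F Y) (OMap ?F Z) \<Zcomp>\<^bsub>?S\<^esub>
        Id ?S (OMap ?F X) \<odot>\<^bsub>?S\<^esub> TenMap ?F Y Z \<Zcomp>\<^bsub>?S\<^esub>
        TenMap ?F X (Y \<otimes>\<^bsub>?S\<^esub> Z)"
      using id_right[OF comp_hom[OF ten_hom[OF lunit_hom id_hom[OF unit_obj]] lunit_hom]]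
      by (simp add: fun_eq_iff tri ten_id id_left[OF id_hom] id_left[OF a] id_right[OF a] split:
          nat.split)
  next
    fix X assume "X \<in> Obj ?S"
    then have [simp]: "X n \<in> Obj C" for n by simp
    have a: "Lunit C (X n) \<in> hom C (?I \<otimes> X n) (X n)" "Runit C (X n) \<in> hom C (X n \<otimes> ?I) (X n)" for n
      using lunit_iso[of "X n"] runit_iso[of "X n"] by (simp_all add: iso_def)
    show "UnitMap ?F \<odot>\<^bsub>?S\<^esub> Id ?S (OMap ?F X) \<Zcomp>\<^bsub>?S\<^esub>
        TenMap ?F (Unit ?S) X \<Zcomp>\<^bsub>?S\<^esub> AMap ?F (Lunit ?S X)
      = Lunit ?S (OMap ?F X)"
      "Id ?S (OMap ?F X) \<odot>\<^bsub>?S\<^esub> UnitMap ?F \<Zcomp>\<^bsub>?S\<^esub>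
        TenMap ?F X (Unit ?S) \<Zcomp>\<^bsub>?S\<^esub> AMap ?F (Runit ?S X)
      = Runit ?S (OMap ?F X)"
      by (simp_all add: fun_eq_iff ten_id lr[symmetric] id_left[OF lunit_hom] id_right[OF
          lunit_hom] id_left[OF id_hom]
        id_left[OF a(1)] id_left[OF a(2)] split: nat.split)
  next
    fix X Y assume "X \<in> Obj ?S" "Y \<in> Obj ?S"
    then have a: "Sym C (X n) (Y n) \<in> hom C (X n \<otimes> Y n) (Y n \<otimes> X n)" for n by (simp add: sym_hom)
    show "TenMap ?F X Y \<Zcomp>\<^bsub>?S\<^esub> AMap ?F (Sym ?S X Y)
      = Sym ?S (OMap ?F X) (OMap ?F Y) \<Zcomp>\<^bsub>?S\<^esub> TenMap ?F Y X"
      by (simp add: fun_eq_iff sl id_right[OF lunit_hom] id_left[OF a] id_right[OF a] split: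
          nat.split)
  qed
qed

lemma St_eq_eSeq:
  "St (seq_category C) (delay C) X Y = eSeq C X Y"
proof -
  let ?D = "seq_category C" and ?F = "delay C"
  have c: "St_carrier ?D ?F X Y = eSeq_carrier C X Y"
    by (auto simp: St_carrier_def eSeq_carrier_def seq_hom)
  have "St_step ?D ?F X Y p q \<longleftrightarrow> eSeq_step C X Y q p" for p q
  proof
    assume "St_step ?D ?F X Y p q"
    then obtain S T r h where "S \<in> Obj ?D" "T \<in> Obj ?D" "r \<in> hom ?D S T"
      "h \<in> hom ?D (OMap ?F T \<otimes>\<^bsub>?D\<^esub> X) (S \<otimes>\<^bsub>?D\<^esub> Y)"
      "p = (S, (AMap ?F r \<odot>\<^bsub>?D\<^esub> Id ?D X) \<Zcomp>\<^bsub>?D\<^esub> h)" "q = (T, h \<Zcomp>\<^bsub>?D\<^esub> (r \<odot>\<^bsub>?D\<^esub> Id ?D Y))"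
      unfolding St_step_def by blast
    then show "eSeq_step C X Y q p"
      \<comment> \<open>The step is read backwards, so \<open>T\<close> takes the place of
        \<open>M\<close> and \<open>S\<close> that of \<open>N\<close>. \<open>M\<close> at index
        \<open>n - 1\<close> is the delayed sequence at index \<open>n\<close>.\<close>
      unfolding eSeq_step_def by (intro exI[of _ T] exI[of _ S] exI[of _ h] exI[of _ r])
          (simp add: seq_hom)
  next
    assume "eSeq_step C X Y q p"
    then obtain M N f r where "\<forall>n. M n \<in> Obj C" "\<forall>n. N n \<in> Obj C"
      "\<forall>n. f n \<in> hom C (case_nat (Unit C) M n \<otimes> X n) (N n \<otimes> Y n)" "\<forall>n. r n \<in> hom C (N n) (M n)"
      "q = (M, \<lambda>n. f n \<Zcomp> (r n \<odot> Id C (Y n)))"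
      "p = (N, \<lambda>n. (case_nat (Id C (Unit C)) r n \<odot> Id C (X n)) \<Zcomp> f n)"
      unfolding eSeq_step_def by blast
    then show "St_step ?D ?F X Y p q"
      unfolding St_step_def by (intro bexI[of _ N] bexI[of _ M] bexI[of _ r] bexI[of _ f])
          (simp_all add: seq_hom)
  qed
  then have "St_step ?D ?F X Y = (eSeq_step C X Y)\<inverse>\<inverse>" by (simp add: fun_eq_iff)
  \<comment> \<open>The generated equivalence relation does not see the direction of the
    steps.\<close>
  then have "equivclp (St_step ?D ?F X Y) = equivclp (eSeq_step C X Y)" by simp
  then have "St_rel ?D ?F X Y = eSeq_rel C X Y"
    unfolding St_rel_def eSeq_rel_def c by simp
  then show ?thesis by (simp add: St_def eSeq_def c)
qed

end

text \<open>The existence clause keeps the comparison clause from being vacuous: the category that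
  it provides is free for targets of its own type, which is also the type of the category of
  classes, and so meets both hypotheses of the comparison.\<close>

theorem theorem5p9:
  fixes C :: "('o, 'm) smc"
  assumes "symmetric_monoidal_category C"
  shows
    "(\<exists>(E :: (nat \<Rightarrow> 'o, ('o, 'm) stream_arr) fbc) J.
        free_feedback_category TYPE((nat \<Rightarrow> 'o, ('o, 'm) stream_arr) fbc) (seq_category C) (delay C) E J \<and>
        free_feedback_category TYPE(('p, 'q) fbc) (seq_category C) (delay C) E J)
     \<and>
     (\<forall>(eStream :: (nat \<Rightarrow> 'o, 'e) fbc) J.
        free_feedback_category TYPE((nat \<Rightarrow> 'o, 'e) fbc) (seq_category C) (delay C) eStream J \<and>
        free_feedback_category TYPE((nat \<Rightarrow> 'o, ('o, 'm) stream_arr) fbc) (seq_category C) (delay C) eStream J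
        \<longrightarrow>
        (\<exists>\<Phi>.
          (\<forall>X \<in> Obj (seq_category C). \<forall>Y \<in> Obj (seq_category C).
             bij_betw (\<Phi> X Y) (hom eStream X Y) (St (seq_category C) (delay C) X Y)) \<and>
          (\<forall>X X' Y Y' u v e.
             u \<in> hom (seq_category C) X' X \<and> v \<in> hom (seq_category C) Y Y' \<and> e \<in> hom eStream X Y \<longrightarrow>
             \<Phi> X' Y' (AMap J u \<Zcomp>\<^bsub>eStream\<^esub> e \<Zcomp>\<^bsub>eStream\<^esub> AMap J v)
               = St_map (seq_category C) (delay C) u v (\<Phi> X Y e))))
     \<and>
     (\<forall>X \<in> Obj (seq_category C). \<forall>Y \<in> Obj (seq_category C).
        St (seq_category C) (delay C) X Y = eSeq C X Y)"
proof -
  interpret C: symmetric_monoidal_category C by fact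
  interpret S: symmetric_monoidal_category "seq_category C" by (rule C.symmetric_monoidal_seq)
  interpret D: symmetric_monoidal_functor "seq_category C" "seq_category C" "delay C"
    by (rule C.symmetric_monoidal_delay)
  interpret E: monoidal_endofunctor "seq_category C" "delay C" by unfold_locales
  \<comment> \<open>The two uses of \<open>free_scat\<close> concern the same category and differ
    only in the type of the targets.\<close>
  show ?thesis
    using E.free_scat E.free_scat E.free_hom_St C.St_eq_eSeq by (intro conjI) blast+
qed

end
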